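(* Fix $T\in]0,+\infty[$. The set $\mathcal W_T$ is an open subset of $(\mathcal F_{k,T}^0,d_T^+)$. The mapping $$[(V,W)]\in\mathcal W_T\mapsto[(V,y_{(v,w)})]\in\mathcal F_{n,T}$$ is the unique extension to $\mathcal W_T$ of the input-to-trajectory map $[(t,U)]\mapsto[(t,x_u)]$ (defined for the ordinary controls $u$ with $[(t,U)]\in\mathcal W_T$) that is continuous with respect to the metrics $d_T^+$ in the domain and in the image.
   Context: "Absolutely continuous" on a non-compact interval means absolutely continuous on each compact subinterval. $\mathcal T$ is the set of increasing absolutely continuous bijections of $[0,+\infty[$ with absolutely continuous inverse. Absolutely continuous $g_1,g_2:[0,+\infty[\to\mathbb R^m$ are equivalent if $\inf_{\alpha\in\mathcal T}\|g_1-g_2\circ\alpha\|_{L_\infty[0,+\infty[}=0$; $[g]$ is the equivalence class (Fréchet curve) of $g$. A function $g$ on a bounded interval $[0,S[$ defines the class $[g\circ\alpha]$, where $\alpha:[0,+\infty[\to[0,S[$ is any increasing absolutely continuous bijection with absolutely continuous inverse. $\ell_g(t)=\int_0^t|\dot g|\,ds$. For nondecreasing $\alpha$, $\alpha^{\#}(t)=\sup\{s\ge0:\alpha(s)\le t\}$. $\mathcal Y_n$ is the set of absolutely continuous $(\theta,y):[0,+\infty[\to\mathbb R^{1+n}$ with $\theta(0)=0$, $\dot\theta\ge0$ a.e., $\ell_{(\theta,y)}(\infty)=+\infty$; $\mathcal Y_{n,T}=\{(\theta,y)\in\mathcal Y_n:\theta(\infty)>T\}$; $\mathcal F_{n,T}=\{[(\theta,y)]:(\theta,y)\in\mathcal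 Y_{n,T}\}$. The truncation $(\theta_T,y_T)$ equals $(\theta,y)$ on $[0,\theta^{\#}(T)[$ and equals the constant $(T,y(\theta^{\#}(T)))$ on $[\theta^{\#}(T),+\infty[$. Put $$d_T([(\theta_1,y_1)],[(\theta_2,y_2)])=\inf\|(\tilde\theta_{1,T},\tilde y_{1,T})-(\tilde\theta_{2,T},\tilde y_{2,T})\|_{L_\infty[0,+\infty[},$$ the infimum being over representatives $(\tilde\theta_i,\tilde y_i)\in[(\theta_i,y_i)]$ with truncations $(\tilde\theta_{i,T},\tilde y_{i,T})$, and $$d_T^+([(\theta_1,y_1)],[(\theta_2,y_2)])=d_T([(\theta_1,y_1)],[(\theta_2,y_2)])+\left|\ell_{(\theta_1,y_1)}(\theta_1^{\#}(T))-\ell_{(\theta_2,y_2)}(\theta_2^{\#}(T))\right|.$$ Elements of $\mathcal F_{n,T}$ with the same truncated curve (the segment in $[0,T]\times\mathbb R^n$) are identified; a curve is relevant only through its truncation, so that $d_T^+$ is a metric. $\mathcal Y_{k,T}^0=\{(V,W)\in\mathcal Y_{k,T}:W(0)=0\}$, and $\mathcal F_{k,T}^0=\{[(V,W)]:(V,W)\in\mathcal Y_{k,T}^0\}$ is the space of Fréchet generalized controls, with the metric $d_T^+$ (with $n$ replaced by $k$). The vector fields $f,g_1,\dots,g_k$ on $\mathbb R^n$ are locally Lipschitz, $G=(g_1,\dots,g_k)$, and $x^0\in\mathbb R^n$ is fixed. An ordinary control is a locally integrable $u:[0,+\infty[\to\mathbb R^k$; $U(t)=\int_0^tu(s)\,ds$,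 and $x_u$ is the maximal solution of $\dot x=f(x)+G(x)u$, $x(0)=x^0$. For $(V,W)\in\mathcal Y_{k,T}^0$ put $(v,w)=(\dot V,\dot W)$ and let $y_{(v,w)}$ be the maximal solution of $\dot y=f(y)v+G(y)w$, $y(0)=x^0$. The class $[(V,y_{(v,w)})]$ does not depend on the representative of $[(V,W)]$. $\mathcal W_T$ is the set of $[(V,W)]\in\mathcal F_{k,T}^0$ with $[(V,y_{(v,w)})]\in\mathcal F_{n,T}$, i.e. those for which the generalized trajectory is well defined on the time interval $[0,T]$ (equivalently, $y_{(v,w)}$ is defined on $[0,V^{\#}(T)]$). *)

theory Defs
  imports "HOL-Probability.Essential_Supremum"
begin

section \<open>Absolute continuity and arc length\<close>

text \<open>
  A function on an interval \<open>I\<close> is a total function on the reals of which only the values on \<open>I\<close> matter.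
  In the following definition \<open>D\<close> is a finite set of nonoverlapping closed intervals \<open>K = {Inf K..Sup K}\<close>.
\<close>

definition abs_continuous_on :: "real set \<Rightarrow> (real \<Rightarrow> 'a::real_normed_vector) \<Rightarrow> bool" where
  "abs_continuous_on I g \<longleftrightarrow>
     (\<forall>a b. {a..b} \<subseteq> I \<longrightarrow>
       (\<forall>\<epsilon>>0. \<exists>\<delta>>0. \<forall>D E. D division_of E \<and> E \<subseteq> {a..b} \<and> (\<Sum>K\<in>D. Sup K - Inf K) < \<delta> \<longrightarrow>
          (\<Sum>K\<in>D. norm (g (Sup K) - g (Inf K))) < \<epsilon>))"

definition arc_length :: "(real \<Rightarrow> 'a::euclidean_space) \<Rightarrow> real \<Rightarrow> real" where
  "arc_length g t = integral {0..t} (\<lambda>s. norm (vector_derivative g (at s)))"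

section \<open>Frechet curves\<close>

definition half_open :: "ereal \<Rightarrow> real set" where
  "half_open S = {t. 0 \<le> t \<and> ereal t < S}"

text \<open>
  \<open>reparam S\<close> consists of the increasing absolutely continuous bijections from \<open>[0,\<infinity>[\<close> to \<open>[0,S[\<close>
  with absolutely continuous inverse. The set \<open>\<T>\<close> of admissible changes of parameter is \<open>reparam \<infinity>\<close>.
\<close>

definition reparam :: "ereal \<Rightarrow> (real \<Rightarrow> real) set" where
  "reparam S = {\<alpha>. bij_betw \<alpha> {0..} (half_open S) \<and> strict_mono_on {0..} \<alpha> \<and>
     abs_continuous_on {0..} \<alpha> \<and> abs_continuous_on (half_open S) (the_inv_into {0..} \<alpha>)}"

definition Linf_norm :: "(real \<Rightarrow> 'a::real_normed_vector) \<Rightarrow> ereal" where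
  "Linf_norm g = esssup (lebesgue_on {0..}) (\<lambda>t. ereal (norm (g t)))"

definition frechet_equiv :: "(real \<Rightarrow> 'a::euclidean_space) \<Rightarrow> (real \<Rightarrow> 'a) \<Rightarrow> bool" where
  "frechet_equiv g1 g2 \<longleftrightarrow> (INF \<alpha>\<in>reparam \<infinity>. Linf_norm (\<lambda>t. g1 t - g2 (\<alpha> t))) = 0"

definition frechet_class :: "(real \<Rightarrow> 'a::euclidean_space) \<Rightarrow> (real \<Rightarrow> 'a) set" where
  "frechet_class g = {h. abs_continuous_on {0..} h \<and> frechet_equiv g h}"

text \<open>
  The class of a function on \<open>[0,S[\<close>, where \<open>0 < S \<le> \<infinity>\<close>. It does not depend on the choice of the
  change of parameter, and \<open>frechet_class_on \<infinity> g = frechet_class g\<close> for absolutely continuous \<open>g\<close>.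
\<close>

definition frechet_class_on :: "ereal \<Rightarrow> (real \<Rightarrow> 'a::euclidean_space) \<Rightarrow> (real \<Rightarrow> 'a) set" where
  "frechet_class_on S g = frechet_class (g \<circ> (SOME \<alpha>. \<alpha> \<in> reparam S))"

section \<open>Space-time curves\<close>

definition YY :: "(real \<Rightarrow> real \<times> 'a::euclidean_space) set" where
  "YY = {g. abs_continuous_on {0..} g \<and> fst (g 0) = 0 \<and>
     (AE t in lebesgue. 0 \<le> t \<longrightarrow> 0 \<le> vector_derivative (\<lambda>s. fst (g s)) (at t)) \<and>
     filterlim (arc_length g) at_top at_top}"

definition YYT :: "real \<Rightarrow> (real \<Rightarrow> real \<times> 'a::euclidean_space) set" where
  "YYT T = {g \<in> YY. Lim at_top (\<lambda>t. ereal (fst (g t))) > ereal T}"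

definition FF :: "real \<Rightarrow> (real \<Rightarrow> real \<times> 'a::euclidean_space) set set" where
  "FF T = frechet_class ` YYT T"

definition sharp :: "(real \<Rightarrow> real) \<Rightarrow> real \<Rightarrow> real" where
  "sharp \<alpha> t = Sup {s. 0 \<le> s \<and> \<alpha> s \<le> t}"

definition end_time :: "real \<Rightarrow> (real \<Rightarrow> real \<times> 'a::euclidean_space) \<Rightarrow> real" where
  "end_time T g = sharp (\<lambda>s. fst (g s)) T"

definition trunc :: "real \<Rightarrow> (real \<Rightarrow> real \<times> 'a::euclidean_space) \<Rightarrow> real \<Rightarrow> real \<times> 'a" where
  "trunc T g t = (if t < end_time T g then g t else (T, snd (g (end_time T g))))"

section \<open>The distance, and the identification of curves with the same truncation\<close>

text \<open>The infimum is finite because truncations of elements of \<open>YYT T\<close> are bounded.\<close>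

definition d_T :: "real \<Rightarrow> (real \<Rightarrow> real \<times> 'a::euclidean_space) set \<Rightarrow> (real \<Rightarrow> real \<times> 'a) set \<Rightarrow> real" where
  "d_T T c1 c2 = real_of_ereal (INF g1\<in>c1. INF g2\<in>c2. Linf_norm (\<lambda>t. trunc T g1 t - trunc T g2 t))"

text \<open>The length of the truncated part does not depend on the representative of the class.\<close>

definition trunc_length :: "real \<Rightarrow> (real \<Rightarrow> real \<times> 'a::euclidean_space) set \<Rightarrow> real" where
  "trunc_length T c = (let g = (SOME g. g \<in> c) in arc_length g (end_time T g))"

definition d_plus :: "real \<Rightarrow> (real \<Rightarrow> real \<times> 'a::euclidean_space) set \<Rightarrow> (real \<Rightarrow> real \<times> 'a) set \<Rightarrow> real" where
  "d_plus T c1 c2 = d_T T c1 c2 + \<bar>trunc_length T c1 - trunc_length T c2\<bar>"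

definition same_trunc ::
    "real \<Rightarrow> ((real \<Rightarrow> real \<times> 'a::euclidean_space) set \<times> (real \<Rightarrow> real \<times> 'a) set) set" where
  "same_trunc T = {(c1, c2). c1 \<in> FF T \<and> c2 \<in> FF T \<and>
     (\<exists>g1\<in>c1. \<exists>g2\<in>c2. frechet_class (trunc T g1) = frechet_class (trunc T g2))}"

text \<open>
  \<open>FFQ T\<close> is \<open>FF T\<close> after the identification, \<open>ident T c\<close> is the point of \<open>FFQ T\<close> given by a curve
  \<open>c\<close> in \<open>FF T\<close>, and \<open>d_plusQ T\<close> is \<open>d_plus T\<close> on the quotient, where it does not depend on the
  representatives.
\<close>

definition FFQ :: "real \<Rightarrow> (real \<Rightarrow> real \<times> 'a::euclidean_space) set set set" where
  "FFQ T = FF T // same_trunc T"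

definition ident :: "real \<Rightarrow> (real \<Rightarrow> real \<times> 'a::euclidean_space) set \<Rightarrow> (real \<Rightarrow> real \<times> 'a) set set" where
  "ident T c = same_trunc T `` {c}"

definition d_plusQ ::
    "real \<Rightarrow> (real \<Rightarrow> real \<times> 'a::euclidean_space) set set \<Rightarrow> (real \<Rightarrow> real \<times> 'a) set set \<Rightarrow> real" where
  "d_plusQ T C1 C2 = d_plus T (SOME c. c \<in> C1) (SOME c. c \<in> C2)"

definition YYT0 :: "real \<Rightarrow> (real \<Rightarrow> real \<times> 'a::euclidean_space) set" where
  "YYT0 T = {g \<in> YYT T. snd (g 0) = 0}"

definition FFQ0 :: "real \<Rightarrow> (real \<Rightarrow> real \<times> 'a::euclidean_space) set set set" where
  "FFQ0 T = (frechet_class ` YYT0 T) // same_trunc T"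

definition curve_topology :: "real \<Rightarrow> (real \<Rightarrow> real \<times> 'a::euclidean_space) set set topology" where
  "curve_topology T = Metric_space.mtopology (FFQ T) (d_plusQ T)"

definition control_topology :: "real \<Rightarrow> (real \<Rightarrow> real \<times> 'a::euclidean_space) set set topology" where
  "control_topology T = Metric_space.mtopology (FFQ0 T) (d_plusQ T)"

section \<open>Caratheodory solutions\<close>

definition is_solution ::
    "(real \<Rightarrow> 'a::euclidean_space \<Rightarrow> 'a) \<Rightarrow> 'a \<Rightarrow> ereal \<Rightarrow> (real \<Rightarrow> 'a) \<Rightarrow> bool" where
  "is_solution F x0 S y \<longleftrightarrow> 0 < S \<and> abs_continuous_on (half_open S) y \<and> y 0 = x0 \<and>
     (AE t in lebesgue. t \<in> half_open S \<longrightarrow> (y has_vector_derivative F t (y t)) (at t))"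

definition is_max_solution ::
    "(real \<Rightarrow> 'a::euclidean_space \<Rightarrow> 'a) \<Rightarrow> 'a \<Rightarrow> ereal \<Rightarrow> (real \<Rightarrow> 'a) \<Rightarrow> bool" where
  "is_max_solution F x0 S y \<longleftrightarrow> is_solution F x0 S y \<and>
     \<not> (\<exists>S' z. S < S' \<and> is_solution F x0 S' z \<and> (\<forall>t\<in>half_open S. z t = y t))"

text \<open>
  The pair of the end \<open>S\<close> of the maximal interval \<open>[0,S[\<close> of existence and the maximal solution. For
  the equations below with locally Lipschitz vector fields it is unique up to the values outside \<open>[0,S[\<close>.
\<close>

definition max_solution ::
    "(real \<Rightarrow> 'a::euclidean_space \<Rightarrow> 'a) \<Rightarrow> 'a \<Rightarrow> ereal \<times> (real \<Rightarrow> 'a)" where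
  "max_solution F x0 = (SOME (S, y). is_max_solution F x0 S y)"

section \<open>Ordinary and generalized controls and trajectories\<close>

definition ordinary_control :: "(real \<Rightarrow> real ^ 'k) \<Rightarrow> bool" where
  "ordinary_control u \<longleftrightarrow> (\<forall>t\<ge>0. u absolutely_integrable_on {0..t})"

definition control_graph :: "(real \<Rightarrow> real ^ 'k) \<Rightarrow> real \<Rightarrow> real \<times> (real ^ 'k)" where
  "control_graph u t = (t, integral {0..t} u)"

definition ordinary_trajectory ::
    "(real ^ 'n \<Rightarrow> real ^ 'n) \<Rightarrow> ('k \<Rightarrow> real ^ 'n \<Rightarrow> real ^ 'n) \<Rightarrow> real ^ 'n \<Rightarrow>
     (real \<Rightarrow> real ^ 'k) \<Rightarrow> (real \<Rightarrow> real \<times> (real ^ 'n)) set" where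
  "ordinary_trajectory f G x0 u =
     (let (S, x) = max_solution (\<lambda>t x. f x + (\<Sum>i\<in>UNIV. (u t $ i) *\<^sub>R G i x)) x0
      in frechet_class_on S (\<lambda>t. (t, x t)))"

text \<open>With \<open>h = (V,W)\<close>, the following is the class \<open>[(V,y\<^sub>(\<^sub>v\<^sub>,\<^sub>w\<^sub>))]\<close>.\<close>

definition generalized_trajectory ::
    "(real ^ 'n \<Rightarrow> real ^ 'n) \<Rightarrow> ('k \<Rightarrow> real ^ 'n \<Rightarrow> real ^ 'n) \<Rightarrow> real ^ 'n \<Rightarrow>
     (real \<Rightarrow> real \<times> (real ^ 'k)) \<Rightarrow> (real \<Rightarrow> real \<times> (real ^ 'n)) set" where
  "generalized_trajectory f G x0 h =
     (let v = (\<lambda>t. vector_derivative (\<lambda>s. fst (h s)) (at t));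
          w = (\<lambda>t. vector_derivative (\<lambda>s. snd (h s)) (at t));
          (S, y) = max_solution (\<lambda>t y. v t *\<^sub>R f y + (\<Sum>i\<in>UNIV. (w t $ i) *\<^sub>R G i y)) x0
      in frechet_class_on S (\<lambda>t. (fst (h t), y t)))"

text \<open>
  A point of the quotient lies in \<open>WW\<close> iff one of the identified curves is the class of some \<open>(V,W)\<close>
  with \<open>[(V,y\<^sub>(\<^sub>v\<^sub>,\<^sub>w\<^sub>))]\<close> in \<open>FF T\<close>. If \<open>y\<^sub>(\<^sub>v\<^sub>,\<^sub>w\<^sub>)\<close> is defined up to \<open>end_time T (V,W)\<close> but \<open>(V,y\<^sub>(\<^sub>v\<^sub>,\<^sub>w\<^sub>))\<close> has
  finite total length, then \<open>(V,W)\<close> may be changed after \<open>end_time T (V,W)\<close> so that this holds.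
\<close>

definition WW ::
    "(real ^ 'n \<Rightarrow> real ^ 'n) \<Rightarrow> ('k \<Rightarrow> real ^ 'n \<Rightarrow> real ^ 'n) \<Rightarrow> real ^ 'n \<Rightarrow> real \<Rightarrow>
     (real \<Rightarrow> real \<times> (real ^ 'k)) set set set" where
  "WW f G x0 T =
     {frechet_class h |h. h \<in> YYT0 T \<and> generalized_trajectory f G x0 h \<in> FF T} // same_trunc T"

definition extends_input_to_trajectory ::
    "(real ^ 'n \<Rightarrow> real ^ 'n) \<Rightarrow> ('k \<Rightarrow> real ^ 'n \<Rightarrow> real ^ 'n) \<Rightarrow> real ^ 'n \<Rightarrow> real \<Rightarrow>
     ((real \<Rightarrow> real \<times> (real ^ 'k)) set set \<Rightarrow> (real \<Rightarrow> real \<times> (real ^ 'n)) set set) \<Rightarrow> bool" where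
  "extends_input_to_trajectory f G x0 T \<Phi> \<longleftrightarrow>
     (\<forall>u. ordinary_control u \<and> ident T (frechet_class (control_graph u)) \<in> WW f G x0 T \<longrightarrow>
        \<Phi> (ident T (frechet_class (control_graph u))) = ident T (ordinary_trajectory f G x0 u))"

end

theory Submission
  imports Defs
begin

text \<open>
  A trajectory depends on the control curve \<open>h\<close> only through the increments of \<open>h\<close>: if the state is
  frozen on the pieces of a partition, the trajectory moves on each piece by a linear image of the
  increment of \<open>h\<close>. The error is of the order of the oscillation of the state times the length of
  \<open>h\<close>. Hence a uniformly small change of \<open>h\<close> with bounded length changes the trajectory little, by
  Gronwall's inequality with respect to arc length, and a global solution persists. For the lengths
  of the trajectories one needs more: when the length of a curve is close to that of an inscribed
  polygon, the curve runs nearly in the direction of the chords, so that the length of its frozen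
  image is nearly a function of the increments. This is where the term with the lengths in the
  distance is used. Everything is invariant under changes of parameter, which gives openness and
  continuity; uniqueness holds because replacing \<open>V\<close> by a multiple of \<open>V + e t\<close> turns a generalized
  control into the graph of an ordinary one at arbitrarily small distance.
\<close>

text \<open>Absolute continuity is defined by increments and arc length by derivatives, so Lebesgue
  differentiation must be available before any equation can be handled; lengths are then compared
  through inscribed polygons. The equation is recast by frozen increments because these and the
  lengths are unchanged by a change of parameter, whereas a chain rule at almost every point would
  require control of preimages of null sets. The length condition in the dependence theorem is
  one-sided: uniform closeness already prevents a nearby curve from being much shorter, so only an
  excess of length, such as fine oscillation, has to be excluded. Locally Lipschitz fields are
  reduced to global ones by projecting the state onto a ball; a nearby trajectory stays in a
  slightly larger ball and so solves the original equation. A separate obstacle is that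
  \<open>FF T\<close> demands infinite total length, also beyond time \<open>T\<close>. A trajectory
  that reaches \<open>T\<close> may fail this, and then only another representative of the same
  point of the quotient is admissible.\<close>

section \<open>Divisions of intervals and absolute continuity\<close>

lemma abs_continuous_on_subset:
  "abs_continuous_on I g \<Longrightarrow> J \<subseteq> I \<Longrightarrow> abs_continuous_on J g"
  unfolding abs_continuous_on_def by (meson subset_trans)

lemma abs_continuous_onD:
  assumes "abs_continuous_on I g" "{a..b} \<subseteq> I" "0 < e"
  obtains d where "0 < d"
    "\<And>D. D division_of \<Union>D \<Longrightarrow> \<Union>D \<subseteq> {a..b} \<Longrightarrow> (\<Sum>K\<in>D. Sup K - Inf K) < d \<Longrightarrow>
       (\<Sum>K\<in>D. norm (g (Sup K) - g (Inf K))) < e"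
proof -
  obtain d where "0 < d" and d: "\<forall>D E. D division_of E \<and> E \<subseteq> {a..b} \<and> (\<Sum>K\<in>D. Sup K - Inf K) < d \<longrightarrow>
          (\<Sum>K\<in>D. norm (g (Sup K) - g (Inf K))) < e"
    using assms unfolding abs_continuous_on_def by meson
  show thesis
    by (rule that[OF \<open>0 < d\<close>]) (use d in blast)
qed

lemma division_of_IccE:
  fixes D :: "real set set"
  assumes "D division_of E" "K \<in> D"
  obtains c d where "c \<le> d" "K = {c..d}" "Inf K = c" "Sup K = d"
proof -
  obtain c d where "K = cbox c d" using division_ofD(4)[OF assms] by blast
  moreover have "K \<noteq> {}" using division_ofD(3)[OF assms] .
  ultimately show thesis using that[of c d] by auto
qed

lemma abs_continuous_on_close:
  assumes "abs_continuous_on I g" "{a..b} \<subseteq> I" "0 < e"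
  obtains d where "0 < d" "\<And>s t. s \<in> {a..b} \<Longrightarrow> t \<in> {a..b} \<Longrightarrow> \<bar>t - s\<bar> < d \<Longrightarrow> norm (g t - g s) < e"
proof -
  obtain d where "0 < d" and d: "\<And>D. D division_of \<Union>D \<Longrightarrow> \<Union>D \<subseteq> {a..b} \<Longrightarrow>
      (\<Sum>K\<in>D. Sup K - Inf K) < d \<Longrightarrow> (\<Sum>K\<in>D. norm (g (Sup K) - g (Inf K))) < e"
    by (rule abs_continuous_onD[OF assms]) blast
  have *: "norm (g t - g s) < e" if "s \<in> {a..b}" "t \<in> {a..b}" "t - s < d" "s \<le> t" for s t
  proof -
    have "{{s..t}} division_of \<Union>{{s..t}}"
      using that division_of_self[of s t] by simp
    from d[OF this] that show ?thesis by auto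
  qed
  show thesis
  proof (rule that[OF \<open>0 < d\<close>])
    fix s t assume "s \<in> {a..b}" "t \<in> {a..b}" "\<bar>t - s\<bar> < d"
    then show "norm (g t - g s) < e"
      using *[of s t] *[of t s] by (cases "s \<le> t") (auto simp: norm_minus_commute)
  qed
qed

lemma abs_continuous_on_imp_continuous_on_Icc:
  assumes "abs_continuous_on {a..b} g"
  shows "continuous_on {a..b} g"
  unfolding continuous_on_iff
proof (intro ballI allI impI)
  fix x e :: real assume "x \<in> {a..b}" "0 < e"
  obtain d where "0 < d" "\<And>s t. s \<in> {a..b} \<Longrightarrow> t \<in> {a..b} \<Longrightarrow> \<bar>t - s\<bar> < d \<Longrightarrow> norm (g t - g s) < e"
    by (rule abs_continuous_on_close[OF assms order.refl \<open>0 < e\<close>]) blast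
  then show "\<exists>d>0. \<forall>x'\<in>{a..b}. dist x' x < d \<longrightarrow> dist (g x') (g x) < e"
    using \<open>x \<in> {a..b}\<close> by (auto simp: dist_norm intro!: exI[of _ d])
qed

text \<open>Tagging every interval with its left end turns the division into a tagged one, for which
  telescoping is known.\<close>

lemma sum_division_Icc:
  fixes g :: "real \<Rightarrow> 'a::real_normed_vector"
  assumes D: "D division_of {a..b}" and "a \<le> b"
  shows "(\<Sum>K\<in>D. g (Sup K) - g (Inf K)) = g b - g a"
proof -
  let ?p = "(\<lambda>K. (Inf K, K)) ` D"
  have "?p tagged_division_of {a..b}"
  proof (rule tagged_division_ofI)
    show "finite ?p" using D by auto
    have "{K. \<exists>x. (x, K) \<in> ?p} = D" by auto
    then show "\<Union>{K. \<exists>x. (x, K) \<in> ?p} = {a..b}" using division_ofD(6)[OF D] by simp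
    fix x K assume xK: "(x, K) \<in> ?p"
    then have K: "K \<in> D" "x = Inf K" by auto
    obtain c d where "c \<le> d" "K = {c..d}" "Inf K = c" "Sup K = d" by (rule division_of_IccE[OF D K(1)])
    then show "x \<in> K" "\<exists>u v. K = cbox u v" using K by auto
    show "K \<subseteq> {a..b}" using K division_ofD(2)[OF D] by auto
  next
    fix x1 K1 x2 K2 assume "(x1, K1) \<in> ?p" "(x2, K2) \<in> ?p" "(x1, K1) \<noteq> (x2, K2)"
    then show "interior K1 \<inter> interior K2 = {}" using division_ofD(5)[OF D] by auto
  qed
  from additive_tagged_division_1[OF \<open>a \<le> b\<close> this, of g] show ?thesis
    by (subst (asm) sum.reindex) (auto simp: inj_on_def)
qed

text \<open>Both divisions are completed to a division of an enclosing interval by the same intervals.\<close>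

lemma sum_division_unique:
  fixes g :: "real \<Rightarrow> 'a::real_normed_vector"
  assumes D1: "D1 division_of S" and D2: "D2 division_of S"
  shows "(\<Sum>K\<in>D1. g (Sup K) - g (Inf K)) = (\<Sum>K\<in>D2. g (Sup K) - g (Inf K))"
proof -
  let ?f = "\<lambda>K. g (Sup K) - g (Inf K)"
  obtain a b where ab: "S \<subseteq> cbox a b" using elementary_subset_cbox[OF D1] by blast
  show ?thesis
  proof (cases "S = {}")
    case True
    then show ?thesis using D1 D2 by simp
  next
    case False
    then have "a \<le> b" using ab by auto
    have sub: "\<Union>D1 \<subseteq> {a..b}" using division_ofD(6)[OF D1] ab by auto
    have D1': "D1 division_of \<Union>D1" using D1 division_ofD(6)[OF D1] by simp
    obtain P where P: "D1 \<subseteq> P" "P division_of {a..b}"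
      using partial_division_extend[OF D1' division_of_self[of a b]] sub \<open>a \<le> b\<close> by auto
    define Q where "Q = P - D1"
    have Q: "Q division_of \<Union>Q"
      by (rule division_of_subset[of P]) (use P division_ofD(6)[OF P(2)] in \<open>auto simp: Q_def\<close>)
    have fin: "finite P" using P by auto
    have int0: "interior K \<inter> interior (\<Union>D1) = {}" if "K \<in> Q" for K
    proof -
      have "interior K \<inter> interior (\<Union>D1) = {}"
        by (rule Int_interior_Union_intervals)
          (use that P division_ofD(4,5)[OF P(2)] D1 in \<open>auto simp: Q_def\<close>)
      then show ?thesis .
    qed
    have intQ: "interior S \<inter> interior (\<Union>Q) = {}"
    proof (rule Int_interior_Union_intervals)
      show "finite Q" using fin by (auto simp: Q_def)
      show "open (interior S)" by simp
      fix T assume "T \<in> Q"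
      then show "\<exists>a b. T = cbox a b" using division_ofD(4)[OF Q] by blast
      show "interior S \<inter> interior T = {}"
        using int0[OF \<open>T \<in> Q\<close>] division_ofD(6)[OF D1] by auto
    qed
    have D2Q: "(D2 \<union> Q) division_of (S \<union> \<Union>Q)"
      by (rule division_disjoint_union[OF D2 Q intQ])
    have "S \<union> \<Union>Q = \<Union>P"
      unfolding division_ofD(6)[OF D1, symmetric] using P(1) by (auto simp: Q_def)
    then have "S \<union> \<Union>Q = {a..b}" using division_ofD(6)[OF P(2)] by simp
    with D2Q have D2Q': "(D2 \<union> Q) division_of {a..b}" by simp
    \<comment> \<open>An interval common to both families has its interior in two sets with disjoint
      interiors, so it is a single point and its increment vanishes; the sum over the union
      therefore still splits.\<close>
    have z: "?f K = 0" if "K \<in> D2 \<inter> Q" for K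
    proof -
      have "K \<in> D2" using that by simp
      obtain c d where K: "c \<le> d" "K = {c..d}" "Inf K = c" "Sup K = d"
        by (rule division_of_IccE[OF D2 \<open>K \<in> D2\<close>])
      have "K \<subseteq> S" "K \<subseteq> \<Union>Q" using that division_ofD(2)[OF D2] by auto
      then have "interior K \<subseteq> interior S \<inter> interior (\<Union>Q)" by (simp add: interior_mono)
      then have "{c<..<d} = {}" using intQ K by auto
      then have "c = d" using K by simp
      then show ?thesis using K by simp
    qed
    have "sum ?f D1 + sum ?f Q = sum ?f P"
      using sum.subset_diff[OF P(1) fin, of ?f] by (simp add: Q_def)
    also have "\<dots> = g b - g a" by (rule sum_division_Icc[OF P(2) \<open>a \<le> b\<close>])
    also have "\<dots> = sum ?f (D2 \<union> Q)" by (rule sum_division_Icc[OF D2Q' \<open>a \<le> b\<close>, symmetric])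
    also have "\<dots> = sum ?f D2 + sum ?f Q"
      by (rule sum.union_inter_neutral) (use z D2 fin in \<open>auto simp: Q_def\<close>)
    finally show ?thesis by simp
  qed
qed

section \<open>Vitali coverings and differentiability almost everywhere\<close>

text \<open>The points finely covered, in the sense of Vitali, by the intervals with property
  \<open>P\<close>. Requiring \<open>x\<close> to be interior to the interval makes the set a
  countable intersection of open sets, hence measurable whatever \<open>P\<close> is.\<close>

definition fine_points :: "(real \<Rightarrow> real \<Rightarrow> bool) \<Rightarrow> real set" where
  "fine_points P = {x. \<forall>d>0. \<exists>s t. s < x \<and> x < t \<and> t - s < d \<and> P s t}"

lemma fine_points_sets: "fine_points P \<in> sets lebesgue"
proof -
  let ?G = "\<lambda>n. \<Union>{{s<..<t} |s t. t - s < inverse (Suc n) \<and> P s t}"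
  have "fine_points P = (\<Inter>n. ?G n)"
  proof (intro equalityI subsetI)
    fix x assume x: "x \<in> (\<Inter>n. ?G n)"
    show "x \<in> fine_points P"
      unfolding fine_points_def
    proof (clarify)
      fix d :: real assume "0 < d"
      then obtain n where n: "inverse (Suc n) < d" using reals_Archimedean by blast
      have "x \<in> ?G n" using x by (rule INT_D) simp
      then obtain s t where "x \<in> {s<..<t}" "t - s < inverse (Suc n)" "P s t" by blast
      then show "\<exists>s t. s < x \<and> x < t \<and> t - s < d \<and> P s t"
        using n by (intro exI[of _ s] exI[of _ t]) auto
    qed
  next
    fix x assume x: "x \<in> fine_points P"
    show "x \<in> (\<Inter>n. ?G n)"
    proof
      fix n
      have "0 < inverse (real (Suc n))" by simp
      then obtain s t where "s < x" "x < t" "t - s < inverse (Suc n)" "P s t"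
        using x unfolding fine_points_def by blast
      then show "x \<in> ?G n" by (intro UnionI[of "{s<..<t}"]) auto
    qed
  qed
  moreover have "open (?G n)" for n by (auto intro!: open_Union)
  ultimately show ?thesis by auto
qed

text \<open>The covering theorem yields countably many disjoint intervals that miss only a null set;
  by continuity of the measure finitely many of them miss less than \<open>e\<close>.\<close>

lemma Vitali_finite:
  fixes E W :: "real set"
  assumes E: "E \<in> lmeasurable" "E \<subseteq> W" "E \<subseteq> fine_points P" and W: "open W" "W \<in> lmeasurable" and "0 < e"
  obtains D where "D division_of \<Union>D" "\<Union>D \<subseteq> W" "\<And>K. K \<in> D \<Longrightarrow> \<exists>s t. s < t \<and> K = {s..t} \<and> P s t"
    "measure lebesgue (E - \<Union>D) < e"
proof -
  \<comment> \<open>Indices are pairs of end points; each interval is presented as a closed ball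
    around its midpoint, the form in which the covering theorem is stated.\<close>
  define K where "K = {i. fst i < snd i \<and> {fst i..snd i} \<subseteq> W \<and> P (fst i) (snd i)}"
  define a where "a = (\<lambda>i::real \<times> real. (fst i + snd i) / 2)"
  define r where "r = (\<lambda>i::real \<times> real. (snd i - fst i) / 2)"
  have cb: "cball (a i) (r i) = {fst i..snd i}" for i
    unfolding cball_eq_atLeastAtMost a_def r_def by (simp add: field_simps)
  have ex: "\<exists>i. i \<in> K \<and> x \<in> cball (a i) (r i) \<and> r i < d" if "x \<in> E" "0 < d" for x d
  proof -
    have "x \<in> W" using E that by auto
    then obtain w where "0 < w" and w: "ball x w \<subseteq> W" using W openE by blast
    have "x \<in> fine_points P" "0 < min d w" using E(3) that \<open>0 < w\<close> by auto
    then obtain s t where st: "s < x" "x < t" "t - s < min d w" "P s t"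
      unfolding fine_points_def by blast
    have "{s..t} \<subseteq> ball x w" using st by (auto simp: dist_real_def)
    then have "(s, t) \<in> K" using st w by (auto simp: K_def)
    moreover have "x \<in> cball (a (s, t)) (r (s, t))" using st unfolding cb by auto
    moreover have "r (s, t) < d" using st by (auto simp: r_def)
    ultimately show ?thesis by blast
  qed
  obtain C where C: "countable C" "C \<subseteq> K"
     "pairwise (\<lambda>i j. disjnt (cball (a i) (r i)) (cball (a j) (r j))) C"
     and neg: "negligible (E - (\<Union>i \<in> C. cball (a i) (r i)))"
    by (rule Vitali_covering_theorem_cballs[of K r E a]) (use ex in \<open>auto simp: K_def r_def\<close>)
  let ?DD = "(\<lambda>i. cball (a i) (r i)) ` C"
  have subW: "\<Union>?DD \<subseteq> W" using C(2) unfolding cb by (auto simp: K_def)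
  have lmDD: "\<Union>?DD \<in> lmeasurable"
  proof (rule fmeasurableI2[OF W(2) subW])
    show "\<Union>?DD \<in> sets lebesgue" using C(1) by (intro sets.countable_Union) auto
  qed
  obtain D where D: "D \<subseteq> ?DD" "finite D" "measure lebesgue (\<Union>?DD) - e < measure lebesgue (\<Union>D)"
  proof (rule measure_countable_Union_approachable[of ?DD e "measure lebesgue W"])
    show "countable ?DD" using C(1) by auto
    show "\<And>d. d \<in> ?DD \<Longrightarrow> d \<in> lmeasurable" by auto
    fix D' assume "D' \<subseteq> ?DD" "finite D'"
    then show "measure lebesgue (\<Union>D') \<le> measure lebesgue W"
      by (intro measure_mono_fmeasurable) (use subW W in \<open>auto intro!: sets.finite_Union\<close>)
  qed (use \<open>0 < e\<close> in auto)
  have lmD: "\<Union>D \<in> lmeasurable"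
    by (rule fmeasurableI2[OF lmDD]) (use D in \<open>auto intro!: sets.finite_Union\<close>)
  have st: "\<exists>s t. s < t \<and> X = {s..t} \<and> P s t" if "X \<in> D" for X
  proof -
    obtain i where i: "i \<in> C" "X = {fst i..snd i}" using D(1) \<open>X \<in> D\<close> cb by auto
    then have "fst i < snd i" "P (fst i) (snd i)" using C(2) by (auto simp: K_def)
    then show ?thesis using i by blast
  qed
  show thesis
  proof (rule that)
    show "D division_of \<Union>D"
    proof (rule division_ofI)
      fix X assume "X \<in> D"
      then show "X \<subseteq> \<Union>D" by auto
      show "X \<noteq> {}" "\<exists>a b. X = cbox a b" using st[OF \<open>X \<in> D\<close>] by auto
    next
      fix X Y assume "X \<in> D" "Y \<in> D" "X \<noteq> Y"
      obtain i j where ij: "i \<in> C" "j \<in> C" "X = cball (a i) (r i)" "Y = cball (a j) (r j)"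
        using D(1) \<open>X \<in> D\<close> \<open>Y \<in> D\<close> by blast
      then have "i \<noteq> j" using \<open>X \<noteq> Y\<close> by auto
      then have "disjnt X Y" using C(3) ij by (auto simp: pairwise_def)
      then show "interior X \<inter> interior Y = {}" using interior_subset by (fastforce simp: disjnt_def)
    qed (use D in auto)
    show "\<Union>D \<subseteq> W" using D(1) subW by auto
    have "measure lebesgue (E - \<Union>D) \<le> measure lebesgue ((E - \<Union>?DD) \<union> (\<Union>?DD - \<Union>D))"
      by (rule measure_mono_fmeasurable)
        (use neg lmDD lmD E in \<open>auto intro: negligible_imp_measurable\<close>)
    also have "\<dots> \<le> measure lebesgue (E - \<Union>?DD) + measure lebesgue (\<Union>?DD - \<Union>D)"
      by (rule measure_Un_le) (use neg lmDD lmD in \<open>auto intro: negligible_imp_sets\<close>)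
    also have "measure lebesgue (E - \<Union>?DD) = 0" using neg by (rule negligible_imp_measure0)
    also have "measure lebesgue (\<Union>?DD - \<Union>D) = measure lebesgue (\<Union>?DD) - measure lebesgue (\<Union>D)"
      by (rule measurable_measure_Diff) (use lmDD lmD D(1) in auto)
    also have "0 + \<dots> < e" using D(3) by simp
    finally show "measure lebesgue (E - \<Union>D) < e" .
  qed (use st in auto)
qed

lemma measure_division_Icc:
  fixes D :: "real set set"
  assumes "D division_of \<Union>D"
  shows "measure lebesgue (\<Union>D) = (\<Sum>K\<in>D. Sup K - Inf K)"
proof -
  have "measure lebesgue (\<Union>D) = sum (measure lebesgue) D"
  proof (rule measure_negligible_finite_Union)
    show "finite D" using assms by auto
    show "S \<in> lmeasurable" if "S \<in> D" for S
      using division_ofD(4)[OF assms that] by auto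
    show "pairwise (\<lambda>S T. negligible (S \<inter> T)) D"
    proof (rule pairwiseI)
      fix S T assume ST: "S \<in> D" "T \<in> D" "S \<noteq> T"
      obtain a b c d where "S = cbox a b" "T = cbox c d"
        using division_ofD(4)[OF assms] ST by meson
      moreover have "interior S \<inter> interior T = {}" by (rule division_ofD(5)[OF assms ST])
      ultimately have "negligible (cbox a b \<inter> cbox c d)"
        using negligible_convex_interior[of "cbox a b \<inter> cbox c d"] by (simp add: convex_Int interior_Int)
      then show "negligible (S \<inter> T)" using \<open>S = _\<close> \<open>T = _\<close> by simp
    qed
  qed
  also have "\<dots> = (\<Sum>K\<in>D. Sup K - Inf K)"
  proof (rule sum.cong[OF refl])
    fix K assume "K \<in> D"
    obtain c d where "c \<le> d" "K = {c..d}" "Inf K = c" "Sup K = d"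
      by (rule division_of_IccE[OF assms \<open>K \<in> D\<close>])
    then show "measure lebesgue K = Sup K - Inf K" by simp
  qed
  finally show ?thesis .
qed

text \<open>Lebesgue's argument with two coverings. The set is covered by intervals of slope below
  \<open>p\<close>, and inside these again by intervals of slope above \<open>q\<close>. The part of
  the first family missed by the second is short, and absolute continuity, taking the place of
  monotonicity in the classical proof, makes the increment over it negligible. Hence
  \<open>q\<close> times the measure is nearly at most \<open>p\<close> times the measure.\<close>

lemma negligible_distinct_derivates:
  fixes g :: "real \<Rightarrow> real"
  assumes ac: "abs_continuous_on {a..b} g" and "p < q"
  shows "negligible (fine_points (\<lambda>s t. a < s \<and> t < b \<and> g t - g s < p * (t - s)) \<inter>
                     fine_points (\<lambda>s t. a < s \<and> t < b \<and> g t - g s > q * (t - s)))"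
    (is "negligible ?E")
proof -
  let ?P = "\<lambda>s t. a < s \<and> t < b \<and> g t - g s < p * (t - s)"
  let ?Q = "\<lambda>s t. a < s \<and> t < b \<and> g t - g s > q * (t - s)"
  let ?\<Delta> = "\<lambda>K. g (Sup K) - g (Inf K)"
  define E where "E = fine_points ?P \<inter> fine_points ?Q"
  have E_sub: "E \<subseteq> fine_points ?P" "E \<subseteq> fine_points ?Q" and Emeas: "E \<in> sets lebesgue"
    unfolding E_def using fine_points_sets by auto
  have Eab: "E \<subseteq> {a<..<b}"
  proof
    fix x assume "x \<in> E"
    then have "x \<in> fine_points ?P" using E_sub by blast
    then have "\<exists>s t. s < x \<and> x < t \<and> t - s < 1 \<and> ?P s t" unfolding fine_points_def by force
    then show "x \<in> {a<..<b}" by auto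
  qed
  have Elm: "E \<in> lmeasurable"
    by (rule fmeasurableI2[of "{a<..<b}"]) (use Eab Emeas in auto)
  let ?m = "measure lebesgue E"
  \<comment> \<open>The three terms account for the increment over the remainder, for its measure
    multiplied by \<open>q\<close>, and for the part of \<open>E\<close> missed by the first
    covering.\<close>
  have key: "(q - p) * ?m \<le> e * (1 + \<bar>q\<bar> + (q - p))" if "0 < e" for e
  proof -
    obtain d where "0 < d" and d: "\<And>D. D division_of \<Union>D \<Longrightarrow> \<Union>D \<subseteq> {a..b} \<Longrightarrow>
        (\<Sum>K\<in>D. Sup K - Inf K) < d \<Longrightarrow> (\<Sum>K\<in>D. norm (?\<Delta> K)) < e"
      by (rule abs_continuous_onD[OF ac order.refl \<open>0 < e\<close>]) blast
    \<comment> \<open>The remainder has measure below \<open>2 * e'\<close>: one \<open>e'\<close>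
      from the excess of \<open>W\<close> over \<open>E\<close>, one from the points missed by the
      second covering. So \<open>2 * e'\<close> must not exceed \<open>d\<close> or
      \<open>e\<close>.\<close>
    define e' where "e' = min e d / 2"
    have e': "0 < e'" "2 * e' \<le> e" "2 * e' \<le> d" "e' \<le> e" using \<open>0 < e\<close> \<open>0 < d\<close> by (auto simp: e'_def)
    obtain U where U: "open U" "E \<subseteq> U" "U - E \<in> lmeasurable" "emeasure lebesgue (U - E) < ennreal e'"
      using sets_lebesgue_outer_open[OF Emeas e'(1)] by blast
    have mU: "measure lebesgue (U - E) < e'"
      using U(3,4) by (metis e'(1) emeasure_eq_measure2 ennreal_less_iff measure_nonneg)
    define W where "W = U \<inter> {a<..<b}"
    have W: "open W" "E \<subseteq> W" "W \<in> lmeasurable" "W \<subseteq> {a..b}"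
    proof -
      show "open W" using U by (auto simp: W_def)
      show "W \<in> lmeasurable" unfolding W_def
        by (rule fmeasurableI2[of "{a<..<b}"]) (use U in auto)
    qed (use U Eab in \<open>auto simp: W_def\<close>)
    have mW: "measure lebesgue (W - E) < e'"
    proof -
      have "measure lebesgue (W - E) \<le> measure lebesgue (U - E)"
        by (rule measure_mono_fmeasurable) (use U W Elm in \<open>auto simp: W_def\<close>)
      with mU show ?thesis by simp
    qed
    obtain D1 where D1: "D1 division_of \<Union>D1" "\<Union>D1 \<subseteq> W" 
        and D1': "\<And>K. K \<in> D1 \<Longrightarrow> \<exists>s t. s < t \<and> K = {s..t} \<and> ?P s t"
        and m1: "measure lebesgue (E - \<Union>D1) < e'"
      by (rule Vitali_finite[OF Elm W(2) E_sub(1) W(1,3) e'(1)]) blast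
    define S where "S = \<Union>D1"
    note D1 = D1[folded S_def] and m1 = m1[folded S_def]
    have D1_self: "D1 division_of \<Union>D1" using D1(1) by (simp add: S_def)
    have lmS: "S \<in> lmeasurable" by (rule lmeasurable_division[OF D1(1)])
    \<comment> \<open>The second covering has to take place in an open set, hence in
      \<open>interior S\<close>; only end points are lost.\<close>
    have neg: "negligible (S - interior S)"
    proof (rule negligible_subset)
      show "negligible (\<Union>K\<in>D1. {Inf K, Sup K})" 
        using division_of_finite[OF D1(1)] by (intro negligible_finite) auto
      show "S - interior S \<subseteq> (\<Union>K\<in>D1. {Inf K, Sup K})"
      proof
        fix x assume x: "x \<in> S - interior S"
        then obtain K where K: "K \<in> D1" "x \<in> K" by (auto simp: S_def)
        obtain s t where st: "s < t" "K = {s..t}" using D1'[OF K(1)] by auto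
        have "interior K \<subseteq> interior S" using K by (intro interior_mono) (auto simp: S_def)
        then have "x \<notin> {s<..<t}" using x st by auto
        then have "x = s \<or> x = t" using K st by auto
        then show "x \<in> (\<Union>K\<in>D1. {Inf K, Sup K})" using K st by (intro UN_I[OF K(1)]) auto
      qed
    qed
    let ?E2 = "E \<inter> interior S"
    have lmi: "interior S \<in> lmeasurable"
      by (rule fmeasurableI2[OF lmS]) (auto simp: interior_subset)
    obtain D2 where D2: "D2 division_of \<Union>D2" "\<Union>D2 \<subseteq> interior S"
        and D2': "\<And>K. K \<in> D2 \<Longrightarrow> \<exists>s t. s < t \<and> K = {s..t} \<and> ?Q s t"
        and m2: "measure lebesgue (?E2 - \<Union>D2) < e'"
      
    proof (rule Vitali_finite[OF _ _ _ _ lmi e'(1), of ?E2 ?Q])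
      show "?E2 \<in> lmeasurable" using Elm lmi by (rule fmeasurable.Int)
      show "?E2 \<subseteq> fine_points ?Q" using E_sub by blast
    qed auto
    have lmD2: "\<Union>D2 \<in> lmeasurable" by (rule lmeasurable_division[OF D2(1)])
    have D2S: "\<Union>D2 \<subseteq> S" using D2(2) interior_subset by blast
    have diff: "measure lebesgue (S - \<Union>D2) < 2 * e'"
    proof -
      have "measure lebesgue (S - \<Union>D2) \<le> measure lebesgue (((W - E) \<union> (?E2 - \<Union>D2)) \<union> (S - interior S))"
        by (rule measure_mono_fmeasurable) (use D1(2) W Elm lmi lmD2 lmS in auto)
      also have "\<dots> \<le> measure lebesgue ((W - E) \<union> (?E2 - \<Union>D2)) + measure lebesgue (S - interior S)"
        by (rule measure_Un_le) (use W Elm lmi lmD2 lmS in auto)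
      also have "\<dots> = measure lebesgue ((W - E) \<union> (?E2 - \<Union>D2))"
        using negligible_imp_measure0[OF neg] by simp
      also have "\<dots> \<le> measure lebesgue (W - E) + measure lebesgue (?E2 - \<Union>D2)"
        by (rule measure_Un_le) (use W Elm lmi lmD2 lmS in auto)
      finally show ?thesis using mW m2 by simp
    qed
    have mdiff: "measure lebesgue (S - \<Union>D2) = measure lebesgue S - measure lebesgue (\<Union>D2)"
      by (rule measurable_measure_Diff) (use lmS lmD2 D2S in auto)
    have mS: "?m - e' \<le> measure lebesgue S"
    proof -
      have "?m \<le> measure lebesgue ((E - S) \<union> S)"
        by (rule measure_mono_fmeasurable) (use Elm lmS in auto)
      also have "\<dots> \<le> measure lebesgue (E - S) + measure lebesgue S"
        by (rule measure_Un_le) (use Elm lmS in auto)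
      finally show ?thesis using m1 by simp
    qed
    \<comment> \<open>Completing \<open>D2\<close> to a division of \<open>S\<close> expresses the
      increment of \<open>g\<close> over \<open>S\<close>, computed with \<open>D1\<close>, as the
      increment over \<open>D2\<close> plus that over the short remainder \<open>?R\<close>.\<close>
    obtain r where r: "D2 \<subseteq> r" "r division_of S"
      using partial_division_extend[OF D2(1) D1(1) D2S] by blast
    have rfin: "finite r" using r by auto
    let ?R = "r - D2"
    have R: "?R division_of \<Union>?R"
      by (rule division_of_subset[of r]) (use r division_ofD(6)[OF r(2)] in auto)
    have RS: "\<Union>?R \<subseteq> {a..b}" using division_ofD(6)[OF r(2)] D1(2) W(4) by blast
    have split: "sum f r = sum f ?R + sum f D2" for f :: "real set \<Rightarrow> real"
      using sum.subset_diff[OF r(1) rfin, of f] .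
    have lenR: "(\<Sum>K\<in>?R. Sup K - Inf K) < d"
    proof -
      have "(\<Sum>K\<in>?R. Sup K - Inf K) = (\<Sum>K\<in>r. Sup K - Inf K) - (\<Sum>K\<in>D2. Sup K - Inf K)"
        by (subst split) simp
      also have "(\<Sum>K\<in>r. Sup K - Inf K) = (\<Sum>K\<in>D1. Sup K - Inf K)"
        by (rule sum_division_unique[OF r(2) D1(1)])
      finally show ?thesis
        using diff mdiff e'(3) measure_division_Icc[OF D1_self, folded S_def] measure_division_Icc[OF D2(1)] by simp
    qed
    have "norm (sum ?\<Delta> ?R) < e" by (rule le_less_trans[OF norm_sum d[OF R RS lenR]])
    moreover have "sum ?\<Delta> D1 = sum ?\<Delta> ?R + sum ?\<Delta> D2"
      using sum_division_unique[OF r(2) D1(1), of g] split[of ?\<Delta>] by simp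
    moreover have "sum ?\<Delta> D1 \<le> p * measure lebesgue S"
      unfolding measure_division_Icc[OF D1_self, folded S_def] sum_distrib_left
    proof (rule sum_mono)
      fix K assume "K \<in> D1"
      then obtain s t where "s < t" "K = {s..t}" "g t - g s < p * (t - s)" using D1' by blast
      then show "?\<Delta> K \<le> p * (Sup K - Inf K)" by simp
    qed
    moreover have "q * measure lebesgue (\<Union>D2) \<le> sum ?\<Delta> D2"
      unfolding measure_division_Icc[OF D2(1)] sum_distrib_left
    proof (rule sum_mono)
      fix K assume "K \<in> D2"
      then obtain s t where "s < t" "K = {s..t}" "g t - g s > q * (t - s)" using D2' by blast
      then show "q * (Sup K - Inf K) \<le> ?\<Delta> K" by simp
    qed
    ultimately have 1: "q * measure lebesgue (\<Union>D2) \<le> p * measure lebesgue S + e" by auto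
    have "q * (measure lebesgue S - measure lebesgue (\<Union>D2)) \<le> \<bar>q\<bar> * (2 * e')"
    proof -
      have "q * measure lebesgue (S - \<Union>D2) \<le> \<bar>q\<bar> * measure lebesgue (S - \<Union>D2)"
        by (intro mult_right_mono) auto
      also have "\<dots> \<le> \<bar>q\<bar> * (2 * e')" using diff by (intro mult_left_mono) auto
      finally show ?thesis using mdiff by simp
    qed
    also have "\<dots> \<le> \<bar>q\<bar> * e" using e'(2) by (intro mult_left_mono) auto
    finally have 2: "(q - p) * measure lebesgue S \<le> e + \<bar>q\<bar> * e" using 1 by (simp add: algebra_simps)
    have "(q - p) * (?m - e) \<le> (q - p) * measure lebesgue S"
      using \<open>p < q\<close> mS e'(4) by (intro mult_left_mono) auto
    then show ?thesis using 2 by (simp add: algebra_simps)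
  qed
  have "?m = 0"
  proof (rule ccontr)
    assume "?m \<noteq> 0"
    then have pos: "0 < (q - p) * ?m" using \<open>p < q\<close> by (auto simp: zero_less_measure_iff)
    define c where "c = 1 + \<bar>q\<bar> + (q - p)"
    have "0 < c" using \<open>p < q\<close> by (auto simp: c_def)
    have "(q - p) * ?m \<le> ((q - p) * ?m / (2 * c)) * c"
      using key[of "(q - p) * ?m / (2 * c)"] pos \<open>0 < c\<close> by (simp add: c_def)
    then show False using pos \<open>0 < c\<close> by simp
  qed
  then show ?thesis using Elm negligible_iff_measure E_def by metis
qed

text \<open>Where the quotients are unbounded, disjoint intervals of slope above
  \<open>Suc n\<close> cover all but \<open>inverse (Suc n)\<close> of the set; their own total
  length is at most \<open>inverse (Suc n)\<close>, because the variation is at most 1.\<close>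

lemma negligible_infinite_derivates:
  fixes g :: "real \<Rightarrow> real"
  assumes bv: "\<And>D. D division_of \<Union>D \<Longrightarrow> \<Union>D \<subseteq> {a..b} \<Longrightarrow> (\<Sum>K\<in>D. norm (g (Sup K) - g (Inf K))) \<le> 1"
  shows "negligible (\<Inter>n::nat. fine_points (\<lambda>s t. a < s \<and> t < b \<and> \<bar>g t - g s\<bar> > n * (t - s)))"
    (is "negligible ?E")
proof -
  let ?P = "\<lambda>n::nat. \<lambda>s t. a < s \<and> t < b \<and> \<bar>g t - g s\<bar> > n * (t - s)"
  define E where "E = (\<Inter>n. fine_points (?P n))"
  have E_sub: "E \<subseteq> fine_points (?P n)" for n unfolding E_def by blast
  have Emeas: "E \<in> sets lebesgue"
    unfolding E_def by (rule sets.countable_INT') (use fine_points_sets in auto)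
  have Eab: "E \<subseteq> {a<..<b}"
  proof
    fix x assume "x \<in> E"
    then have "x \<in> fine_points (?P 0)" using E_sub by blast
    then obtain s t where "s < x" "x < t" "a < s" "t < b"
      unfolding fine_points_def using zero_less_one by blast
    then show "x \<in> {a<..<b}" by simp
  qed
  have Elm: "E \<in> lmeasurable"
    by (rule fmeasurableI2[of "{a<..<b}"]) (use Eab Emeas in auto)
  let ?m = "measure lebesgue E"
  have key: "?m \<le> 2 * inverse (Suc n)" for n
  proof -
    obtain D where D: "D division_of \<Union>D" "\<Union>D \<subseteq> {a<..<b}"
        and D': "\<And>K. K \<in> D \<Longrightarrow> \<exists>s t. s < t \<and> K = {s..t} \<and> ?P (Suc n) s t"
        and m: "measure lebesgue (E - \<Union>D) < inverse (Suc n)"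
      by (rule Vitali_finite[OF Elm Eab E_sub[of "Suc n"], of "inverse (Suc n)"]) (simp, simp, simp, blast)
    have lmD: "\<Union>D \<in> lmeasurable" by (rule lmeasurable_division[OF D(1)])
    have "Suc n * measure lebesgue (\<Union>D) \<le> (\<Sum>K\<in>D. norm (g (Sup K) - g (Inf K)))"
      unfolding measure_division_Icc[OF D(1)] sum_distrib_left
    proof (rule sum_mono)
      fix K assume "K \<in> D"
      from D'[OF this] obtain s t :: real where "s < t" "K = {s..t}" "\<bar>g t - g s\<bar> > real (Suc n) * (t - s)" by auto
      then show "Suc n * (Sup K - Inf K) \<le> norm (g (Sup K) - g (Inf K))" by simp
    qed
    also have "\<Union>D \<subseteq> {a..b}" using D(2) by auto
    then have "(\<Sum>K\<in>D. norm (g (Sup K) - g (Inf K))) \<le> 1" by (rule bv[OF D(1)])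
    finally have 1: "measure lebesgue (\<Union>D) \<le> inverse (Suc n)" by (simp add: field_simps)
    have "?m \<le> measure lebesgue ((E - \<Union>D) \<union> \<Union>D)"
      by (rule measure_mono_fmeasurable) (use Elm lmD in auto)
    also have "\<dots> \<le> measure lebesgue (E - \<Union>D) + measure lebesgue (\<Union>D)"
      by (rule measure_Un_le) (use Elm lmD in auto)
    finally show ?thesis using m 1 by simp
  qed
  have "?m = 0"
  proof (rule ccontr)
    assume "?m \<noteq> 0"
    then have "0 < ?m / 2" by (auto simp: zero_less_measure_iff)
    then obtain n where "inverse (real (Suc n)) < ?m / 2" using reals_Archimedean by blast
    with key[of n] show False by simp
  qed
  then show ?thesis using Elm negligible_iff_measure E_def by metis
qed

text \<open>A difference quotient at \<open>x\<close> belongs to an interval ending at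
  \<open>x\<close>, whereas \<open>fine_points\<close> wants \<open>x\<close> inside. By continuity
  of \<open>g\<close> that end can be moved slightly across \<open>x\<close> without leaving the
  open set \<open>U\<close>.\<close>

lemma interval_perturb:
  fixes g :: "real \<Rightarrow> real"
  assumes cont: "continuous_on {a..b} g" and "open U"
    and x: "a < x" "x < b" and y: "a < y" "y < b" "y \<noteq> x" "\<bar>y - x\<bar> < d"
    and U: "(max x y - min x y, g (max x y) - g (min x y)) \<in> U"
  shows "\<exists>s t. s < x \<and> x < t \<and> t - s < d \<and> a < s \<and> t < b \<and> (t - s, g t - g s) \<in> U"
proof -
  have gx: "(g \<longlongrightarrow> g x) (at x)"
    using continuous_on_interior[OF cont, of x] x by (simp add: continuous_at)
  show ?thesis
  proof (cases "x < y")
    case True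
    have "((\<lambda>s. (y - s, g y - g s)) \<longlongrightarrow> (y - x, g y - g x)) (at x)"
      by (intro tendsto_intros gx)
    then have "eventually (\<lambda>s. (y - s, g y - g s) \<in> U) (at x)"
      by (rule topological_tendstoD[OF _ \<open>open U\<close>]) (use U True in auto)
    then have "eventually (\<lambda>s. (y - s, g y - g s) \<in> U) (at_left x)"
      by (rule filter_leD[OF at_le, rotated]) auto
    moreover have "eventually (\<lambda>s. max a (y - d) < s) (at_left x)"
      by (rule order_tendstoD(1)[OF tendsto_ident_at]) (use x y True in auto)
    moreover have "eventually (\<lambda>s. s < x) (at_left x)"
      by (simp add: eventually_at_filter)
    ultimately have "eventually (\<lambda>s. (y - s, g y - g s) \<in> U \<and> max a (y - d) < s \<and> s < x) (at_left x)"
      by eventually_elim simp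
    from eventually_happens'[OF trivial_limit_at_left_real this] 
    obtain s where "(y - s, g y - g s) \<in> U" "max a (y - d) < s" "s < x" by blast
    then show ?thesis using True y by (intro exI[of _ s] exI[of _ y]) auto
  next
    case False
    then have "y < x" using y by simp
    have "((\<lambda>s. (s - y, g s - g y)) \<longlongrightarrow> (x - y, g x - g y)) (at x)"
      by (intro tendsto_intros gx)
    then have "eventually (\<lambda>s. (s - y, g s - g y) \<in> U) (at x)"
      by (rule topological_tendstoD[OF _ \<open>open U\<close>]) (use U \<open>y < x\<close> in auto)
    then have "eventually (\<lambda>s. (s - y, g s - g y) \<in> U) (at_right x)"
      by (rule filter_leD[OF at_le, rotated]) auto
    moreover have "eventually (\<lambda>s. s < min b (y + d)) (at_right x)"
      by (rule order_tendstoD(2)[OF tendsto_ident_at]) (use x y \<open>y < x\<close> in auto)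
    moreover have "eventually (\<lambda>s. x < s) (at_right x)"
      by (simp add: eventually_at_filter)
    ultimately have "eventually (\<lambda>s. (s - y, g s - g y) \<in> U \<and> s < min b (y + d) \<and> x < s) (at_right x)"
      by eventually_elim simp
    from eventually_happens'[OF trivial_limit_at_right_real this] 
    obtain s where "(s - y, g s - g y) \<in> U" "s < min b (y + d)" "x < s" by blast
    then show ?thesis using \<open>y < x\<close> y by (intro exI[of _ y] exI[of _ s]) auto
  qed
qed

text \<open>Turns the absence of fine intervals into a bound on the difference quotients near
  \<open>x\<close>; \<open>max\<close> and \<open>min\<close> treat both sides of \<open>x\<close>
  at once.\<close>

lemma eventually_not_fine_points:
  fixes g :: "real \<Rightarrow> real"
  assumes cont: "continuous_on {a..b} g" and "open U" and x: "a < x" "x < b"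
    and nf: "x \<notin> fine_points (\<lambda>s t. a < s \<and> t < b \<and> (t - s, g t - g s) \<in> U)"
  shows "eventually (\<lambda>y. y \<noteq> x \<and> (max x y - min x y, g (max x y) - g (min x y)) \<notin> U) (at x)"
proof -
  obtain d where "0 < d" and d: "\<And>s t. s < x \<Longrightarrow> x < t \<Longrightarrow> t - s < d \<Longrightarrow> a < s \<Longrightarrow> t < b \<Longrightarrow> (t - s, g t - g s) \<notin> U"
    using nf unfolding fine_points_def by blast
  have "eventually (\<lambda>y. y \<in> {a<..<b} \<and> y \<noteq> x \<and> \<bar>y - x\<bar> < d) (at x)"
  proof -
    have "eventually (\<lambda>y. y \<in> {a<..<b}) (at x)" by (rule eventually_at_in_open') (use x in auto)
    moreover have "eventually (\<lambda>y. y \<noteq> x \<and> \<bar>y - x\<bar> < d) (at x)"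
      unfolding eventually_at using \<open>0 < d\<close> by (intro exI[of _ d]) (auto simp: dist_real_def)
    ultimately show ?thesis by eventually_elim simp
  qed
  then show ?thesis
  proof eventually_elim
    case (elim y)
    show ?case
    proof (rule conjI)
      show "y \<noteq> x" using elim by simp
      show "(max x y - min x y, g (max x y) - g (min x y)) \<notin> U"
        using interval_perturb[OF cont \<open>open U\<close> x, of y d] elim d by auto
    qed
  qed
qed

text \<open>Outside the two kinds of exceptional sets the lower and upper limits of the difference
  quotient are finite and no two rationals separate them, so they agree. Rational pairs keep the
  union countable.\<close>

lemma negligible_not_differentiable_short:
  fixes g :: "real \<Rightarrow> real"
  assumes ac: "abs_continuous_on {a..b} g"
    and bv: "\<And>D. D division_of \<Union>D \<Longrightarrow> \<Union>D \<subseteq> {a..b} \<Longrightarrow> (\<Sum>K\<in>D. norm (g (Sup K) - g (Inf K))) \<le> 1"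
  shows "negligible {x \<in> {a<..<b}. \<not> g differentiable (at x)}"
proof -
  have cont: "continuous_on {a..b} g" by (rule abs_continuous_on_imp_continuous_on_Icc[OF ac])
  define Einf where "Einf = (\<Inter>n::nat. fine_points (\<lambda>s t. a < s \<and> t < b \<and> \<bar>g t - g s\<bar> > n * (t - s)))"
  define E where "E = (\<lambda>(p, q). fine_points (\<lambda>s t. a < s \<and> t < b \<and> g t - g s < real_of_rat p * (t - s)) \<inter>
                     fine_points (\<lambda>s t. a < s \<and> t < b \<and> g t - g s > real_of_rat q * (t - s)))"
  have "negligible Einf" unfolding Einf_def by (rule negligible_infinite_derivates[OF bv])
  have "negligible (\<Union>(E ` {(p, q). p < q}))"
  proof (rule negligible_countable_Union)
    fix S assume "S \<in> E ` {(p, q). p < q}"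
    then obtain p q where "p < q" "S = E (p, q)" by blast
    then show "negligible S"
      unfolding E_def using negligible_distinct_derivates[OF ac, of "real_of_rat p" "real_of_rat q"]
      by (simp add: of_rat_less)
  qed auto
  with \<open>negligible Einf\<close> have neg: "negligible (Einf \<union> \<Union>(E ` {(p, q). p < q}))" by simp
  have diff: "g differentiable (at x)" if x: "a < x" "x < b" and
    xn: "x \<notin> Einf" "\<And>p q. p < q \<Longrightarrow> x \<notin> E (p, q)" for x
  proof -
    define \<phi> where "\<phi> = (\<lambda>y. (g y - g x) / (y - x))"
    have low: "eventually (\<lambda>y. \<phi> y \<ge> p) (at x)"
      if "x \<notin> fine_points (\<lambda>s t. a < s \<and> t < b \<and> g t - g s < p * (t - s))" for p
    proof -
      have op: "open {z :: real \<times> real. snd z < p * fst z}"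
        by (intro open_Collect_less continuous_intros)
      have "eventually (\<lambda>y. y \<noteq> x \<and> (max x y - min x y, g (max x y) - g (min x y)) \<notin> {z. snd z < p * fst z}) (at x)"
        by (rule eventually_not_fine_points[OF cont op x]) (use that in simp)
      then show ?thesis
        by eventually_elim (auto simp: \<phi>_def max_def min_def field_simps split: if_splits)
    qed
    have up: "eventually (\<lambda>y. \<phi> y \<le> p) (at x)"
      if "x \<notin> fine_points (\<lambda>s t. a < s \<and> t < b \<and> g t - g s > p * (t - s))" for p
    proof -
      have op: "open {z :: real \<times> real. snd z > p * fst z}"
        by (intro open_Collect_less continuous_intros)
      have "eventually (\<lambda>y. y \<noteq> x \<and> (max x y - min x y, g (max x y) - g (min x y)) \<notin> {z. snd z > p * fst z}) (at x)"
        by (rule eventually_not_fine_points[OF cont op x]) (use that in simp)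
      then show ?thesis
        by eventually_elim (auto simp: \<phi>_def max_def min_def field_simps split: if_splits)
    qed
    obtain n :: nat where n: "x \<notin> fine_points (\<lambda>s t. a < s \<and> t < b \<and> \<bar>g t - g s\<bar> > n * (t - s))"
      using xn(1) unfolding Einf_def by blast
    have "x \<notin> fine_points (\<lambda>s t. a < s \<and> t < b \<and> g t - g s > n * (t - s))"
      using n unfolding fine_points_def by (auto simp: abs_if) (smt (verit))
    then have upn: "eventually (\<lambda>y. \<phi> y \<le> n) (at x)" by (rule up)
    have "x \<notin> fine_points (\<lambda>s t. a < s \<and> t < b \<and> g t - g s < (- n) * (t - s))"
      using n unfolding fine_points_def by (auto simp: abs_if) (smt (verit))
    then have lown: "eventually (\<lambda>y. \<phi> y \<ge> - n) (at x)" using low by blast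
    define l where "l = Liminf (at x) (\<lambda>y. ereal (\<phi> y))"
    define u where "u = Limsup (at x) (\<lambda>y. ereal (\<phi> y))"
    have "l \<le> u" unfolding l_def u_def by (rule Liminf_le_Limsup) simp
    have l_ge: "ereal p \<le> l" if "eventually (\<lambda>y. \<phi> y \<ge> p) (at x)" for p
      unfolding l_def by (rule Liminf_bounded) (use that in simp)
    have u_le: "u \<le> ereal p" if "eventually (\<lambda>y. \<phi> y \<le> p) (at x)" for p
      unfolding u_def by (rule Limsup_bounded) (use that in simp)
    have "l = u"
    proof (rule ccontr)
      assume "l \<noteq> u"
      then have "l < u" using \<open>l \<le> u\<close> by simp
      then obtain p where p: "l < ereal (real_of_rat p)" "ereal (real_of_rat p) < u" using ereal_dense3 by blast
      then obtain q where q: "ereal (real_of_rat p) < ereal (real_of_rat q)" "ereal (real_of_rat q) < u"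
        using ereal_dense3 by blast
      then have "p < q" by (simp add: of_rat_less)
      from xn(2)[OF this] consider "x \<notin> fine_points (\<lambda>s t. a < s \<and> t < b \<and> g t - g s < real_of_rat p * (t - s))"
        | "x \<notin> fine_points (\<lambda>s t. a < s \<and> t < b \<and> g t - g s > real_of_rat q * (t - s))"
        unfolding E_def by auto
      then show False
      proof cases
        case 1
        then show ?thesis using l_ge[OF low[OF 1]] p by simp
      next
        case 2
        then show ?thesis using u_le[OF up[OF 2]] q by simp
      qed
    qed
    moreover have "ereal (- n) \<le> l" "u \<le> ereal n" using l_ge[OF lown] u_le[OF upn] by auto
    ultimately obtain r where r: "l = ereal r" "u = ereal r" by (cases l) auto
    have "((\<lambda>y. ereal (\<phi> y)) \<longlongrightarrow> ereal r) (at x)"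
      by (subst tendsto_iff_Liminf_eq_Limsup) (use r in \<open>auto simp: l_def u_def\<close>)
    then have "(\<phi> \<longlongrightarrow> r) (at x)" by simp
    then have "(g has_field_derivative r) (at x)"
      unfolding \<phi>_def has_field_derivative_iff by simp
    then show ?thesis using real_differentiable_def by blast
  qed
  show ?thesis
  proof (rule negligible_subset[OF neg], rule subsetI, rule ccontr)
    fix x assume x: "x \<in> {x \<in> {a<..<b}. \<not> g differentiable at x}"
      and "x \<notin> Einf \<union> \<Union> (E ` {(p, q). p < q})"
    then have "x \<notin> Einf" "\<And>p q. p < q \<Longrightarrow> x \<notin> E (p, q)" by blast+
    then show False using diff[of x] x by auto
  qed
qed

text \<open>Absolute continuity with tolerance 1 bounds the variation by 1 on every interval shorter
  than \<open>d\<close>; countably many of these with rational ends cover the open interval.\<close>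

lemma negligible_not_differentiable_real:
  fixes g :: "real \<Rightarrow> real"
  assumes ac: "abs_continuous_on {a..b} g"
  shows "negligible {x \<in> {a<..<b}. \<not> g differentiable (at x)}"
proof -
  obtain d where "0 < d" and d: "\<And>D. D division_of \<Union>D \<Longrightarrow> \<Union>D \<subseteq> {a..b} \<Longrightarrow>
      (\<Sum>K\<in>D. Sup K - Inf K) < d \<Longrightarrow> (\<Sum>K\<in>D. norm (g (Sup K) - g (Inf K))) < 1"
    by (rule abs_continuous_onD[OF ac order.refl zero_less_one]) blast
  define I where "I = {(p, q). a \<le> real_of_rat p \<and> real_of_rat q \<le> b \<and> real_of_rat q - real_of_rat p < d}"
  define E where "E = (\<lambda>(p, q). {x \<in> {real_of_rat p<..<real_of_rat q}. \<not> g differentiable (at x)})"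
  have neg: "negligible (\<Union>(E ` I))"
  proof (rule negligible_countable_Union)
    fix S assume "S \<in> E ` I"
    then obtain p q where pq: "(p, q) \<in> I" "S = E (p, q)" by auto
    let ?p = "real_of_rat p" and ?q = "real_of_rat q"
    have sub: "{?p..?q} \<subseteq> {a..b}" using pq by (auto simp: I_def)
    show "negligible S"
      unfolding pq(2) E_def prod.case
    proof (rule negligible_not_differentiable_short)
      show "abs_continuous_on {?p..?q} g" by (rule abs_continuous_on_subset[OF ac sub])
      fix D :: "real set set" assume D: "D division_of \<Union>D" "\<Union>D \<subseteq> {?p..?q}"
      have "measure lebesgue (\<Union>D) \<le> measure lebesgue {?p..?q}"
        by (rule measure_mono_fmeasurable) (use D lmeasurable_division[OF D(1)] in auto)
      also have "\<dots> < d" using pq \<open>0 < d\<close> by (simp add: I_def)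
      finally have "(\<Sum>K\<in>D. Sup K - Inf K) < d" using measure_division_Icc[OF D(1)] by simp
      from d[OF D(1) subset_trans[OF D(2) sub] this]
      show "(\<Sum>K\<in>D. norm (g (Sup K) - g (Inf K))) \<le> 1" by simp
    qed
  qed auto
  show ?thesis
  proof (rule negligible_subset[OF neg], rule subsetI)
    fix x assume x: "x \<in> {x \<in> {a<..<b}. \<not> g differentiable (at x)}"
    obtain p where p: "max a (x - d / 2) < real_of_rat p" "real_of_rat p < x"
      using of_rat_dense[of "max a (x - d / 2)" x] x \<open>0 < d\<close> by auto
    obtain q where q: "x < real_of_rat q" "real_of_rat q < min b (x + d / 2)"
      using of_rat_dense[of x "min b (x + d / 2)"] x \<open>0 < d\<close> by auto
    have "(p, q) \<in> I" using p q by (auto simp: I_def)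
    moreover have "x \<in> E (p, q)" using x p q by (auto simp: E_def)
    ultimately show "x \<in> \<Union>(E ` I)" by (rule UN_I)
  qed
qed

section \<open>Domination criteria and the fundamental theorem of calculus\<close>

text \<open>The working criterion for absolute continuity. The constant may depend on the compact
  subinterval, since absolute continuity is itself a condition on each of these.\<close>

lemma abs_continuous_on_dominated:
  assumes ac: "abs_continuous_on I g1" "abs_continuous_on I g2"
    and dom: "\<And>a b. {a..b} \<subseteq> I \<Longrightarrow> \<exists>C. \<forall>s t. a \<le> s \<longrightarrow> s \<le> t \<longrightarrow> t \<le> b \<longrightarrow>
        norm (g t - g s) \<le> C * (norm (g1 t - g1 s) + norm (g2 t - g2 s))"
  shows "abs_continuous_on I g"
  unfolding abs_continuous_on_def
proof (intro allI impI)
  fix a b e :: real assume ab: "{a..b} \<subseteq> I" and "0 < e"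
  obtain C where C: "\<And>s t. a \<le> s \<Longrightarrow> s \<le> t \<Longrightarrow> t \<le> b \<Longrightarrow>
        norm (g t - g s) \<le> C * (norm (g1 t - g1 s) + norm (g2 t - g2 s))"
    using dom[OF ab] by blast
  define e' where "e' = e / (2 * (\<bar>C\<bar> + 1))"
  have "0 < e'" using \<open>0 < e\<close> by (auto simp: e'_def intro!: divide_pos_pos)
  obtain d1 where "0 < d1" and d1: "\<And>D. D division_of \<Union>D \<Longrightarrow> \<Union>D \<subseteq> {a..b} \<Longrightarrow>
      (\<Sum>K\<in>D. Sup K - Inf K) < d1 \<Longrightarrow> (\<Sum>K\<in>D. norm (g1 (Sup K) - g1 (Inf K))) < e'"
    by (rule abs_continuous_onD[OF ac(1) ab \<open>0 < e'\<close>]) blast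
  obtain d2 where "0 < d2" and d2: "\<And>D. D division_of \<Union>D \<Longrightarrow> \<Union>D \<subseteq> {a..b} \<Longrightarrow>
      (\<Sum>K\<in>D. Sup K - Inf K) < d2 \<Longrightarrow> (\<Sum>K\<in>D. norm (g2 (Sup K) - g2 (Inf K))) < e'"
    by (rule abs_continuous_onD[OF ac(2) ab \<open>0 < e'\<close>]) blast
  show "\<exists>d>0. \<forall>D E. D division_of E \<and> E \<subseteq> {a..b} \<and> (\<Sum>K\<in>D. Sup K - Inf K) < d \<longrightarrow>
          (\<Sum>K\<in>D. norm (g (Sup K) - g (Inf K))) < e"
  proof (intro exI[of _ "min d1 d2"] conjI allI impI)
    show "0 < min d1 d2" using \<open>0 < d1\<close> \<open>0 < d2\<close> by simp
    fix D E :: "_ set" assume *: "D division_of E \<and> E \<subseteq> {a..b} \<and> (\<Sum>K\<in>D. Sup K - Inf K) < min d1 d2"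
    then have DE: "D division_of \<Union>D" "\<Union>D \<subseteq> {a..b}" using division_ofD(6)[of D E] by auto
    have "(\<Sum>K\<in>D. norm (g (Sup K) - g (Inf K))) \<le>
        (\<Sum>K\<in>D. (\<bar>C\<bar> + 1) * (norm (g1 (Sup K) - g1 (Inf K)) + norm (g2 (Sup K) - g2 (Inf K))))"
    proof (rule sum_mono)
      fix K assume K: "K \<in> D"
      obtain c d where cd: "c \<le> d" "K = {c..d}" "Inf K = c" "Sup K = d" by (rule division_of_IccE[OF DE(1) K])
      have "{c..d} \<subseteq> {a..b}" using K DE(2) cd(2) by blast
      then have "a \<le> c" "d \<le> b" using cd(1) by auto
      then have "norm (g d - g c) \<le> C * (norm (g1 d - g1 c) + norm (g2 d - g2 c))" using C cd by simp
      also have "\<dots> \<le> (\<bar>C\<bar> + 1) * (norm (g1 d - g1 c) + norm (g2 d - g2 c))" by (intro mult_right_mono) auto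
      finally show "norm (g (Sup K) - g (Inf K)) \<le>
         (\<bar>C\<bar> + 1) * (norm (g1 (Sup K) - g1 (Inf K)) + norm (g2 (Sup K) - g2 (Inf K)))" using cd by simp
    qed
    also have "\<dots> = (\<bar>C\<bar> + 1) * ((\<Sum>K\<in>D. norm (g1 (Sup K) - g1 (Inf K))) + (\<Sum>K\<in>D. norm (g2 (Sup K) - g2 (Inf K))))"
      by (simp add: sum.distrib flip: sum_distrib_left)
    also have "\<dots> < (\<bar>C\<bar> + 1) * (e' + e')"
      by (intro mult_strict_left_mono add_strict_mono d1[OF DE] d2[OF DE]) (use * in auto)
    also have "\<dots> = e"
    proof -
      have "2 * (\<bar>C\<bar> + 1) * e' = e" unfolding e'_def by (simp add: add_nonneg_eq_0_iff)
      then show ?thesis by (simp add: algebra_simps)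
    qed
    finally show "(\<Sum>K\<in>D. norm (g (Sup K) - g (Inf K))) < e" .
  qed
qed

lemma abs_continuous_on_dominated1:
  assumes "abs_continuous_on I g1"
    and "\<And>s t. s \<in> I \<Longrightarrow> t \<in> I \<Longrightarrow> s \<le> t \<Longrightarrow> norm (g t - g s) \<le> C * norm (g1 t - g1 s)"
  shows "abs_continuous_on I g"
proof (rule abs_continuous_on_dominated[OF assms(1) assms(1)], intro exI[of _ "C / 2"] allI impI)
  fix a b s t :: real assume *: "{a..b} \<subseteq> I" "a \<le> s" "s \<le> t" "t \<le> b"
  then have "s \<in> I" "t \<in> I" by auto
  then show "norm (g t - g s) \<le> C / 2 * (norm (g1 t - g1 s) + norm (g1 t - g1 s))"
    using assms(2)[of s t] * by auto
qed

lemma negligible_not_differentiable: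
  fixes g :: "real \<Rightarrow> 'a::euclidean_space"
  assumes ac: "abs_continuous_on {a..b} g"
  shows "negligible {x \<in> {a<..<b}. \<not> g differentiable (at x)}"
proof -
  have "negligible (\<Union>i\<in>Basis. {x \<in> {a<..<b}. \<not> (\<lambda>x. g x \<bullet> i) differentiable (at x)})"
  proof (rule negligible_countable_Union[unfolded image_def[symmetric]])
    fix S assume "S \<in> (\<lambda>i. {x \<in> {a<..<b}. \<not> (\<lambda>x. g x \<bullet> i) differentiable (at x)}) ` Basis"
    then obtain i where i: "i \<in> Basis" "S = {x \<in> {a<..<b}. \<not> (\<lambda>x. g x \<bullet> i) differentiable (at x)}" by blast
    have "abs_continuous_on {a..b} (\<lambda>x. g x \<bullet> i)"
    proof (rule abs_continuous_on_dominated1[OF ac])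
      fix s t
      show "norm (g t \<bullet> i - g s \<bullet> i) \<le> 1 * norm (g t - g s)"
        using Basis_le_norm[OF i(1), of "g t - g s"] by (simp add: inner_diff_left)
    qed
    from negligible_not_differentiable_real[OF this] show "negligible S" unfolding i(2) .
  qed (simp add: countable_finite)
  moreover have "{x \<in> {a<..<b}. \<not> g differentiable (at x)} =
     (\<Union>i\<in>Basis. {x \<in> {a<..<b}. \<not> (\<lambda>x. g x \<bullet> i) differentiable (at x)})"
    using differentiable_componentwise_within[of g _ UNIV] by auto
  ultimately show ?thesis by simp
qed

text \<open>Around the points of the exceptional null set the gauge is a fixed open set of small measure, so
  that absolute continuity bounds the increments over the intervals tagged there.\<close>

lemma fundamental_theorem_of_calculus_abs_continuous:
  fixes g :: "real \<Rightarrow> 'a::euclidean_space"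
  assumes "a \<le> b" and ac: "abs_continuous_on {a..b} g" and N: "negligible N"
    and vd: "\<And>x. x \<in> {a..b} - N \<Longrightarrow> (g has_vector_derivative f x) (at x within {a..b})"
  shows "(f has_integral (g b - g a)) {a..b}"
proof -
  \<comment> \<open>With the value 0 on \<open>N\<close>, an interval tagged in \<open>N\<close>
    contributes to the error exactly the increment of \<open>g\<close>.\<close>
  define f0 where "f0 = (\<lambda>x. if x \<in> N then 0 else f x)"
  let ?\<Delta> = "\<lambda>K. g (Sup K) - g (Inf K)"
  have "(f0 has_integral (g b - g a)) (cbox a b)"
    unfolding has_integral
  proof (intro allI impI)
    fix e :: real assume "0 < e"
    \<comment> \<open>Each interval tagged outside \<open>N\<close> costs \<open>2 * e1\<close>
      times its length, together at most \<open>e / 2\<close>; the added 1 covers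
      \<open>a = b\<close>.\<close>
    define e1 where "e1 = e / (4 * (b - a + 1))"
    have "0 < e1" using \<open>0 < e\<close> \<open>a \<le> b\<close> by (simp add: e1_def)
    have "\<forall>x. \<exists>d>0. x \<in> {a..b} - N \<longrightarrow>
         (\<forall>y\<in>{a..b}. norm (y - x) < d \<longrightarrow> norm (g y - g x - (y - x) *\<^sub>R f x) \<le> e1 * norm (y - x))"
      using vd[unfolded has_vector_derivative_def has_derivative_within_alt] \<open>0 < e1\<close> zero_less_one by blast
    then obtain d where d: "\<And>x. 0 < d x"
       "\<And>x y. x \<in> {a..b} - N \<Longrightarrow> y \<in> {a..b} \<Longrightarrow> norm (y - x) < d x \<Longrightarrow>
            norm (g y - g x - (y - x) *\<^sub>R f x) \<le> e1 * norm (y - x)"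
      by metis
    have "0 < e / 2" using \<open>0 < e\<close> by simp
    obtain \<delta> where "0 < \<delta>" and \<delta>: "\<And>D. D division_of \<Union>D \<Longrightarrow> \<Union>D \<subseteq> {a..b} \<Longrightarrow>
        (\<Sum>K\<in>D. Sup K - Inf K) < \<delta> \<Longrightarrow> (\<Sum>K\<in>D. norm (?\<Delta> K)) < e / 2"
      by (rule abs_continuous_onD[OF ac order.refl \<open>0 < e / 2\<close>]) blast
    obtain U where U: "open U" "N \<subseteq> U" "U - N \<in> lmeasurable" "emeasure lebesgue (U - N) < ennreal \<delta>"
      using sets_lebesgue_outer_open[OF negligible_imp_sets[OF N] \<open>0 < \<delta>\<close>] by blast
    have "U = (U - N) \<union> N" using U(2) by auto
    moreover have "(U - N) \<union> N \<in> lmeasurable"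
      by (rule fmeasurable.Un[OF U(3) negligible_imp_measurable[OF N]])
    ultimately have Ulm: "U \<in> lmeasurable" by simp
    have mU: "measure lebesgue U < \<delta>"
    proof -
      have "measure lebesgue ((U - N) \<union> N) \<le> measure lebesgue (U - N) + measure lebesgue N"
        by (rule measure_Un_le) (use U(3) negligible_imp_sets[OF N] in auto)
      also have "\<dots> = measure lebesgue (U - N)" using negligible_imp_measure0[OF N] by simp
      also have "\<dots> < \<delta>" using U(3,4) by (metis \<open>0 < \<delta>\<close> emeasure_eq_measure2 ennreal_less_iff measure_nonneg)
      finally show ?thesis using \<open>U = (U - N) \<union> N\<close> by simp
    qed
    define \<gamma> where "\<gamma> = (\<lambda>x. if x \<in> N then U else ball x (d x))"
    show "\<exists>\<gamma>. gauge \<gamma> \<and> (\<forall>p. p tagged_division_of cbox a b \<and> \<gamma> fine p \<longrightarrow>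
              norm ((\<Sum>(x, k)\<in>p. measure lborel k *\<^sub>R f0 x) - (g b - g a)) < e)"
    proof (intro exI[of _ \<gamma>] conjI allI impI)
      show "gauge \<gamma>" using U d(1) by (auto simp: gauge_def \<gamma>_def)
      fix p assume p': "p tagged_division_of cbox a b \<and> \<gamma> fine p"
      then have p: "p tagged_division_of {a..b}" and fine: "\<gamma> fine p" by auto
      have pfin: "finite p" using p by auto
      define p1 where "p1 = {z \<in> p. fst z \<notin> N}"
      define p2 where "p2 = {z \<in> p. fst z \<in> N}"
      have split: "sum F p = sum F p1 + sum F p2" for F :: "real \<times> real set \<Rightarrow> 'b::comm_monoid_add"
      proof -
        have "p = p1 \<union> p2" "p1 \<inter> p2 = {}" "finite p1" "finite p2" using pfin by (auto simp: p1_def p2_def)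
        then show ?thesis by (simp add: sum.union_disjoint)
      qed
      have Kab: "\<exists>u v. K = {u..v} \<and> u \<le> x \<and> x \<le> v \<and> a \<le> u \<and> v \<le> b" if "(x, K) \<in> p" for x K
      proof -
        obtain u v where "K = {u..v}" using tagged_division_ofD(4)[OF p \<open>(x, K) \<in> p\<close>] by auto
        moreover have "x \<in> K" "K \<subseteq> {a..b}" using tagged_division_ofD(2,3)[OF p \<open>(x, K) \<in> p\<close>] by auto
        ultimately show ?thesis by auto
      qed
      have "(\<Sum>(x, k)\<in>p. measure lborel k *\<^sub>R f0 x) - (g b - g a) = (\<Sum>(x, K)\<in>p. measure lborel K *\<^sub>R f0 x - ?\<Delta> K)"
        using additive_tagged_division_1[OF \<open>a \<le> b\<close> p, of g] by (simp add: case_prod_unfold sum_subtractf)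
      also have "\<dots> = (\<Sum>(x, K)\<in>p1. measure lborel K *\<^sub>R f0 x - ?\<Delta> K) + (\<Sum>(x, K)\<in>p2. measure lborel K *\<^sub>R f0 x - ?\<Delta> K)"
        by (rule split)
      also have "norm \<dots> \<le> norm (\<Sum>(x, K)\<in>p1. measure lborel K *\<^sub>R f0 x - ?\<Delta> K) + norm (\<Sum>(x, K)\<in>p2. measure lborel K *\<^sub>R f0 x - ?\<Delta> K)"
        by (rule norm_triangle_ineq)
      also have "norm (\<Sum>(x, K)\<in>p1. measure lborel K *\<^sub>R f0 x - ?\<Delta> K) \<le> (\<Sum>(x, K)\<in>p1. 2 * e1 * (Sup K - Inf K))"
        unfolding case_prod_unfold
      proof (rule sum_norm_le)
        fix z assume z: "z \<in> p1"
        obtain x K where xK: "z = (x, K)" by (cases z)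
        have xKp: "(x, K) \<in> p" and xN: "x \<notin> N" using z xK by (auto simp: p1_def)
        obtain u v where uv: "K = {u..v}" "u \<le> x" "x \<le> v" "a \<le> u" "v \<le> b" using Kab[OF xKp] by blast
        have "K \<subseteq> \<gamma> x" using fine xKp by (auto simp: fine_def)
        then have "K \<subseteq> ball x (d x)" using xN by (simp add: \<gamma>_def)
        moreover have "u \<in> K" "v \<in> K" using uv by auto
        ultimately have "u \<in> ball x (d x)" "v \<in> ball x (d x)" by blast+
        then have "norm (g u - g x - (u - x) *\<^sub>R f x) \<le> e1 * norm (u - x)"
            "norm (g v - g x - (v - x) *\<^sub>R f x) \<le> e1 * norm (v - x)"
        proof -
          have "norm (u - x) < d x" "norm (v - x) < d x" "x \<in> {a..b} - N" "u \<in> {a..b}" "v \<in> {a..b}"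
            using \<open>u \<in> ball x (d x)\<close> \<open>v \<in> ball x (d x)\<close> xN uv by (auto simp: dist_real_def)
          then show "norm (g u - g x - (u - x) *\<^sub>R f x) \<le> e1 * norm (u - x)"
            "norm (g v - g x - (v - x) *\<^sub>R f x) \<le> e1 * norm (v - x)" using d(2) by blast+
        qed
        moreover have "measure lborel K *\<^sub>R f0 x - ?\<Delta> K =
            (g u - g x - (u - x) *\<^sub>R f x) - (g v - g x - (v - x) *\<^sub>R f x)"
          using uv xN by (simp add: f0_def algebra_simps)
        moreover have "e1 * norm (u - x) \<le> e1 * (v - u)" "e1 * norm (v - x) \<le> e1 * (v - u)"
          using uv \<open>0 < e1\<close> by (auto intro!: mult_left_mono)
        ultimately have "norm (measure lborel K *\<^sub>R f0 x - ?\<Delta> K) \<le> e1 * (v - u) + e1 * (v - u)"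
          using norm_triangle_ineq4[of "g u - g x - (u - x) *\<^sub>R f x" "g v - g x - (v - x) *\<^sub>R f x"] by simp
        then show "norm (measure lborel (snd z) *\<^sub>R f0 (fst z) - ?\<Delta> (snd z)) \<le> 2 * e1 * (Sup (snd z) - Inf (snd z))"
          using uv xK by simp
      qed
      also have "(\<Sum>(x, K)\<in>p1. 2 * e1 * (Sup K - Inf K)) \<le> (\<Sum>(x, K)\<in>p. 2 * e1 * (Sup K - Inf K))"
      proof (rule sum_mono2[OF pfin])
        show "p1 \<subseteq> p" by (auto simp: p1_def)
        fix z assume "z \<in> p - p1"
        then have "0 \<le> Sup (snd z) - Inf (snd z)" using Kab[of "fst z" "snd z"] by force
        then show "0 \<le> (case z of (x, K) \<Rightarrow> 2 * e1 * (Sup K - Inf K))" using \<open>0 < e1\<close> by (simp add: case_prod_unfold)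
      qed
      also have "(\<Sum>(x, K)\<in>p. 2 * e1 * (Sup K - Inf K)) = 2 * e1 * (b - a)"
        using additive_tagged_division_1[OF \<open>a \<le> b\<close> p, of "\<lambda>x. x"]
        by (simp add: case_prod_unfold sum_distrib_left[symmetric])
      also have "\<dots> \<le> e / 2"
      proof -
        have "4 * (b - a + 1) * e1 = e" using \<open>a \<le> b\<close> by (simp add: e1_def)
        then show ?thesis using \<open>0 < e1\<close> by (simp add: algebra_simps)
      qed
      also have "norm (\<Sum>(x, K)\<in>p2. measure lborel K *\<^sub>R f0 x - ?\<Delta> K) < e / 2"
      proof -
        \<comment> \<open>Passing from tagged pairs to the set of intervals requires a function that
          vanishes on every box without interior. For a single point this is automatic; the empty
          set, where \<open>Sup\<close> and \<open>Inf\<close> are unspecified, has to be treated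
          explicitly.\<close>
        let ?d = "\<lambda>K. if K = {} then 0 else norm (?\<Delta> K)"
        have p2: "p2 tagged_partial_division_of {a..b}"
          by (rule tagged_partial_division_subset[of p]) (use p in \<open>auto simp: p2_def tagged_division_of_def\<close>)
        have "norm (\<Sum>(x, K)\<in>p2. measure lborel K *\<^sub>R f0 x - ?\<Delta> K) \<le> (\<Sum>(x, K)\<in>p2. ?d K)"
          unfolding case_prod_unfold
        proof (rule sum_norm_le)
          fix z assume "z \<in> p2"
          then have "fst z \<in> N" "snd z \<noteq> {}" using tagged_division_ofD(2)[OF p, of "fst z" "snd z"] by (auto simp: p2_def)
          then show "norm (measure lborel (snd z) *\<^sub>R f0 (fst z) - ?\<Delta> (snd z)) \<le> ?d (snd z)"
            by (simp add: f0_def norm_minus_commute)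
        qed
        also have "\<dots> = sum ?d (snd ` p2)"
        proof (rule sum.over_tagged_division_lemma[OF tagged_partial_division_of_Union_self[OF p2]])
          fix u v :: real assume "box u v = {}"
          then show "?d (cbox u v) = 0" by (cases "u = v") auto
        qed
        also have "\<dots> = (\<Sum>K\<in>snd ` p2. norm (?\<Delta> K))"
        proof (rule sum.cong[OF refl])
          fix K assume "K \<in> snd ` p2"
          then obtain x where "(x, K) \<in> p" by (auto simp: p2_def)
          from tagged_division_ofD(2)[OF p this] have "K \<noteq> {}" by auto
          then show "?d K = norm (?\<Delta> K)" by simp
        qed
        also have "\<dots> < e / 2"
        proof (rule \<delta>)
          show div: "snd ` p2 division_of \<Union>(snd ` p2)" by (rule partial_division_of_tagged_division[OF p2])
          show "\<Union>(snd ` p2) \<subseteq> {a..b}"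
          proof
            fix y assume "y \<in> \<Union>(snd ` p2)"
            then obtain x K where "(x, K) \<in> p2" "y \<in> K" by auto
            then show "y \<in> {a..b}" using tagged_partial_division_ofD(3)[OF p2] by blast
          qed
          have "\<Union>(snd ` p2) \<subseteq> U"
          proof
            fix y assume "y \<in> \<Union>(snd ` p2)"
            then obtain x K where "(x, K) \<in> p2" "y \<in> K" by auto
            then have "K \<subseteq> \<gamma> x" "x \<in> N" using fine by (auto simp: p2_def fine_def)
            then show "y \<in> U" using \<open>y \<in> K\<close> by (auto simp: \<gamma>_def)
          qed
          then have "measure lebesgue (\<Union>(snd ` p2)) \<le> measure lebesgue U"
            by (rule measure_mono_fmeasurable) (use Ulm lmeasurable_division[OF div] in auto)
          then show "(\<Sum>K\<in>snd ` p2. Sup K - Inf K) < \<delta>"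
            using mU measure_division_Icc[OF div] by simp
        qed
        finally show ?thesis .
      qed
      finally show "norm ((\<Sum>(x, k)\<in>p. measure lborel k *\<^sub>R f0 x) - (g b - g a)) < e" by simp
    qed
  qed
  then have f0: "(f0 has_integral (g b - g a)) {a..b}" by simp
  show ?thesis
    by (rule has_integral_spike[OF N _ f0]) (auto simp: f0_def)
qed


section \<open>Derivatives of absolutely continuous functions\<close>

lemma abs_continuous_on_negligible_derivative:
  fixes g :: "real \<Rightarrow> 'a::euclidean_space"
  assumes ac: "abs_continuous_on {a..b} g"
  shows "negligible {x \<in> {a..b}. \<not> (g has_vector_derivative vector_derivative g (at x)) (at x)}"
proof (rule negligible_subset)
  show "negligible ({x \<in> {a<..<b}. \<not> g differentiable (at x)} \<union> {a, b})"
    using negligible_not_differentiable[OF ac] by (simp add: negligible_finite)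
  show "{x \<in> {a..b}. \<not> (g has_vector_derivative vector_derivative g (at x)) (at x)} \<subseteq>
     {x \<in> {a<..<b}. \<not> g differentiable (at x)} \<union> {a, b}"
    using vector_derivative_works by auto
qed

lemma abs_continuous_on_has_integral_derivative:
  fixes g :: "real \<Rightarrow> 'a::euclidean_space"
  assumes "a \<le> b" and ac: "abs_continuous_on {a..b} g"
  shows "((\<lambda>x. vector_derivative g (at x)) has_integral (g b - g a)) {a..b}"
  by (rule fundamental_theorem_of_calculus_abs_continuous[OF assms abs_continuous_on_negligible_derivative[OF ac]])
    (auto intro: has_vector_derivative_at_within)

text \<open>On intervals shorter than \<open>d\<close> the variation of \<open>g\<close>, which is
  the sum of the norms of the integrals of the derivative, stays below 1, and bounded variation of
  the integral gives absolute integrability. Finitely many such intervals are glued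
  together.\<close>

lemma abs_continuous_on_absolutely_integrable_derivative:
  fixes g :: "real \<Rightarrow> 'a::euclidean_space"
  assumes ac: "abs_continuous_on {a..b} g"
  shows "(\<lambda>x. vector_derivative g (at x)) absolutely_integrable_on {a..b}"
proof (cases "a \<le> b")
  case False
  then show ?thesis by simp
next
  case True
  let ?g' = "\<lambda>x. vector_derivative g (at x)"
  obtain d where "0 < d" and d: "\<And>D. D division_of \<Union>D \<Longrightarrow> \<Union>D \<subseteq> {a..b} \<Longrightarrow>
      (\<Sum>K\<in>D. Sup K - Inf K) < d \<Longrightarrow> (\<Sum>K\<in>D. norm (g (Sup K) - g (Inf K))) < 1"
    by (rule abs_continuous_onD[OF ac order.refl zero_less_one]) blast
  have short: "?g' absolutely_integrable_on {u..v}" if uv: "a \<le> u" "u \<le> v" "v \<le> b" "v - u < d" for u v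
  proof -
    have acuv: "abs_continuous_on {u..v} g" by (rule abs_continuous_on_subset[OF ac]) (use uv in auto)
    have "?g' absolutely_integrable_on cbox u v"
    proof (rule bounded_variation_absolutely_integrable_interval)
      show "?g' integrable_on cbox u v"
        using abs_continuous_on_has_integral_derivative[OF uv(2) acuv] by auto
      fix D assume D: "D division_of cbox u v"
      have UD: "\<Union>D = {u..v}" using division_ofD(6)[OF D] by simp
      have D': "D division_of \<Union>D" using D UD by simp
      have "(\<Sum>K\<in>D. norm (integral K ?g')) = (\<Sum>K\<in>D. norm (g (Sup K) - g (Inf K)))"
      proof (rule sum.cong[OF refl])
        fix K assume K: "K \<in> D"
        obtain c d where cd: "c \<le> d" "K = {c..d}" "Inf K = c" "Sup K = d" by (rule division_of_IccE[OF D K])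
        have "{c..d} \<subseteq> {u..v}" using division_ofD(2)[OF D K] cd(2) by simp
        then have "abs_continuous_on {c..d} g" by (rule abs_continuous_on_subset[OF acuv])
        from abs_continuous_on_has_integral_derivative[OF cd(1) this]
        show "norm (integral K ?g') = norm (g (Sup K) - g (Inf K))" using cd by (simp add: integral_unique)
      qed
      also have "\<dots> < 1"
      proof (rule d[OF D'])
        show "\<Union>D \<subseteq> {a..b}" using UD uv by auto
        show "(\<Sum>K\<in>D. Sup K - Inf K) < d" using measure_division_Icc[OF D'] UD uv by simp
      qed
      finally show "(\<Sum>K\<in>D. norm (integral K ?g')) \<le> 1" by simp
    qed
    then show ?thesis by simp
  qed
  obtain n :: nat where n: "(b - a) / d < n" using reals_Archimedean2 by blast
  have "0 < n"
  proof (rule ccontr)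
    assume "\<not> 0 < n"
    then have "(b - a) / d < 0" using n by simp
    then show False using True \<open>0 < d\<close> by (simp add: divide_less_0_iff)
  qed
  define h where "h = (b - a) / n"
  have h: "0 \<le> h" "h < d" "n * h = b - a"
    using n \<open>0 < n\<close> \<open>0 < d\<close> True by (auto simp: h_def field_simps)
  have "?g' absolutely_integrable_on {a..a + m * h}" if "m \<le> n" for m :: nat
    using that
  proof (induction m)
    case 0
    then show ?case using absolutely_integrable_on_null[of a a ?g'] by simp
  next
    case (Suc m)
    have "real (Suc m) * h \<le> real n * h" using Suc.prems h(1) by (intro mult_right_mono) auto
    then have le: "a + Suc m * h \<le> b" using h by simp
    have "?g' absolutely_integrable_on {a + m * h..a + Suc m * h}"
      by (rule short) (use le h in \<open>auto simp: algebra_simps\<close>)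
    with Suc have "?g' absolutely_integrable_on ({a..a + m * h} \<union> {a + m * h..a + Suc m * h})"
      by (intro set_integrable_Un) auto
    moreover have "{a..a + m * h} \<union> {a + m * h..a + Suc m * h} = {a..a + Suc m * h}"
      using h(1) by (intro ivl_disj_un_two_touch) (auto simp: algebra_simps)
    ultimately show ?case by simp
  qed
  from this[of n] show ?thesis using h by simp
qed

text \<open>The errors to the left and to the right of \<open>x\<close> add up, and so do the two
  lengths; thus the derivative at \<open>x\<close> controls all short intervals that merely contain
  \<open>x\<close>.\<close>

lemma straddle:
  fixes g :: "real \<Rightarrow> 'a::real_normed_vector"
  assumes "(g has_vector_derivative D) (at x)" "0 < e"
  obtains d where "0 < d"
    "\<And>u v. u \<le> x \<Longrightarrow> x \<le> v \<Longrightarrow> v - u < d \<Longrightarrow> norm (g v - g u - (v - u) *\<^sub>R D) \<le> e * (v - u)"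
proof -
  obtain d where "0 < d" and d: "\<And>y. norm (y - x) < d \<Longrightarrow> norm (g y - g x - (y - x) *\<^sub>R D) \<le> e * norm (y - x)"
    using assms unfolding has_vector_derivative_def has_derivative_at_alt by blast
  show thesis
  proof (rule that[OF \<open>0 < d\<close>])
    fix u v assume uv: "u \<le> x" "x \<le> v" "v - u < d"
    have "norm (g v - g u - (v - u) *\<^sub>R D) = norm ((g v - g x - (v - x) *\<^sub>R D) - (g u - g x - (u - x) *\<^sub>R D))"
      by (simp add: algebra_simps)
    also have "\<dots> \<le> norm (g v - g x - (v - x) *\<^sub>R D) + norm (g u - g x - (u - x) *\<^sub>R D)"
      by (rule norm_triangle_ineq4)
    also have "\<dots> \<le> e * norm (v - x) + e * norm (u - x)"
      by (intro add_mono d) (use uv in auto)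
    also have "\<dots> = e * (v - u)" using uv by (simp add: algebra_simps)
    finally show "norm (g v - g u - (v - u) *\<^sub>R D) \<le> e * (v - u)" .
  qed
qed

text \<open>The difference quotients over a uniform partition, cut off at the norm of the derivative,
  converge boundedly to that norm.\<close>

lemma variation_uniform_partition:
  fixes g :: "real \<Rightarrow> 'a::euclidean_space"
  assumes ac: "abs_continuous_on {0..b} g" and "0 \<le> b" and "0 < e"
  shows "\<exists>n0. \<forall>n\<ge>n0. integral {0..b} (\<lambda>x. norm (vector_derivative g (at x))) - e <
     (\<Sum>i<Suc n. norm (g (b * Suc i / Suc n) - g (b * i / Suc n)))"
proof (cases "b = 0")
  case True
  then show ?thesis using \<open>0 < e\<close> by simp
next
  case False
  then have "0 < b" using \<open>0 \<le> b\<close> by simp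
  let ?g' = "\<lambda>x. vector_derivative g (at x)"
  define N where "N = {x \<in> {0..b}. \<not> (g has_vector_derivative ?g' x) (at x)}"
  have N: "negligible N" unfolding N_def by (rule abs_continuous_on_negligible_derivative[OF ac])
  define G where "G = (\<lambda>x. if x \<in> N then 0 else norm (?g' x))"
  have nint: "(\<lambda>x. norm (?g' x)) integrable_on {0..b}"
    using abs_continuous_on_absolutely_integrable_derivative[OF ac] by (auto simp: absolutely_integrable_on_def)
  have Gint: "G integrable_on {0..b}"
    by (rule integrable_spike[OF nint N]) (auto simp: G_def)
  have G0: "0 \<le> G x" for x by (simp add: G_def)
  define h where "h = (\<lambda>n::nat. b / Suc n)"
  have h0: "0 < h n" for n using \<open>0 < b\<close> by (simp add: h_def)
  \<comment> \<open>Slopes of the chords over the cells of mesh \<open>h n\<close>;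
    \<open>Q n\<close> is the step function they form. Cutting it off at \<open>G\<close> supplies
    an integrable majorant, and it can only decrease the sum, which is harmless for a lower
    bound.\<close>
  define q where "q = (\<lambda>n (i::nat). norm (g (h n * Suc i) - g (h n * i)) / h n)"
  define Q where "Q = (\<lambda>n x. q n (nat \<lfloor>x / h n\<rfloor>))"
  define f where "f = (\<lambda>n x. min (Q n x) (G x))"
  have f_piece: "(f n has_integral integral {h n * i..h n * Suc i} (\<lambda>x. min (q n i) (G x))) {h n * i..h n * Suc i} \<and>
      integral {h n * i..h n * Suc i} (\<lambda>x. min (q n i) (G x)) \<le> norm (g (h n * Suc i) - g (h n * i))"
    if "i < Suc n" for n i
  proof -
    have "h n * Suc i \<le> h n * Suc n" using that h0[of n] by (intro mult_left_mono) auto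
    moreover have "h n * Suc n = b" "0 \<le> h n * i" using h0[of n] by (simp_all add: h_def \<open>0 \<le> b\<close>)
    ultimately have sub: "{h n * i..h n * Suc i} \<subseteq> {0..b}" by auto
    have "G integrable_on {h n * i..h n * Suc i}" by (rule integrable_on_subinterval[OF Gint sub])
    then have "G absolutely_integrable_on {h n * i..h n * Suc i}"
      using G0 by (intro nonnegative_absolutely_integrable_1) auto
    moreover have "(\<lambda>x. q n i) absolutely_integrable_on {h n * i..h n * Suc i}"
      using absolutely_integrable_on_const[of "{h n * i..h n * Suc i}" "q n i"] by simp
    ultimately have "(\<lambda>x. min (q n i) (G x)) absolutely_integrable_on {h n * i..h n * Suc i}"
      by (intro absolutely_integrable_min_1)
    then have int: "(\<lambda>x. min (q n i) (G x)) integrable_on {h n * i..h n * Suc i}"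
      by (simp add: absolutely_integrable_on_def)
    have "(f n has_integral integral {h n * i..h n * Suc i} (\<lambda>x. min (q n i) (G x))) {h n * i..h n * Suc i}"
    proof (rule has_integral_spike_finite[OF _ _ integrable_integral[OF int]])
      \<comment> \<open>At the right end of a cell the floor already belongs to the next
        cell.\<close>
      show "finite {h n * Suc i}" by simp
      fix x assume x: "x \<in> {h n * i..h n * Suc i} - {h n * Suc i}"
      have "x / h n < real i + 1" "real i \<le> x / h n"
        using x h0[of n] by (auto simp: field_simps less_le)
      then have "\<lfloor>x / h n\<rfloor> = int i" by (simp add: floor_unique)
      then show "f n x = min (q n i) (G x)" by (simp add: f_def Q_def)
    qed
    moreover have "integral {h n * i..h n * Suc i} (\<lambda>x. min (q n i) (G x)) \<le> integral {h n * i..h n * Suc i} (\<lambda>x. q n i)"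
      by (rule integral_le[OF int]) auto
    moreover have "integral {h n * i..h n * Suc i} (\<lambda>x. q n i) = norm (g (h n * Suc i) - g (h n * i))"
      using h0[of n] by (simp add: q_def algebra_simps)
    ultimately show ?thesis by simp
  qed
  have f_int: "f n integrable_on {0..h n * m} \<and>
      integral {0..h n * m} (f n) \<le> (\<Sum>i<m. norm (g (h n * Suc i) - g (h n * i)))" if "m \<le> Suc n" for n m
    using that
  proof (induction m)
    case 0
    then show ?case using integrable_on_refl[of "f n" 0] by simp
  next
    case (Suc m)
    have le: "0 \<le> h n * m" "h n * m \<le> h n * Suc m" using h0[of n] by (auto intro: mult_left_mono)
    have piece: "f n integrable_on {h n * m..h n * Suc m}"
      "integral {h n * m..h n * Suc m} (f n) \<le> norm (g (h n * Suc m) - g (h n * m))"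
      using f_piece[of m n] Suc.prems by (auto simp: integral_unique)
    have IH: "f n integrable_on {0..h n * m}"
       "integral {0..h n * m} (f n) \<le> (\<Sum>i<m. norm (g (h n * Suc i) - g (h n * i)))"
      using Suc by auto
    have int: "f n integrable_on {0..h n * Suc m}" by (rule Henstock_Kurzweil_Integration.integrable_combine[OF le IH(1) piece(1)])
    have "integral {0..h n * Suc m} (f n) = integral {0..h n * m} (f n) + integral {h n * m..h n * Suc m} (f n)"
      by (rule Henstock_Kurzweil_Integration.integral_combine[OF le int, symmetric])
    then show ?case using int IH(2) piece(2) by simp
  qed
  have hb: "h n * Suc n = b" for n by (simp add: h_def)
  have conv: "(\<lambda>n. f n x) \<longlonglongrightarrow> G x" if x: "x \<in> {0..b}" for x
  proof (cases "x \<in> N")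
    case True
    have "0 \<le> Q n x" for n using h0[of n] by (simp add: Q_def q_def)
    then show ?thesis using True by (simp add: f_def G_def min_absorb2)
  next
    case False
    have "(\<lambda>n. Q n x) \<longlonglongrightarrow> norm (?g' x)"
      unfolding LIMSEQ_iff
    proof (intro allI impI)
      fix r :: real assume "0 < r"
      have "(g has_vector_derivative ?g' x) (at x)" "0 < r / 2" using False x \<open>0 < r\<close> by (auto simp: N_def)
      then obtain d where "0 < d" and d: "\<And>u v. u \<le> x \<Longrightarrow> x \<le> v \<Longrightarrow> v - u < d \<Longrightarrow>
          norm (g v - g u - (v - u) *\<^sub>R ?g' x) \<le> r / 2 * (v - u)"
        by (rule straddle) blast
      obtain m :: nat where m: "b / d < m" using reals_Archimedean2 by blast
      show "\<exists>no. \<forall>n\<ge>no. norm (Q n x - norm (?g' x)) < r"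
      proof (intro exI[of _ m] allI impI)
        fix n assume "m \<le> n"
        then have "b / d < Suc n" using m by simp
        then have hd: "h n < d" using \<open>0 < d\<close> by (simp add: h_def field_simps)
        define i where "i = nat \<lfloor>x / h n\<rfloor>"
        have "0 \<le> x / h n" using x h0[of n] by simp
        then have "real i \<le> x / h n" "x / h n < real i + 1" by (auto simp: i_def)
        then have i: "h n * i \<le> x" "x \<le> h n * Suc i" using h0[of n] by (auto simp: field_simps)
        have diff: "h n * Suc i - h n * i = h n" by (simp add: algebra_simps)
        have "norm (g (h n * Suc i) - g (h n * i) - h n *\<^sub>R ?g' x) \<le> r / 2 * h n"
          using d[OF i] hd diff by simp
        then have "\<bar>norm (g (h n * Suc i) - g (h n * i)) - h n * norm (?g' x)\<bar> \<le> r / 2 * h n"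
          using norm_triangle_ineq3[of "g (h n * Suc i) - g (h n * i)" "h n *\<^sub>R ?g' x"] h0[of n] by simp
        moreover have "Q n x * h n = norm (g (h n * Suc i) - g (h n * i))"
          using h0[of n] by (simp add: Q_def q_def i_def)
        ultimately have "\<bar>Q n x * h n - h n * norm (?g' x)\<bar> \<le> r / 2 * h n" by simp
        moreover have "Q n x * h n - h n * norm (?g' x) = h n * (Q n x - norm (?g' x))" by (simp add: algebra_simps)
        ultimately have "h n * \<bar>Q n x - norm (?g' x)\<bar> \<le> h n * (r / 2)"
          using h0[of n] by (simp only: abs_mult) (simp add: mult.commute)
        then have "\<bar>Q n x - norm (?g' x)\<bar> \<le> r / 2" using h0[of n] mult_le_cancel_left_pos by blast
        then show "norm (Q n x - norm (?g' x)) < r" using \<open>0 < r\<close> by simp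
      qed
    qed
    then have "(\<lambda>n. min (Q n x) (G x)) \<longlonglongrightarrow> min (norm (?g' x)) (G x)" by (intro tendsto_min tendsto_const)
    then show ?thesis using False by (simp add: f_def G_def)
  qed
  have "(\<lambda>n. integral {0..b} (f n)) \<longlonglongrightarrow> integral {0..b} G"
  proof (rule dominated_convergence(2)[OF _ Gint])
    show "f n integrable_on {0..b}" for n using f_int[of "Suc n" n] hb[of n] by simp
    show "norm (f n x) \<le> G x" for n x
      using h0[of n] by (auto simp: f_def G_def Q_def q_def min_def)
  qed (rule conv)
  moreover have "integral {0..b} G = integral {0..b} (\<lambda>x. norm (?g' x))"
    by (rule integral_spike[OF N]) (auto simp: G_def)
  ultimately have "eventually (\<lambda>n. integral {0..b} (\<lambda>x. norm (?g' x)) - e < integral {0..b} (f n)) sequentially"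
    using \<open>0 < e\<close> by (intro order_tendstoD(1)) auto
  then obtain n0 where n0: "\<And>n. n \<ge> n0 \<Longrightarrow> integral {0..b} (\<lambda>x. norm (?g' x)) - e < integral {0..b} (f n)"
    by (auto simp: eventually_sequentially)
  show ?thesis
  proof (intro exI[of _ n0] allI impI)
    fix n assume "n0 \<le> n"
    from n0[OF this] have "integral {0..b} (\<lambda>x. norm (?g' x)) - e < (\<Sum>i<Suc n. norm (g (h n * Suc i) - g (h n * i)))"
      using f_int[of "Suc n" n] hb[of n] by simp
    then show "integral {0..b} (\<lambda>x. norm (?g' x)) - e < (\<Sum>i<Suc n. norm (g (b * Suc i / Suc n) - g (b * i / Suc n)))"
      by (simp add: h_def)
  qed
qed

section \<open>Indefinite integrals\<close>

text \<open>Cut \<open>norm f\<close> at height \<open>n\<close>: the bounded part contributes at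
  most \<open>n\<close> times the total length, and the integral of the excess is small for large
  \<open>n\<close> by dominated convergence, uniformly over all divisions.\<close>

lemma abs_continuous_on_integral_Icc:
  fixes f :: "real \<Rightarrow> 'a::euclidean_space"
  assumes f: "f absolutely_integrable_on {a..b}"
  shows "abs_continuous_on {a..b} (\<lambda>t. integral {a..t} f)"
  unfolding abs_continuous_on_def
proof (intro allI impI)
  fix a' b' e :: real assume ab': "{a'..b'} \<subseteq> {a..b}" and "0 < e"
  have fi: "f integrable_on {a..b}" and nf: "(\<lambda>x. norm (f x)) integrable_on {a..b}"
    using f by (auto simp: absolutely_integrable_on_def)
  define h where "h = (\<lambda>(n::nat) x. max (norm (f x) - n) 0)"
  have hint: "h n integrable_on {a..b}" for n
  proof -
    have "(\<lambda>x. norm (f x) - n) absolutely_integrable_on {a..b}"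
      using set_integral_diff(1)[OF absolutely_integrable_norm[OF f] absolutely_integrable_on_const[of "{a..b}" "real n"]] by (simp add: o_def)
    then have "(\<lambda>x. max (norm (f x) - n) 0) absolutely_integrable_on {a..b}"
      by (intro absolutely_integrable_max_1 absolutely_integrable_zero)
    then show ?thesis by (simp add: h_def absolutely_integrable_on_def)
  qed
  have "(\<lambda>n. integral {a..b} (h n)) \<longlonglongrightarrow> integral {a..b} (\<lambda>x. 0)"
  proof (rule dominated_convergence(2)[OF hint nf])
    show "norm (h n x) \<le> norm (f x)" for n x by (auto simp: h_def max_def)
    fix x
    obtain m :: nat where "norm (f x) < m" using reals_Archimedean2 by blast
    then have "h n x = 0" if "n \<ge> m" for n using that by (simp add: h_def)
    then show "(\<lambda>n. h n x) \<longlonglongrightarrow> 0"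
      by (intro tendsto_eventually) (auto simp: eventually_sequentially)
  qed
  then have "eventually (\<lambda>n. integral {a..b} (h n) < e / 2) sequentially"
    using \<open>0 < e\<close> by (intro order_tendstoD(2)) auto
  then obtain n where n: "integral {a..b} (h n) < e / 2" by (auto simp: eventually_sequentially)
  have h0: "0 \<le> h n x" for x by (simp add: h_def)
  define d where "d = e / (2 * (real n + 1))"
  have "0 < d" using \<open>0 < e\<close> by (simp add: d_def)
  show "\<exists>d>0. \<forall>D E. D division_of E \<and> E \<subseteq> {a'..b'} \<and> (\<Sum>K\<in>D. Sup K - Inf K) < d \<longrightarrow>
     (\<Sum>K\<in>D. norm (integral {a..Sup K} f - integral {a..Inf K} f)) < e"
  proof (intro exI[of _ d] conjI allI impI \<open>0 < d\<close>)
    fix D E :: "_ set" assume *: "D division_of E \<and> E \<subseteq> {a'..b'} \<and> (\<Sum>K\<in>D. Sup K - Inf K) < d"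
    then have D: "D division_of E" and Eab: "E \<subseteq> {a..b}" and len: "(\<Sum>K\<in>D. Sup K - Inf K) < d"
      using ab' by auto
    have "(\<Sum>K\<in>D. norm (integral {a..Sup K} f - integral {a..Inf K} f)) \<le>
        (\<Sum>K\<in>D. n * (Sup K - Inf K) + integral K (h n))"
    proof (rule sum_mono)
      fix K assume K: "K \<in> D"
      obtain c d where cd: "c \<le> d" "K = {c..d}" "Inf K = c" "Sup K = d" by (rule division_of_IccE[OF D K])
      have sub: "{c..d} \<subseteq> {a..b}" using division_ofD(2)[OF D K] Eab unfolding cd(2) by (rule subset_trans)
      then have ac: "a \<le> c" "d \<le> b" using cd(1) by auto
      have fad: "f integrable_on {a..d}" by (rule integrable_on_subinterval[OF fi]) (use ac in auto)
      have "integral {a..c} f + integral {c..d} f = integral {a..d} f"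
        by (rule Henstock_Kurzweil_Integration.integral_combine[OF ac(1) cd(1) fad])
      then have "norm (integral {a..d} f - integral {a..c} f) = norm (integral {c..d} f)"
        by (metis add_diff_cancel_left')
      also have "\<dots> \<le> integral {c..d} (\<lambda>x. real n + h n x)"
      proof (rule integral_norm_bound_integral)
        show "f integrable_on {c..d}" by (rule integrable_on_subinterval[OF fi sub])
        show "(\<lambda>x. real n + h n x) integrable_on {c..d}"
          by (intro integrable_add integrable_on_subinterval[OF hint sub]) auto
        show "norm (f x) \<le> real n + h n x" for x by (simp add: h_def)
      qed
      also have "\<dots> = n * (d - c) + integral {c..d} (h n)"
        by (subst integral_add) (use cd(1) integrable_on_subinterval[OF hint sub] in auto)
      finally show "norm (integral {a..Sup K} f - integral {a..Inf K} f) \<le> n * (Sup K - Inf K) + integral K (h n)"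
        using cd by simp
    qed
    also have "\<dots> = n * (\<Sum>K\<in>D. Sup K - Inf K) + (\<Sum>K\<in>D. integral K (h n))"
      by (simp add: sum.distrib sum_distrib_left)
    also have "(\<Sum>K\<in>D. integral K (h n)) = integral E (h n)"
      by (rule integral_combine_division_topdown[symmetric, OF integrable_on_subdivision[OF D hint Eab] D])
    also have "integral E (h n) \<le> integral {a..b} (h n)"
      by (rule integral_subset_le[OF Eab integrable_on_subdivision[OF D hint Eab] hint]) (use h0 in auto)
    also have "n * (\<Sum>K\<in>D. Sup K - Inf K) \<le> n * d" using len by (intro mult_left_mono) auto
    also have "n * d \<le> e / 2"
    proof -
      have "2 * (real n + 1) * d = e" unfolding d_def by simp
      then show ?thesis using \<open>0 < d\<close> by (simp add: algebra_simps)
    qed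
    finally show "(\<Sum>K\<in>D. norm (integral {a..Sup K} f - integral {a..Inf K} f)) < e" using n by simp
  qed
qed

lemma AE_lebesgue_iff_negligible:
  fixes P :: "'a::euclidean_space \<Rightarrow> bool"
  shows "(AE x in lebesgue. P x) \<longleftrightarrow> negligible {x. \<not> P x}"
proof
  assume "AE x in lebesgue. P x"
  then obtain N where N: "\<And>x. x \<in> space lebesgue - N \<Longrightarrow> P x" "N \<in> null_sets lebesgue" by (rule AE_E3) blast
  from N(2) have "negligible N" by (simp add: negligible_iff_null_sets)
  then show "negligible {x. \<not> P x}" by (rule negligible_subset) (use N(1) in auto)
next
  assume "negligible {x. \<not> P x}"
  then have "{x. \<not> P x} \<in> null_sets lebesgue" by (simp add: negligible_iff_null_sets)
  then show "AE x in lebesgue. P x" by (rule AE_I') auto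
qed

text \<open>Since every integral over a subinterval vanishes, the Riemann sums of
  \<open>norm f\<close> are exactly the sums estimated by Henstock's lemma. So \<open>norm f\<close>
  has integral 0, and being nonnegative it vanishes almost everywhere.\<close>

lemma negligible_zero_integrals:
  fixes f :: "real \<Rightarrow> 'a::euclidean_space"
  assumes f: "f integrable_on {a..b}"
    and zero: "\<And>s t. a \<le> s \<Longrightarrow> s \<le> t \<Longrightarrow> t \<le> b \<Longrightarrow> integral {s..t} f = 0"
  shows "negligible {x \<in> {a..b}. f x \<noteq> 0}"
proof (cases "a \<le> b")
  case False
  then show ?thesis by simp
next
  case True
  have fi: "f integrable_on cbox a b" using f by simp
  have "((\<lambda>x. norm (f x)) has_integral 0) (cbox a b)"
    unfolding has_integral
  proof (intro allI impI)
    fix e :: real assume "0 < e"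
    \<comment> \<open>Henstock's lemma loses the factor \<open>2 * DIM('a)\<close>.\<close>
    define e1 where "e1 = e / (4 * DIM('a))"
    have e1: "0 < e1" "2 * real DIM('a) * e1 < e" using \<open>0 < e\<close> by (auto simp: e1_def)
    obtain \<gamma> where \<gamma>: "gauge \<gamma>" "\<And>p. p tagged_division_of (cbox a b) \<Longrightarrow> \<gamma> fine p \<Longrightarrow>
        norm ((\<Sum>(x, k)\<in>p. measure lborel k *\<^sub>R f x) - integral (cbox a b) f) < e1"
      by (rule has_integralD[OF integrable_integral[OF fi] e1(1)]) blast
    show "\<exists>\<gamma>. gauge \<gamma> \<and> (\<forall>p. p tagged_division_of cbox a b \<and> \<gamma> fine p \<longrightarrow>
              norm ((\<Sum>(x, k)\<in>p. measure lborel k *\<^sub>R norm (f x)) - 0) < e)"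
    proof (intro exI[of _ \<gamma>] conjI allI impI \<gamma>(1))
      fix p assume p: "p tagged_division_of cbox a b \<and> \<gamma> fine p"
      have "(\<Sum>(x, k)\<in>p. measure lborel k *\<^sub>R norm (f x)) = (\<Sum>(x, k)\<in>p. norm (measure lborel k *\<^sub>R f x - integral k f))"
      proof (rule sum.cong[OF refl], clarify)
        fix x k assume xk: "(x, k) \<in> p"
        have p': "p tagged_division_of {a..b}" using p by simp
        obtain u v where k: "k = {u..v}" using tagged_division_ofD(4)[OF p' xk] by auto
        have "x \<in> k" "k \<subseteq> {a..b}" by (rule tagged_division_ofD(2,3)[OF p' xk])+
        then have "integral k f = 0" unfolding k by (intro zero) auto
        then show "measure lborel k *\<^sub>R norm (f x) = norm (measure lborel k *\<^sub>R f x - integral k f)"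
          by simp
      qed
      also have "\<dots> \<le> 2 * real DIM('a) * e1"
        by (rule Henstock_lemma_part2[OF fi e1(1) \<gamma>(1) \<gamma>(2)]) (use p in \<open>auto simp: tagged_division_of_def\<close>)
      also have "\<dots> < e" by (rule e1(2))
      finally have "(\<Sum>(x, k)\<in>p. measure lborel k *\<^sub>R norm (f x)) < e" .
      moreover have "0 \<le> (\<Sum>(x, k)\<in>p. measure lborel k *\<^sub>R norm (f x))"
        by (rule sum_nonneg) auto
      ultimately show "norm ((\<Sum>(x, k)\<in>p. measure lborel k *\<^sub>R norm (f x)) - 0) < e" by simp
    qed
  qed
  then have n0: "((\<lambda>x. norm (f x)) has_integral 0) {a..b}" by simp
  then have ai: "(\<lambda>x. norm (f x)) absolutely_integrable_on {a..b}"
    by (intro nonnegative_absolutely_integrable_1) auto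
  have "integral\<^sup>L lebesgue (\<lambda>x. indicator {a..b} x *\<^sub>R norm (f x)) = 0"
    using set_lebesgue_integral_eq_integral(2)[OF ai] integral_unique[OF n0] by (simp add: set_lebesgue_integral_def)
  then have "AE x in lebesgue. indicator {a..b} x *\<^sub>R norm (f x) = 0"
    using integral_nonneg_eq_0_iff_AE[OF ai[unfolded set_integrable_def]] by simp
  then have "AE x in lebesgue. \<not> (x \<in> {a..b} \<and> f x \<noteq> 0)"
    by eventually_elim (auto simp: indicator_def)
  then show ?thesis by (simp only: AE_lebesgue_iff_negligible not_not)
qed

text \<open>The primitive is absolutely continuous, so its derivative exists almost everywhere and
  has the same integral as \<open>f\<close> over every subinterval; the two can differ only on a
  null set.\<close>

lemma negligible_derivative_integral:
  fixes f :: "real \<Rightarrow> 'a::euclidean_space"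
  assumes f: "f absolutely_integrable_on {a..b}"
  shows "negligible {x \<in> {a..b}. \<not> ((\<lambda>t. integral {a..t} f) has_vector_derivative f x) (at x)}"
proof -
  let ?F = "\<lambda>t. integral {a..t} f"
  let ?F' = "\<lambda>x. vector_derivative ?F (at x)"
  have fi: "f integrable_on {a..b}" using f by (simp add: absolutely_integrable_on_def)
  have ac: "abs_continuous_on {a..b} ?F" by (rule abs_continuous_on_integral_Icc[OF f])
  have F'i: "?F' integrable_on {a..b}"
    using abs_continuous_on_absolutely_integrable_derivative[OF ac] by (simp add: absolutely_integrable_on_def)
  have "negligible {x \<in> {a..b}. ?F' x - f x \<noteq> 0}"
  proof (rule negligible_zero_integrals)
    show "(\<lambda>x. ?F' x - f x) integrable_on {a..b}" by (rule integrable_diff[OF F'i fi])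
    fix s t assume st: "a \<le> s" "s \<le> t" "t \<le> b"
    have sub: "{s..t} \<subseteq> {a..b}" using st by auto
    have "f integrable_on {a..t}" by (rule integrable_on_subinterval[OF fi]) (use st in auto)
    then have "?F t - ?F s = integral {s..t} f"
      using Henstock_Kurzweil_Integration.integral_combine[OF st(1,2)] by (metis add_diff_cancel_left')
    moreover have "integral {s..t} ?F' = ?F t - ?F s"
      by (rule integral_unique[OF abs_continuous_on_has_integral_derivative[OF st(2) abs_continuous_on_subset[OF ac sub]]])
    ultimately show "integral {s..t} (\<lambda>x. ?F' x - f x) = 0"
      by (subst integral_diff) (use integrable_on_subinterval[OF F'i sub] integrable_on_subinterval[OF fi sub] in auto)
  qed
  then have "negligible ({x \<in> {a..b}. ?F' x - f x \<noteq> 0} \<union> {x \<in> {a..b}. \<not> (?F has_vector_derivative ?F' x) (at x)})"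
    using abs_continuous_on_negligible_derivative[OF ac] by simp
  then show ?thesis by (rule negligible_subset) auto
qed


section \<open>Locality and composition of absolutely continuous functions\<close>

lemma abs_continuous_on_Icc_iff:
  "abs_continuous_on I g \<longleftrightarrow> (\<forall>a b. a \<le> b \<longrightarrow> {a..b} \<subseteq> I \<longrightarrow> abs_continuous_on {a..b} g)" (is "?L \<longleftrightarrow> ?R")
proof
  show "?L \<Longrightarrow> ?R" using abs_continuous_on_subset by blast
  assume R: ?R
  show ?L
    unfolding abs_continuous_on_def
  proof (intro allI impI)
    fix a b e :: real assume ab: "{a..b} \<subseteq> I" "0 < e"
    show "\<exists>d>0. \<forall>D E. D division_of E \<and> E \<subseteq> {a..b} \<and> (\<Sum>K\<in>D. Sup K - Inf K) < d \<longrightarrow>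
        (\<Sum>K\<in>D. norm (g (Sup K) - g (Inf K))) < e"
    proof (cases "a \<le> b")
      case True
      then have "abs_continuous_on {a..b} g" using R ab by blast
      then show ?thesis using \<open>0 < e\<close> unfolding abs_continuous_on_def by blast
    next
      case False
      then show ?thesis using \<open>0 < e\<close> by (intro exI[of _ 1]) auto
    qed
  qed
qed

lemma abs_continuous_on_cong:
  assumes "\<And>t. t \<in> I \<Longrightarrow> g t = h t"
  shows "abs_continuous_on I g \<longleftrightarrow> abs_continuous_on I h"
proof -
  have "abs_continuous_on I f" if "abs_continuous_on I k" "\<And>t. t \<in> I \<Longrightarrow> k t = f t" for f k :: "real \<Rightarrow> 'a"
    by (rule abs_continuous_on_dominated1[OF that(1), of _ 1]) (use that(2) in simp)
  from this[of g h] this[of h g] show ?thesis using assms by auto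
qed

lemma abs_continuous_on_integralI:
  fixes f :: "real \<Rightarrow> 'a::euclidean_space"
  assumes "\<And>b. b \<in> I \<Longrightarrow> 0 \<le> b \<and> f absolutely_integrable_on {0..b} \<and> g b = c + integral {0..b} f"
  shows "abs_continuous_on I g"
  unfolding abs_continuous_on_Icc_iff[of I]
proof (intro allI impI)
  fix a b :: real assume ab: "a \<le> b" "{a..b} \<subseteq> I"
  then have "a \<in> I" "b \<in> I" by auto
  then have "0 \<le> a" and f: "f absolutely_integrable_on {0..b}" using assms by auto
  have "abs_continuous_on {a..b} (\<lambda>t. integral {0..t} f)"
    by (rule abs_continuous_on_subset[OF abs_continuous_on_integral_Icc[OF f]]) (use \<open>0 \<le> a\<close> in auto)
  then show "abs_continuous_on {a..b} g"
  proof (rule abs_continuous_on_dominated1[of _ _ _ 1])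
    fix s t assume "s \<in> {a..b}" "t \<in> {a..b}"
    then have "s \<in> I" "t \<in> I" using ab by auto
    then show "norm (g t - g s) \<le> 1 * norm (integral {0..t} f - integral {0..s} f)" using assms by simp
  qed
qed

lemma abs_continuous_on_ident: "abs_continuous_on I (\<lambda>x. x)"
  unfolding abs_continuous_on_def
proof (intro allI impI)
  fix a b e :: real assume "0 < e"
  show "\<exists>d>0. \<forall>D E. D division_of E \<and> E \<subseteq> {a..b} \<and> (\<Sum>K\<in>D. Sup K - Inf K) < d \<longrightarrow>
        (\<Sum>K\<in>D. norm (Sup K - Inf K)) < e"
  proof (intro exI[of _ e] conjI allI impI \<open>0 < e\<close>)
    fix D E :: "_ set" assume *: "D division_of E \<and> E \<subseteq> {a..b} \<and> (\<Sum>K\<in>D. Sup K - Inf K) < e"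
    have "(\<Sum>K\<in>D. norm (Sup K - Inf K)) = (\<Sum>K\<in>D. Sup K - Inf K)"
    proof (rule sum.cong[OF refl])
      fix K assume "K \<in> D"
      have "D division_of E" using * by simp
      obtain c d where "c \<le> d" "K = {c..d}" "Inf K = c" "Sup K = d"
        by (rule division_of_IccE[OF \<open>D division_of E\<close> \<open>K \<in> D\<close>])
      then show "norm (Sup K - Inf K) = Sup K - Inf K" by simp
    qed
    then show "(\<Sum>K\<in>D. norm (Sup K - Inf K)) < e" using * by simp
  qed
qed

lemma abs_continuous_on_continuous_on:
  assumes "abs_continuous_on {a..} g"
  shows "continuous_on {a..} g"
  unfolding continuous_on_eq_continuous_within
proof
  fix x assume "x \<in> {a..}"
  have "continuous_on {a..x + 1} g"
    by (rule abs_continuous_on_imp_continuous_on_Icc[OF abs_continuous_on_subset[OF assms]]) auto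
  then have "continuous (at x within {a..x + 1}) g" using \<open>x \<in> {a..}\<close> by (simp add: continuous_on_eq_continuous_within)
  moreover have "at x within {a..x + 1} = at x within {a..}"
    by (rule at_within_nhd[of _ "{..<x + 1}"]) auto
  ultimately show "continuous (at x within {a..}) g" by simp
qed

text \<open>Composition does not preserve absolute continuity in general; a strictly increasing
  inner function carries a division to a division of the image, so its small total increment is the
  small total length that \<open>g\<close> asks for.\<close>

lemma abs_continuous_on_compose:
  fixes \<alpha> :: "real \<Rightarrow> real"
  assumes g: "abs_continuous_on J g" and \<alpha>: "abs_continuous_on I \<alpha>" "strict_mono_on I \<alpha>"
    and sub: "\<And>t. t \<in> I \<Longrightarrow> \<alpha> t \<in> J" and J: "is_interval J"
  shows "abs_continuous_on I (\<lambda>t. g (\<alpha> t))"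
  unfolding abs_continuous_on_Icc_iff[of I]
proof (intro allI impI)
  fix a b assume ab: "a \<le> b" "{a..b} \<subseteq> I"
  have "a \<in> I" "b \<in> I" using ab by auto
  from sub[OF this(1)] sub[OF this(2)] have "\<alpha> a \<in> J" "\<alpha> b \<in> J" .
  then have subJ: "{\<alpha> a..\<alpha> b} \<subseteq> J" using J unfolding is_interval_1 by (meson atLeastAtMost_iff subsetI)
  have smono: "\<alpha> s < \<alpha> t" if "a \<le> s" "s < t" "t \<le> b" for s t
  proof -
    have "s \<in> I" "t \<in> I" using that ab by auto
    then show ?thesis using strict_mono_onD[OF \<alpha>(2)] that(2) by blast
  qed
  have mono: "\<alpha> s \<le> \<alpha> t" if "a \<le> s" "s \<le> t" "t \<le> b" for s t
    using smono[of s t] that by (cases "s = t") auto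
  have "abs_continuous_on {\<alpha> a..\<alpha> b} g" by (rule abs_continuous_on_subset[OF g subJ])
  show "abs_continuous_on {a..b} (\<lambda>t. g (\<alpha> t))"
    unfolding abs_continuous_on_def
  proof (intro allI impI)
    fix a' b' e :: real assume ab': "{a'..b'} \<subseteq> {a..b}" and "0 < e"
    obtain d1 where "0 < d1" and d1: "\<And>D. D division_of \<Union>D \<Longrightarrow> \<Union>D \<subseteq> {\<alpha> a..\<alpha> b} \<Longrightarrow>
        (\<Sum>K\<in>D. Sup K - Inf K) < d1 \<Longrightarrow> (\<Sum>K\<in>D. norm (g (Sup K) - g (Inf K))) < e"
      by (rule abs_continuous_onD[OF g subJ \<open>0 < e\<close>]) blast
    obtain d2 where "0 < d2" and d2: "\<And>D. D division_of \<Union>D \<Longrightarrow> \<Union>D \<subseteq> {a..b} \<Longrightarrow>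
        (\<Sum>K\<in>D. Sup K - Inf K) < d2 \<Longrightarrow> (\<Sum>K\<in>D. norm (\<alpha> (Sup K) - \<alpha> (Inf K))) < d1"
      by (rule abs_continuous_onD[OF \<alpha>(1) ab(2) \<open>0 < d1\<close>]) blast
    show "\<exists>d>0. \<forall>D E. D division_of E \<and> E \<subseteq> {a'..b'} \<and> (\<Sum>K\<in>D. Sup K - Inf K) < d \<longrightarrow>
        (\<Sum>K\<in>D. norm (g (\<alpha> (Sup K)) - g (\<alpha> (Inf K)))) < e"
    proof (intro exI[of _ d2] conjI allI impI \<open>0 < d2\<close>)
      fix D E :: "_ set" assume *: "D division_of E \<and> E \<subseteq> {a'..b'} \<and> (\<Sum>K\<in>D. Sup K - Inf K) < d2"
      have UE: "\<Union>D = E" using * division_ofD(6) by blast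
      have D: "D division_of \<Union>D" "\<Union>D \<subseteq> {a..b}" using * ab' UE by auto
      let ?im = "\<lambda>K. {\<alpha> (Inf K)..\<alpha> (Sup K)}"
      have Kprop: "K = {Inf K..Sup K} \<and> a \<le> Inf K \<and> Inf K \<le> Sup K \<and> Sup K \<le> b" if KD: "K \<in> D" for K
      proof -
        obtain c d where cd: "c \<le> d" "K = {c..d}" "Inf K = c" "Sup K = d" by (rule division_of_IccE[OF D(1) KD])
        have "{c..d} \<subseteq> {a..b}" using KD D(2) cd(2) by blast
        then show ?thesis using cd by auto
      qed
      have imb: "\<alpha> a \<le> \<alpha> (Inf K) \<and> \<alpha> (Inf K) \<le> \<alpha> (Sup K) \<and> \<alpha> (Sup K) \<le> \<alpha> b" if "K \<in> D" for K
        using Kprop[OF that] mono ab(1) by auto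
      have SI: "Sup (?im K) = \<alpha> (Sup K)" "Inf (?im K) = \<alpha> (Inf K)" if "K \<in> D" for K
        using imb[OF that] by auto
      have inj: "inj_on ?im D"
      proof (rule inj_onI)
        fix K L assume KL: "K \<in> D" "L \<in> D" "?im K = ?im L"
        then have "\<alpha> (Sup K) = \<alpha> (Sup L)" "\<alpha> (Inf K) = \<alpha> (Inf L)"
          using imb[OF KL(1)] imb[OF KL(2)] by (simp_all only: Icc_eq_Icc) auto
        moreover have inj\<alpha>: "s = t" if "\<alpha> s = \<alpha> t" "a \<le> s" "a \<le> t" "s \<le> b" "t \<le> b" for s t
          using smono[of s t] smono[of t s] that by (cases s t rule: linorder_cases) auto
        ultimately have "Sup K = Sup L" "Inf K = Inf L"
          using Kprop[OF KL(1)] Kprop[OF KL(2)] by (auto intro!: inj\<alpha>)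
        then show "K = L" using Kprop[OF KL(1)] Kprop[OF KL(2)] by simp
      qed
      have "?im ` D division_of \<Union>(?im ` D)"
      proof (rule division_ofI)
        show "finite (?im ` D)" using D by auto
        fix M assume "M \<in> ?im ` D"
        then obtain K where K: "K \<in> D" "M = ?im K" by blast
        show "M \<subseteq> \<Union>(?im ` D)" using K by blast
        show "M \<noteq> {}" using imb[OF K(1)] K(2) by simp
        show "\<exists>a b. M = cbox a b" using K(2) by auto
      next
        fix M N assume MN: "M \<in> ?im ` D" "N \<in> ?im ` D" "M \<noteq> N"
        then obtain K L where KL: "K \<in> D" "L \<in> D" "M = ?im K" "N = ?im L" "K \<noteq> L" by blast
        have "interior K \<inter> interior L = {}" by (rule division_ofD(5)[OF D(1) KL(1,2,5)])
        moreover have "interior K = {Inf K<..<Sup K}" "interior L = {Inf L<..<Sup L}"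
          using Kprop[OF KL(1)] Kprop[OF KL(2)] interior_atLeastAtMost_real by metis+
        ultimately have dis: "{Inf K<..<Sup K} \<inter> {Inf L<..<Sup L} = {}" by simp
        \<comment> \<open>Degenerate members must be allowed for: a one-point interval of a division
          may lie inside another member.\<close>
        have "Sup K \<le> Inf L \<or> Sup L \<le> Inf K \<or> Inf K = Sup K \<or> Inf L = Sup L"
        proof (rule ccontr)
          assume "\<not> ?thesis"
          then have "max (Inf K) (Inf L) < min (Sup K) (Sup L)"
            using Kprop[OF KL(1)] Kprop[OF KL(2)] by auto
          then obtain z where "max (Inf K) (Inf L) < z" "z < min (Sup K) (Sup L)" using dense by blast
          then have "z \<in> {Inf K<..<Sup K} \<inter> {Inf L<..<Sup L}" by simp
          then show False unfolding dis by simp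
        qed
        then have "\<alpha> (Sup K) \<le> \<alpha> (Inf L) \<or> \<alpha> (Sup L) \<le> \<alpha> (Inf K) \<or> \<alpha> (Inf K) = \<alpha> (Sup K) \<or> \<alpha> (Inf L) = \<alpha> (Sup L)"
          using mono[of "Sup K" "Inf L"] mono[of "Sup L" "Inf K"] Kprop[OF KL(1)] Kprop[OF KL(2)] by auto
        then show "interior M \<inter> interior N = {}"
          unfolding KL(3,4) interior_atLeastAtMost_real by auto
      qed auto
      moreover have "\<Union>(?im ` D) \<subseteq> {\<alpha> a..\<alpha> b}"
      proof (rule UN_least)
        fix K assume "K \<in> D"
        from imb[OF this] show "?im K \<subseteq> {\<alpha> a..\<alpha> b}" by auto
      qed
      moreover have "(\<Sum>K\<in>?im ` D. Sup K - Inf K) < d1"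
      proof -
        have "(\<Sum>K\<in>?im ` D. Sup K - Inf K) = (\<Sum>K\<in>D. norm (\<alpha> (Sup K) - \<alpha> (Inf K)))"
          unfolding sum.reindex[OF inj] o_def by (rule sum.cong[OF refl]) (use SI imb in auto)
        also have "\<dots> < d1" using d2[OF D] * by blast
        finally show ?thesis .
      qed
      ultimately have "(\<Sum>K\<in>?im ` D. norm (g (Sup K) - g (Inf K))) < e" by (rule d1)
      moreover have "(\<Sum>K\<in>?im ` D. norm (g (Sup K) - g (Inf K))) = (\<Sum>K\<in>D. norm (g (\<alpha> (Sup K)) - g (\<alpha> (Inf K))))"
        unfolding sum.reindex[OF inj] o_def by (rule sum.cong[OF refl]) (use SI in auto)
      ultimately show "(\<Sum>K\<in>D. norm (g (\<alpha> (Sup K)) - g (\<alpha> (Inf K)))) < e" by simp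
    qed
  qed
qed

section \<open>Arc length\<close>

lemma arc_length_0 [simp]: "arc_length g 0 = 0"
  by (simp add: arc_length_def)

lemma arc_length_cong:
  assumes "\<And>t. 0 \<le> t \<Longrightarrow> t \<le> b \<Longrightarrow> g t = h t"
  shows "arc_length g b = arc_length h b"
  unfolding arc_length_def
proof (rule integral_spike)
  \<comment> \<open>The derivative is two-sided, so the two functions can be compared only inside
    the interval.\<close>
  show "negligible {0, b}" by (rule negligible_finite) simp
  fix x assume x: "x \<in> {0..b} - {0, b}"
  have "eventually (\<lambda>y. y \<in> {0<..<b}) (nhds x)" by (rule eventually_nhds_in_open) (use x in auto)
  then have "vector_derivative g (at x) = vector_derivative h (at x)"
    by (intro vector_derivative_cong_eq) (auto elim!: eventually_mono simp: assms)
  then show "norm (vector_derivative h (at x)) = norm (vector_derivative g (at x))" by simp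
qed

context
  fixes g :: "real \<Rightarrow> 'a::euclidean_space" and b :: real
  assumes ac: "abs_continuous_on {0..b} g"
begin

lemma integrable_norm_derivative:
  assumes "0 \<le> s" "t \<le> b"
  shows "(\<lambda>x. norm (vector_derivative g (at x))) integrable_on {s..t}"
proof (rule integrable_on_subinterval)
  show "(\<lambda>x. norm (vector_derivative g (at x))) integrable_on {0..b}"
    using abs_continuous_on_absolutely_integrable_derivative[OF ac] by (simp add: absolutely_integrable_on_def)
qed (use assms in auto)

lemma arc_length_diff:
  assumes "0 \<le> s" "s \<le> t" "t \<le> b"
  shows "arc_length g t - arc_length g s = integral {s..t} (\<lambda>x. norm (vector_derivative g (at x)))"
  unfolding arc_length_def
  using Henstock_Kurzweil_Integration.integral_combine[OF assms(1,2) integrable_norm_derivative] assms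
  by (metis add_diff_cancel_left' order.refl)

lemma norm_diff_le_arc_length:
  assumes "0 \<le> s" "s \<le> t" "t \<le> b"
  shows "norm (g t - g s) \<le> arc_length g t - arc_length g s"
proof -
  have acst: "abs_continuous_on {s..t} g" by (rule abs_continuous_on_subset[OF ac]) (use assms in auto)
  from abs_continuous_on_has_integral_derivative[OF assms(2) acst]
  have "g t - g s = integral {s..t} (\<lambda>x. vector_derivative g (at x))" by (simp add: integral_unique)
  also have "norm \<dots> \<le> integral {s..t} (\<lambda>x. norm (vector_derivative g (at x)))"
    by (rule integral_norm_bound_integral)
      (use abs_continuous_on_absolutely_integrable_derivative[OF acst] in \<open>auto simp: absolutely_integrable_on_def\<close>)
  finally show ?thesis by (simp add: arc_length_diff[OF assms])
qed

lemma arc_length_mono: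
  assumes "0 \<le> s" "s \<le> t" "t \<le> b"
  shows "arc_length g s \<le> arc_length g t"
  using norm_diff_le_arc_length[OF assms] norm_ge_zero[of "g t - g s"] by linarith

lemma sum_norm_diff_le_arc_length:
  assumes "\<And>i. i < n \<Longrightarrow> \<tau> i \<le> \<tau> (Suc i)" "0 \<le> \<tau> 0" "\<tau> n \<le> b"
  shows "(\<Sum>i<n. norm (g (\<tau> (Suc i)) - g (\<tau> i))) \<le> arc_length g (\<tau> n) - arc_length g (\<tau> 0)"
proof -
  have up: "\<tau> i \<le> \<tau> n" if "i \<le> n" for i
    using that assms(1) by (induction rule: inc_induct) (auto intro: order_trans)
  have low: "0 \<le> \<tau> i" if "i \<le> n" for i
    using that assms(1,2) by (induction i) (auto intro: order_trans)
  have "(\<Sum>i<n. norm (g (\<tau> (Suc i)) - g (\<tau> i))) \<le> (\<Sum>i<n. arc_length g (\<tau> (Suc i)) - arc_length g (\<tau> i))"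
  proof (rule sum_mono)
    fix i assume "i \<in> {..<n}"
    then show "norm (g (\<tau> (Suc i)) - g (\<tau> i)) \<le> arc_length g (\<tau> (Suc i)) - arc_length g (\<tau> i)"
      using assms up[of "Suc i"] low[of i] by (intro norm_diff_le_arc_length) auto
  qed
  then show ?thesis using sum_lessThan_telescope[of "\<lambda>i. arc_length g (\<tau> i)" n] by simp
qed

lemma negligible_arc_length_derivative:
  "negligible {x \<in> {0..b}. \<not> (arc_length g has_vector_derivative norm (vector_derivative g (at x))) (at x)}"
  using negligible_derivative_integral[OF absolutely_integrable_norm[OF abs_continuous_on_absolutely_integrable_derivative[OF ac]]]
  by (simp add: arc_length_def[abs_def] o_def)

lemma abs_continuous_on_arc_length: "abs_continuous_on {0..b} (arc_length g)"
  using abs_continuous_on_integral_Icc[OF absolutely_integrable_norm[OF abs_continuous_on_absolutely_integrable_derivative[OF ac]]]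
  by (simp add: arc_length_def[abs_def] o_def)

lemma arc_length_uniform_partition:
  assumes "0 \<le> b" "0 < e"
  shows "\<exists>n0. \<forall>n\<ge>n0. arc_length g b - e < (\<Sum>i<Suc n. norm (g (b * Suc i / Suc n) - g (b * i / Suc n)))"
  using variation_uniform_partition[OF ac assms] by (simp add: arc_length_def)

end

text \<open>Polygons inscribed in the composed curve are inscribed in \<open>g\<close>, which
  replaces a chain rule. Applied to a change of parameter and to its inverse this gives equality of
  lengths.\<close>

lemma arc_length_compose_le:
  assumes ac: "abs_continuous_on {0..\<beta> b} g" "abs_continuous_on {0..b} (\<lambda>t. g (\<beta> t))"
    and "0 \<le> b" "0 \<le> \<beta> 0" and mono: "\<And>s t. 0 \<le> s \<Longrightarrow> s \<le> t \<Longrightarrow> t \<le> b \<Longrightarrow> \<beta> s \<le> \<beta> t"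
  shows "arc_length (\<lambda>t. g (\<beta> t)) b \<le> arc_length g (\<beta> b)"
proof (rule field_le_epsilon)
  fix e :: real assume "0 < e"
  obtain n where n: "arc_length (\<lambda>t. g (\<beta> t)) b - e <
      (\<Sum>i<Suc n. norm (g (\<beta> (b * Suc i / Suc n)) - g (\<beta> (b * i / Suc n))))"
    using arc_length_uniform_partition[OF ac(2) \<open>0 \<le> b\<close> \<open>0 < e\<close>] by blast
  define \<tau> where "\<tau> = (\<lambda>i. \<beta> (b * real i / Suc n))"
  have "(\<Sum>i<Suc n. norm (g (\<tau> (Suc i)) - g (\<tau> i))) \<le> arc_length g (\<tau> (Suc n)) - arc_length g (\<tau> 0)"
  proof (rule sum_norm_diff_le_arc_length[OF ac(1)])
    fix i assume "i < Suc n"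
    then have "b * real (Suc i) / real (Suc n) \<le> b * real (Suc n) / real (Suc n)"
      using \<open>0 \<le> b\<close> by (intro divide_right_mono mult_left_mono) auto
    then show "\<tau> i \<le> \<tau> (Suc i)"
      unfolding \<tau>_def using \<open>0 \<le> b\<close> by (intro mono) (auto intro!: divide_right_mono mult_left_mono)
  qed (use \<open>0 \<le> \<beta> 0\<close> in \<open>auto simp: \<tau>_def\<close>)
  moreover have "0 \<le> arc_length g (\<tau> 0)"
  proof -
    have "\<tau> 0 = \<beta> 0" by (simp add: \<tau>_def)
    then show ?thesis using arc_length_mono[OF ac(1), of 0 "\<beta> 0"] \<open>0 \<le> \<beta> 0\<close> mono[of 0 b] \<open>0 \<le> b\<close> by simp
  qed
  ultimately show "arc_length (\<lambda>t. g (\<beta> t)) b \<le> arc_length g (\<beta> b) + e"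
    using n by (simp add: \<tau>_def del: of_nat_Suc)
qed

section \<open>Changes of parameter\<close>

lemma half_open_infty [simp]: "half_open \<infinity> = {0..}"
  by (auto simp: half_open_def)

lemma half_openD: "t \<in> half_open S \<Longrightarrow> 0 \<le> s \<Longrightarrow> s \<le> t \<Longrightarrow> s \<in> half_open S"
  unfolding half_open_def by (auto intro: le_less_trans[of "ereal s" "ereal t"])

lemma is_interval_half_open: "is_interval (half_open S)"
  unfolding is_interval_1
proof (intro ballI allI impI)
  fix a b x assume "a \<in> half_open S" "b \<in> half_open S" "a \<le> x \<and> x \<le> b"
  then show "x \<in> half_open S" by (intro half_openD[of b S x]) (auto simp: half_open_def)
qed

lemma half_open_nonneg: "t \<in> half_open S \<Longrightarrow> 0 \<le> t"
  by (simp add: half_open_def)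

lemma half_open_interval: "b \<in> half_open S \<Longrightarrow> {0..b} \<subseteq> half_open S"
  by (auto intro: half_openD)

lemma half_open_exceed:
  assumes "t \<in> half_open S"
  obtains b where "t < b" "b \<in> half_open S"
proof -
  have "ereal t < S" "0 \<le> t" using assms by (auto simp: half_open_def)
  then obtain z where "ereal t < ereal z" "ereal z < S" using ereal_dense2 by blast
  then show thesis using that[of z] \<open>0 \<le> t\<close> by (auto simp: half_open_def)
qed

text \<open>Rational right ends exhaust the half-open interval, so countably many null sets
  suffice.\<close>

lemma AE_half_open:
  assumes "\<And>b. b \<in> half_open S \<Longrightarrow> negligible {x \<in> {0..b}. \<not> P x}"
  shows "AE x in lebesgue. x \<in> half_open S \<longrightarrow> P x"
proof -
  let ?N = "\<lambda>q. {x \<in> {0..real_of_rat q}. \<not> P x}"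
  have "negligible (\<Union>(?N ` {q. real_of_rat q \<in> half_open S}))"
    by (rule negligible_countable_Union) (use assms in auto)
  then have "negligible {x. \<not> (x \<in> half_open S \<longrightarrow> P x)}"
  proof (rule negligible_subset, intro subsetI)
    fix x assume x: "x \<in> {x. \<not> (x \<in> half_open S \<longrightarrow> P x)}"
    then obtain b where b: "x < b" "b \<in> half_open S" using half_open_exceed by blast
    obtain q where q: "x < real_of_rat q" "real_of_rat q < b" using of_rat_dense[OF b(1)] by blast
    have "0 \<le> x" using x half_open_nonneg by blast
    then have "0 \<le> real_of_rat q" "real_of_rat q \<le> b" using q by linarith+
    then have "real_of_rat q \<in> half_open S" by (rule half_openD[OF b(2)])
    moreover have "x \<in> ?N q" using x q \<open>0 \<le> x\<close> by simp
    ultimately show "x \<in> \<Union>(?N ` {q. real_of_rat q \<in> half_open S})" by blast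
  qed
  then show ?thesis by (simp only: AE_lebesgue_iff_negligible)
qed

lemma negligible_half_open:
  assumes "AE x in lebesgue. x \<in> half_open S \<longrightarrow> P x" "b \<in> half_open S"
  shows "negligible {x \<in> {0..b}. \<not> P x}"
proof (rule negligible_subset)
  show "negligible {x. \<not> (x \<in> half_open S \<longrightarrow> P x)}" using assms(1) by (simp only: AE_lebesgue_iff_negligible)
  show "{x \<in> {0..b}. \<not> P x} \<subseteq> {x. \<not> (x \<in> half_open S \<longrightarrow> P x)}"
    using half_open_interval[OF assms(2)] by blast
qed

lemma reparamI:
  assumes val: "\<And>t. 0 \<le> t \<Longrightarrow> \<alpha> t \<in> half_open S"
    and inv: "\<And>s. s \<in> half_open S \<Longrightarrow> 0 \<le> \<beta> s \<and> \<alpha> (\<beta> s) = s"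
    and mono: "\<And>s t. 0 \<le> s \<Longrightarrow> s < t \<Longrightarrow> \<alpha> s < \<alpha> t"
    and ac: "abs_continuous_on {0..} \<alpha>" "abs_continuous_on (half_open S) \<beta>"
  shows "\<alpha> \<in> reparam S"
proof -
  have sm: "strict_mono_on {0..} \<alpha>" by (rule strict_mono_onI) (use mono in auto)
  then have inj: "inj_on \<alpha> {0..}" by (rule strict_mono_on_imp_inj_on)
  have "\<alpha> ` {0..} = half_open S"
  proof
    show "\<alpha> ` {0..} \<subseteq> half_open S" using val by auto
    show "half_open S \<subseteq> \<alpha> ` {0..}"
    proof
      fix s assume "s \<in> half_open S"
      from inv[OF this] show "s \<in> \<alpha> ` {0..}" by (metis atLeast_iff imageI)
    qed
  qed
  then have bij: "bij_betw \<alpha> {0..} (half_open S)" using inj by (simp add: bij_betw_def)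
  have "the_inv_into {0..} \<alpha> s = \<beta> s" if "s \<in> half_open S" for s
    by (rule the_inv_into_f_eq[OF inj]) (use inv[OF that] in auto)
  then have "abs_continuous_on (half_open S) (the_inv_into {0..} \<alpha>)"
    using abs_continuous_on_cong[of "half_open S" "the_inv_into {0..} \<alpha>" \<beta>] ac(2) by blast
  then show ?thesis using bij sm ac(1) by (simp add: reparam_def)
qed

context
  fixes \<alpha> S assumes \<alpha>: "\<alpha> \<in> reparam S"
begin

abbreviation (input) "inv\<alpha> \<equiv> the_inv_into {0..} \<alpha>"

lemma reparam_val: "0 \<le> t \<Longrightarrow> \<alpha> t \<in> half_open S"
  using \<alpha> by (auto simp: reparam_def bij_betw_def)

lemma reparam_strict: "0 \<le> s \<Longrightarrow> s < t \<Longrightarrow> \<alpha> s < \<alpha> t"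
  using \<alpha> by (auto simp: reparam_def intro: strict_mono_onD)

lemma reparam_strict_mono_on: "strict_mono_on {0..} \<alpha>"
  using \<alpha> by (simp add: reparam_def)

lemma reparam_mono: "0 \<le> s \<Longrightarrow> s \<le> t \<Longrightarrow> \<alpha> s \<le> \<alpha> t"
  using reparam_strict[of s t] by (cases "s = t") auto

lemma reparam_le_iff: "0 \<le> s \<Longrightarrow> 0 \<le> t \<Longrightarrow> \<alpha> s \<le> \<alpha> t \<longleftrightarrow> s \<le> t"
  using reparam_mono[of s t] reparam_strict[of t s] by (cases "s \<le> t") auto

lemma reparam_nonneg: "0 \<le> t \<Longrightarrow> 0 \<le> \<alpha> t"
  using reparam_val half_open_nonneg by blast

lemma reparam_ac: "abs_continuous_on {0..} \<alpha>"
  using \<alpha> by (simp add: reparam_def)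

lemma reparam_inv:
  assumes "s \<in> half_open S"
  shows "0 \<le> inv\<alpha> s" "\<alpha> (inv\<alpha> s) = s"
proof -
  have inj: "inj_on \<alpha> {0..}" and im: "\<alpha> ` {0..} = half_open S"
    using \<alpha> by (auto simp: reparam_def bij_betw_def)
  show "0 \<le> inv\<alpha> s" using the_inv_into_into[OF inj, of s "{0..}"] im assms by simp
  show "\<alpha> (inv\<alpha> s) = s" by (rule f_the_inv_into_f[OF inj]) (use im assms in simp)
qed

lemma reparam_inv_val: "0 \<le> t \<Longrightarrow> inv\<alpha> (\<alpha> t) = t"
  using \<alpha> by (intro the_inv_into_f_f) (auto simp: reparam_def bij_betw_def)

lemma reparam_inv_ac: "abs_continuous_on (half_open S) inv\<alpha>"
  using \<alpha> by (simp add: reparam_def)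

lemma reparam_inv_strict:
  assumes "s \<in> half_open S" "t \<in> half_open S" "s < t"
  shows "inv\<alpha> s < inv\<alpha> t"
proof (rule ccontr)
  assume "\<not> inv\<alpha> s < inv\<alpha> t"
  then have "\<alpha> (inv\<alpha> t) \<le> \<alpha> (inv\<alpha> s)" using reparam_inv[OF assms(2)] by (intro reparam_mono) auto
  then show False using reparam_inv[OF assms(1)] reparam_inv[OF assms(2)] assms(3) by simp
qed

lemma reparam_0: "\<alpha> 0 = 0"
proof -
  have "0 \<in> half_open S" by (rule half_openD[OF reparam_val[of 0]]) (use reparam_nonneg in auto)
  from reparam_inv[OF this] reparam_mono[of 0 "inv\<alpha> 0"] reparam_nonneg[of 0] show ?thesis by simp
qed

lemma abs_continuous_on_reparam:
  "abs_continuous_on (half_open S) g \<Longrightarrow> abs_continuous_on {0..} (\<lambda>t. g (\<alpha> t))"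
  by (rule abs_continuous_on_compose[OF _ reparam_ac reparam_strict_mono_on reparam_val is_interval_half_open]) auto

end

lemma reparam_id: "(\<lambda>t. t) \<in> reparam \<infinity>"
  by (rule reparamI[of _ _ "\<lambda>t. t"]) (auto intro: abs_continuous_on_ident)

lemma reparam_inverse:
  assumes "\<alpha> \<in> reparam \<infinity>"
  shows "the_inv_into {0..} \<alpha> \<in> reparam \<infinity>"
proof (rule reparamI[of _ _ \<alpha>])
  show "\<And>t. 0 \<le> t \<Longrightarrow> the_inv_into {0..} \<alpha> t \<in> half_open \<infinity>" using reparam_inv[OF assms] by simp
  show "\<And>s. s \<in> half_open \<infinity> \<Longrightarrow> 0 \<le> \<alpha> s \<and> the_inv_into {0..} \<alpha> (\<alpha> s) = s"
    using reparam_nonneg[OF assms] reparam_inv_val[OF assms] by simp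
  show "\<And>s t. 0 \<le> s \<Longrightarrow> s < t \<Longrightarrow> the_inv_into {0..} \<alpha> s < the_inv_into {0..} \<alpha> t"
    using reparam_inv_strict[OF assms] by simp
  show "abs_continuous_on {0..} (the_inv_into {0..} \<alpha>)" using reparam_inv_ac[OF assms] by simp
  show "abs_continuous_on (half_open \<infinity>) \<alpha>" using reparam_ac[OF assms] by simp
qed

lemma reparam_compose:
  assumes \<gamma>: "\<gamma> \<in> reparam S" and \<beta>: "\<beta> \<in> reparam \<infinity>"
  shows "(\<lambda>t. \<gamma> (\<beta> t)) \<in> reparam S"
proof (rule reparamI[of _ _ "\<lambda>s. the_inv_into {0..} \<beta> (the_inv_into {0..} \<gamma> s)"])
  show "\<gamma> (\<beta> t) \<in> half_open S" if "0 \<le> t" for t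
    by (rule reparam_val[OF \<gamma> reparam_nonneg[OF \<beta> that]])
  show "0 \<le> the_inv_into {0..} \<beta> (the_inv_into {0..} \<gamma> s) \<and> \<gamma> (\<beta> (the_inv_into {0..} \<beta> (the_inv_into {0..} \<gamma> s))) = s"
    if "s \<in> half_open S" for s
    using reparam_inv[OF \<gamma> that] reparam_inv[OF \<beta>, of "the_inv_into {0..} \<gamma> s"] by simp
  show "\<gamma> (\<beta> s) < \<gamma> (\<beta> t)" if "0 \<le> s" "s < t" for s t
    by (rule reparam_strict[OF \<gamma> reparam_nonneg[OF \<beta> that(1)] reparam_strict[OF \<beta> that]])
  show "abs_continuous_on {0..} (\<lambda>t. \<gamma> (\<beta> t))"
    by (rule abs_continuous_on_reparam[OF \<beta>]) (use reparam_ac[OF \<gamma>] in simp)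
  show "abs_continuous_on (half_open S) (\<lambda>s. the_inv_into {0..} \<beta> (the_inv_into {0..} \<gamma> s))"
  proof (rule abs_continuous_on_compose[OF _ reparam_inv_ac[OF \<gamma>], of "{0..}"])
    show "abs_continuous_on {0..} (the_inv_into {0..} \<beta>)" using reparam_inv_ac[OF \<beta>] by simp
    show "strict_mono_on (half_open S) (the_inv_into {0..} \<gamma>)"
      by (rule strict_mono_onI) (rule reparam_inv_strict[OF \<gamma>])
    show "\<And>t. t \<in> half_open S \<Longrightarrow> the_inv_into {0..} \<gamma> t \<in> {0..}" using reparam_inv[OF \<gamma>] by simp
    show "is_interval {0::real..}" by (rule is_interval_ci)
  qed
qed

text \<open>Compose one map with the inverse of the other. This makes the class of a curve on
  \<open>[0,S[\<close> independent of the map picked by \<open>SOME\<close>.\<close>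

lemma reparam_factor:
  assumes \<gamma>: "\<gamma> \<in> reparam S" and \<alpha>: "\<alpha> \<in> reparam S"
  obtains \<beta> where "\<beta> \<in> reparam \<infinity>" "\<And>t. 0 \<le> t \<Longrightarrow> \<gamma> t = \<alpha> (\<beta> t)"
proof
  let ?i = "the_inv_into {0..} \<alpha>" and ?j = "the_inv_into {0..} \<gamma>"
  show "\<gamma> t = \<alpha> (?i (\<gamma> t))" if "0 \<le> t" for t
    by (rule reparam_inv(2)[OF \<alpha> reparam_val[OF \<gamma> that], symmetric])
  show "(\<lambda>t. ?i (\<gamma> t)) \<in> reparam \<infinity>"
  proof (rule reparamI[of _ _ "\<lambda>s. ?j (\<alpha> s)"])
    show "?i (\<gamma> t) \<in> half_open \<infinity>" if "0 \<le> t" for t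
      using reparam_inv(1)[OF \<alpha> reparam_val[OF \<gamma> that]] by simp
    show "0 \<le> ?j (\<alpha> s) \<and> ?i (\<gamma> (?j (\<alpha> s))) = s" if "s \<in> half_open \<infinity>" for s
    proof -
      have "0 \<le> s" using that by simp
      from reparam_inv[OF \<gamma> reparam_val[OF \<alpha> this]] reparam_inv_val[OF \<alpha> this] show ?thesis by simp
    qed
    show "?i (\<gamma> s) < ?i (\<gamma> t)" if "0 \<le> s" "s < t" for s t
      by (rule reparam_inv_strict[OF \<alpha> reparam_val[OF \<gamma>] reparam_val[OF \<gamma>] reparam_strict[OF \<gamma>]]) (use that in auto)
    show "abs_continuous_on {0..} (\<lambda>t. ?i (\<gamma> t))"
      by (rule abs_continuous_on_reparam[OF \<gamma> reparam_inv_ac[OF \<alpha>]])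
    show "abs_continuous_on (half_open \<infinity>) (\<lambda>s. ?j (\<alpha> s))"
      using abs_continuous_on_reparam[OF \<alpha> reparam_inv_ac[OF \<gamma>]] by simp
  qed
qed

section \<open>Frechet equivalence\<close>

text \<open>A continuous function whose norm exceeds \<open>r\<close> at a point does so on a right
  neighbourhood of that point, which is not null and lies in the half-line; so the essential
  supremum is a supremum.\<close>

lemma Linf_norm_le_iff:
  fixes g :: "real \<Rightarrow> 'a::euclidean_space"
  assumes cont: "continuous_on {0..} g"
  shows "Linf_norm g \<le> ereal r \<longleftrightarrow> (\<forall>t\<ge>0. norm (g t) \<le> r)"
proof
  have "g \<in> borel_measurable (lebesgue_on {0..})"
    by (rule continuous_imp_measurable_on_sets_lebesgue[OF cont]) simp
  then have meas: "(\<lambda>t. ereal (norm (g t))) \<in> borel_measurable (lebesgue_on {0..})" by measurable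
  show "Linf_norm g \<le> ereal r" if "\<forall>t\<ge>0. norm (g t) \<le> r"
    unfolding Linf_norm_def by (rule esssup_I[OF meas]) (use that in \<open>auto intro!: AE_I2\<close>)
  show "\<forall>t\<ge>0. norm (g t) \<le> r" if le: "Linf_norm g \<le> ereal r"
  proof (rule ccontr)
    assume "\<not> (\<forall>t\<ge>0. norm (g t) \<le> r)"
    then obtain t0 where t0: "0 \<le> t0" "r < norm (g t0)" by auto
    have "continuous_on {0..} (\<lambda>t. norm (g t))" by (intro continuous_intros cont)
    then have "((\<lambda>t. norm (g t)) \<longlongrightarrow> norm (g t0)) (at t0 within {0..})"
      using t0(1) by (simp add: continuous_on_def)
    then have "eventually (\<lambda>t. r < norm (g t)) (at t0 within {0..})" using t0(2) by (rule order_tendstoD)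
    then obtain d where "0 < d" and d: "\<And>t. t \<in> {0..} \<Longrightarrow> t \<noteq> t0 \<Longrightarrow> dist t t0 < d \<Longrightarrow> r < norm (g t)"
      unfolding eventually_at by blast
    have "AE t in lebesgue_on {0..}. ereal (norm (g t)) \<le> Linf_norm g"
      unfolding Linf_norm_def by (rule esssup_AE)
    then have "AE t in lebesgue_on {0..}. norm (g t) \<le> r"
    proof (rule AE_mp, intro AE_I2 impI)
      fix t assume "ereal (norm (g t)) \<le> Linf_norm g"
      from order_trans[OF this le] show "norm (g t) \<le> r" by simp
    qed
    then have "AE t in lebesgue. t \<in> {0..} \<longrightarrow> norm (g t) \<le> r"
      by (subst (asm) AE_restrict_space_iff) auto
    then have "negligible {t. \<not> (t \<in> {0..} \<longrightarrow> norm (g t) \<le> r)}" by (simp only: AE_lebesgue_iff_negligible)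
    then have "negligible {t0<..<t0 + d}"
    proof (rule negligible_subset, intro subsetI)
      fix t assume "t \<in> {t0<..<t0 + d}"
      then have "r < norm (g t)" "0 \<le> t" using d[of t] t0(1) by (auto simp: dist_real_def)
      then show "t \<in> {t. \<not> (t \<in> {0..} \<longrightarrow> norm (g t) \<le> r)}" by simp
    qed
    moreover have "\<not> negligible {t0<..<t0 + d}"
      by (rule open_not_negligible) (use \<open>0 < d\<close> in auto)
    ultimately show False by simp
  qed
qed

text \<open>A negative essential supremum would bound a norm almost everywhere on a set of positive
  measure.\<close>

lemma Linf_norm_nonneg: "0 \<le> Linf_norm g"
proof (rule ccontr)
  assume neg: "\<not> 0 \<le> Linf_norm g"
  have key: "\<not> ereal (norm (g t)) \<le> Linf_norm g" for t
  proof
    assume "ereal (norm (g t)) \<le> Linf_norm g"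
    moreover have "0 \<le> ereal (norm (g t))" by simp
    ultimately show False using neg order_trans by blast
  qed
  have "AE t in lebesgue_on {0..}. ereal (norm (g t)) \<le> Linf_norm g"
    unfolding Linf_norm_def by (rule esssup_AE)
  then have "AE t :: real in lebesgue_on {0..}. False" by (simp only: key)
  then have "AE t :: real in lebesgue. t \<in> {0..} \<longrightarrow> False"
    by (subst (asm) AE_restrict_space_iff) auto
  then have "negligible {t :: real. \<not> (t \<in> {0..} \<longrightarrow> False)}" by (simp only: AE_lebesgue_iff_negligible)
  then have "negligible {0<..<1 :: real}" by (rule negligible_subset) auto
  moreover have "\<not> negligible {0<..<1 :: real}" by (rule open_not_negligible) auto
  ultimately show False by simp
qed

text \<open>The infimum of essential suprema is replaced by a single change of parameter with a
  pointwise bound. Inverses and compositions in \<open>reparam \<infinity>\<close> make the relation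
  symmetric and, with added radii, transitive.\<close>

definition close_up_to :: "real \<Rightarrow> (real \<Rightarrow> 'a::real_normed_vector) \<Rightarrow> (real \<Rightarrow> 'a) \<Rightarrow> bool" where
  "close_up_to r g1 g2 \<longleftrightarrow> (\<exists>\<alpha>\<in>reparam \<infinity>. \<forall>t\<ge>0. norm (g1 t - g2 (\<alpha> t)) \<le> r)"

lemma close_up_toI_id: "(\<And>t. 0 \<le> t \<Longrightarrow> norm (g1 t - g2 t) \<le> r) \<Longrightarrow> close_up_to r g1 g2"
  unfolding close_up_to_def using reparam_id by (intro bexI[of _ "\<lambda>t. t"]) auto

lemma close_up_to_sym:
  assumes "close_up_to r g1 g2"
  shows "close_up_to r g2 g1"
proof -
  obtain \<alpha> where \<alpha>: "\<alpha> \<in> reparam \<infinity>" "\<forall>t\<ge>0. norm (g1 t - g2 (\<alpha> t)) \<le> r"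
    using assms by (auto simp: close_up_to_def)
  let ?i = "the_inv_into {0..} \<alpha>"
  have "norm (g2 t - g1 (?i t)) \<le> r" if "0 \<le> t" for t
  proof -
    have "0 \<le> ?i t" "\<alpha> (?i t) = t" using reparam_inv[OF \<alpha>(1), of t] that by auto
    then show ?thesis using \<alpha>(2)[rule_format, of "?i t"] by (simp add: norm_minus_commute)
  qed
  then show ?thesis unfolding close_up_to_def using reparam_inverse[OF \<alpha>(1)] by blast
qed

lemma close_up_to_trans:
  assumes "close_up_to r g1 g2" "close_up_to r' g2 g3"
  shows "close_up_to (r + r') g1 g3"
proof -
  obtain \<alpha> \<beta> where \<alpha>: "\<alpha> \<in> reparam \<infinity>" "\<forall>t\<ge>0. norm (g1 t - g2 (\<alpha> t)) \<le> r"
    and \<beta>: "\<beta> \<in> reparam \<infinity>" "\<forall>t\<ge>0. norm (g2 t - g3 (\<beta> t)) \<le> r'"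
    using assms unfolding close_up_to_def by blast
  have "norm (g1 t - g3 (\<beta> (\<alpha> t))) \<le> r + r'" if "0 \<le> t" for t
  proof -
    have "norm (g1 t - g2 (\<alpha> t)) \<le> r" using \<alpha>(2) that by blast
    moreover have "norm (g2 (\<alpha> t) - g3 (\<beta> (\<alpha> t))) \<le> r'" using \<beta>(2) reparam_nonneg[OF \<alpha>(1) that] by blast
    ultimately show ?thesis
      using norm_triangle_ineq[of "g1 t - g2 (\<alpha> t)" "g2 (\<alpha> t) - g3 (\<beta> (\<alpha> t))"] by simp
  qed
  then have "\<forall>t\<ge>0. norm (g1 t - g3 (\<beta> (\<alpha> t))) \<le> r + r'" by simp
  then show ?thesis unfolding close_up_to_def by (rule bexI[OF _ reparam_compose[OF \<beta>(1) \<alpha>(1)]])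
qed

lemma frechet_equiv_iff:
  fixes g1 g2 :: "real \<Rightarrow> 'a::euclidean_space"
  assumes ac: "abs_continuous_on {0..} g1" "abs_continuous_on {0..} g2"
  shows "frechet_equiv g1 g2 \<longleftrightarrow> (\<forall>e>0. close_up_to e g1 g2)"
proof -
  have cont: "continuous_on {0..} (\<lambda>t. g1 t - g2 (\<alpha> t))" if "\<alpha> \<in> reparam \<infinity>" for \<alpha>
  proof -
    have "abs_continuous_on {0..} (\<lambda>t. g2 (\<alpha> t))"
      by (rule abs_continuous_on_reparam[OF that]) (use ac in simp)
    then show ?thesis by (intro continuous_on_diff abs_continuous_on_continuous_on ac)
  qed
  let ?I = "INF \<alpha>\<in>reparam \<infinity>. Linf_norm (\<lambda>t. g1 t - g2 (\<alpha> t))"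
  have "0 \<le> ?I" by (rule INF_greatest) (rule Linf_norm_nonneg)
  show ?thesis
    unfolding frechet_equiv_def
  proof
    assume I: "?I = 0"
    show "\<forall>e>0. close_up_to e g1 g2"
    proof (intro allI impI)
      fix e :: real assume "0 < e"
      then have "?I < ereal e" using I by simp
      then obtain \<alpha> where \<alpha>: "\<alpha> \<in> reparam \<infinity>" "Linf_norm (\<lambda>t. g1 t - g2 (\<alpha> t)) < ereal e"
        unfolding INF_less_iff by blast
      from Linf_norm_le_iff[OF cont[OF \<alpha>(1)], of e] less_imp_le[OF \<alpha>(2)]
      have "\<forall>t\<ge>0. norm (g1 t - g2 (\<alpha> t)) \<le> e" by blast
      then show "close_up_to e g1 g2" unfolding close_up_to_def using \<alpha>(1) by blast
    qed
  next
    assume c: "\<forall>e>0. close_up_to e g1 g2"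
    have "?I \<le> ereal e" if "0 < e" for e
    proof -
      have "close_up_to e g1 g2" using c that by blast
      then obtain \<alpha> where \<alpha>: "\<alpha> \<in> reparam \<infinity>" "\<forall>t\<ge>0. norm (g1 t - g2 (\<alpha> t)) \<le> e"
        unfolding close_up_to_def by blast
      show ?thesis by (rule INF_lower2[OF \<alpha>(1)]) (use Linf_norm_le_iff[OF cont[OF \<alpha>(1)]] \<alpha>(2) in blast)
    qed
    then have "?I \<le> 0 + ereal e" if "0 < e" for e using that by simp
    then have "?I \<le> 0" using ereal_le_epsilon2 by blast
    then show "?I = 0" using \<open>0 \<le> ?I\<close> by (rule antisym)
  qed
qed

lemma frechet_equiv_refl: "abs_continuous_on {0..} g \<Longrightarrow> frechet_equiv g (g :: real \<Rightarrow> 'a::euclidean_space)"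
  by (simp add: frechet_equiv_iff close_up_toI_id)

lemma frechet_equiv_sym:
  fixes g1 g2 :: "real \<Rightarrow> 'a::euclidean_space"
  assumes "abs_continuous_on {0..} g1" "abs_continuous_on {0..} g2" "frechet_equiv g1 g2"
  shows "frechet_equiv g2 g1"
  using assms by (simp add: frechet_equiv_iff close_up_to_sym)

lemma frechet_equiv_trans:
  fixes g1 g2 g3 :: "real \<Rightarrow> 'a::euclidean_space"
  assumes ac: "abs_continuous_on {0..} g1" "abs_continuous_on {0..} g2" "abs_continuous_on {0..} g3"
    and "frechet_equiv g1 g2" "frechet_equiv g2 g3"
  shows "frechet_equiv g1 g3"
  unfolding frechet_equiv_iff[OF ac(1,3)]
proof (intro allI impI)
  fix e :: real assume "0 < e"
  then have "0 < e / 2" by simp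
  then have "close_up_to (e / 2) g1 g2" "close_up_to (e / 2) g2 g3"
    using assms by (auto simp: frechet_equiv_iff)
  from close_up_to_trans[OF this] show "close_up_to e g1 g3" by simp
qed

lemma frechet_class_eq_iff:
  fixes g1 g2 :: "real \<Rightarrow> 'a::euclidean_space"
  assumes ac: "abs_continuous_on {0..} g1" "abs_continuous_on {0..} g2"
  shows "frechet_class g1 = frechet_class g2 \<longleftrightarrow> frechet_equiv g1 g2"
proof
  assume eq: "frechet_class g1 = frechet_class g2"
  have "g2 \<in> frechet_class g2" using ac frechet_equiv_refl by (simp add: frechet_class_def)
  then have "g2 \<in> frechet_class g1" unfolding eq .
  then show "frechet_equiv g1 g2" by (simp add: frechet_class_def)
next
  assume e: "frechet_equiv g1 g2"
  show "frechet_class g1 = frechet_class g2"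
  proof (intro set_eqI iffI)
    fix h assume "h \<in> frechet_class g1"
    then have h: "abs_continuous_on {0..} h" "frechet_equiv g1 h" by (auto simp: frechet_class_def)
    from frechet_equiv_trans[OF ac(2) ac(1) h(1) frechet_equiv_sym[OF ac e] h(2)] h(1)
    show "h \<in> frechet_class g2" by (simp add: frechet_class_def)
  next
    fix h assume "h \<in> frechet_class g2"
    then have h: "abs_continuous_on {0..} h" "frechet_equiv g2 h" by (auto simp: frechet_class_def)
    from frechet_equiv_trans[OF ac h(1) e h(2)] h(1)
    show "h \<in> frechet_class g1" by (simp add: frechet_class_def)
  qed
qed

lemma frechet_equiv_reparam:
  fixes g1 g2 :: "real \<Rightarrow> 'a::euclidean_space"
  assumes "abs_continuous_on {0..} g1" "abs_continuous_on {0..} g2" "\<beta> \<in> reparam \<infinity>"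
    "\<And>t. 0 \<le> t \<Longrightarrow> g1 t = g2 (\<beta> t)"
  shows "frechet_equiv g1 g2"
  unfolding frechet_equiv_iff[OF assms(1,2)] close_up_to_def
  using assms(3,4) by (intro allI impI bexI[of _ \<beta>]) auto

lemma frechet_class_on_eq:
  fixes g :: "real \<Rightarrow> 'a::euclidean_space"
  assumes \<gamma>: "\<gamma> \<in> reparam S" and g: "abs_continuous_on (half_open S) g"
  shows "frechet_class_on S g = frechet_class (\<lambda>t. g (\<gamma> t))"
proof -
  define \<alpha> where "\<alpha> = (SOME \<alpha>. \<alpha> \<in> reparam S)"
  have \<alpha>: "\<alpha> \<in> reparam S" unfolding \<alpha>_def by (rule someI[where P = "\<lambda>\<alpha>. \<alpha> \<in> reparam S", OF \<gamma>])
  obtain \<beta> where \<beta>: "\<beta> \<in> reparam \<infinity>" "\<And>t. 0 \<le> t \<Longrightarrow> \<alpha> t = \<gamma> (\<beta> t)"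
    by (rule reparam_factor[OF \<alpha> \<gamma>]) blast
  have ac: "abs_continuous_on {0..} (\<lambda>t. g (\<alpha> t))" "abs_continuous_on {0..} (\<lambda>t. g (\<gamma> t))"
    by (rule abs_continuous_on_reparam[OF _ g]; fact)+
  have "frechet_equiv (\<lambda>t. g (\<alpha> t)) (\<lambda>t. g (\<gamma> t))"
    by (rule frechet_equiv_reparam[OF ac \<beta>(1)]) (simp add: \<beta>(2))
  then have "frechet_class (\<lambda>t. g (\<alpha> t)) = frechet_class (\<lambda>t. g (\<gamma> t))"
    using frechet_class_eq_iff[OF ac] by simp
  then show ?thesis by (simp add: frechet_class_on_def \<alpha>_def o_def)
qed

section \<open>Space-time curves and their truncations\<close>

lemma abs_continuous_on_arc_length_infty:
  fixes g :: "real \<Rightarrow> 'a::euclidean_space"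
  assumes "abs_continuous_on {0..} g"
  shows "abs_continuous_on {0..} (arc_length g)"
  unfolding abs_continuous_on_Icc_iff[of "{0..}"]
proof (intro allI impI)
  fix a b :: real assume "a \<le> b" "{a..b} \<subseteq> {0..}"
  then have "{a..b} \<subseteq> {0..b}" by auto
  moreover have "abs_continuous_on {0..b} (arc_length g)"
    by (rule abs_continuous_on_arc_length[OF abs_continuous_on_subset[OF assms]]) auto
  ultimately show "abs_continuous_on {a..b} (arc_length g)" using abs_continuous_on_subset by blast
qed

lemma abs_continuous_on_restrict: "abs_continuous_on {0..} g \<Longrightarrow> abs_continuous_on {0..b} g"
  by (rule abs_continuous_on_subset) auto

text \<open>Increments of the stopped curve are dominated by increments of the arc length of the
  original one.\<close>

lemma abs_continuous_on_stop:
  fixes g :: "real \<Rightarrow> 'a::euclidean_space"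
  assumes ac: "abs_continuous_on {0..} g" and "0 \<le> E"
  shows "abs_continuous_on {0..} (\<lambda>t. g (min t E))"
proof (rule abs_continuous_on_dominated1[OF abs_continuous_on_arc_length_infty[OF ac], of _ 1])
  fix s t :: real assume st: "s \<in> {0..}" "t \<in> {0..}" "s \<le> t"
  have "norm (g (min t E) - g (min s E)) \<le> arc_length g (min t E) - arc_length g (min s E)"
    by (rule norm_diff_le_arc_length[OF abs_continuous_on_restrict[OF ac, of t]]) (use st \<open>0 \<le> E\<close> in auto)
  also have "\<dots> \<le> arc_length g t - arc_length g s"
  proof (cases "s \<le> E")
    case True
    have "arc_length g (min t E) \<le> arc_length g t"
      by (rule arc_length_mono[OF abs_continuous_on_restrict[OF ac, of t]]) (use st \<open>0 \<le> E\<close> in auto)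
    then show ?thesis using True by simp
  next
    case False
    then have "min t E = E" "min s E = E" using st by auto
    moreover have "arc_length g s \<le> arc_length g t"
      by (rule arc_length_mono[OF abs_continuous_on_restrict[OF ac, of t]]) (use st in auto)
    ultimately show ?thesis by simp
  qed
  also have "\<dots> \<le> 1 * norm (arc_length g t - arc_length g s)" by simp
  finally show "norm (g (min t E) - g (min s E)) \<le> 1 * norm (arc_length g t - arc_length g s)" .
qed

lemma arc_length_const_after:
  fixes g :: "real \<Rightarrow> 'a::euclidean_space"
  assumes ac: "abs_continuous_on {0..} g" and "0 \<le> E" "E \<le> M" and const: "\<And>t. E \<le> t \<Longrightarrow> g t = c"
  shows "arc_length g M = arc_length g E"
proof -
  have "arc_length g M - arc_length g E = integral {E..M} (\<lambda>x. norm (vector_derivative g (at x)))"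
    by (rule arc_length_diff[OF abs_continuous_on_restrict[OF ac] assms(2,3) order.refl])
  also have "\<dots> = integral {E..M} (\<lambda>x. 0)"
  proof (rule integral_spike)
    show "negligible {E}" by simp
    fix x assume x: "x \<in> {E..M} - {E}"
    have "eventually (\<lambda>y. y \<in> {E<..}) (nhds x)" by (rule eventually_nhds_in_open) (use x in auto)
    then have "vector_derivative g (at x) = vector_derivative (\<lambda>_. c) (at x)"
      by (intro vector_derivative_cong_eq) (auto elim!: eventually_mono intro: const)
    then show "0 = norm (vector_derivative g (at x))" by simp
  qed
  finally show ?thesis by simp
qed

section \<open>Curves that cross the time level T\<close>

text \<open>What the truncation at \<open>T\<close> depends on among the properties in
  \<open>YYT T\<close>. The sign condition on the derivative becomes monotonicity and the limit
  becomes a value above \<open>T\<close>; in this form the properties pass to equivalent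
  curves.\<close>

definition crosses :: "real \<Rightarrow> (real \<Rightarrow> real \<times> 'a::euclidean_space) \<Rightarrow> bool" where
  "crosses T g \<longleftrightarrow> abs_continuous_on {0..} g \<and> fst (g 0) = 0 \<and>
     (\<forall>s t. 0 \<le> s \<longrightarrow> s \<le> t \<longrightarrow> fst (g s) \<le> fst (g t)) \<and> (\<exists>t\<ge>0. T < fst (g t))"

lemma crossesD:
  assumes "crosses T g"
  shows "abs_continuous_on {0..} g" "fst (g 0) = 0"
    "\<And>s t. 0 \<le> s \<Longrightarrow> s \<le> t \<Longrightarrow> fst (g s) \<le> fst (g t)"
  using assms by (auto simp: crosses_def)

lemma norm_fst_diff_le: "norm (fst a - fst b) \<le> norm (a - b :: 'a::real_normed_vector \<times> 'b::real_normed_vector)"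
  and norm_snd_diff_le: "norm (snd a - snd b) \<le> norm (a - b)"
  by (metis fst_diff norm_fst_le prod.collapse) (metis snd_diff norm_snd_le prod.collapse)

lemma crosses_ac_fst:
  assumes "abs_continuous_on I (g :: real \<Rightarrow> real \<times> 'a::euclidean_space)"
  shows "abs_continuous_on I (\<lambda>t. fst (g t))"
  by (rule abs_continuous_on_dominated1[OF assms, of _ 1])
    (simp only: norm_fst_diff_le mult_1)

lemma crosses_ac_snd:
  assumes "abs_continuous_on I (g :: real \<Rightarrow> real \<times> 'a::euclidean_space)"
  shows "abs_continuous_on I (\<lambda>t. snd (g t))"
  by (rule abs_continuous_on_dominated1[OF assms, of _ 1])
    (simp only: norm_snd_diff_le mult_1)

context
  fixes T :: real and g :: "real \<Rightarrow> real \<times> 'a::euclidean_space"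
  assumes T: "0 \<le> T" and g: "crosses T g"
begin

text \<open>The set in \<open>sharp\<close> is closed and bounded, so its supremum is attained; were
  the time there below \<open>T\<close>, the intermediate value theorem would produce a later
  parameter in the set.\<close>

lemma end_time_aux:
  "0 \<le> end_time T g \<and> fst (g (end_time T g)) = T \<and> (\<forall>t>end_time T g. T < fst (g t))"
proof -
  define A where "A = {s. 0 \<le> s \<and> fst (g s) \<le> T}"
  have E: "end_time T g = Sup A" by (simp add: end_time_def sharp_def A_def)
  obtain t1 where t1: "0 \<le> t1" "T < fst (g t1)" using g by (auto simp: crosses_def)
  have "0 \<in> A" using T crossesD(2)[OF g] by (simp add: A_def)
  have A_le: "s \<le> t1" if "s \<in> A" for s
  proof (rule ccontr)
    assume "\<not> s \<le> t1"
    then have "fst (g t1) \<le> fst (g s)" using t1 by (intro crossesD(3)[OF g]) auto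
    then show False using that t1 by (simp add: A_def)
  qed
  have bdd: "bdd_above A" by (rule bdd_aboveI) (rule A_le)
  have cont: "continuous_on {0..} (\<lambda>t. fst (g t))"
    by (intro continuous_intros abs_continuous_on_continuous_on crossesD[OF g])
  have "closed ({0..} \<inter> (\<lambda>t. fst (g t)) -` {..T})"
    by (rule continuous_closed_preimage[OF cont]) auto
  moreover have "A = {0..} \<inter> (\<lambda>t. fst (g t)) -` {..T}" by (auto simp: A_def)
  ultimately have "closed A" by simp
  have "A \<noteq> {}" using \<open>0 \<in> A\<close> by blast
  have EA: "Sup A \<in> A" by (rule closed_contains_Sup[OF \<open>A \<noteq> {}\<close> bdd \<open>closed A\<close>])
  have gt: "T < fst (g t)" if "Sup A < t" for t
  proof (rule ccontr)
    assume "\<not> T < fst (g t)"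
    then have "t \<in> A" using that EA by (auto simp: A_def)
    then have "t \<le> Sup A" by (rule cSup_upper[OF _ bdd])
    then show False using that by simp
  qed
  have "fst (g (Sup A)) = T"
  proof -
    have "Sup A \<le> t1" by (rule cSup_least[OF \<open>A \<noteq> {}\<close> A_le])
    moreover have "continuous_on {Sup A..t1} (\<lambda>t. fst (g t))"
      by (rule continuous_on_subset[OF cont]) (use EA in \<open>auto simp: A_def\<close>)
    ultimately obtain s where s: "Sup A \<le> s" "s \<le> t1" "fst (g s) = T"
      using IVT'[of "\<lambda>t. fst (g t)" "Sup A" T t1] EA t1 by (auto simp: A_def)
    then have "s \<in> A" using EA by (auto simp: A_def)
    then have "s \<le> Sup A" by (rule cSup_upper[OF _ bdd])
    then show ?thesis using s by simp
  qed
  then show ?thesis using gt EA by (auto simp: E A_def)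
qed

lemma end_time_nonneg: "0 \<le> end_time T g"
  and fst_end_time: "fst (g (end_time T g)) = T"
  and fst_gt_after_end_time: "end_time T g < t \<Longrightarrow> T < fst (g t)"
  using end_time_aux by auto

lemma end_time_unique:
  assumes "0 \<le> E" "fst (g E) = T" "\<And>t. E < t \<Longrightarrow> T < fst (g t)"
  shows "end_time T g = E"
proof (rule antisym)
  show "end_time T g \<le> E" using assms(3)[of "end_time T g"] fst_end_time by force
  show "E \<le> end_time T g" using fst_gt_after_end_time[of E] assms(2) by force
qed

text \<open>The time at the end parameter is exactly \<open>T\<close>, so the constant in
  \<open>trunc\<close> is the value of the curve there, and truncating becomes stopping.\<close>

lemma trunc_eq: "trunc T g t = g (min t (end_time T g))"
  using fst_end_time by (auto simp: trunc_def min_def prod_eq_iff)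

lemma trunc_ac: "abs_continuous_on {0..} (trunc T g)"
  using abs_continuous_on_stop[OF crossesD(1)[OF g] end_time_nonneg] by (simp add: trunc_eq[abs_def])

lemma trunc_const: "end_time T g \<le> t \<Longrightarrow> trunc T g t = g (end_time T g)"
  by (simp add: trunc_eq min_def)

lemma arc_length_trunc:
  assumes "end_time T g \<le> M"
  shows "arc_length (trunc T g) M = arc_length g (end_time T g)"
proof -
  have "arc_length (trunc T g) M = arc_length (trunc T g) (end_time T g)"
    by (rule arc_length_const_after[OF trunc_ac end_time_nonneg assms trunc_const])
  also have "\<dots> = arc_length g (end_time T g)"
    by (rule arc_length_cong) (simp add: trunc_eq min_def)
  finally show ?thesis .
qed

lemma end_time_osc:
  assumes "0 < e"
  obtains \<tau> where "0 < \<tau>" "\<And>s. end_time T g \<le> s \<Longrightarrow> s \<le> end_time T g + \<tau> \<Longrightarrow> norm (g s - g (end_time T g)) \<le> e"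
proof -
  let ?E = "end_time T g"
  have "continuous_on {0..} g" by (rule abs_continuous_on_continuous_on[OF crossesD(1)[OF g]])
  then obtain d where "0 < d" and d: "\<And>s. s \<in> {0..} \<Longrightarrow> dist s ?E < d \<Longrightarrow> dist (g s) (g ?E) < e"
    using end_time_nonneg assms unfolding continuous_on_iff by (metis atLeast_iff)
  show thesis
  proof (rule that[of "d / 2"])
    show "0 < d / 2" using \<open>0 < d\<close> by simp
    fix s assume "?E \<le> s" "s \<le> ?E + d / 2"
    then have "s \<in> {0..}" "dist s ?E < d" using end_time_nonneg \<open>0 < d\<close> by (auto simp: dist_real_def)
    from d[OF this] show "norm (g s - g ?E) \<le> e" by (simp add: dist_norm)
  qed
qed

lemma crosses_reparam:
  assumes "\<alpha> \<in> reparam \<infinity>"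
  shows "crosses T (\<lambda>t. g (\<alpha> t))"
  unfolding crosses_def
proof (intro conjI allI impI)
  show "abs_continuous_on {0..} (\<lambda>t. g (\<alpha> t))"
    by (rule abs_continuous_on_reparam[OF assms]) (use crossesD[OF g] in simp)
  show "fst (g (\<alpha> 0)) = 0" using crossesD(2)[OF g] by (simp add: reparam_0[OF assms])
  show "fst (g (\<alpha> s)) \<le> fst (g (\<alpha> t))" if "0 \<le> s" "s \<le> t" for s t
    by (rule crossesD(3)[OF g reparam_nonneg[OF assms that(1)] reparam_mono[OF assms that]])
  obtain t1 where "0 \<le> t1" "T < fst (g t1)" using g by (auto simp: crosses_def)
  then show "\<exists>t\<ge>0. T < fst (g (\<alpha> t))"
    using reparam_inv[OF assms, of t1] by (intro exI[of _ "the_inv_into {0..} \<alpha> t1"]) simp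
qed

text \<open>Ensures that the infimum in \<open>d_T\<close> is finite, so that
  \<open>real_of_ereal\<close> does not replace an infinite value by 0.\<close>

lemma norm_trunc_le: "0 \<le> t \<Longrightarrow> norm (trunc T g t) \<le> norm (g 0) + arc_length g (end_time T g)"
proof -
  assume "0 \<le> t"
  let ?E = "end_time T g"
  have "norm (g (min t ?E) - g 0) \<le> arc_length g (min t ?E) - arc_length g 0"
    by (rule norm_diff_le_arc_length[OF abs_continuous_on_restrict[OF crossesD(1)[OF g], of ?E]])
      (use \<open>0 \<le> t\<close> end_time_nonneg in auto)
  also have "arc_length g (min t ?E) \<le> arc_length g ?E"
    by (rule arc_length_mono[OF abs_continuous_on_restrict[OF crossesD(1)[OF g], of ?E]])
      (use \<open>0 \<le> t\<close> end_time_nonneg in auto)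
  finally show ?thesis using norm_triangle_sub[of "g (min t ?E)" "g 0"] by (simp add: trunc_eq)
qed

end

lemma end_time_reparam:
  assumes T: "0 \<le> T" and g: "crosses T g" and \<alpha>: "\<alpha> \<in> reparam \<infinity>"
  shows "\<alpha> (end_time T (\<lambda>t. g (\<alpha> t))) = end_time T g"
proof (rule end_time_unique[OF T g, symmetric])
  let ?E = "end_time T (\<lambda>t. g (\<alpha> t))"
  note c = crosses_reparam[OF T g \<alpha>]
  show "0 \<le> \<alpha> ?E" by (rule reparam_nonneg[OF \<alpha> end_time_nonneg[OF T c]])
  show "fst (g (\<alpha> ?E)) = T" by (rule fst_end_time[OF T c])
  fix t assume t: "\<alpha> ?E < t"
  then have "t \<in> half_open \<infinity>" using \<open>0 \<le> \<alpha> ?E\<close> by simp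
  note i = reparam_inv[OF \<alpha> this]
  have "?E < the_inv_into {0..} \<alpha> t"
    using reparam_le_iff[OF \<alpha> i(1) end_time_nonneg[OF T c]] i(2) t by simp
  from fst_gt_after_end_time[OF T c this] show "T < fst (g t)" by (simp add: i(2))
qed

lemma trunc_reparam:
  assumes T: "0 \<le> T" and g: "crosses T g" and \<alpha>: "\<alpha> \<in> reparam \<infinity>" and "0 \<le> t"
  shows "trunc T (\<lambda>t. g (\<alpha> t)) t = trunc T g (\<alpha> t)"
proof -
  let ?E = "end_time T (\<lambda>t. g (\<alpha> t))"
  note c = crosses_reparam[OF T g \<alpha>]
  have "\<alpha> (min t ?E) = min (\<alpha> t) (\<alpha> ?E)"
    using reparam_le_iff[OF \<alpha> \<open>0 \<le> t\<close> end_time_nonneg[OF T c]] by (simp add: min_def)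
  then show ?thesis by (simp add: trunc_eq[OF T c] trunc_eq[OF T g] end_time_reparam[OF T g \<alpha>])
qed

text \<open>Along an order-preserving change of parameter the times of \<open>g\<close> and
  \<open>g'\<close> differ by at most \<open>e\<close>. Initial value and monotonicity follow as
  \<open>e\<close> tends to 0, the crossing with \<open>e\<close> equal to half the excess over
  \<open>T\<close>.\<close>

lemma crosses_equiv:
  assumes g: "crosses T g" and ac: "abs_continuous_on {0..} g'" and eq: "frechet_equiv g g'"
  shows "crosses T g'"
proof -
  have close: "\<exists>\<alpha>\<in>reparam \<infinity>. \<forall>t\<ge>0. \<bar>fst (g t) - fst (g' (\<alpha> t))\<bar> \<le> e" if "0 < e" for e
  proof -
    have "close_up_to e g g'" using eq that frechet_equiv_iff[OF crossesD(1)[OF g] ac] by blast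
    then obtain \<alpha> where \<alpha>: "\<alpha> \<in> reparam \<infinity>" "\<forall>t\<ge>0. norm (g t - g' (\<alpha> t)) \<le> e"
      unfolding close_up_to_def by blast
    have "\<bar>fst (g t) - fst (g' (\<alpha> t))\<bar> \<le> e" if "0 \<le> t" for t
      using norm_fst_diff_le[of "g t" "g' (\<alpha> t)"] \<alpha>(2)[rule_format, OF that] by simp
    then show ?thesis using \<alpha>(1) by blast
  qed
  show ?thesis
    unfolding crosses_def
  proof (intro conjI allI impI ac)
    have "\<bar>fst (g' 0)\<bar> \<le> 0"
    proof (rule field_le_epsilon)
      fix e :: real assume "0 < e"
      from close[OF this] obtain \<alpha> where \<alpha>: "\<alpha> \<in> reparam \<infinity>" "\<forall>t\<ge>0. \<bar>fst (g t) - fst (g' (\<alpha> t))\<bar> \<le> e" by blast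
      then show "\<bar>fst (g' 0)\<bar> \<le> 0 + e" using \<alpha>(2)[rule_format, of 0] reparam_0[OF \<alpha>(1)] crossesD(2)[OF g] by simp
    qed
    then show "fst (g' 0) = 0" by simp
    show "fst (g' s) \<le> fst (g' t)" if "0 \<le> s" "s \<le> t" for s t
    proof (rule field_le_epsilon)
      fix e :: real assume "0 < e"
      then have "0 < e / 2" by simp
      from close[OF this] obtain \<alpha> where \<alpha>: "\<alpha> \<in> reparam \<infinity>" "\<forall>t\<ge>0. \<bar>fst (g t) - fst (g' (\<alpha> t))\<bar> \<le> e / 2" by blast
      let ?i = "the_inv_into {0..} \<alpha>"
      have s: "0 \<le> ?i s" "\<alpha> (?i s) = s" and t: "0 \<le> ?i t" "\<alpha> (?i t) = t"
        using reparam_inv[OF \<alpha>(1), of s] reparam_inv[OF \<alpha>(1), of t] \<open>0 \<le> s\<close> \<open>s \<le> t\<close> by simp_all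
      have "?i s \<le> ?i t" using reparam_le_iff[OF \<alpha>(1) s(1) t(1)] s t \<open>s \<le> t\<close> by simp
      then have "fst (g (?i s)) \<le> fst (g (?i t))" by (rule crossesD(3)[OF g s(1)])
      moreover have "\<bar>fst (g (?i s)) - fst (g' s)\<bar> \<le> e / 2" using \<alpha>(2)[rule_format, OF s(1)] s(2) by simp
      moreover have "\<bar>fst (g (?i t)) - fst (g' t)\<bar> \<le> e / 2" using \<alpha>(2)[rule_format, OF t(1)] t(2) by simp
      ultimately show "fst (g' s) \<le> fst (g' t) + e" by linarith
    qed
    obtain t1 where t1: "0 \<le> t1" "T < fst (g t1)" using g by (auto simp: crosses_def)
    then have "0 < (fst (g t1) - T) / 2" by simp
    from close[OF this] obtain \<alpha> where \<alpha>: "\<alpha> \<in> reparam \<infinity>"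
      "\<forall>t\<ge>0. \<bar>fst (g t) - fst (g' (\<alpha> t))\<bar> \<le> (fst (g t1) - T) / 2" by blast
    have "\<bar>fst (g t1) - fst (g' (\<alpha> t1))\<bar> \<le> (fst (g t1) - T) / 2" using \<alpha>(2) t1(1) by blast
    then have "fst (g t1) - fst (g' (\<alpha> t1)) \<le> (fst (g t1) - T) / 2" using abs_ge_self order_trans by blast
    then have "T < fst (g' (\<alpha> t1))" using t1(2) by (simp add: field_simps)
    then show "\<exists>t\<ge>0. T < fst (g' t)" using reparam_nonneg[OF \<alpha>(1) t1(1)] by blast
  qed
qed

text \<open>Two close parametrizations reach the time level \<open>T\<close> for the last time at close parameters,
  because both curves have passed a level above \<open>T\<close> shortly afterwards.\<close>

lemma trunc_equiv:
  assumes T: "0 \<le> T" and g: "crosses T g" and g': "crosses T g'" and eq: "frechet_equiv g g'"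
  shows "frechet_equiv (trunc T g) (trunc T g')"
  unfolding frechet_equiv_iff[OF trunc_ac[OF T g] trunc_ac[OF T g']]
proof (intro allI impI)
  fix e :: real assume "0 < e"
  let ?E = "end_time T g" and ?E' = "end_time T g'"
  note tr = trunc_eq[OF T g] trunc_eq[OF T g']
  have "0 < e / 2" using \<open>0 < e\<close> by simp
  obtain \<tau> where "0 < \<tau>" and \<tau>: "\<And>s. ?E \<le> s \<Longrightarrow> s \<le> ?E + \<tau> \<Longrightarrow> norm (g s - g ?E) \<le> e / 2"
    by (rule end_time_osc[OF T g \<open>0 < e / 2\<close>]) blast
  obtain \<tau>' where "0 < \<tau>'" and \<tau>': "\<And>s. ?E' \<le> s \<Longrightarrow> s \<le> ?E' + \<tau>' \<Longrightarrow> norm (g' s - g' ?E') \<le> e / 2"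
    by (rule end_time_osc[OF T g' \<open>0 < e / 2\<close>]) blast
  \<comment> \<open>Each curve has risen by at least \<open>m\<close> above \<open>T\<close> when
    its window of small oscillation ends. With a deviation of at most \<open>m / 2\<close> neither
    curve can still be at level \<open>T\<close> while the other is past its window.\<close>
  define m where "m = min (fst (g (?E + \<tau>)) - T) (fst (g' (?E' + \<tau>')) - T)"
  have "0 < m" using fst_gt_after_end_time[OF T g, of "?E + \<tau>"] fst_gt_after_end_time[OF T g', of "?E' + \<tau>'"]
      \<open>0 < \<tau>\<close> \<open>0 < \<tau>'\<close> by (simp add: m_def)
  have "0 < min (e / 2) (m / 2)" using \<open>0 < e\<close> \<open>0 < m\<close> by simp
  then have "close_up_to (min (e / 2) (m / 2)) g g'"
    using eq frechet_equiv_iff[OF crossesD(1)[OF g] crossesD(1)[OF g']] by blast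
  then obtain \<alpha> where \<alpha>: "\<alpha> \<in> reparam \<infinity>" and cl: "\<forall>t\<ge>0. norm (g t - g' (\<alpha> t)) \<le> min (e / 2) (m / 2)"
    unfolding close_up_to_def by blast
  have cl1: "norm (g t - g' (\<alpha> t)) \<le> e / 2" if "0 \<le> t" for t using cl that by simp
  have cl2: "\<bar>fst (g t) - fst (g' (\<alpha> t))\<bar> \<le> m / 2" if "0 \<le> t" for t
    using norm_fst_diff_le[of "g t" "g' (\<alpha> t)"] cl[rule_format, OF that] by simp
  have E0: "0 \<le> ?E" "0 \<le> ?E'" using end_time_nonneg T g g' by blast+
  \<comment> \<open>The parameter at which the reparametrized \<open>g'\<close> is stopped, to be
    compared with \<open>?E\<close>.\<close>
  define c where "c = the_inv_into {0..} \<alpha> ?E'"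
  have c: "0 \<le> c" "\<alpha> c = ?E'" using reparam_inv[OF \<alpha>, of ?E'] E0 by (simp_all add: c_def)
  have aE: "\<alpha> ?E < ?E' + \<tau>'"
  proof (rule ccontr)
    assume "\<not> \<alpha> ?E < ?E' + \<tau>'"
    then have "fst (g' (?E' + \<tau>')) \<le> fst (g' (\<alpha> ?E))"
      using E0 \<open>0 < \<tau>'\<close> by (intro crossesD(3)[OF g']) auto
    moreover have "m \<le> fst (g' (?E' + \<tau>')) - T" by (simp add: m_def)
    ultimately show False using cl2[OF E0(1)] fst_end_time[OF T g] \<open>0 < m\<close> by linarith
  qed
  have cE: "c < ?E + \<tau>"
  proof (rule ccontr)
    assume "\<not> c < ?E + \<tau>"
    then have "fst (g (?E + \<tau>)) \<le> fst (g c)"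
      using E0 \<open>0 < \<tau>\<close> by (intro crossesD(3)[OF g]) auto
    moreover have "m \<le> fst (g (?E + \<tau>)) - T" by (simp add: m_def)
    ultimately show False using cl2[OF c(1)] fst_end_time[OF T g'] \<open>0 < m\<close> unfolding c(2) by linarith
  qed
  have "norm (trunc T g t - trunc T g' (\<alpha> t)) \<le> e" if t: "0 \<le> t" for t
  proof -
    have le_c: "\<alpha> t \<le> ?E' \<longleftrightarrow> t \<le> c" using reparam_le_iff[OF \<alpha> t c(1)] c(2) by simp
    \<comment> \<open>When exactly one curve has been stopped, or both at different parameters, the
      one that runs longer moves only inside its window, at the cost of another
      \<open>e / 2\<close>.\<close>
    consider "t \<le> ?E" "t \<le> c" | "t \<le> ?E" "c < t" | "?E < t" "t \<le> c" | "?E < t" "c < t" "?E \<le> c" | "?E < t" "c < t" "c < ?E"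
      by linarith
    then show ?thesis
    proof cases
      case 1
      then show ?thesis using cl1[OF t] le_c \<open>0 < e\<close> by (simp add: tr min_def)
    next
      case 2
      then have "?E' \<le> \<alpha> t" "\<alpha> t \<le> \<alpha> ?E" using le_c reparam_mono[OF \<alpha> t] by auto
      then have "norm (g' (\<alpha> t) - g' ?E') \<le> e / 2" using aE by (intro \<tau>') auto
      then show ?thesis
        using norm_triangle_ineq[of "g t - g' (\<alpha> t)" "g' (\<alpha> t) - g' ?E'"] cl1[OF t] 2 le_c
        by (simp add: tr min_def)
    next
      case 3
      then have "norm (g t - g ?E) \<le> e / 2" using cE by (intro \<tau>) auto
      then show ?thesis
        using norm_triangle_ineq[of "g ?E - g t" "g t - g' (\<alpha> t)"] cl1[OF t] 3 le_c
        by (simp add: tr min_def norm_minus_commute)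
    next
      case 4
      then have "norm (g c - g ?E) \<le> e / 2" using cE by (intro \<tau>) auto
      then show ?thesis
        using norm_triangle_ineq[of "g ?E - g c" "g c - g' (\<alpha> c)"] cl1[OF c(1)] 4 le_c c(2)
        by (simp add: tr min_def norm_minus_commute)
    next
      case 5
      then have "?E' \<le> \<alpha> ?E" using reparam_mono[OF \<alpha> c(1), of ?E] c(2) by simp
      then have "norm (g' (\<alpha> ?E) - g' ?E') \<le> e / 2" using aE by (intro \<tau>') auto
      then show ?thesis
        using norm_triangle_ineq[of "g ?E - g' (\<alpha> ?E)" "g' (\<alpha> ?E) - g' ?E'"] cl1[OF E0(1)] 5 le_c
        by (simp add: tr min_def)
    qed
  qed
  then show "close_up_to e (trunc T g) (trunc T g')" unfolding close_up_to_def using \<alpha> by blast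
qed

text \<open>Lower semicontinuity of length: an almost optimal polygon in \<open>h1\<close> is
  approximated by one inscribed in \<open>h2\<close>. A change of parameter need not map
  \<open>E1\<close> to \<open>E2\<close>; the constancy of \<open>h2\<close> after \<open>E2\<close>
  absorbs this.\<close>

lemma arc_length_equiv_le:
  fixes h1 h2 :: "real \<Rightarrow> 'a::euclidean_space"
  assumes ac: "abs_continuous_on {0..} h1" "abs_continuous_on {0..} h2"
    and E: "0 \<le> E1" "0 \<le> E2" and const: "\<And>t. E2 \<le> t \<Longrightarrow> h2 t = c"
    and eq: "frechet_equiv h1 h2"
  shows "arc_length h1 E1 \<le> arc_length h2 E2"
proof (rule field_le_epsilon)
  fix e :: real assume "0 < e"
  then have "0 < e / 2" by simp
  obtain n where n: "arc_length h1 E1 - e / 2 < (\<Sum>i<Suc n. norm (h1 (E1 * Suc i / Suc n) - h1 (E1 * i / Suc n)))"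
    using arc_length_uniform_partition[OF abs_continuous_on_restrict[OF ac(1)] E(1) \<open>0 < e / 2\<close>] by blast
  \<comment> \<open>Each of the \<open>Suc n\<close> chords changes by at most \<open>2 * r\<close>,
    all of them together by \<open>e / 2\<close>.\<close>
  define r where "r = e / (4 * Suc n)"
  have "0 < r" using \<open>0 < e\<close> by (simp add: r_def)
  then have "close_up_to r h1 h2" using eq frechet_equiv_iff[OF ac] by blast
  then obtain \<alpha> where \<alpha>: "\<alpha> \<in> reparam \<infinity>" "\<forall>t\<ge>0. norm (h1 t - h2 (\<alpha> t)) \<le> r"
    unfolding close_up_to_def by blast
  define \<sigma> where "\<sigma> = (\<lambda>i. E1 * real i / Suc n)"
  define \<tau> where "\<tau> = (\<lambda>i. \<alpha> (\<sigma> i))"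
  define M where "M = max (\<alpha> E1) E2"
  have \<sigma>0: "0 \<le> \<sigma> i" for i using E(1) by (simp add: \<sigma>_def)
  have \<sigma>n: "\<sigma> (Suc n) = E1" by (simp add: \<sigma>_def)
  have \<sigma>mono: "\<sigma> i \<le> \<sigma> (Suc i)" for i
    unfolding \<sigma>_def using E(1) by (intro divide_right_mono mult_left_mono) auto
  have "(\<Sum>i<Suc n. norm (h1 (\<sigma> (Suc i)) - h1 (\<sigma> i))) \<le> (\<Sum>i<Suc n. norm (h2 (\<tau> (Suc i)) - h2 (\<tau> i)) + 2 * r)"
  proof (rule sum_mono)
    fix i
    have 1: "norm (h1 (\<sigma> i) - h2 (\<tau> i)) \<le> r" "norm (h1 (\<sigma> (Suc i)) - h2 (\<tau> (Suc i))) \<le> r"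
      unfolding \<tau>_def using \<alpha>(2) \<sigma>0 by blast+
    have "h1 (\<sigma> (Suc i)) - h1 (\<sigma> i) = (h2 (\<tau> (Suc i)) - h2 (\<tau> i)) + ((h1 (\<sigma> (Suc i)) - h2 (\<tau> (Suc i))) - (h1 (\<sigma> i) - h2 (\<tau> i)))"
      by simp
    also have "norm \<dots> \<le> norm (h2 (\<tau> (Suc i)) - h2 (\<tau> i)) + norm ((h1 (\<sigma> (Suc i)) - h2 (\<tau> (Suc i))) - (h1 (\<sigma> i) - h2 (\<tau> i)))"
      by (rule norm_triangle_ineq)
    also have "norm ((h1 (\<sigma> (Suc i)) - h2 (\<tau> (Suc i))) - (h1 (\<sigma> i) - h2 (\<tau> i))) \<le> r + r"
      using norm_triangle_ineq4[of "h1 (\<sigma> (Suc i)) - h2 (\<tau> (Suc i))" "h1 (\<sigma> i) - h2 (\<tau> i)"] 1 by linarith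
    finally show "norm (h1 (\<sigma> (Suc i)) - h1 (\<sigma> i)) \<le> norm (h2 (\<tau> (Suc i)) - h2 (\<tau> i)) + 2 * r" by simp
  qed
  also have "\<dots> = (\<Sum>i<Suc n. norm (h2 (\<tau> (Suc i)) - h2 (\<tau> i))) + Suc n * (2 * r)"
    by (simp only: sum.distrib sum_constant card_lessThan)
  also have "Suc n * (2 * r) = e / 2" by (simp add: r_def field_simps)
  also have "(\<Sum>i<Suc n. norm (h2 (\<tau> (Suc i)) - h2 (\<tau> i))) \<le> arc_length h2 (\<tau> (Suc n)) - arc_length h2 (\<tau> 0)"
  proof (rule sum_norm_diff_le_arc_length[OF abs_continuous_on_restrict[OF ac(2), of M]])
    show "\<tau> i \<le> \<tau> (Suc i)" for i unfolding \<tau>_def by (rule reparam_mono[OF \<alpha>(1) \<sigma>0 \<sigma>mono])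
    show "0 \<le> \<tau> 0" unfolding \<tau>_def by (rule reparam_nonneg[OF \<alpha>(1) \<sigma>0])
    show "\<tau> (Suc n) \<le> M" by (simp add: \<tau>_def \<sigma>n M_def)
  qed
  also have "\<tau> 0 = 0" using reparam_0[OF \<alpha>(1)] by (simp add: \<tau>_def \<sigma>_def)
  also have "\<tau> (Suc n) = \<alpha> E1" by (simp add: \<tau>_def \<sigma>n)
  also have "arc_length h2 (\<alpha> E1) \<le> arc_length h2 M"
    by (rule arc_length_mono[OF abs_continuous_on_restrict[OF ac(2), of M]])
      (use reparam_nonneg[OF \<alpha>(1) E(1)] in \<open>auto simp: M_def\<close>)
  also have "arc_length h2 M = arc_length h2 E2"
    by (rule arc_length_const_after[OF ac(2) E(2) _ const]) (simp_all add: M_def)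
  finally show "arc_length h1 E1 \<le> arc_length h2 E2 + e" using n unfolding \<sigma>_def by simp
qed

lemma arc_length_end_time_equiv:
  assumes T: "0 \<le> T" and g: "crosses T g1" "crosses T g2"
    and eq: "frechet_equiv (trunc T g1) (trunc T g2)"
  shows "arc_length g1 (end_time T g1) = arc_length g2 (end_time T g2)"
proof -
  have le: "arc_length g (end_time T g) \<le> arc_length g' (end_time T g')"
    if "crosses T g" "crosses T g'" "frechet_equiv (trunc T g) (trunc T g')" for g g' :: "real \<Rightarrow> real \<times> 'a"
    using arc_length_equiv_le[OF trunc_ac[OF T that(1)] trunc_ac[OF T that(2)] end_time_nonneg[OF T that(1)]
        end_time_nonneg[OF T that(2)] trunc_const[OF T that(2)] that(3)]
    by (simp add: arc_length_trunc[OF T that(1)] arc_length_trunc[OF T that(2)])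
  show ?thesis
    by (rule antisym) (intro le g eq frechet_equiv_sym trunc_ac T)+
qed


section \<open>The metric\<close>

lemma mem_frechet_class: "abs_continuous_on {0..} g \<Longrightarrow> g \<in> frechet_class (g :: real \<Rightarrow> 'a::euclidean_space)"
  by (simp add: frechet_class_def frechet_equiv_refl)

lemma frechet_class_crosses:
  assumes "crosses T g" "h \<in> frechet_class g"
  shows "crosses T h" "frechet_equiv g h"
  using assms crosses_equiv[of T g h] by (auto simp: frechet_class_def)

context
  fixes T :: real
  assumes T: "0 \<le> T"
begin

lemma continuous_trunc_diff:
  assumes "crosses T g1" "crosses T g2"
  shows "continuous_on {0..} (\<lambda>t. trunc T g1 t - trunc T g2 t)"
  by (intro continuous_on_diff abs_continuous_on_continuous_on trunc_ac[OF T] assms)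

lemma d_T_INF_nonneg:
  "0 \<le> (INF h1\<in>c1. INF h2\<in>c2. Linf_norm (\<lambda>t. trunc T h1 t - trunc T h2 t))"
  by (intro INF_greatest Linf_norm_nonneg)

lemma d_T_nonneg: "0 \<le> d_T T c1 c2"
  unfolding d_T_def by (rule real_of_ereal_pos[OF d_T_INF_nonneg])

lemma d_T_sym:
  fixes c1 c2 :: "(real \<Rightarrow> real \<times> 'a::euclidean_space) set"
  shows "d_T T c1 c2 = d_T T c2 c1"
proof -
  have *: "Linf_norm (\<lambda>t. trunc T h1 t - trunc T h2 t) = Linf_norm (\<lambda>t. trunc T h2 t - trunc T h1 t)" for h1 h2 :: "real \<Rightarrow> real \<times> 'a"
    unfolding Linf_norm_def by (simp add: norm_minus_commute)
  show ?thesis unfolding d_T_def by (subst INF_commute) (simp only: *)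
qed

text \<open>Truncation commutes with changes of parameter, so the map that aligns the truncations
  turns \<open>g2\<close> itself into a representative of its class that realizes the bound.\<close>

lemma d_T_le:
  assumes g: "crosses T g1" "crosses T g2" and c: "close_up_to r (trunc T g1) (trunc T g2)"
  shows "d_T T (frechet_class g1) (frechet_class g2) \<le> r"
    and "(INF h1\<in>frechet_class g1. INF h2\<in>frechet_class g2. Linf_norm (\<lambda>t. trunc T h1 t - trunc T h2 t)) \<le> ereal r"
proof -
  let ?I = "INF h1\<in>frechet_class g1. INF h2\<in>frechet_class g2. Linf_norm (\<lambda>t. trunc T h1 t - trunc T h2 t)"
  obtain \<alpha> where \<alpha>: "\<alpha> \<in> reparam \<infinity>" "\<forall>t\<ge>0. norm (trunc T g1 t - trunc T g2 (\<alpha> t)) \<le> r"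
    using c unfolding close_up_to_def by blast
  define h where "h = (\<lambda>t. g2 (\<alpha> t))"
  have h: "crosses T h" unfolding h_def by (rule crosses_reparam[OF T g(2) \<alpha>(1)])
  have "frechet_equiv h g2"
    by (rule frechet_equiv_reparam[OF crossesD(1)[OF h] crossesD(1)[OF g(2)] \<alpha>(1)]) (simp add: h_def)
  then have "frechet_equiv g2 h" by (rule frechet_equiv_sym[OF crossesD(1)[OF h] crossesD(1)[OF g(2)]])
  then have hc: "h \<in> frechet_class g2" using crossesD(1)[OF h] by (simp add: frechet_class_def)
  have "\<forall>t\<ge>0. norm (trunc T g1 t - trunc T h t) \<le> r"
    using \<alpha>(2) by (simp add: h_def trunc_reparam[OF T g(2) \<alpha>(1)])
  then have "Linf_norm (\<lambda>t. trunc T g1 t - trunc T h t) \<le> ereal r"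
    by (subst Linf_norm_le_iff[OF continuous_trunc_diff[OF g(1) h]])
  then show le: "?I \<le> ereal r"
    by (intro INF_lower2[OF mem_frechet_class[OF crossesD(1)[OF g(1)]]] INF_lower2[OF hc])
  show "d_T T (frechet_class g1) (frechet_class g2) \<le> r"
    unfolding d_T_def using le d_T_INF_nonneg[where ?c1.0 = "frechet_class g1" and ?c2.0 = "frechet_class g2"] by (cases ?I) auto
qed

text \<open>The infimum may be approached along other representatives; \<open>trunc_equiv\<close>
  carries the estimate back to the given ones at an arbitrarily small cost, paid for by the strict
  inequality.\<close>

lemma close_up_to_d_T:
  assumes g: "crosses T g1" "crosses T g2" and less: "d_T T (frechet_class g1) (frechet_class g2) < r"
  shows "close_up_to r (trunc T g1) (trunc T g2)"
proof -
  let ?I = "INF h1\<in>frechet_class g1. INF h2\<in>frechet_class g2. Linf_norm (\<lambda>t. trunc T h1 t - trunc T h2 t)"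
  let ?d = "d_T T (frechet_class g1) (frechet_class g2)"
  \<comment> \<open>Any finite bound serves: it shows that the infimum is a real number, hence equal
    to \<open>ereal ?d\<close>.\<close>
  define B where "B = (norm (g1 0) + arc_length g1 (end_time T g1)) + (norm (g2 0) + arc_length g2 (end_time T g2))"
  have "close_up_to B (trunc T g1) (trunc T g2)"
  proof (rule close_up_toI_id)
    fix t :: real assume "0 \<le> t"
    from norm_trunc_le[OF T g(1) this] norm_trunc_le[OF T g(2) this]
    show "norm (trunc T g1 t - trunc T g2 t) \<le> B"
      using norm_triangle_ineq4[of "trunc T g1 t" "trunc T g2 t"] by (simp add: B_def)
  qed
  from d_T_le(2)[OF g this] d_T_INF_nonneg[where ?c1.0 = "frechet_class g1" and ?c2.0 = "frechet_class g2"] have I: "?I = ereal ?d"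
    unfolding d_T_def by (cases ?I) auto
  define r' where "r' = (?d + r) / 2"
  have r': "?d < r'" "r' < r" using less by (auto simp: r'_def)
  then have "?I < ereal r'" unfolding I by simp
  then obtain h1 where h1: "h1 \<in> frechet_class g1"
    "(INF h2\<in>frechet_class g2. Linf_norm (\<lambda>t. trunc T h1 t - trunc T h2 t)) < ereal r'"
    unfolding INF_less_iff by blast
  then obtain h2 where h2: "h2 \<in> frechet_class g2" "Linf_norm (\<lambda>t. trunc T h1 t - trunc T h2 t) < ereal r'"
    unfolding INF_less_iff by blast
  note c1 = frechet_class_crosses[OF g(1) h1(1)] and c2 = frechet_class_crosses[OF g(2) h2(1)]
  have "\<forall>t\<ge>0. norm (trunc T h1 t - trunc T h2 t) \<le> r'"
    using Linf_norm_le_iff[OF continuous_trunc_diff[OF c1(1) c2(1)], of r'] less_imp_le[OF h2(2)] by blast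
  then have m: "close_up_to r' (trunc T h1) (trunc T h2)" by (intro close_up_toI_id) blast
  define e where "e = (r - r') / 2"
  have "0 < e" using r' by (simp add: e_def)
  have a: "close_up_to e (trunc T g1) (trunc T h1)" "close_up_to e (trunc T g2) (trunc T h2)"
    using trunc_equiv[OF T g(1) c1] trunc_equiv[OF T g(2) c2] \<open>0 < e\<close>
      frechet_equiv_iff[OF trunc_ac[OF T g(1)] trunc_ac[OF T c1(1)]]
      frechet_equiv_iff[OF trunc_ac[OF T g(2)] trunc_ac[OF T c2(1)]] by blast+
  have "close_up_to (e + r' + e) (trunc T g1) (trunc T g2)"
    by (rule close_up_to_trans[OF close_up_to_trans[OF a(1) m] close_up_to_sym[OF a(2)]])
  then show ?thesis by (simp add: e_def field_simps)
qed

lemma d_T_triangle: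
  assumes g: "crosses T g1" "crosses T g2" "crosses T g3"
  shows "d_T T (frechet_class g1) (frechet_class g3) \<le>
    d_T T (frechet_class g1) (frechet_class g2) + d_T T (frechet_class g2) (frechet_class g3)"
    (is "?d13 \<le> ?d12 + ?d23")
proof (rule field_le_epsilon)
  fix e :: real assume "0 < e"
  have "close_up_to (?d12 + e / 2) (trunc T g1) (trunc T g2)" "close_up_to (?d23 + e / 2) (trunc T g2) (trunc T g3)"
    using \<open>0 < e\<close> by (intro close_up_to_d_T g; simp)+
  from close_up_to_trans[OF this] have "close_up_to ((?d12 + ?d23) + e) (trunc T g1) (trunc T g3)"
    by (simp add: algebra_simps)
  then show "?d13 \<le> (?d12 + ?d23) + e" by (rule d_T_le(1)[OF g(1,3)])
qed

lemma d_T_zero_iff: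
  assumes g: "crosses T g1" "crosses T g2"
  shows "d_T T (frechet_class g1) (frechet_class g2) = 0 \<longleftrightarrow> frechet_equiv (trunc T g1) (trunc T g2)"
  unfolding frechet_equiv_iff[OF trunc_ac[OF T g(1)] trunc_ac[OF T g(2)]]
proof
  assume "d_T T (frechet_class g1) (frechet_class g2) = 0"
  then show "\<forall>e>0. close_up_to e (trunc T g1) (trunc T g2)" by (intro allI impI close_up_to_d_T g) simp
next
  assume "\<forall>e>0. close_up_to e (trunc T g1) (trunc T g2)"
  then have "d_T T (frechet_class g1) (frechet_class g2) \<le> e" if "0 < e" for e
    using d_T_le(1)[OF g] that by blast
  then have "d_T T (frechet_class g1) (frechet_class g2) \<le> 0 + e" if "0 < e" for e
    using that by simp
  then have "d_T T (frechet_class g1) (frechet_class g2) \<le> 0" by (rule field_le_epsilon)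
  then show "d_T T (frechet_class g1) (frechet_class g2) = 0" using d_T_nonneg[of "frechet_class g1" "frechet_class g2"] by simp
qed

text \<open>The curve picked by \<open>SOME\<close> has an equivalent truncation, and length is an
  invariant of equivalence.\<close>

lemma trunc_length_eq:
  assumes g: "crosses T g"
  shows "trunc_length T (frechet_class g) = arc_length g (end_time T g)"
proof -
  define h where "h = (SOME h. h \<in> frechet_class g)"
  have "h \<in> frechet_class g"
    unfolding h_def by (rule someI[where P = "\<lambda>h. h \<in> frechet_class g"]) (rule mem_frechet_class[OF crossesD(1)[OF g]])
  note h = frechet_class_crosses[OF g this]
  have "arc_length g (end_time T g) = arc_length h (end_time T h)"
    by (rule arc_length_end_time_equiv[OF T g h(1) trunc_equiv[OF T g h]])
  then show ?thesis by (simp add: trunc_length_def h_def Let_def)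
qed

lemma d_plus_zero_iff:
  assumes g: "crosses T g1" "crosses T g2"
  shows "d_plus T (frechet_class g1) (frechet_class g2) = 0 \<longleftrightarrow> frechet_equiv (trunc T g1) (trunc T g2)"
proof
  assume "d_plus T (frechet_class g1) (frechet_class g2) = 0"
  then have "d_T T (frechet_class g1) (frechet_class g2) = 0"
    using d_T_nonneg[of "frechet_class g1" "frechet_class g2"] by (simp add: d_plus_def)
  then show "frechet_equiv (trunc T g1) (trunc T g2)" using d_T_zero_iff[OF g] by simp
next
  assume eq: "frechet_equiv (trunc T g1) (trunc T g2)"
  then show "d_plus T (frechet_class g1) (frechet_class g2) = 0"
    using d_T_zero_iff[OF g] arc_length_end_time_equiv[OF T g eq] by (simp add: d_plus_def trunc_length_eq g)
qed

text \<open>By monotonicity the limit exists in the extended reals as a supremum, so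
  \<open>Lim\<close> has its intended meaning.\<close>

lemma Lim_fst:
  fixes g :: "real \<Rightarrow> real \<times> 'a::euclidean_space"
  assumes mono: "\<And>s t. 0 \<le> s \<Longrightarrow> s \<le> t \<Longrightarrow> fst (g s) \<le> fst (g t)"
  shows "Lim at_top (\<lambda>t. ereal (fst (g t))) > ereal T \<longleftrightarrow> (\<exists>t\<ge>0. T < fst (g t))"
proof -
  let ?l = "SUP t\<in>{0..}. ereal (fst (g t))"
  have "((\<lambda>t. ereal (fst (g t))) \<longlongrightarrow> ?l) at_top"
  proof (rule order_tendstoI)
    fix a assume "a < ?l"
    then obtain t0 where t0: "t0 \<in> {0..}" "a < ereal (fst (g t0))" unfolding less_SUP_iff by blast
    show "eventually (\<lambda>t. a < ereal (fst (g t))) at_top"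
      using eventually_ge_at_top[of t0]
    proof eventually_elim
      case (elim t)
      then have "ereal (fst (g t0)) \<le> ereal (fst (g t))" using mono[of t0 t] t0(1) by simp
      with t0(2) show ?case by (rule less_le_trans)
    qed
  next
    fix a assume a: "?l < a"
    show "eventually (\<lambda>t. ereal (fst (g t)) < a) at_top"
      using eventually_ge_at_top[of 0]
    proof eventually_elim
      case (elim t)
      then have "ereal (fst (g t)) \<le> ?l" by (intro SUP_upper) simp
      then show ?case using a by (rule le_less_trans)
    qed
  qed
  then have "Lim at_top (\<lambda>t. ereal (fst (g t))) = ?l" by (rule tendsto_Lim[rotated]) simp
  then show ?thesis by (auto simp: less_SUP_iff)
qed

lemma YYT_crosses:
  fixes g :: "real \<Rightarrow> real \<times> 'a::euclidean_space"
  assumes "g \<in> YYT T"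
  shows "crosses T g"
proof -
  have ac: "abs_continuous_on {0..} g" and g0: "fst (g 0) = 0"
    and nn: "AE t in lebesgue. 0 \<le> t \<longrightarrow> 0 \<le> vector_derivative (\<lambda>s. fst (g s)) (at t)"
    and L: "Lim at_top (\<lambda>t. ereal (fst (g t))) > ereal T"
    using assms unfolding YYT_def YY_def by blast+
  have mono: "fst (g s) \<le> fst (g t)" if st: "0 \<le> s" "s \<le> t" for s t
  proof -
    let ?v = "\<lambda>x. vector_derivative (\<lambda>s. fst (g s)) (at x)"
    have "abs_continuous_on {s..t} (\<lambda>s. fst (g s))"
      by (rule abs_continuous_on_subset[OF crosses_ac_fst[OF ac]]) (use st in auto)
    from abs_continuous_on_has_integral_derivative[OF st(2) this]
    have hi: "(?v has_integral (fst (g t) - fst (g s))) {s..t}" .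
    have "negligible {x. \<not> (0 \<le> x \<longrightarrow> 0 \<le> ?v x)}" using nn by (simp only: AE_lebesgue_iff_negligible)
    then have "((\<lambda>x. \<bar>?v x\<bar>) has_integral (fst (g t) - fst (g s))) {s..t}"
    proof (rule has_integral_spike[OF _ _ hi])
      fix x assume "x \<in> {s..t} - {x. \<not> (0 \<le> x \<longrightarrow> 0 \<le> ?v x)}"
      then have "s \<le> x" "0 \<le> x \<longrightarrow> 0 \<le> ?v x" by simp_all
      then show "\<bar>?v x\<bar> = ?v x" using st(1) by simp
    qed
    then have "0 \<le> fst (g t) - fst (g s)" by (rule has_integral_nonneg) simp
    then show ?thesis by simp
  qed
  from L have "\<exists>t\<ge>0. T < fst (g t)" by (subst (asm) Lim_fst[OF mono])
  with ac g0 mono show ?thesis unfolding crosses_def by simp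
qed

lemma YYT_I:
  fixes g :: "real \<Rightarrow> real \<times> 'a::euclidean_space"
  assumes g: "crosses T g" and len: "filterlim (arc_length g) at_top at_top"
  shows "g \<in> YYT T"
proof -
  note ac = crosses_ac_fst[OF crossesD(1)[OF g]]
  let ?f = "\<lambda>s. fst (g s)"
  have "AE t in lebesgue. t \<in> half_open \<infinity> \<longrightarrow> 0 \<le> vector_derivative ?f (at t)"
  proof (rule AE_half_open)
    fix b :: real
    have neg: "negligible ({x \<in> {0..b}. \<not> (?f has_vector_derivative vector_derivative ?f (at x)) (at x)} \<union> {0})"
      using abs_continuous_on_negligible_derivative[OF abs_continuous_on_restrict[OF ac]] by simp
    show "negligible {x \<in> {0..b}. \<not> 0 \<le> vector_derivative ?f (at x)}"
    proof (rule negligible_subset[OF neg], rule subsetI, rule ccontr)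
      fix x assume x: "x \<in> {x \<in> {0..b}. \<not> 0 \<le> vector_derivative ?f (at x)}"
        and nx: "x \<notin> {x \<in> {0..b}. \<not> (?f has_vector_derivative vector_derivative ?f (at x)) (at x)} \<union> {0}"
      then have "0 < x" and neg: "vector_derivative ?f (at x) < 0"
        and "(?f has_vector_derivative vector_derivative ?f (at x)) (at x)"
        by (simp_all add: less_le not_le)
      then have "(?f has_real_derivative vector_derivative ?f (at x)) (at x)"
        by (simp add: has_real_derivative_iff_has_vector_derivative)
      from DERIV_neg_dec_right[OF this neg] obtain d where "0 < d" "\<forall>h>0. h < d \<longrightarrow> fst (g (x + h)) < fst (g x)"
        by blast
      then have "fst (g (x + d / 2)) < fst (g x)" by simp
      moreover have "fst (g x) \<le> fst (g (x + d / 2))" using \<open>0 < x\<close> \<open>0 < d\<close> by (intro crossesD(3)[OF g]) auto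
      ultimately show False by simp
    qed
  qed
  then have "AE t in lebesgue. 0 \<le> t \<longrightarrow> 0 \<le> vector_derivative ?f (at t)" by simp
  moreover have "Lim at_top (\<lambda>t. ereal (fst (g t))) > ereal T"
    using Lim_fst[OF crossesD(3)[OF g]] g by (auto simp: crosses_def)
  ultimately show ?thesis using crossesD(1,2)[OF g] len unfolding YYT_def YY_def by blast
qed

lemma FF_E:
  assumes "c \<in> FF T"
  obtains g where "g \<in> YYT T" "crosses T g" "c = frechet_class g"
  using assms YYT_crosses by (auto simp: FF_def)

text \<open>Truncations of equivalent curves are equivalent, so the representatives in
  \<open>same_trunc\<close> can be exchanged for the given ones.\<close>

lemma same_trunc_iff:
  fixes g1 g2 :: "real \<Rightarrow> real \<times> 'a::euclidean_space"
  assumes g: "crosses T g1" "crosses T g2" and FF: "frechet_class g1 \<in> FF T" "frechet_class g2 \<in> FF T"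
  shows "(frechet_class g1, frechet_class g2) \<in> same_trunc T \<longleftrightarrow> frechet_equiv (trunc T g1) (trunc T g2)"
proof
  assume "(frechet_class g1, frechet_class g2) \<in> same_trunc T"
  then obtain h1 h2 where h: "h1 \<in> frechet_class g1" "h2 \<in> frechet_class g2"
    "frechet_class (trunc T h1) = frechet_class (trunc T h2)"
    by (auto simp: same_trunc_def)
  note c1 = frechet_class_crosses[OF g(1) h(1)] and c2 = frechet_class_crosses[OF g(2) h(2)]
  note ac = trunc_ac[OF T g(1)] trunc_ac[OF T g(2)] trunc_ac[OF T c1(1)] trunc_ac[OF T c2(1)]
  have "frechet_equiv (trunc T h1) (trunc T h2)" using h(3) frechet_class_eq_iff[OF ac(3,4)] by simp
  from frechet_equiv_trans[OF ac(1,3,4) trunc_equiv[OF T g(1) c1] this]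
  have "frechet_equiv (trunc T g1) (trunc T h2)" .
  from frechet_equiv_trans[OF ac(1,4,2) this frechet_equiv_sym[OF ac(2,4) trunc_equiv[OF T g(2) c2]]]
  show "frechet_equiv (trunc T g1) (trunc T g2)" .
next
  assume "frechet_equiv (trunc T g1) (trunc T g2)"
  then have "frechet_class (trunc T g1) = frechet_class (trunc T g2)"
    using frechet_class_eq_iff[OF trunc_ac[OF T g(1)] trunc_ac[OF T g(2)]] by simp
  then show "(frechet_class g1, frechet_class g2) \<in> same_trunc T"
    unfolding same_trunc_def using FF mem_frechet_class[OF crossesD(1)[OF g(1)]] mem_frechet_class[OF crossesD(1)[OF g(2)]]
    by blast
qed

text \<open>The identification is exactly vanishing distance; equivalence axioms and the quotient
  metric thus come from the pseudometric \<open>d_plus\<close>.\<close>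

lemma same_trunc_iff_d_plus:
  assumes "c1 \<in> FF T" "c2 \<in> FF T"
  shows "(c1, c2) \<in> same_trunc T \<longleftrightarrow> d_plus T c1 c2 = 0"
proof -
  obtain g1 where g1: "g1 \<in> YYT T" "crosses T g1" "c1 = frechet_class g1" by (rule FF_E[OF assms(1)])
  obtain g2 where g2: "g2 \<in> YYT T" "crosses T g2" "c2 = frechet_class g2" by (rule FF_E[OF assms(2)])
  show ?thesis using same_trunc_iff[OF g1(2) g2(2)] d_plus_zero_iff[OF g1(2) g2(2)] assms
    unfolding g1(3) g2(3) by blast
qed

lemma d_plus_nonneg: "0 \<le> d_plus T c1 c2"
  by (simp add: d_plus_def d_T_nonneg)

lemma d_plus_sym: "d_plus T c1 c2 = d_plus T c2 c1"
  by (simp add: d_plus_def d_T_sym abs_minus_commute)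

lemma d_plus_triangle:
  assumes "c1 \<in> FF T" "c2 \<in> FF T" "c3 \<in> FF T"
  shows "d_plus T c1 c3 \<le> d_plus T c1 c2 + d_plus T c2 c3"
proof -
  obtain g1 where g1: "g1 \<in> YYT T" "crosses T g1" "c1 = frechet_class g1" by (rule FF_E[OF assms(1)])
  obtain g2 where g2: "g2 \<in> YYT T" "crosses T g2" "c2 = frechet_class g2" by (rule FF_E[OF assms(2)])
  obtain g3 where g3: "g3 \<in> YYT T" "crosses T g3" "c3 = frechet_class g3" by (rule FF_E[OF assms(3)])
  show ?thesis
    using d_T_triangle[OF g1(2) g2(2) g3(2)] by (simp add: d_plus_def g1(3) g2(3) g3(3))
qed

lemma same_trunc_FF: "(c1, c2) \<in> same_trunc T \<Longrightarrow> c1 \<in> FF T \<and> c2 \<in> FF T"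
  by (simp add: same_trunc_def)

lemma d_plus_refl:
  assumes "c \<in> FF T"
  shows "d_plus T c c = 0"
proof -
  obtain g where g: "g \<in> YYT T" "crosses T g" "c = frechet_class g" by (rule FF_E[OF assms])
  show ?thesis unfolding g(3) d_plus_zero_iff[OF g(2,2)] by (rule frechet_equiv_refl[OF trunc_ac[OF T g(2)]])
qed

lemma equiv_same_trunc: "equiv (FF T) (same_trunc T)"
proof (rule equivI)
  show "same_trunc T \<subseteq> FF T \<times> FF T" by (auto simp: same_trunc_def)
  show "refl_on (FF T) (same_trunc T)"
    by (rule refl_onI) (simp add: same_trunc_iff_d_plus d_plus_refl)
  show "sym (same_trunc T)"
  proof (rule symI)
    fix c1 c2 assume c: "(c1, c2) \<in> same_trunc T"
    then have F: "c1 \<in> FF T" "c2 \<in> FF T" using same_trunc_FF by blast+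
    then show "(c2, c1) \<in> same_trunc T" using c d_plus_sym[of c1 c2] by (simp add: same_trunc_iff_d_plus)
  qed
  show "trans (same_trunc T)"
  proof (rule transI)
    fix c1 c2 c3 assume c: "(c1, c2) \<in> same_trunc T" "(c2, c3) \<in> same_trunc T"
    then have F: "c1 \<in> FF T" "c2 \<in> FF T" "c3 \<in> FF T" using same_trunc_FF by blast+
    have "d_plus T c1 c3 \<le> 0" using d_plus_triangle[OF F] c F by (simp add: same_trunc_iff_d_plus)
    then show "(c1, c3) \<in> same_trunc T"
      using d_plus_nonneg[of c1 c3] F by (simp add: same_trunc_iff_d_plus)
  qed
qed

lemma ident_mem: "c \<in> FF T \<Longrightarrow> ident T c \<in> FFQ T"
  unfolding ident_def FFQ_def by (rule quotientI)

lemma FFQ_E: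
  assumes "C \<in> FFQ T"
  obtains c where "c \<in> FF T" "C = ident T c"
  using assms unfolding FFQ_def ident_def by (rule quotientE)

lemma ident_eq_iff:
  assumes "c1 \<in> FF T" "c2 \<in> FF T"
  shows "ident T c1 = ident T c2 \<longleftrightarrow> d_plus T c1 c2 = 0"
  unfolding ident_def using eq_equiv_class_iff[OF equiv_same_trunc assms] same_trunc_iff_d_plus[OF assms] by simp

lemma d_plusQ_ident:
  fixes c1 c2 :: "(real \<Rightarrow> real \<times> 'a::euclidean_space) set"
  assumes "c1 \<in> FF T" "c2 \<in> FF T"
  shows "d_plusQ T (ident T c1) (ident T c2) = d_plus T c1 c2"
proof -
  define s where "s = (\<lambda>C :: (real \<Rightarrow> real \<times> 'a) set set. SOME c. c \<in> C)"
  have s: "s (ident T c) \<in> FF T" "d_plus T c (s (ident T c)) = 0" if "c \<in> FF T" for c :: "(real \<Rightarrow> real \<times> 'a) set"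
  proof -
    have "c \<in> ident T c" unfolding ident_def by (rule equiv_class_self[OF equiv_same_trunc that])
    then have "s (ident T c) \<in> ident T c" unfolding s_def by (rule someI[where P = "\<lambda>x. x \<in> ident T c"])
    then have "(c, s (ident T c)) \<in> same_trunc T" by (simp add: ident_def)
    then show "s (ident T c) \<in> FF T" "d_plus T c (s (ident T c)) = 0"
      using same_trunc_FF same_trunc_iff_d_plus[OF that] by blast+
  qed
  note s1 = s[OF assms(1)] and s2 = s[OF assms(2)]
  have "d_plus T (s (ident T c1)) (s (ident T c2)) = d_plus T c1 c2"
    using d_plus_triangle[OF s1(1) assms(1) s2(1)] d_plus_triangle[OF assms(1) assms(2) s2(1)]
      d_plus_triangle[OF assms(1) s1(1) assms(2)] d_plus_triangle[OF s1(1) s2(1) assms(2)]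
      d_plus_sym[of c1 "s (ident T c1)"] d_plus_sym[of c2 "s (ident T c2)"] s1(2) s2(2)
    by linarith
  then show ?thesis by (simp add: d_plusQ_def s_def)
qed

lemma Metric_space_FFQ: "Metric_space (FFQ T :: (real \<Rightarrow> real \<times> 'a::euclidean_space) set set set) (d_plusQ T)"
proof
  fix C1 C2 C3 :: "(real \<Rightarrow> real \<times> 'a) set set"
  show "0 \<le> d_plusQ T C1 C2" by (simp add: d_plusQ_def d_plus_nonneg)
  show "d_plusQ T C1 C2 = d_plusQ T C2 C1" by (simp add: d_plusQ_def d_plus_sym)
  assume "C1 \<in> FFQ T" "C2 \<in> FFQ T"
  then obtain c1 c2 where c: "c1 \<in> FF T" "C1 = ident T c1" "c2 \<in> FF T" "C2 = ident T c2"
    by (metis FFQ_E)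
  then show "d_plusQ T C1 C2 = 0 \<longleftrightarrow> C1 = C2" by (simp add: d_plusQ_ident ident_eq_iff)
  assume "C3 \<in> FFQ T"
  then obtain c3 where "c3 \<in> FF T" "C3 = ident T c3" by (metis FFQ_E)
  then show "d_plusQ T C1 C3 \<le> d_plusQ T C1 C2 + d_plusQ T C2 C3"
    using c by (simp add: d_plusQ_ident d_plus_triangle)
qed

end

section \<open>Equations driven by absolutely continuous functions\<close>

text \<open>\<open>F y\<close> is the linear map applied to the velocity of the driver; one constant
  \<open>M\<close> bounds its operator norm and serves as Lipschitz constant in the state.\<close>

definition glip :: "real \<Rightarrow> ('a::euclidean_space \<Rightarrow> 'b::euclidean_space \<Rightarrow> 'a) \<Rightarrow> bool" where
  "glip M F \<longleftrightarrow> 0 \<le> M \<and> (\<forall>y. linear (F y)) \<and> (\<forall>y p. norm (F y p) \<le> M * norm p) \<and>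
     (\<forall>y z p. norm (F y p - F z p) \<le> M * norm (y - z) * norm p)"

text \<open>Composition with the nearest-point projection onto a ball, which is 1-Lipschitz: the
  field is unchanged on the ball and Lipschitz bounds are kept.\<close>

definition cutoff :: "real \<Rightarrow> ('a::euclidean_space \<Rightarrow> 'c) \<Rightarrow> 'a \<Rightarrow> 'c" where
  "cutoff R F = (\<lambda>y. F (closest_point (cball 0 R) y))"

definition loc_lip :: "('a::euclidean_space \<Rightarrow> 'b::euclidean_space \<Rightarrow> 'a) \<Rightarrow> bool" where
  "loc_lip F \<longleftrightarrow> (\<forall>R>0. \<exists>M. glip M (cutoff R F))"

text \<open>The equation is \<open>dy = F y dh\<close>, in integrated form.\<close>

definition solves_on :: "('a::euclidean_space \<Rightarrow> 'b::euclidean_space \<Rightarrow> 'a) \<Rightarrow> (real \<Rightarrow> 'b) \<Rightarrow> 'a \<Rightarrow> real set \<Rightarrow> (real \<Rightarrow> 'a) \<Rightarrow> bool" where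
  "solves_on F h x0 I y \<longleftrightarrow> (\<forall>b\<in>I. continuous_on {0..b} y \<and>
     ((\<lambda>s. F (y s) (vector_derivative h (at s))) has_integral (y b - x0)) {0..b})"

lemma glipD:
  assumes "glip M F"
  shows "0 \<le> M" "linear (F y)" "norm (F y p) \<le> M * norm p"
    "norm (F y p - F z p) \<le> M * norm (y - z) * norm p"
  using assms by (auto simp: glip_def)

lemma cutoff_eq: "norm y \<le> R \<Longrightarrow> cutoff R F y = F y"
  unfolding cutoff_def by (subst closest_point_self) auto

lemma loc_lip_linear:
  assumes "loc_lip F"
  shows "linear (F y)"
proof -
  have "0 < norm y + 1" by (rule add_nonneg_pos) auto
  then obtain M where "glip M (cutoff (norm y + 1) F)" using assms unfolding loc_lip_def by blast
  from glipD(2)[OF this, of y] show ?thesis by (simp add: cutoff_eq)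
qed

lemma solves_on_subset: "solves_on F h x0 I y \<Longrightarrow> J \<subseteq> I \<Longrightarrow> solves_on F h x0 J y"
  by (auto simp: solves_on_def)

lemma solves_on_cong:
  assumes "\<And>b s. b \<in> I \<Longrightarrow> 0 \<le> s \<Longrightarrow> s \<le> b \<Longrightarrow> y s = z s \<and> F (y s) = G (y s)"
    and "\<And>b. b \<in> I \<Longrightarrow> 0 \<le> b"
  shows "solves_on F h x0 I y \<longleftrightarrow> solves_on G h x0 I z"
  unfolding solves_on_def
proof (rule ball_cong[OF refl])
  fix b assume b: "b \<in> I"
  have eq: "y s = z s" "F (y s) = G (z s)" if "s \<in> {0..b}" for s
    using assms(1)[OF b, of s] that by auto
  have "continuous_on {0..b} y \<longleftrightarrow> continuous_on {0..b} z"
    by (rule continuous_on_cong[OF refl]) (rule eq(1))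
  moreover have "((\<lambda>s. F (y s) (vector_derivative h (at s))) has_integral (y b - x0)) {0..b} \<longleftrightarrow>
      ((\<lambda>s. G (z s) (vector_derivative h (at s))) has_integral (z b - x0)) {0..b}"
  proof -
    have "y b = z b" using eq(1)[of b] assms(2)[OF b] by simp
    moreover have "((\<lambda>s. F (y s) (vector_derivative h (at s))) has_integral (y b - x0)) {0..b} \<longleftrightarrow>
      ((\<lambda>s. G (z s) (vector_derivative h (at s))) has_integral (y b - x0)) {0..b}"
      by (rule has_integral_cong) (simp add: eq(2))
    ultimately show ?thesis by simp
  qed
  ultimately show "(continuous_on {0..b} y \<and> ((\<lambda>s. F (y s) (vector_derivative h (at s))) has_integral (y b - x0)) {0..b}) \<longleftrightarrow>
    (continuous_on {0..b} z \<and> ((\<lambda>s. G (z s) (vector_derivative h (at s))) has_integral (z b - x0)) {0..b})" by blast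
qed

lemma glip_continuous:
  assumes F: "glip M F" and y: "continuous_on S y"
  shows "continuous_on S (\<lambda>s. F (y s) p)"
proof -
  have "(M * norm p)-lipschitz_on UNIV (\<lambda>y. F y p)"
  proof (rule lipschitz_onI)
    show "dist (F y p) (F z p) \<le> M * norm p * dist y z" for y z
      using glipD(4)[OF F, of y p z] by (simp add: dist_norm algebra_simps)
    show "0 \<le> M * norm p" using glipD(1)[OF F] by simp
  qed
  then have "continuous_on UNIV (\<lambda>y. F y p)" by (rule lipschitz_on_continuous_on)
  from continuous_on_compose2[OF this y] show ?thesis by simp
qed

text \<open>Expanding the velocity in a basis leaves products of a bounded continuous coefficient
  with an integrable component.\<close>

lemma absolutely_integrable_drive:
  fixes F :: "'a::euclidean_space \<Rightarrow> 'b::euclidean_space \<Rightarrow> 'a"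
  assumes F: "glip M F" and y: "continuous_on {a..b} y" and u: "u absolutely_integrable_on {a..b::real}"
  shows "(\<lambda>s. F (y s) (u s)) absolutely_integrable_on {a..b}"
proof -
  have eq: "F (y s) (u s) = (\<Sum>i\<in>Basis. (u s \<bullet> i) *\<^sub>R F (y s) i)" for s
  proof -
    have "F (y s) (u s) = F (y s) (\<Sum>i\<in>Basis. (u s \<bullet> i) *\<^sub>R i)" by (simp add: euclidean_representation)
    also have "\<dots> = (\<Sum>i\<in>Basis. (u s \<bullet> i) *\<^sub>R F (y s) i)"
      using glipD(2)[OF F, of "y s"] by (simp add: linear_sum linear_cmul)
    finally show ?thesis .
  qed
  have "(\<lambda>s. (u s \<bullet> i) *\<^sub>R F (y s) i) absolutely_integrable_on {a..b}" if i: "i \<in> Basis" for i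
  proof (rule absolutely_integrable_bounded_measurable_product[of "\<lambda>x r. r *\<^sub>R x"])
    show "bilinear (\<lambda>x r. r *\<^sub>R (x :: 'a))"
      by (auto simp: bilinear_def algebra_simps intro!: linearI)
    have c: "continuous_on {a..b} (\<lambda>s. F (y s) i)" by (rule glip_continuous[OF F y])
    then show "(\<lambda>s. F (y s) i) \<in> borel_measurable (lebesgue_on {a..b})"
      by (rule continuous_imp_measurable_on_sets_lebesgue) simp
    show "bounded ((\<lambda>s. F (y s) i) ` {a..b})"
      by (rule compact_imp_bounded[OF compact_continuous_image[OF c]]) simp
    show "(\<lambda>s. u s \<bullet> i) absolutely_integrable_on {a..b}" by (rule absolutely_integrable_component[OF u])
  qed auto
  then show ?thesis unfolding eq by (intro absolutely_integrable_sum) auto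
qed

lemma AC_drive:
  assumes "glip M F" "abs_continuous_on {0..b} h" "continuous_on {0..b} y"
  shows "(\<lambda>s. F (y s) (vector_derivative h (at s))) absolutely_integrable_on {0..b}"
  by (rule absolutely_integrable_drive[OF assms(1,3) abs_continuous_on_absolutely_integrable_derivative[OF assms(2)]])

lemma integrable_times_norm_derivative:
  fixes h :: "real \<Rightarrow> 'b::euclidean_space" and u :: "real \<Rightarrow> real"
  assumes h: "abs_continuous_on {0..b} h" and u: "continuous_on {0..b} u"
  shows "(\<lambda>s. u s * norm (vector_derivative h (at s))) integrable_on {0..b}"
proof -
  have "(\<lambda>s. u s * norm (vector_derivative h (at s))) absolutely_integrable_on {0..b}"
  proof (rule absolutely_integrable_bounded_measurable_product_real)
    show "u \<in> borel_measurable (lebesgue_on {0..b})"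
      by (rule continuous_imp_measurable_on_sets_lebesgue[OF u]) simp
    show "bounded (u ` {0..b})"
      by (rule compact_imp_bounded[OF compact_continuous_image[OF u]]) simp
    show "(\<lambda>s. norm (vector_derivative h (at s))) absolutely_integrable_on {0..b}"
      using absolutely_integrable_norm[OF abs_continuous_on_absolutely_integrable_derivative[OF h]] by (simp add: o_def)
  qed simp
  then show ?thesis by (simp add: absolutely_integrable_on_def)
qed

lemma continuous_on_arc_length:
  fixes h :: "real \<Rightarrow> 'b::euclidean_space"
  assumes "abs_continuous_on {0..b} h"
  shows "continuous_on {0..b} (arc_length h)"
  by (rule abs_continuous_on_imp_continuous_on_Icc[OF abs_continuous_on_arc_length[OF assms]])

text \<open>The weight for Picard iteration and for Gronwall's inequality: with
  \<open>k = 2 * M\<close>, integrating it against arc length and multiplying by \<open>M\<close>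
  gives at most half of it, on intervals of any length.\<close>

lemma has_integral_exp_arc_length:
  fixes h :: "real \<Rightarrow> 'b::euclidean_space"
  assumes h: "abs_continuous_on {0..b} h" and "0 \<le> b" and "0 \<le> k"
  shows "((\<lambda>s. k * exp (k * arc_length h s) * norm (vector_derivative h (at s))) has_integral
     (exp (k * arc_length h b) - 1)) {0..b}"
proof -
  let ?l = "arc_length h"
  have ac: "abs_continuous_on {0..b} (\<lambda>s. exp (k * ?l s))"
  proof (rule abs_continuous_on_dominated1[OF abs_continuous_on_arc_length[OF h], of _ "k * exp (k * ?l b)"])
    fix s t assume st: "s \<in> {0..b}" "t \<in> {0..b}" "s \<le> t"
    have l: "?l s \<le> ?l t" "?l t \<le> ?l b" using st by (auto intro!: arc_length_mono[OF h])
    have "exp (k * ?l t) - exp (k * ?l s) = exp (k * ?l t) * (1 - exp (k * ?l s - k * ?l t))"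
      by (simp add: algebra_simps flip: exp_add)
    also have "\<dots> \<le> exp (k * ?l t) * (k * ?l t - k * ?l s)"
    proof (rule mult_left_mono)
      show "1 - exp (k * ?l s - k * ?l t) \<le> k * ?l t - k * ?l s"
        using exp_ge_add_one_self[of "k * ?l s - k * ?l t"] by linarith
    qed simp
    also have "\<dots> \<le> exp (k * ?l b) * (k * ?l t - k * ?l s)"
      using l \<open>0 \<le> k\<close> by (intro mult_right_mono) (auto intro!: mult_left_mono)
    finally have "exp (k * ?l t) - exp (k * ?l s) \<le> k * exp (k * ?l b) * (?l t - ?l s)" by (simp add: algebra_simps)
    moreover have "exp (k * ?l s) \<le> exp (k * ?l t)" using l \<open>0 \<le> k\<close> by (simp add: mult_left_mono)
    ultimately show "norm (exp (k * ?l t) - exp (k * ?l s)) \<le> k * exp (k * ?l b) * norm (?l t - ?l s)"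
      using l by simp
  qed
  have "((\<lambda>s. k * exp (k * ?l s) * norm (vector_derivative h (at s))) has_integral
     (exp (k * ?l b) - exp (k * ?l 0))) {0..b}"
  proof (rule fundamental_theorem_of_calculus_abs_continuous[OF \<open>0 \<le> b\<close> ac negligible_arc_length_derivative[OF h]])
    fix x assume "x \<in> {0..b} - {x \<in> {0..b}. \<not> (?l has_vector_derivative norm (vector_derivative h (at x))) (at x)}"
    then have "(?l has_real_derivative norm (vector_derivative h (at x))) (at x)"
      by (simp add: has_real_derivative_iff_has_vector_derivative)
    then have "((\<lambda>s. exp (k * ?l s)) has_real_derivative (k * exp (k * ?l x) * norm (vector_derivative h (at x)))) (at x)"
      by (auto intro!: derivative_eq_intros)
    then show "((\<lambda>s. exp (k * ?l s)) has_vector_derivative (k * exp (k * ?l x) * norm (vector_derivative h (at x)))) (at x within {0..b})"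
      by (simp add: has_real_derivative_iff_has_vector_derivative has_vector_derivative_at_within)
  qed
  then show ?thesis by simp
qed

text \<open>The supremum of \<open>u\<close> weighted by \<open>exp (- 2 M l)\<close> is at most \<open>\<eta>\<close> plus half of itself.\<close>

lemma gronwall_arc_length:
  fixes h :: "real \<Rightarrow> 'b::euclidean_space" and u :: "real \<Rightarrow> real"
  assumes h: "abs_continuous_on {0..b} h" and "0 \<le> M" "0 \<le> \<eta>"
    and u: "continuous_on {0..b} u" "\<And>t. t \<in> {0..b} \<Longrightarrow> 0 \<le> u t"
    and le: "\<And>t. t \<in> {0..b} \<Longrightarrow> u t \<le> \<eta> + M * integral {0..t} (\<lambda>s. u s * norm (vector_derivative h (at s)))"
    and t: "t \<in> {0..b}"
  shows "u t \<le> 2 * \<eta> * exp (2 * M * arc_length h t)"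
proof -
  let ?l = "arc_length h"
  have l0: "0 \<le> ?l s" if "s \<in> {0..b}" for s
    using arc_length_mono[OF h, of 0 s] that by simp
  define w where "w = (\<lambda>s. exp (- (2 * M * ?l s)) * u s)"
  have "continuous_on {0..b} w"
    unfolding w_def by (intro continuous_intros continuous_on_arc_length[OF h] u(1))
  moreover have "compact {0..b}" "{0..b} \<noteq> {}" using t by auto
  ultimately obtain m where m: "m \<in> {0..b}" "\<And>s. s \<in> {0..b} \<Longrightarrow> w s \<le> w m"
    using continuous_attains_sup[of "{0..b}" w] by blast
  define K where "K = w m"
  have "0 \<le> K" using u(2)[OF m(1)] by (simp add: K_def w_def)
  have uK: "u s \<le> K * exp (2 * M * ?l s)" if "s \<in> {0..b}" for s
  proof -
    have "w s \<le> K" using m(2)[OF that] by (simp add: K_def)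
    then have "exp (- (2 * M * ?l s)) * u s * exp (2 * M * ?l s) \<le> K * exp (2 * M * ?l s)"
      unfolding w_def by (intro mult_right_mono) auto
    moreover have "exp (- (2 * M * ?l s)) * u s * exp (2 * M * ?l s) = u s * (exp (- (2 * M * ?l s)) * exp (2 * M * ?l s))" by simp
    ultimately show ?thesis by (simp flip: exp_add)
  qed
  have hm: "abs_continuous_on {0..m} h" by (rule abs_continuous_on_subset[OF h]) (use m(1) in auto)
  have um: "continuous_on {0..m} u" by (rule continuous_on_subset[OF u(1)]) (use m(1) in auto)
  have "0 \<le> m" "0 \<le> 2 * M" using m(1) \<open>0 \<le> M\<close> by auto
  note ex = has_integral_exp_arc_length[OF hm this]
  have "integral {0..m} (\<lambda>s. M * (u s * norm (vector_derivative h (at s)))) \<le>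
      integral {0..m} (\<lambda>s. K / 2 * (2 * M * exp (2 * M * ?l s) * norm (vector_derivative h (at s))))"
  proof (rule integral_le)
    show "(\<lambda>s. M * (u s * norm (vector_derivative h (at s)))) integrable_on {0..m}"
      using integrable_times_norm_derivative[OF hm um] by (rule integrable_on_mult_right)
    show "(\<lambda>s. K / 2 * (2 * M * exp (2 * M * ?l s) * norm (vector_derivative h (at s)))) integrable_on {0..m}"
      by (rule integrable_on_mult_right) (use ex in blast)
    fix s assume "s \<in> {0..m}"
    then have "u s \<le> K * exp (2 * M * ?l s)" using m(1) by (intro uK) auto
    then have "M * (u s * norm (vector_derivative h (at s))) \<le> M * (K * exp (2 * M * ?l s) * norm (vector_derivative h (at s)))"
      using \<open>0 \<le> M\<close> by (intro mult_left_mono mult_right_mono) auto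
    then show "M * (u s * norm (vector_derivative h (at s))) \<le>
        K / 2 * (2 * M * exp (2 * M * ?l s) * norm (vector_derivative h (at s)))" by (simp add: algebra_simps)
  qed
  also have "\<dots> = K / 2 * (exp (2 * M * ?l m) - 1)"
    by (rule integral_unique[OF has_integral_mult_right[OF ex]])
  also have "\<dots> \<le> K / 2 * exp (2 * M * ?l m)" using \<open>0 \<le> K\<close> by (intro mult_left_mono) auto
  finally have "M * integral {0..m} (\<lambda>s. u s * norm (vector_derivative h (at s))) \<le> K / 2 * exp (2 * M * ?l m)"
    by simp
  with le[OF m(1)] have "u m \<le> \<eta> + K / 2 * exp (2 * M * ?l m)" by linarith
  moreover have "u m = K * exp (2 * M * ?l m)"
    by (simp add: K_def w_def flip: exp_add)
  ultimately have "K * exp (2 * M * ?l m) \<le> 2 * \<eta>" by simp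
  moreover have "K * 1 \<le> K * exp (2 * M * ?l m)"
    using \<open>0 \<le> K\<close> \<open>0 \<le> M\<close> l0[OF m(1)] by (intro mult_left_mono) auto
  ultimately have "K \<le> 2 * \<eta>" by simp
  have "u t \<le> K * exp (2 * M * ?l t)" by (rule uK[OF t])
  also have "\<dots> \<le> 2 * \<eta> * exp (2 * M * ?l t)" using \<open>K \<le> 2 * \<eta>\<close> by (intro mult_right_mono) auto
  finally show ?thesis .
qed

lemma solves_on_unique_glip:
  assumes F: "glip M F" and h: "abs_continuous_on {0..b} h"
    and y: "solves_on F h x0 {0..b} y" and z: "solves_on F h x0 {0..b} z" and t: "t \<in> {0..b}"
  shows "y t = z t"
proof -
  let ?h' = "\<lambda>s. vector_derivative h (at s)"
  have "0 \<le> b" using t by simp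
  have c: "continuous_on {0..b} y" "continuous_on {0..b} z" using y z \<open>0 \<le> b\<close> by (auto simp: solves_on_def)
  define u where "u = (\<lambda>s. norm (y s - z s))"
  have cu: "continuous_on {0..b} u" unfolding u_def by (intro continuous_intros c)
  have "u t \<le> 2 * 0 * exp (2 * M * arc_length h t)"
  proof (rule gronwall_arc_length[OF h glipD(1)[OF F] order.refl cu _ _ t])
    show "0 \<le> u s" for s by (simp add: u_def)
    fix s assume s: "s \<in> {0..b}"
    have hs: "abs_continuous_on {0..s} h" by (rule abs_continuous_on_subset[OF h]) (use s in auto)
    have us: "continuous_on {0..s} u" by (rule continuous_on_subset[OF cu]) (use s in auto)
    have "((\<lambda>r. F (y r) (?h' r) - F (z r) (?h' r)) has_integral ((y s - x0) - (z s - x0))) {0..s}"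
      by (rule has_integral_diff) (use y z s in \<open>auto simp: solves_on_def\<close>)
    then have i: "integral {0..s} (\<lambda>r. F (y r) (?h' r) - F (z r) (?h' r)) = y s - z s"
      "(\<lambda>r. F (y r) (?h' r) - F (z r) (?h' r)) integrable_on {0..s}" by (auto simp: integral_unique)
    have "norm (integral {0..s} (\<lambda>r. F (y r) (?h' r) - F (z r) (?h' r))) \<le> integral {0..s} (\<lambda>r. M * (u r * norm (?h' r)))"
    proof (rule integral_norm_bound_integral[OF i(2)])
      show "(\<lambda>r. M * (u r * norm (?h' r))) integrable_on {0..s}"
        by (rule integrable_on_mult_right[OF integrable_times_norm_derivative[OF hs us]])
      fix r
      show "norm (F (y r) (?h' r) - F (z r) (?h' r)) \<le> M * (u r * norm (?h' r))"
        using glipD(4)[OF F, of "y r" "?h' r" "z r"] by (simp add: u_def algebra_simps)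
    qed
    then show "u s \<le> 0 + M * integral {0..s} (\<lambda>r. u r * norm (?h' r))" unfolding i(1) by (simp add: u_def)
  qed
  then show ?thesis by (simp add: u_def)
qed

text \<open>Picard iterates: the \<open>n\<close>-th increment is at most \<open>exp (2 M l) / 2 ^ n\<close>.\<close>

lemma solves_on_exists_glip:
  fixes F :: "'a::euclidean_space \<Rightarrow> 'b::euclidean_space \<Rightarrow> 'a"
  assumes F: "glip M F" and h: "abs_continuous_on {0..} h"
  shows "\<exists>y. solves_on F h x0 {0..} y"
proof -
  let ?h' = "\<lambda>s. vector_derivative h (at s)"
  let ?l = "arc_length h"
  have M: "0 \<le> M" by (rule glipD(1)[OF F])
  have hb: "abs_continuous_on {0..b} h" for b by (rule abs_continuous_on_restrict[OF h])
  have l0: "0 \<le> ?l t" if "0 \<le> t" for t using arc_length_mono[OF hb, of 0 t t] that by simp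
  define P where "P = (\<lambda>y t. x0 + integral {0..t} (\<lambda>s. F (y s) (?h' s)))"
  define Y where "Y = (\<lambda>n. (P ^^ n) (\<lambda>_. x0))"
  have Y_Suc: "Y (Suc n) = P (Y n)" for n by (simp add: Y_def)
  have Y_0: "Y 0 = (\<lambda>_. x0)" by (simp add: Y_def)
  have int: "(\<lambda>s. F (y s) (?h' s)) integrable_on {0..b}" if "continuous_on {0..b} y" for y b
    using AC_drive[OF F hb that] by (simp add: absolutely_integrable_on_def)
  have cont: "continuous_on {0..b} (Y n)" for n b
  proof (induction n)
    case (Suc n)
    show ?case unfolding Y_Suc P_def
      by (intro continuous_intros indefinite_integral_continuous_1 int[OF Suc])
  qed (simp add: Y_0)
  \<comment> \<open>The Picard operator contracts by one half in the norm weighted with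
    \<open>exp (2 * M * ?l t)\<close>, on every \<open>[0,t]\<close>; so the iteration converges
    globally and no local solutions have to be patched.\<close>
  have P_diff: "norm (P y t - P z t) \<le> c / 2 * exp (2 * M * ?l t)"
    if t: "0 \<le> t" and c: "0 \<le> c" and yz: "continuous_on {0..t} y" "continuous_on {0..t} z"
    and le: "\<And>s. 0 \<le> s \<Longrightarrow> s \<le> t \<Longrightarrow> norm (y s - z s) \<le> c * exp (2 * M * ?l s)" for y z t c
  proof -
    have "0 \<le> 2 * M" using M by simp
    note ex = has_integral_exp_arc_length[OF hb[of t] t this]
    have "P y t - P z t = integral {0..t} (\<lambda>s. F (y s) (?h' s) - F (z s) (?h' s))"
      using integral_diff[OF int[OF yz(1)] int[OF yz(2)]] by (simp add: P_def)
    also have "norm \<dots> \<le> integral {0..t} (\<lambda>s. c / 2 * (2 * M * exp (2 * M * ?l s) * norm (?h' s)))"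
    proof (rule integral_norm_bound_integral)
      show "(\<lambda>s. F (y s) (?h' s) - F (z s) (?h' s)) integrable_on {0..t}"
        by (rule integrable_diff[OF int[OF yz(1)] int[OF yz(2)]])
      show "(\<lambda>s. c / 2 * (2 * M * exp (2 * M * ?l s) * norm (?h' s))) integrable_on {0..t}"
        by (rule integrable_on_mult_right) (use ex in blast)
      fix s assume s: "s \<in> {0..t}"
      have "norm (F (y s) (?h' s) - F (z s) (?h' s)) \<le> M * norm (y s - z s) * norm (?h' s)"
        by (rule glipD(4)[OF F])
      also have "\<dots> \<le> M * (c * exp (2 * M * ?l s)) * norm (?h' s)"
        using le[of s] s M by (intro mult_right_mono mult_left_mono) auto
      finally show "norm (F (y s) (?h' s) - F (z s) (?h' s)) \<le> c / 2 * (2 * M * exp (2 * M * ?l s) * norm (?h' s))"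
        by (simp add: algebra_simps)
    qed
    also have "\<dots> = c / 2 * (exp (2 * M * ?l t) - 1)" by (rule integral_unique[OF has_integral_mult_right[OF ex]])
    also have "\<dots> \<le> c / 2 * exp (2 * M * ?l t)" using c by (intro mult_left_mono) auto
    finally show ?thesis .
  qed
  have incr: "norm (Y (Suc n) t - Y n t) \<le> (1 / 2) ^ n * exp (2 * M * ?l t)" if "0 \<le> t" for n t
    using that
  proof (induction n arbitrary: t)
    case 0
    have "norm (integral {0..t} (\<lambda>s. F x0 (?h' s))) \<le> integral {0..t} (\<lambda>s. M * norm (?h' s))"
    proof (rule integral_norm_bound_integral)
      show "(\<lambda>s. F x0 (?h' s)) integrable_on {0..t}" using int[of t "\<lambda>_. x0"] by simp
      show "(\<lambda>s. M * norm (?h' s)) integrable_on {0..t}"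
        by (rule integrable_on_mult_right[OF integrable_norm_derivative[OF hb order.refl order.refl]])
      show "norm (F x0 (?h' s)) \<le> M * norm (?h' s)" for s by (rule glipD(3)[OF F])
    qed
    also have "\<dots> = M * ?l t" by (simp add: arc_length_def)
    also have "\<dots> \<le> exp (2 * M * ?l t)"
      using exp_ge_add_one_self[of "2 * M * ?l t"] mult_nonneg_nonneg[OF M l0[OF 0]] by linarith
    finally show ?case unfolding Y_Suc Y_0 P_def by simp
  next
    case (Suc n)
    have "norm (P (Y (Suc n)) t - P (Y n) t) \<le> (1 / 2) ^ n / 2 * exp (2 * M * ?l t)"
      by (rule P_diff[OF Suc.prems _ cont cont]) (auto intro: Suc.IH)
    then show ?case by (simp only: Y_Suc power_Suc)
  qed
  have tail: "norm (Y (n + m) t - Y n t) \<le> 2 * (1 / 2) ^ n * exp (2 * M * ?l t)" if t: "0 \<le> t" for n m t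
  proof -
    \<comment> \<open>The coefficient is the exact finite geometric sum, so that the induction on
      \<open>m\<close> closes.\<close>
    have "norm (Y (n + m) t - Y n t) \<le> (2 * (1 / 2) ^ n - 2 * (1 / 2) ^ (n + m)) * exp (2 * M * ?l t)"
    proof (induction m)
      case (Suc m)
      have "norm (Y (n + Suc m) t - Y n t) \<le> norm (Y (Suc (n + m)) t - Y (n + m) t) + norm (Y (n + m) t - Y n t)"
        using norm_triangle_ineq[of "Y (Suc (n + m)) t - Y (n + m) t" "Y (n + m) t - Y n t"] by simp
      also have "\<dots> \<le> (1 / 2) ^ (n + m) * exp (2 * M * ?l t) + (2 * (1 / 2) ^ n - 2 * (1 / 2) ^ (n + m)) * exp (2 * M * ?l t)"
        by (rule add_mono[OF incr[OF t] Suc])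
      also have "\<dots> = (2 * (1 / 2) ^ n - 2 * (1 / 2) ^ (n + Suc m)) * exp (2 * M * ?l t)"
        by (simp add: algebra_simps)
      finally show ?case .
    qed simp
    also have "\<dots> \<le> 2 * (1 / 2) ^ n * exp (2 * M * ?l t)" by (intro mult_right_mono) auto
    finally show ?thesis .
  qed
  have pow0: "(\<lambda>n. 2 * (1 / 2 :: real) ^ n * c) \<longlonglongrightarrow> 0" for c
    by (intro tendsto_eq_intros LIMSEQ_realpow_zero) auto
  have "convergent (\<lambda>n. Y n t)" if t: "0 \<le> t" for t
  proof (rule Cauchy_convergent, rule metric_CauchyI)
    fix e :: real assume "0 < e"
    then have "eventually (\<lambda>n. 2 * (1 / 2 :: real) ^ n * exp (2 * M * ?l t) < e / 2) sequentially"
      by (intro order_tendstoD(2)[OF pow0]) simp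
    then obtain N where N: "2 * (1 / 2 :: real) ^ N * exp (2 * M * ?l t) < e / 2"
      by (auto simp: eventually_sequentially)
    have *: "norm (Y n t - Y N t) < e / 2" if "N \<le> n" for n
      using tail[OF t, of N "n - N"] N that by simp
    have "dist (Y m t) (Y n t) < e" if "N \<le> m" "N \<le> n" for m n
      using *[OF that(1)] *[OF that(2)] norm_triangle_ineq4[of "Y m t - Y N t" "Y n t - Y N t"]
      by (simp add: dist_norm)
    then show "\<exists>N. \<forall>m\<ge>N. \<forall>n\<ge>N. dist (Y m t) (Y n t) < e" by blast
  qed
  then obtain y where y: "\<And>t. 0 \<le> t \<Longrightarrow> (\<lambda>n. Y n t) \<longlonglongrightarrow> y t" unfolding convergent_def by metis
  have lim_le: "norm (y t - Y n t) \<le> 2 * (1 / 2) ^ n * exp (2 * M * ?l t)" if t: "0 \<le> t" for n t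
  proof (rule Lim_norm_ubound)
    show "(\<lambda>m. Y (n + m) t - Y n t) \<longlonglongrightarrow> y t - Y n t"
      using LIMSEQ_ignore_initial_segment[OF y[OF t], of n] by (intro tendsto_intros) (simp add: add.commute)
    show "eventually (\<lambda>m. norm (Y (n + m) t - Y n t) \<le> 2 * (1 / 2) ^ n * exp (2 * M * ?l t)) sequentially"
      using tail[OF t] by simp
  qed simp
  have ycont: "continuous_on {0..b} y" if b: "0 \<le> b" for b
  proof (rule uniform_limit_theorem)
    show "eventually (\<lambda>n. continuous_on {0..b} (Y n)) sequentially" using cont by simp
    show "uniform_limit {0..b} Y y sequentially"
    proof (rule uniform_limitI)
      fix e :: real assume "0 < e"
      then have "eventually (\<lambda>n. 2 * (1 / 2 :: real) ^ n * exp (2 * M * ?l b) < e) sequentially"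
        by (intro order_tendstoD(2)[OF pow0])
      then show "eventually (\<lambda>n. \<forall>t\<in>{0..b}. dist (Y n t) (y t) < e) sequentially"
      proof eventually_elim
        case (elim n)
        show ?case
        proof
          fix t assume t: "t \<in> {0..b}"
          then have "0 \<le> t" by simp
          have "?l t \<le> ?l b" by (rule arc_length_mono[OF hb[of b]]) (use t in auto)
          then have "2 * M * ?l t \<le> 2 * M * ?l b" using M by (intro mult_left_mono) auto
          then have "2 * (1 / 2) ^ n * exp (2 * M * ?l t) \<le> 2 * (1 / 2) ^ n * exp (2 * M * ?l b)"
            by (intro mult_left_mono) auto
          with lim_le[OF \<open>0 \<le> t\<close>, of n] elim have "norm (y t - Y n t) < e" by linarith
          then show "dist (Y n t) (y t) < e" by (simp add: dist_norm norm_minus_commute)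
        qed
      qed
    qed
  qed simp
  have "y b = P y b" if b: "0 \<le> b" for b
  proof -
    have "(\<lambda>n. Y (Suc n) b) \<longlonglongrightarrow> P y b"
    proof (rule Lim_null_comparison[THEN LIM_zero_cancel])
      show "eventually (\<lambda>n. norm (Y (Suc n) b - P y b) \<le> 2 * (1 / 2) ^ n * (exp (2 * M * ?l b) / 2)) sequentially"
      proof (rule always_eventually, rule allI)
        fix n
        have "norm (P (Y n) b - P y b) \<le> 2 * (1 / 2) ^ n / 2 * exp (2 * M * ?l b)"
        proof (rule P_diff[OF b _ cont ycont[OF b]])
          fix s :: real assume "0 \<le> s"
          from lim_le[OF this, of n] show "norm (Y n s - y s) \<le> 2 * (1 / 2) ^ n * exp (2 * M * ?l s)"
            by (simp add: norm_minus_commute)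
        qed simp
        then show "norm (Y (Suc n) b - P y b) \<le> 2 * (1 / 2) ^ n * (exp (2 * M * ?l b) / 2)"
          by (simp add: Y_Suc)
      qed
      show "(\<lambda>n. 2 * (1 / 2) ^ n * (exp (2 * M * ?l b) / 2)) \<longlonglongrightarrow> 0" by (rule pow0)
    qed
    moreover have "(\<lambda>n. Y (Suc n) b) \<longlonglongrightarrow> y b" using y[OF b] by (rule LIMSEQ_Suc)
    ultimately show ?thesis using LIMSEQ_unique by blast
  qed
  then have "y b - x0 = integral {0..b} (\<lambda>s. F (y s) (?h' s))" if "0 \<le> b" for b
    using that by (simp add: P_def)
  then have "solves_on F h x0 {0..} y"
    unfolding solves_on_def using ycont int[OF ycont] by (simp add: has_integral_integrable_integral)
  then show ?thesis by blast
qed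

section \<open>Maximal solutions\<close>

abbreviation drive :: "('a::euclidean_space \<Rightarrow> 'b::euclidean_space \<Rightarrow> 'a) \<Rightarrow> (real \<Rightarrow> 'b) \<Rightarrow> real \<Rightarrow> 'a \<Rightarrow> 'a" where
  "drive F h \<equiv> \<lambda>t y. F y (vector_derivative h (at t))"

lemma solves_on_cutoff:
  assumes "\<And>b s. b \<in> I \<Longrightarrow> 0 \<le> s \<Longrightarrow> s \<le> b \<Longrightarrow> norm (y s) \<le> R" "\<And>b. b \<in> I \<Longrightarrow> 0 \<le> b"
  shows "solves_on (cutoff R F) h x0 I y \<longleftrightarrow> solves_on F h x0 I y"
proof (rule solves_on_cong)
  fix b s assume "b \<in> I" "0 \<le> s" "s \<le> b"
  from assms(1)[OF this] show "y s = y s \<and> cutoff R F (y s) = F (y s)" by (simp add: cutoff_eq)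
qed (rule assms(2))

lemma bounded_on_Icc:
  fixes y :: "real \<Rightarrow> 'a::euclidean_space"
  assumes "continuous_on {0..b} y"
  obtains R where "0 < R" "\<And>s. s \<in> {0..b} \<Longrightarrow> norm (y s) \<le> R"
proof -
  have "bounded (y ` {0..b})" by (rule compact_imp_bounded[OF compact_continuous_image[OF assms]]) simp
  then obtain R where "0 < R" "\<forall>x\<in>y ` {0..b}. norm x \<le> R" unfolding bounded_pos by blast
  then show thesis by (intro that[of R]) auto
qed

lemma solves_on_IccD:
  assumes "solves_on F h x0 {0..b} y" "0 \<le> b"
  shows "continuous_on {0..b} y" "y 0 = x0"
proof -
  show "continuous_on {0..b} y" using assms by (simp add: solves_on_def)
  have "((\<lambda>s. F (y s) (vector_derivative h (at s))) has_integral (y 0 - x0)) {0..0}"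
    using assms unfolding solves_on_def by (metis atLeastAtMost_iff order.refl)
  then have "y 0 - x0 = 0" using has_integral_refl(2) has_integral_unique by (metis atLeastAtMost_singleton box_real(2) cbox_idem)
  then show "y 0 = x0" by simp
qed

lemma solves_on_unique:
  assumes F: "loc_lip F" and h: "abs_continuous_on {0..b} h"
    and y: "solves_on F h x0 {0..b} y" and z: "solves_on F h x0 {0..b} z" and t: "t \<in> {0..b}"
  shows "y t = z t"
proof -
  have "0 \<le> b" using t by simp
  obtain R1 where R1: "0 < R1" "\<And>s. s \<in> {0..b} \<Longrightarrow> norm (y s) \<le> R1"
    by (rule bounded_on_Icc[OF solves_on_IccD(1)[OF y \<open>0 \<le> b\<close>]]) blast
  obtain R2 where R2: "0 < R2" "\<And>s. s \<in> {0..b} \<Longrightarrow> norm (z s) \<le> R2"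
    by (rule bounded_on_Icc[OF solves_on_IccD(1)[OF z \<open>0 \<le> b\<close>]]) blast
  define R where "R = max R1 R2"
  have "0 < R" using R1(1) by (simp add: R_def)
  then obtain M where M: "glip M (cutoff R F)" using F unfolding loc_lip_def by blast
  have "norm (y s) \<le> R" "norm (z s) \<le> R" if "s \<in> {0..b}" for s
    using R1(2)[OF that] R2(2)[OF that] by (auto simp: R_def)
  then have "solves_on (cutoff R F) h x0 {0..b} y" "solves_on (cutoff R F) h x0 {0..b} z"
    using y z by (subst solves_on_cutoff; simp)+
  from solves_on_unique_glip[OF M h this t] show ?thesis .
qed

lemma absolutely_integrable_drive_loc_lip:
  assumes F: "loc_lip F" and h: "abs_continuous_on {0..b} h" and y: "continuous_on {0..b} y"
  shows "(\<lambda>s. F (y s) (vector_derivative h (at s))) absolutely_integrable_on {0..b}"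
proof -
  obtain R where R: "0 < R" "\<And>s. s \<in> {0..b} \<Longrightarrow> norm (y s) \<le> R"
    by (rule bounded_on_Icc[OF y]) blast
  obtain M where M: "glip M (cutoff R F)" using F R(1) unfolding loc_lip_def by blast
  from AC_drive[OF M h y] show ?thesis
    by (rule set_integrable_cong[THEN iffD1, rotated -1]) (simp_all add: R(2) cutoff_eq)
qed

lemma solves_on_ac:
  assumes F: "loc_lip F" and h: "abs_continuous_on {0..} h" and y: "solves_on F h x0 I y"
    and I: "\<And>b. b \<in> I \<Longrightarrow> 0 \<le> b"
  shows "abs_continuous_on I y"
proof (rule abs_continuous_on_integralI)
  fix b assume b: "b \<in> I"
  then have "continuous_on {0..b} y"
    "((\<lambda>s. F (y s) (vector_derivative h (at s))) has_integral (y b - x0)) {0..b}"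
    using y by (auto simp: solves_on_def)
  then show "0 \<le> b \<and> (\<lambda>s. F (y s) (vector_derivative h (at s))) absolutely_integrable_on {0..b} \<and>
      y b = x0 + integral {0..b} (\<lambda>s. F (y s) (vector_derivative h (at s)))"
    using I[OF b] absolutely_integrable_drive_loc_lip[OF F abs_continuous_on_restrict[OF h]]
    by (simp add: integral_unique)
qed

lemma continuous_on_half_open:
  assumes "abs_continuous_on (half_open S) y" "b \<in> half_open S"
  shows "continuous_on {0..b} y"
  by (rule abs_continuous_on_imp_continuous_on_Icc[OF abs_continuous_on_subset[OF assms(1) half_open_interval[OF assms(2)]]])

text \<open>One direction is the fundamental theorem, the other the differentiation of an indefinite
  integral almost everywhere.\<close>

lemma is_solution_iff:
  assumes F: "loc_lip F" and h: "abs_continuous_on {0..} h"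
  shows "is_solution (drive F h) x0 S y \<longleftrightarrow> 0 < S \<and> solves_on F h x0 (half_open S) y"
proof
  assume s: "is_solution (drive F h) x0 S y"
  then have "0 < S" and ac: "abs_continuous_on (half_open S) y" and y0: "y 0 = x0"
    and ae: "AE t in lebesgue. t \<in> half_open S \<longrightarrow> (y has_vector_derivative F (y t) (vector_derivative h (at t))) (at t)"
    by (auto simp: is_solution_def)
  have "solves_on F h x0 (half_open S) y"
    unfolding solves_on_def
  proof (rule ballI, rule conjI)
    fix b assume b: "b \<in> half_open S"
    show "continuous_on {0..b} y" by (rule continuous_on_half_open[OF ac b])
    have "((\<lambda>s. F (y s) (vector_derivative h (at s))) has_integral (y b - y 0)) {0..b}"
    proof (rule fundamental_theorem_of_calculus_abs_continuous[OF half_open_nonneg[OF b] _ negligible_half_open[OF ae b]])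
      show "abs_continuous_on {0..b} y" by (rule abs_continuous_on_subset[OF ac half_open_interval[OF b]])
    qed (auto intro: has_vector_derivative_at_within)
    then show "((\<lambda>s. F (y s) (vector_derivative h (at s))) has_integral (y b - x0)) {0..b}" by (simp add: y0)
  qed
  then show "0 < S \<and> solves_on F h x0 (half_open S) y" using \<open>0 < S\<close> by simp
next
  assume s: "0 < S \<and> solves_on F h x0 (half_open S) y"
  then have S: "0 < S" and y: "solves_on F h x0 (half_open S) y" by auto
  have "0 \<in> half_open S" using S by (simp add: half_open_def zero_ereal_def)
  then have "solves_on F h x0 {0..0} y" using y solves_on_subset by fastforce
  then have y0: "y 0 = x0" by (rule solves_on_IccD) simp
  have ac: "abs_continuous_on (half_open S) y"
    by (rule solves_on_ac[OF F h y half_open_nonneg])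
  have ae: "AE t in lebesgue. t \<in> half_open S \<longrightarrow> (y has_vector_derivative F (y t) (vector_derivative h (at t))) (at t)"
  proof (rule AE_half_open)
    fix b assume b: "b \<in> half_open S"
    \<comment> \<open>At \<open>b\<close> itself a two-sided derivative requires the integral
      identity slightly beyond \<open>b\<close>.\<close>
    obtain b' where b': "b < b'" "b' \<in> half_open S" by (rule half_open_exceed[OF b])
    let ?f = "\<lambda>s. F (y s) (vector_derivative h (at s))"
    have eq: "y t = x0 + integral {0..t} ?f" if "t \<in> half_open S" for t
    proof -
      have "(?f has_integral (y t - x0)) {0..t}" using y that by (simp add: solves_on_def)
      then show ?thesis by (simp add: integral_unique)
    qed
    have "?f absolutely_integrable_on {0..b'}"
      by (rule absolutely_integrable_drive_loc_lip[OF F abs_continuous_on_restrict[OF h] continuous_on_half_open[OF ac b'(2)]])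
    then have neg: "negligible ({t \<in> {0..b'}. \<not> ((\<lambda>t. integral {0..t} ?f) has_vector_derivative ?f t) (at t)} \<union> {0})"
      using negligible_derivative_integral by simp
    show "negligible {t \<in> {0..b}. \<not> (y has_vector_derivative ?f t) (at t)}"
    proof (rule negligible_subset[OF neg], intro subsetI, rule ccontr)
      fix t assume t: "t \<in> {t \<in> {0..b}. \<not> (y has_vector_derivative ?f t) (at t)}"
        and nt: "t \<notin> {t \<in> {0..b'}. \<not> ((\<lambda>t. integral {0..t} ?f) has_vector_derivative ?f t) (at t)} \<union> {0}"
      have tb: "0 < t" "t < b'" using t nt b'(1) by auto
      have "((\<lambda>t. integral {0..t} ?f) has_vector_derivative ?f t) (at t)" using nt tb by simp
      then have "((\<lambda>t. x0 + integral {0..t} ?f) has_vector_derivative 0 + ?f t) (at t)"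
        by (intro has_vector_derivative_add has_vector_derivative_const)
      then have "(y has_vector_derivative 0 + ?f t) (at t)"
      proof (rule has_vector_derivative_transform_within_open[of _ _ _ "{0<..<b'}"])
        show "x0 + integral {0..s} ?f = y s" if "s \<in> {0<..<b'}" for s
          using eq[OF half_openD[OF b'(2), of s]] that by simp
      qed (use tb in auto)
      then show False using t by simp
    qed
  qed
  show "is_solution (drive F h) x0 S y" using S ac y0 ae by (simp add: is_solution_def)
qed

text \<open>The trajectories are defined with the control \<open>u\<close>, or with derivatives
  taken component by component, and these agree with the derivative of the driver only almost
  everywhere. Equality of the predicates makes the two choices by \<open>SOME\<close> in
  \<open>max_solution\<close> literally equal.\<close>

lemma is_solution_cong:
  fixes F1 F2 :: "real \<Rightarrow> 'a::euclidean_space \<Rightarrow> 'a"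
  assumes "AE t in lebesgue. 0 \<le> t \<longrightarrow> (\<forall>y. F1 t y = F2 t y)"
  shows "is_solution F1 = is_solution F2"
proof (intro ext)
  fix x0 :: 'a and S :: ereal and y :: "real \<Rightarrow> 'a"
  have *: "is_solution F x0 S y \<Longrightarrow> is_solution G x0 S y"
    if "AE t in lebesgue. 0 \<le> t \<longrightarrow> (\<forall>y. F t y = G t y)" for F G :: "real \<Rightarrow> 'a \<Rightarrow> 'a"
  proof -
    assume s: "is_solution F x0 S y"
    then have "AE t in lebesgue. t \<in> half_open S \<longrightarrow> (y has_vector_derivative F t (y t)) (at t)"
      by (simp add: is_solution_def)
    with that have "AE t in lebesgue. t \<in> half_open S \<longrightarrow> (y has_vector_derivative G t (y t)) (at t)"
    proof eventually_elim
      case (elim t)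
      then show ?case using half_open_nonneg[of t S] by auto
    qed
    then show "is_solution G x0 S y" using s by (simp add: is_solution_def)
  qed
  have "AE t in lebesgue. 0 \<le> t \<longrightarrow> (\<forall>y. F2 t y = F1 t y)" using assms by eventually_elim simp
  from *[OF assms] *[OF this] show "is_solution F1 x0 S y = is_solution F2 x0 S y" by blast
qed

lemma max_solution_cong:
  assumes "AE t in lebesgue. 0 \<le> t \<longrightarrow> (\<forall>y. F1 t y = F2 t y)"
  shows "max_solution F1 x0 = max_solution F2 x0"
  by (simp add: max_solution_def is_max_solution_def is_solution_cong[OF assms])

text \<open>The equation cut off at \<open>R + 1\<close> has a global solution. It coincides with
  \<open>y\<close> before \<open>b\<close>, is bounded by \<open>R\<close> up to and including
  \<open>b\<close>, and stays within \<open>R + 1\<close> a little longer, where the cutoff is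
  invisible.\<close>

lemma solves_on_extend:
  assumes F: "loc_lip F" and h: "abs_continuous_on {0..} h" and "0 \<le> b"
    and y: "\<And>c. 0 \<le> c \<Longrightarrow> c < b \<Longrightarrow> solves_on F h x0 {0..c} y" "\<And>t. 0 \<le> t \<Longrightarrow> t < b \<Longrightarrow> norm (y t) \<le> R"
    and x0: "norm x0 \<le> R"
  obtains d z where "0 < d" "solves_on F h x0 {0..b + d} z"
proof -
  have "0 \<le> R" using x0 norm_ge_zero order_trans by blast
  then have "0 < R + 1" by simp
  then obtain M where M: "glip M (cutoff (R + 1) F)" using F unfolding loc_lip_def by blast
  obtain z where z: "solves_on (cutoff (R + 1) F) h x0 {0..} z" using solves_on_exists_glip[OF M h] by blast
  have zc: "solves_on (cutoff (R + 1) F) h x0 {0..c} z" for c by (rule solves_on_subset[OF z]) auto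
  have zb: "norm (z t) \<le> R" if t: "0 \<le> t" "t < b" for t
  proof -
    have "solves_on (cutoff (R + 1) F) h x0 {0..t} y"
      by (subst solves_on_cutoff) (use y t in \<open>auto intro: order_trans[of _ R]\<close>)
    from solves_on_unique_glip[OF M abs_continuous_on_restrict[OF h] this zc, of t] t y(2)[OF t]
    show ?thesis by simp
  qed
  have cz: "continuous_on {0..c} z" if "0 \<le> c" for c by (rule solves_on_IccD(1)[OF zc that])
  have zbb: "norm (z b) \<le> R"
  proof (cases "b = 0")
    case True
    then show ?thesis using solves_on_IccD(2)[OF zc[of 0]] x0 by simp
  next
    case False
    then have "0 < b" using \<open>0 \<le> b\<close> by simp
    have "continuous_on {0..b} (\<lambda>t. norm (z t))" by (intro continuous_intros cz \<open>0 \<le> b\<close>)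
    then have "((\<lambda>t. norm (z t)) \<longlongrightarrow> norm (z b)) (at b within {0..b})"
      using \<open>0 < b\<close> by (simp add: continuous_on_def)
    moreover have "at b within {0..b} \<noteq> bot"
      using \<open>0 < b\<close> by (simp add: at_within_Icc_at_left)
    moreover have "eventually (\<lambda>t. norm (z t) \<le> R) (at b within {0..b})"
      unfolding eventually_at using zb by (intro exI[of _ 1]) (auto simp: less_le)
    ultimately show ?thesis by (intro tendsto_upperbound)
  qed
  have "continuous_on {0..b + 1} z" by (rule cz) (use \<open>0 \<le> b\<close> in simp)
  moreover have "b \<in> {0..b + 1}" using \<open>0 \<le> b\<close> by simp
  ultimately have "\<exists>d>0. \<forall>t\<in>{0..b + 1}. dist t b < d \<longrightarrow> dist (z t) (z b) < 1"
    unfolding continuous_on_iff using zero_less_one by blast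
  then obtain d where "0 < d" and d: "\<And>t. t \<in> {0..b + 1} \<Longrightarrow> dist t b < d \<Longrightarrow> dist (z t) (z b) < 1"
    by blast
  define d' where "d' = min (d / 2) 1"
  have "0 < d'" using \<open>0 < d\<close> by (simp add: d'_def)
  have nz: "norm (z t) \<le> R + 1" if t: "0 \<le> t" "t \<le> b + d'" for t
  proof (cases "t < b")
    case True
    then show ?thesis using zb[OF t(1)] by simp
  next
    case False
    then have "dist (z t) (z b) < 1" using t \<open>0 < d\<close> \<open>0 \<le> b\<close> by (intro d) (auto simp: d'_def dist_real_def)
    then show ?thesis using zbb norm_triangle_ineq2[of "z t" "z b"] by (simp add: dist_norm)
  qed
  have "solves_on F h x0 {0..b + d'} z"
    using zc[of "b + d'"] by (subst (asm) solves_on_cutoff) (use nz in auto)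
  then show thesis by (rule that[OF \<open>0 < d'\<close>])
qed

context
  fixes F :: "'a::euclidean_space \<Rightarrow> 'b::euclidean_space \<Rightarrow> 'a" and h :: "real \<Rightarrow> 'b" and x0 :: 'a
  assumes F: "loc_lip F" and h: "abs_continuous_on {0..} h"
begin

lemma solves_on_half_open_Icc:
  "solves_on F h x0 (half_open S) y \<Longrightarrow> b \<in> half_open S \<Longrightarrow> solves_on F h x0 {0..b} y"
  by (rule solves_on_subset[OF _ half_open_interval])

lemma solves_on_half_openI:
  assumes "\<And>b. b \<in> half_open S \<Longrightarrow> solves_on F h x0 {0..b} y"
  shows "solves_on F h x0 (half_open S) y"
  unfolding solves_on_def
proof
  fix b assume b: "b \<in> half_open S"
  have "b \<in> {0..b}" using half_open_nonneg[OF b] by simp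
  then show "continuous_on {0..b} y \<and> ((\<lambda>s. F (y s) (vector_derivative h (at s))) has_integral (y b - x0)) {0..b}"
    using assms[OF b] unfolding solves_on_def by blast
qed

lemma solves_on_half_open_unique:
  assumes y: "solves_on F h x0 (half_open S) y" and z: "solves_on F h x0 (half_open S') z"
    and t: "t \<in> half_open S" "t \<in> half_open S'"
  shows "y t = z t"
  by (rule solves_on_unique[OF F abs_continuous_on_restrict[OF h] solves_on_half_open_Icc[OF y t(1)]
        solves_on_half_open_Icc[OF z t(2)]]) (use half_open_nonneg[OF t(1)] in simp)

text \<open>The union of all local solutions, consistent by uniqueness, lives up to the supremum of
  their end points.\<close>

lemma is_max_solution_exists: "\<exists>S y. is_max_solution (drive F h) x0 S y"
proof -
  define A where "A = {S. 0 < S \<and> (\<exists>y. solves_on F h x0 (half_open S) y)}"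
  define S where "S = Sup A"
  define Y where "Y = (\<lambda>S'. SOME y. solves_on F h x0 (half_open S') y)"
  have Y: "solves_on F h x0 (half_open S') (Y S')" if "S' \<in> A" for S'
  proof -
    have "\<exists>y. solves_on F h x0 (half_open S') y" using that by (simp add: A_def)
    then show ?thesis unfolding Y_def by (rule someI_ex)
  qed
  define y where "y = (\<lambda>t. Y (SOME S'. S' \<in> A \<and> t \<in> half_open S') t)"
  have y_eq: "y t = Y S' t" if "S' \<in> A" "t \<in> half_open S'" for S' t
  proof -
    define S1 where "S1 = (SOME S'. S' \<in> A \<and> t \<in> half_open S')"
    have "S1 \<in> A \<and> t \<in> half_open S1"
      unfolding S1_def by (rule someI[where P = "\<lambda>S'. S' \<in> A \<and> t \<in> half_open S'"]) (use that in simp)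
    then have "Y S1 t = Y S' t"
      using solves_on_half_open_unique[OF Y Y] that by blast
    then show ?thesis by (simp add: y_def S1_def)
  qed
  \<comment> \<open>With \<open>b = 0\<close> the conditions on the given solution are void, and the
    extension lemma becomes local existence.\<close>
  obtain d z where d: "0 < d" "solves_on F h x0 {0..0 + d} z"
    by (rule solves_on_extend[OF F h order.refl, of x0 "\<lambda>_. x0" "norm x0"]) auto
  have "solves_on F h x0 (half_open (ereal d)) z"
    by (rule solves_on_subset[OF d(2)]) (auto simp: half_open_def)
  then have "ereal d \<in> A" using d(1) by (auto simp: A_def)
  then have "ereal d \<le> S" unfolding S_def by (rule Sup_upper)
  then have "0 < S" using d(1) by (metis ereal_less(2) less_le_trans)
  have sol: "solves_on F h x0 (half_open S) y"
  proof (rule solves_on_half_openI)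
    fix b assume "b \<in> half_open S"
    then have "0 \<le> b" "ereal b < S" by (auto simp: half_open_def)
    then obtain S' where S': "S' \<in> A" "ereal b < S'" unfolding S_def less_Sup_iff by blast
    then have b': "b \<in> half_open S'" using \<open>0 \<le> b\<close> by (simp add: half_open_def)
    have "solves_on F h x0 {0..b} (Y S') \<longleftrightarrow> solves_on F h x0 {0..b} y"
    proof (rule solves_on_cong)
      fix c s assume "c \<in> {0..b}" "0 \<le> s" "s \<le> c"
      then have "s \<in> half_open S'" using half_openD[OF b', of s] by simp
      from y_eq[OF S'(1) this] show "Y S' s = y s \<and> F (Y S' s) = F (Y S' s)" by simp
    qed simp
    then show "solves_on F h x0 {0..b} y" using solves_on_half_open_Icc[OF Y[OF S'(1)] b'] by simp
  qed
  have "is_max_solution (drive F h) x0 S y"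
    unfolding is_max_solution_def is_solution_iff[OF F h]
  proof (intro conjI notI \<open>0 < S\<close> sol)
    assume "\<exists>S' z. S < S' \<and> (0 < S' \<and> solves_on F h x0 (half_open S') z) \<and> (\<forall>t\<in>half_open S. z t = y t)"
    then obtain S' where "S < S'" "S' \<in> A" unfolding A_def by blast
    then show False using Sup_upper[of S' A] unfolding S_def by (simp add: leD)
  qed
  then show ?thesis by blast
qed

lemma max_solution_is_max:
  assumes "max_solution (drive F h) x0 = (S, y)"
  shows "is_max_solution (drive F h) x0 S y"
proof -
  have "\<exists>p. case p of (S, y) \<Rightarrow> is_max_solution (drive F h) x0 S y"
    using is_max_solution_exists by auto
  from someI_ex[OF this] have "case max_solution (drive F h) x0 of (S, y) \<Rightarrow> is_max_solution (drive F h) x0 S y"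
    unfolding max_solution_def .
  then show ?thesis by (simp add: assms)
qed

context
  fixes S y assumes max: "is_max_solution (drive F h) x0 S y"
begin

lemma max_solution_pos: "0 < S"
  and max_solution_solves: "solves_on F h x0 (half_open S) y"
  using max is_solution_iff[OF F h] by (auto simp: is_max_solution_def)

lemma max_solution_ac: "abs_continuous_on (half_open S) y"
  by (rule solves_on_ac[OF F h max_solution_solves half_open_nonneg])

lemma max_solution_maximal:
  assumes "solves_on F h x0 (half_open S') z" "0 < S'"
  shows "S' \<le> S"
proof (rule ccontr)
  assume "\<not> S' \<le> S"
  then have "S < S'" by simp
  have "\<forall>t\<in>half_open S. z t = y t"
  proof
    fix t assume t: "t \<in> half_open S"
    then have "t \<in> half_open S'" using \<open>S < S'\<close> by (auto simp: half_open_def)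
    from solves_on_half_open_unique[OF assms(1) max_solution_solves this t] show "z t = y t" .
  qed
  moreover have "is_solution (drive F h) x0 S' z" using assms is_solution_iff[OF F h] by blast
  ultimately show False using max \<open>S < S'\<close> unfolding is_max_solution_def by blast
qed

lemma max_solution_unbounded:
  assumes "S = ereal b"
  shows "\<exists>t. 0 \<le> t \<and> t < b \<and> R < norm (y t)"
proof (rule ccontr)
  assume "\<not> ?thesis"
  then have R: "norm (y t) \<le> R" if "0 \<le> t" "t < b" for t using that by (meson not_less)
  have b: "0 < b" using max_solution_pos assms by simp
  have mem: "t \<in> half_open S \<longleftrightarrow> 0 \<le> t \<and> t < b" for t by (simp add: half_open_def assms)
  have yc: "solves_on F h x0 {0..c} y" if "0 \<le> c" "c < b" for c
    by (rule solves_on_half_open_Icc[OF max_solution_solves]) (simp add: mem that)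
  have "norm x0 \<le> R" using R[of 0] solves_on_IccD(2)[OF yc[of 0]] b by simp
  then obtain d z where d: "0 < d" "solves_on F h x0 {0..b + d} z"
    using solves_on_extend[OF F h less_imp_le[OF b] yc R] by blast
  have "solves_on F h x0 (half_open (ereal (b + d))) z"
    by (rule solves_on_subset[OF d(2)]) (auto simp: half_open_def)
  moreover have "0 < ereal (b + d)" using b d(1) by simp
  ultimately have "ereal (b + d) \<le> S" by (rule max_solution_maximal)
  then show False using assms d(1) by simp
qed

text \<open>At a finite end of existence the maximal solution is unbounded, while \<open>z\<close>
  is bounded up to \<open>E\<close>; so the end lies strictly beyond \<open>E\<close>.\<close>

lemma max_solution_reaches:
  assumes z: "solves_on F h x0 {0..E} z" and "0 \<le> E"
  shows "ereal E < S" "\<And>t. 0 \<le> t \<Longrightarrow> t \<le> E \<Longrightarrow> y t = z t"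
proof -
  have hE: "abs_continuous_on {0..c} h" for c by (rule abs_continuous_on_restrict[OF h])
  have eq: "y t = z t" if "0 \<le> t" "t \<le> E" "ereal t < S" for t
  proof (rule solves_on_unique[OF F hE[of t]])
    show "solves_on F h x0 {0..t} y"
      by (rule solves_on_half_open_Icc[OF max_solution_solves]) (simp add: half_open_def that)
    show "solves_on F h x0 {0..t} z" by (rule solves_on_subset[OF z]) (use that in auto)
  qed (use that in simp)
  show "ereal E < S"
  proof (rule ccontr)
    assume "\<not> ereal E < S"
    then have "S \<le> ereal E" by simp
    then obtain b where b: "S = ereal b" "b \<le> E" using max_solution_pos by (cases S) auto
    obtain R where R: "\<And>s. s \<in> {0..E} \<Longrightarrow> norm (z s) \<le> R"
      by (rule bounded_on_Icc[OF solves_on_IccD(1)[OF z \<open>0 \<le> E\<close>]]) blast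
    obtain t where t: "0 \<le> t" "t < b" "R < norm (y t)" using max_solution_unbounded[OF b(1)] by blast
    then have "y t = z t" using b by (intro eq) auto
    then show False using R[of t] t b(2) by simp
  qed
  then show "y t = z t" if "0 \<le> t" "t \<le> E" for t
    using that by (intro eq) (auto intro: le_less_trans[of "ereal t" "ereal E"])
qed

end

end

section \<open>Dependence on the driving function\<close>

lemma solves_on_driver_cong:
  assumes eq: "\<And>t. 0 \<le> t \<Longrightarrow> t \<le> B \<Longrightarrow> h t = k t" and I: "I \<subseteq> {0..B}"
  shows "solves_on F h x0 I y \<longleftrightarrow> solves_on F k x0 I y"
  unfolding solves_on_def
proof (rule ball_cong[OF refl], rule conj_cong[OF refl])
  fix b assume "b \<in> I"
  then have b: "b \<le> B" using I by auto
  show "((\<lambda>s. F (y s) (vector_derivative h (at s))) has_integral (y b - x0)) {0..b} \<longleftrightarrow>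
    ((\<lambda>s. F (y s) (vector_derivative k (at s))) has_integral (y b - x0)) {0..b}"
  proof (rule has_integral_spike_finite_eq[of "{0, b}"])
    fix x assume x: "x \<in> {0..b} - {0, b}"
    have "eventually (\<lambda>t. t \<in> {0<..<b}) (nhds x)" by (rule eventually_nhds_in_open) (use x in auto)
    then have "vector_derivative h (at x) = vector_derivative k (at x)"
      by (intro vector_derivative_cong_eq) (use eq b in \<open>auto elim!: eventually_mono\<close>)
    then show "F (y x) (vector_derivative k (at x)) = F (y x) (vector_derivative h (at x))" by simp
  qed simp
qed

lemma solves_on_stop:
  assumes F: "loc_lip F" and h: "abs_continuous_on {0..} h" and "0 \<le> E"
    and y: "solves_on F h x0 {0..E} y"
  shows "solves_on F (\<lambda>t. h (min t E)) x0 {0..} (\<lambda>t. y (min t E))"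
proof -
  let ?h = "\<lambda>t. h (min t E)" and ?y = "\<lambda>t. y (min t E)"
  have yE: "solves_on F ?h x0 {0..E} ?y"
  proof -
    have "solves_on F h x0 {0..E} ?y" using y by (subst solves_on_cong[where z = y and G = F]) auto
    then show ?thesis by (subst solves_on_driver_cong[of E _ h]) auto
  qed
  show ?thesis
    unfolding solves_on_def
  proof
    fix b :: real assume "b \<in> {0..}"
    then have "0 \<le> b" by simp
    show "continuous_on {0..b} ?y \<and> ((\<lambda>s. F (?y s) (vector_derivative ?h (at s))) has_integral (?y b - x0)) {0..b}"
    proof (cases "b \<le> E")
      case True
      then show ?thesis using yE \<open>0 \<le> b\<close> by (auto simp: solves_on_def)
    next
      case False
      have "continuous_on {0..b} ?y"
        by (rule continuous_on_compose2[OF solves_on_IccD(1)[OF y \<open>0 \<le> E\<close>]]) (use \<open>0 \<le> E\<close> in \<open>auto intro!: continuous_intros\<close>)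
      moreover have "((\<lambda>s. F (?y s) (vector_derivative ?h (at s))) has_integral ((?y E - x0) + 0)) {0..b}"
      proof (rule has_integral_combine[OF \<open>0 \<le> E\<close>])
        show "E \<le> b" using False by simp
        show "((\<lambda>s. F (?y s) (vector_derivative ?h (at s))) has_integral (?y E - x0)) {0..E}"
          using yE \<open>0 \<le> E\<close> by (simp add: solves_on_def)
        show "((\<lambda>s. F (?y s) (vector_derivative ?h (at s))) has_integral 0) {E..b}"
        proof (rule has_integral_spike_finite[of "{E}"])
          fix x assume x: "x \<in> {E..b} - {E}"
          have "eventually (\<lambda>t. t \<in> {E<..}) (nhds x)" by (rule eventually_nhds_in_open) (use x in auto)
          then have "vector_derivative ?h (at x) = vector_derivative (\<lambda>_. h E) (at x)"
            by (intro vector_derivative_cong_eq) (auto elim!: eventually_mono)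
          then show "F (?y x) (vector_derivative ?h (at x)) = (\<lambda>_. 0) x"
            by (simp add: linear_0[OF loc_lip_linear[OF F]])
        qed simp_all
      qed
      ultimately show ?thesis using False \<open>0 \<le> E\<close> by simp
    qed
  qed
qed

section \<open>Frozen increments and invariance under changes of parameter\<close>

lemma arc_length_reparam:
  fixes h :: "real \<Rightarrow> 'a::euclidean_space"
  assumes h: "abs_continuous_on {0..} h" and \<beta>: "\<beta> \<in> reparam \<infinity>" and t: "0 \<le> t"
  shows "arc_length (\<lambda>t. h (\<beta> t)) t = arc_length h (\<beta> t)"
proof (rule antisym)
  let ?i = "the_inv_into {0..} \<beta>"
  have hb: "abs_continuous_on {0..} (\<lambda>t. h (\<beta> t))"
    by (rule abs_continuous_on_reparam[OF \<beta>]) (use h in simp)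
  show "arc_length (\<lambda>t. h (\<beta> t)) t \<le> arc_length h (\<beta> t)"
    by (rule arc_length_compose_le[OF abs_continuous_on_restrict[OF h] abs_continuous_on_restrict[OF hb] t])
      (use reparam_nonneg[OF \<beta>] reparam_mono[OF \<beta>] in auto)
  have inv: "?i \<in> reparam \<infinity>" by (rule reparam_inverse[OF \<beta>])
  have bt: "0 \<le> \<beta> t" by (rule reparam_nonneg[OF \<beta> t])
  have eq: "h (\<beta> (?i s)) = h s" if "0 \<le> s" for s using reparam_inv[OF \<beta>, of s] that by simp
  have it: "?i (\<beta> t) = t" by (rule reparam_inv_val[OF \<beta> t])
  have "arc_length h (\<beta> t) = arc_length (\<lambda>s. h (\<beta> (?i s))) (\<beta> t)"
    by (rule arc_length_cong) (simp add: eq)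
  also have "\<dots> \<le> arc_length (\<lambda>t. h (\<beta> t)) (?i (\<beta> t))"
  proof (rule arc_length_compose_le[where g = "\<lambda>t. h (\<beta> t)" and \<beta> = ?i and b = "\<beta> t"])
    show "abs_continuous_on {0..\<beta> t} (\<lambda>s. h (\<beta> (?i s)))"
      using abs_continuous_on_cong[of "{0..\<beta> t}" "\<lambda>s. h (\<beta> (?i s))" h] abs_continuous_on_restrict[OF h] eq by simp
  qed (use bt abs_continuous_on_restrict[OF hb] reparam_nonneg[OF inv] reparam_mono[OF inv] in auto)
  finally show "arc_length h (\<beta> t) \<le> arc_length (\<lambda>t. h (\<beta> t)) t" by (simp add: it)
qed

text \<open>The fixed linear map \<open>F q\<close> can be pulled out of the integral of the
  velocity, so the error is only the oscillation \<open>\<omega>\<close> of the field times the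
  length. The state function \<open>y\<close> and the driver \<open>g\<close> are independent of
  each other, which lets one state function be tested along two drivers.\<close>

lemma frozen_increment:
  fixes F :: "'a::euclidean_space \<Rightarrow> 'b::euclidean_space \<Rightarrow> 'a"
  assumes F: "loc_lip F" and g: "abs_continuous_on {0..} g" and y: "continuous_on {0..b} y"
    and ab: "0 \<le> a" "a \<le> b"
    and \<omega>: "\<And>s p. a \<le> s \<Longrightarrow> s \<le> b \<Longrightarrow> norm (F (y s) p - F q p) \<le> \<omega> * norm p"
  shows "norm (integral {0..b} (\<lambda>s. F (y s) (vector_derivative g (at s))) -
      integral {0..a} (\<lambda>s. F (y s) (vector_derivative g (at s))) - F q (g b - g a))
     \<le> \<omega> * (arc_length g b - arc_length g a)"
proof -
  let ?g' = "\<lambda>s. vector_derivative g (at s)"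
  have gb: "abs_continuous_on {0..b} g" by (rule abs_continuous_on_restrict[OF g])
  have int: "(\<lambda>s. F (y s) (?g' s)) integrable_on {0..b}"
    using absolutely_integrable_drive_loc_lip[OF F gb y] by (simp add: absolutely_integrable_on_def)
  have intab: "(\<lambda>s. F (y s) (?g' s)) integrable_on {a..b}"
    by (rule integrable_on_subinterval[OF int]) (use ab in auto)
  have "integral {0..a} (\<lambda>s. F (y s) (?g' s)) + integral {a..b} (\<lambda>s. F (y s) (?g' s)) = integral {0..b} (\<lambda>s. F (y s) (?g' s))"
    by (rule Henstock_Kurzweil_Integration.integral_combine[OF ab int])
  note comb = this
  have 1: "integral {0..b} (\<lambda>s. F (y s) (?g' s)) - integral {0..a} (\<lambda>s. F (y s) (?g' s)) = integral {a..b} (\<lambda>s. F (y s) (?g' s))"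
    unfolding comb[symmetric] by (rule add_diff_cancel_left')
  have bl: "bounded_linear (F q)" using loc_lip_linear[OF F] by (simp add: linear_conv_bounded_linear)
  have "(?g' has_integral (g b - g a)) {a..b}"
    by (rule abs_continuous_on_has_integral_derivative[OF ab(2) abs_continuous_on_subset[OF gb]]) (use ab in auto)
  from has_integral_linear[OF this bl] have 2: "((\<lambda>s. F q (?g' s)) has_integral F q (g b - g a)) {a..b}" by (simp add: o_def)
  have "integral {a..b} (\<lambda>s. F (y s) (?g' s)) - F q (g b - g a) = integral {a..b} (\<lambda>s. F (y s) (?g' s) - F q (?g' s))"
    using integral_diff[OF intab has_integral_integrable[OF 2]] integral_unique[OF 2] by simp
  also have "norm \<dots> \<le> integral {a..b} (\<lambda>s. \<omega> * norm (?g' s))"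
  proof (rule integral_norm_bound_integral)
    show "(\<lambda>s. F (y s) (?g' s) - F q (?g' s)) integrable_on {a..b}"
      by (rule integrable_diff[OF intab has_integral_integrable[OF 2]])
    show "(\<lambda>s. \<omega> * norm (?g' s)) integrable_on {a..b}"
      by (rule integrable_on_mult_right[OF integrable_norm_derivative[OF gb ab(1) order.refl]])
    show "norm (F (y s) (?g' s) - F q (?g' s)) \<le> \<omega> * norm (?g' s)" if "s \<in> {a..b}" for s
      using that by (intro \<omega>) auto
  qed
  also have "\<dots> = \<omega> * (arc_length g b - arc_length g a)"
    by (simp add: arc_length_diff[OF gb ab order.refl])
  finally show ?thesis unfolding 1 .
qed

lemma solves_on_eq_integral:
  assumes "solves_on F h x0 {0..} y" "0 \<le> t"
  shows "y t = x0 + integral {0..t} (\<lambda>s. F (y s) (vector_derivative h (at s)))" "continuous_on {0..t} y"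
proof -
  have *: "continuous_on {0..t} y \<and> ((\<lambda>s. F (y s) (vector_derivative h (at s))) has_integral (y t - x0)) {0..t}"
    using assms unfolding solves_on_def by simp
  then show "continuous_on {0..t} y" by simp
  from * have "integral {0..t} (\<lambda>s. F (y s) (vector_derivative h (at s))) = y t - x0"
    by (intro integral_unique) simp
  then show "y t = x0 + integral {0..t} (\<lambda>s. F (y s) (vector_derivative h (at s)))" by simp
qed

text \<open>The increments of a solution are characterized, without derivatives, by invariants of the
  parametrization: divide by the increment of the parameter and let it tend to zero.\<close>

lemma solves_onI_frozen:
  fixes F :: "'a::euclidean_space \<Rightarrow> 'b::euclidean_space \<Rightarrow> 'a"
  assumes F: "loc_lip F" and k: "abs_continuous_on {0..} k" and x: "abs_continuous_on {0..} x" and x0: "x 0 = x0"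
    and fr: "\<And>a b \<omega>. 0 \<le> a \<Longrightarrow> a \<le> b \<Longrightarrow> (\<And>s p. a \<le> s \<Longrightarrow> s \<le> b \<Longrightarrow> norm (F (x s) p - F (x a) p) \<le> \<omega> * norm p) \<Longrightarrow>
      norm (x b - x a - F (x a) (k b - k a)) \<le> \<omega> * (arc_length k b - arc_length k a)"
  shows "solves_on F k x0 {0..} x"
  unfolding solves_on_def
proof (rule ballI, rule conjI)
  fix b :: real assume "b \<in> {0..}"
  then have b: "0 \<le> b" by simp
  let ?k' = "\<lambda>s. vector_derivative k (at s)" and ?x' = "\<lambda>s. vector_derivative x (at s)"
  have xb: "abs_continuous_on {0..c} x" and kb: "abs_continuous_on {0..c} k" for c
    by (rule abs_continuous_on_restrict[OF x], rule abs_continuous_on_restrict[OF k])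
  show "continuous_on {0..b} x" by (rule abs_continuous_on_imp_continuous_on_Icc[OF xb])
  define N where "N = {s \<in> {0..b}. \<not> (x has_vector_derivative ?x' s) (at s)} \<union>
      {s \<in> {0..b}. \<not> (k has_vector_derivative ?k' s) (at s)} \<union>
      {s \<in> {0..b}. \<not> (arc_length k has_vector_derivative norm (?k' s)) (at s)}"
  have "negligible N" unfolding N_def
    by (intro negligible_Un abs_continuous_on_negligible_derivative xb kb negligible_arc_length_derivative)
  have "((\<lambda>s. F (x s) (?k' s)) has_integral (x b - x 0)) {0..b}"
  proof (rule fundamental_theorem_of_calculus_abs_continuous[OF b xb \<open>negligible N\<close>])
    fix t assume t: "t \<in> {0..b} - N"
    then have "0 \<le> t" and d: "(x has_vector_derivative ?x' t) (at t)" "(k has_vector_derivative ?k' t) (at t)"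
      "(arc_length k has_vector_derivative norm (?k' t)) (at t)" by (auto simp: N_def)
    obtain R where R: "0 < R" "\<And>s. s \<in> {0..t + 1} \<Longrightarrow> norm (x s) \<le> R"
      by (rule bounded_on_Icc[OF abs_continuous_on_imp_continuous_on_Icc[OF xb[of "t + 1"]]]) blast
    obtain M where M: "glip M (cutoff R F)" using F R(1) unfolding loc_lip_def by blast
    have M0: "0 \<le> M" by (rule glipD(1)[OF M])
    have lin: "linear (F (x t))" by (rule loc_lip_linear[OF F])
    define K where "K = norm (?k' t)"
    have "norm (?x' t - F (x t) (?k' t)) \<le> e * (2 + K + M)" if e: "0 < e" "e \<le> 1" for e
    proof -
      obtain d1 where d1: "0 < d1" "\<And>u v. u \<le> t \<Longrightarrow> t \<le> v \<Longrightarrow> v - u < d1 \<Longrightarrow> norm (x v - x u - (v - u) *\<^sub>R ?x' t) \<le> e * (v - u)"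
        by (rule straddle[OF d(1) e(1)]) blast
      obtain d2 where d2: "0 < d2" "\<And>u v. u \<le> t \<Longrightarrow> t \<le> v \<Longrightarrow> v - u < d2 \<Longrightarrow> norm (k v - k u - (v - u) *\<^sub>R ?k' t) \<le> e * (v - u)"
        by (rule straddle[OF d(2) e(1)]) blast
      obtain d3 where d3: "0 < d3" "\<And>u v. u \<le> t \<Longrightarrow> t \<le> v \<Longrightarrow> v - u < d3 \<Longrightarrow>
          norm (arc_length k v - arc_length k u - (v - u) *\<^sub>R norm (?k' t)) \<le> e * (v - u)"
        by (rule straddle[OF d(3) e(1)]) blast
      have "0 < e / (M + 1)" using e M0 by simp
      obtain d4 where d4: "0 < d4" "\<And>s r. s \<in> {0..t + 1} \<Longrightarrow> r \<in> {0..t + 1} \<Longrightarrow> \<bar>r - s\<bar> < d4 \<Longrightarrow> norm (x r - x s) < e / (M + 1)"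
        by (rule abs_continuous_on_close[OF xb[of "t + 1"] order.refl \<open>0 < e / (M + 1)\<close>]) blast
      define r where "r = min (min d1 d2) (min d3 (min d4 1)) / 2"
      have r: "0 < r" "r < d1" "r < d2" "r < d3" "r < d4" "r \<le> 1" using d1(1) d2(1) d3(1) d4(1) by (auto simp: r_def)
      define v where "v = t + r"
      have vt: "v - t = r" "t \<le> v" using r by (auto simp: v_def)
      have fz: "norm (F (x s) p - F (x t) p) \<le> e * norm p" if s: "t \<le> s" "s \<le> v" for s p
      proof -
        have mem: "s \<in> {0..t + 1}" "t \<in> {0..t + 1}" using s \<open>0 \<le> t\<close> r by (auto simp: v_def)
        have "norm (F (x s) p - F (x t) p) = norm (cutoff R F (x s) p - cutoff R F (x t) p)"
          using R(2)[OF mem(1)] R(2)[OF mem(2)] by (simp add: cutoff_eq)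
        also have "\<dots> \<le> M * norm (x s - x t) * norm p" by (rule glipD(4)[OF M])
        also have "\<dots> \<le> (M + 1) * (e / (M + 1)) * norm p"
        proof (intro mult_right_mono mult_mono)
          show "norm (x s - x t) \<le> e / (M + 1)" using d4(2)[OF mem(2,1)] s r by (auto simp: v_def)
        qed (use M0 e in auto)
        also have "\<dots> = e * norm p" using M0 by simp
        finally show ?thesis .
      qed
      have 1: "norm (x v - x t - F (x t) (k v - k t)) \<le> e * (arc_length k v - arc_length k t)"
        by (rule fr[OF \<open>0 \<le> t\<close> vt(2) fz])
      have 2: "norm (x v - x t - r *\<^sub>R ?x' t) \<le> e * r" using d1(2)[of t v] vt r by simp
      have 3: "norm (k v - k t - r *\<^sub>R ?k' t) \<le> e * r" using d2(2)[of t v] vt r by simp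
      have "\<bar>arc_length k v - arc_length k t - r * K\<bar> \<le> e * r" using d3(2)[of t v] vt r by (simp add: K_def)
      then have "arc_length k v - arc_length k t \<le> r * K + e * r" by linarith
      also have "\<dots> \<le> r * (K + 1)" using r e by (simp add: algebra_simps)
      finally have 4: "e * (arc_length k v - arc_length k t) \<le> e * (r * (K + 1))" using e by (intro mult_left_mono) auto
      have "norm (F (x t) (k v - k t - r *\<^sub>R ?k' t)) = norm (cutoff R F (x t) (k v - k t - r *\<^sub>R ?k' t))"
        using R(2)[of t] \<open>0 \<le> t\<close> by (simp add: cutoff_eq)
      also have "\<dots> \<le> M * norm (k v - k t - r *\<^sub>R ?k' t)" by (rule glipD(3)[OF M])
      also have "\<dots> \<le> M * (e * r)" using 3 M0 by (intro mult_left_mono)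
      finally have 5: "norm (F (x t) (k v - k t - r *\<^sub>R ?k' t)) \<le> M * (e * r)" .
      have "r *\<^sub>R (?x' t - F (x t) (?k' t)) = (x v - x t - F (x t) (k v - k t)) - (x v - x t - r *\<^sub>R ?x' t)
          + F (x t) (k v - k t - r *\<^sub>R ?k' t)"
        using lin by (simp add: linear_diff linear_add linear_cmul algebra_simps)
      also have "norm \<dots> \<le> e * (r * (K + 1)) + e * r + M * (e * r)"
        using norm_triangle_ineq[of "(x v - x t - F (x t) (k v - k t)) - (x v - x t - r *\<^sub>R ?x' t)" "F (x t) (k v - k t - r *\<^sub>R ?k' t)"]
          norm_triangle_ineq4[of "x v - x t - F (x t) (k v - k t)" "x v - x t - r *\<^sub>R ?x' t"] 1 2 4 5 by linarith
      also have "\<dots> = r * (e * (2 + K + M))" by (simp add: algebra_simps)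
      finally have "r * norm (?x' t - F (x t) (?k' t)) \<le> r * (e * (2 + K + M))" using r by simp
      then show ?thesis using r(1) mult_le_cancel_left_pos by blast
    qed
    note bound = this
    have "?x' t = F (x t) (?k' t)"
    proof (rule ccontr)
      assume "?x' t \<noteq> F (x t) (?k' t)"
      then have pos: "0 < norm (?x' t - F (x t) (?k' t))" by simp
      define n where "n = norm (?x' t - F (x t) (?k' t))"
      define c where "c = 2 + K + M"
      have "0 < c" using M0 by (simp add: c_def K_def add_pos_nonneg)
      define e where "e = min 1 (n / (2 * c))"
      have "0 < e" "e \<le> 1" using pos \<open>0 < c\<close> by (auto simp: e_def n_def)
      from bound[OF this] have "n \<le> e * c" by (simp add: n_def c_def)
      also have "\<dots> \<le> n / (2 * c) * c" using \<open>0 < c\<close> by (intro mult_right_mono) (auto simp: e_def)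
      also have "\<dots> = n / 2" using \<open>0 < c\<close> by simp
      finally show False using pos by (simp add: n_def)
    qed
    then show "(x has_vector_derivative F (x t) (?k' t)) (at t within {0..b})"
      using d(1) by (simp add: has_vector_derivative_at_within)
  qed
  then show "((\<lambda>s. F (x s) (?k' s)) has_integral (x b - x0)) {0..b}" by (simp add: x0)
qed

lemma solves_on_reparam:
  fixes F :: "'a::euclidean_space \<Rightarrow> 'b::euclidean_space \<Rightarrow> 'a"
  assumes F: "loc_lip F" and h: "abs_continuous_on {0..} h" and \<beta>: "\<beta> \<in> reparam \<infinity>"
    and y: "solves_on F h x0 {0..} y"
  shows "solves_on F (\<lambda>t. h (\<beta> t)) x0 {0..} (\<lambda>t. y (\<beta> t))"
proof (rule solves_onI_frozen[OF F])
  have ac: "abs_continuous_on {0..} y" by (rule solves_on_ac[OF F h y]) simp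
  show "abs_continuous_on {0..} (\<lambda>t. h (\<beta> t))" "abs_continuous_on {0..} (\<lambda>t. y (\<beta> t))"
    by (rule abs_continuous_on_reparam[OF \<beta>]; simp add: h ac)+
  show "y (\<beta> 0) = x0" using solves_on_eq_integral(1)[OF y, of 0] by (simp add: reparam_0[OF \<beta>])
  fix a b \<omega> assume ab: "0 \<le> a" "a \<le> b"
    and \<omega>: "\<And>s p. a \<le> s \<Longrightarrow> s \<le> b \<Longrightarrow> norm (F (y (\<beta> s)) p - F (y (\<beta> a)) p) \<le> \<omega> * norm p"
  have "0 \<le> b" using ab by simp
  note \<beta>a = reparam_nonneg[OF \<beta> ab(1)] and \<beta>b = reparam_nonneg[OF \<beta> \<open>0 \<le> b\<close>] and \<beta>ab = reparam_mono[OF \<beta> ab]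
  have "norm (integral {0..\<beta> b} (\<lambda>s. F (y s) (vector_derivative h (at s))) -
      integral {0..\<beta> a} (\<lambda>s. F (y s) (vector_derivative h (at s))) - F (y (\<beta> a)) (h (\<beta> b) - h (\<beta> a)))
     \<le> \<omega> * (arc_length h (\<beta> b) - arc_length h (\<beta> a))"
  proof (rule frozen_increment[OF F h solves_on_eq_integral(2)[OF y \<beta>b] \<beta>a \<beta>ab])
    fix s p assume s: "\<beta> a \<le> s" "s \<le> \<beta> b"
    let ?s = "the_inv_into {0..} \<beta> s"
    have i: "0 \<le> ?s" "\<beta> ?s = s" using reparam_inv[OF \<beta>, of s] s \<beta>a by auto
    have "a \<le> ?s" "?s \<le> b" using reparam_le_iff[OF \<beta> ab(1) i(1)] reparam_le_iff[OF \<beta> i(1) \<open>0 \<le> b\<close>] s i(2) by auto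
    from \<omega>[OF this, of p] show "norm (F (y s) p - F (y (\<beta> a)) p) \<le> \<omega> * norm p" by (simp add: i(2))
  qed
  then show "norm (y (\<beta> b) - y (\<beta> a) - F (y (\<beta> a)) (h (\<beta> b) - h (\<beta> a)))
     \<le> \<omega> * (arc_length (\<lambda>t. h (\<beta> t)) b - arc_length (\<lambda>t. h (\<beta> t)) a)"
    by (simp add: arc_length_reparam[OF h \<beta> ab(1)] arc_length_reparam[OF h \<beta> \<open>0 \<le> b\<close>]
        solves_on_eq_integral(1)[OF y \<beta>a] solves_on_eq_integral(1)[OF y \<beta>b] del: Icc_eq_Icc)
qed

section \<open>Continuous dependence, with convergence of lengths\<close>

text \<open>The square of the left side is \<open>2 * norm p * (norm p - p \<bullet> e)\<close>; the
  arithmetic-geometric mean inequality with weight \<open>\<kappa>\<close> removes the root. The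
  result is linear in \<open>norm p\<close> and \<open>p \<bullet> e\<close> and can be
  integrated.\<close>

lemma norm_diff_direction_le:
  fixes p e :: "'a::real_inner"
  assumes "norm e = 1" "0 < \<kappa>"
  shows "norm (p - norm p *\<^sub>R e) \<le> \<kappa> * norm p + (norm p - p \<bullet> e) / (2 * \<kappa>)"
proof (rule power2_le_imp_le)
  have "p \<bullet> e \<le> norm p" using Cauchy_Schwarz_ineq2[of p e] assms(1) by simp
  then have b: "0 \<le> norm p - p \<bullet> e" by simp
  have ee: "e \<bullet> e = 1" using assms(1) by (simp add: norm_eq_sqrt_inner)
  have "(norm (p - norm p *\<^sub>R e))\<^sup>2 = 2 * norm p * (norm p - p \<bullet> e)"
  proof -
    have "(p - a *\<^sub>R e) \<bullet> (p - a *\<^sub>R e) = p \<bullet> p - 2 * a * (p \<bullet> e) + a * a * (e \<bullet> e)" for a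
      by (simp add: inner_diff_left inner_diff_right inner_commute algebra_simps)
    from this[of "norm p"] have "(norm (p - norm p *\<^sub>R e))\<^sup>2 = (norm p)\<^sup>2 - 2 * norm p * (p \<bullet> e) + norm p * norm p"
      unfolding power2_norm_eq_inner ee by simp
    then show ?thesis by (simp add: power2_eq_square algebra_simps)
  qed
  also have "\<dots> \<le> 2 * norm p * (norm p - p \<bullet> e) + (\<kappa> * norm p - (norm p - p \<bullet> e) / (2 * \<kappa>))\<^sup>2" by simp
  also have "\<dots> = (\<kappa> * norm p + (norm p - p \<bullet> e) / (2 * \<kappa>))\<^sup>2"
  proof -
    have "(\<kappa> * norm p) * ((norm p - p \<bullet> e) / (2 * \<kappa>)) = norm p * (norm p - p \<bullet> e) / 2" using assms(2) by simp
    then show ?thesis using assms(2) by (simp add: power2_sum power2_diff)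
  qed
  finally show "(norm (p - norm p *\<^sub>R e))\<^sup>2 \<le> (\<kappa> * norm p + (norm p - p \<bullet> e) / (2 * \<kappa>))\<^sup>2" .
  show "0 \<le> \<kappa> * norm p + (norm p - p \<bullet> e) / (2 * \<kappa>)" using assms(2) b by simp
qed

text \<open>A piece of a curve whose length \<open>l\<close> is close to the distance of its end points has nearly constant
  direction, so that its image under a linear map is nearly as long as the image of the chord.\<close>

lemma length_frozen_piece:
  fixes F :: "'a::euclidean_space \<Rightarrow> 'b::euclidean_space \<Rightarrow> 'a"
  assumes F: "glip M F" and g: "abs_continuous_on {0..} g" and y: "continuous_on {0..b} y"
    and ab: "0 \<le> a" "a \<le> b" and "0 < \<kappa>"
    and \<omega>: "\<And>s p. a \<le> s \<Longrightarrow> s \<le> b \<Longrightarrow> norm (F (y s) p - F q p) \<le> \<omega> * norm p"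
  defines "l \<equiv> arc_length g b - arc_length g a"
  shows "\<bar>(integral {0..b} (\<lambda>s. norm (F (y s) (vector_derivative g (at s)))) -
      integral {0..a} (\<lambda>s. norm (F (y s) (vector_derivative g (at s))))) - norm (F q (g b - g a))\<bar>
     \<le> (\<omega> + M * \<kappa>) * l + (M + M / (2 * \<kappa>)) * (l - norm (g b - g a))"
proof -
  let ?g' = "\<lambda>s. vector_derivative g (at s)"
  define \<Delta> where "\<Delta> = g b - g a"
  have M0: "0 \<le> M" by (rule glipD(1)[OF F])
  have gb: "abs_continuous_on {0..b} g" by (rule abs_continuous_on_restrict[OF g])
  have int: "(\<lambda>s. norm (F (y s) (?g' s))) integrable_on {0..b}"
    using AC_drive[OF F gb y] by (simp add: absolutely_integrable_on_def)
  have intab: "(\<lambda>s. norm (F (y s) (?g' s))) integrable_on {a..b}"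
    by (rule integrable_on_subinterval[OF int]) (use ab in auto)
  define J where "J = integral {a..b} (\<lambda>s. norm (F (y s) (?g' s)))"
  have J: "integral {0..b} (\<lambda>s. norm (F (y s) (?g' s))) - integral {0..a} (\<lambda>s. norm (F (y s) (?g' s))) = J"
    using Henstock_Kurzweil_Integration.integral_combine[OF ab int] by (simp add: J_def algebra_simps)
  have g'i: "?g' absolutely_integrable_on {a..b}"
    by (rule abs_continuous_on_absolutely_integrable_derivative[OF abs_continuous_on_subset[OF gb]]) (use ab in auto)
  have g'h: "(?g' has_integral \<Delta>) {a..b}" unfolding \<Delta>_def
    by (rule abs_continuous_on_has_integral_derivative[OF ab(2) abs_continuous_on_subset[OF gb]]) (use ab in auto)
  have bl: "bounded_linear (F q)" using glipD(2)[OF F] by (simp add: linear_conv_bounded_linear)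
  have Fqi: "(\<lambda>s. F q (?g' s)) absolutely_integrable_on {a..b}"
    using absolutely_integrable_linear[OF g'i bl] by (simp add: o_def)
  then have nFqi: "(\<lambda>s. norm (F q (?g' s))) integrable_on {a..b}" by (simp add: absolutely_integrable_on_def)
  have ng: "(\<lambda>s. norm (?g' s)) integrable_on {a..b}" using g'i by (simp add: absolutely_integrable_on_def)
  have l: "integral {a..b} (\<lambda>s. norm (?g' s)) = l" by (simp add: l_def arc_length_diff[OF gb ab order.refl])
  have lh: "((\<lambda>s. norm (?g' s)) has_integral l) {a..b}" using ng l by (simp add: has_integral_integrable_integral)
  define J0 where "J0 = integral {a..b} (\<lambda>s. norm (F q (?g' s)))"
  have JJ0: "\<bar>J - J0\<bar> \<le> \<omega> * l"
  proof -
    have "J - J0 = integral {a..b} (\<lambda>s. norm (F (y s) (?g' s)) - norm (F q (?g' s)))"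
      unfolding J_def J0_def by (rule integral_diff[OF intab nFqi, symmetric])
    also have "norm \<dots> \<le> integral {a..b} (\<lambda>s. \<omega> * norm (?g' s))"
    proof (rule integral_norm_bound_integral[OF integrable_diff[OF intab nFqi] integrable_on_mult_right[OF ng]])
      fix s assume s: "s \<in> {a..b}"
      have "norm (norm (F (y s) (?g' s)) - norm (F q (?g' s))) \<le> norm (F (y s) (?g' s) - F q (?g' s))"
        by (simp add: norm_triangle_ineq3)
      also have "\<dots> \<le> \<omega> * norm (?g' s)" using s by (intro \<omega>) auto
      finally show "norm (norm (F (y s) (?g' s)) - norm (F q (?g' s))) \<le> \<omega> * norm (?g' s)" .
    qed
    also have "\<dots> = \<omega> * l" by (simp add: l)
    finally show ?thesis by simp
  qed
  have low: "norm (F q \<Delta>) \<le> J0"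
  proof -
    from has_integral_linear[OF g'h bl] have hi: "((\<lambda>s. F q (?g' s)) has_integral F q \<Delta>) {a..b}" by (simp add: o_def)
    have "norm (integral {a..b} (\<lambda>s. F q (?g' s))) \<le> J0"
      unfolding J0_def by (rule integral_norm_bound_integral[OF has_integral_integrable[OF hi] nFqi]) simp
    then show ?thesis by (simp add: integral_unique[OF hi])
  qed
  have dl: "norm \<Delta> \<le> l" unfolding \<Delta>_def l_def by (rule norm_diff_le_arc_length[OF gb ab order.refl])
  have up: "J0 \<le> norm (F q \<Delta>) + M * \<kappa> * l + (M + M / (2 * \<kappa>)) * (l - norm \<Delta>)"
  proof (cases "\<Delta> = 0")
    \<comment> \<open>Without a chord there is no direction; the defect
      \<open>l - norm \<Delta>\<close> is then the whole length, and its term with coefficient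
      \<open>M\<close> suffices.\<close>
    case True
    have "J0 \<le> integral {a..b} (\<lambda>s. M * norm (?g' s))"
      unfolding J0_def by (rule integral_le[OF nFqi integrable_on_mult_right[OF ng] glipD(3)[OF F]])
    then have "J0 \<le> M * l" by (simp add: l)
    moreover have "0 \<le> l" using dl True by simp
    then have "0 \<le> M * \<kappa> * l" "0 \<le> M / (2 * \<kappa>) * l" using M0 \<open>0 < \<kappa>\<close> by auto
    ultimately show ?thesis using True linear_0[OF glipD(2)[OF F]] by (simp add: algebra_simps)
  next
    case False
    define e where "e = \<Delta> /\<^sub>R norm \<Delta>"
    have e1: "norm e = 1" using False by (simp add: e_def)
    have \<Delta>e: "\<Delta> = norm \<Delta> *\<^sub>R e" using False by (simp add: e_def)
    have "\<Delta> \<bullet> e = norm \<Delta>" using False by (simp add: e_def power2_norm_eq_inner[symmetric] power2_eq_square)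
    then have ih: "((\<lambda>s. ?g' s \<bullet> e) has_integral norm \<Delta>) {a..b}"
      using has_integral_linear[OF g'h bounded_linear_inner_left[of e]] by (simp add: o_def)
    \<comment> \<open>The pointwise bound is linear in \<open>norm ?p\<close> and
      \<open>?p \<bullet> e\<close>, whose integrals are \<open>l\<close> and
      \<open>norm \<Delta>\<close>; what remains is the defect \<open>l - norm \<Delta>\<close> and
      a term of order \<open>\<kappa>\<close>.\<close>
    define c where "c = norm (F q e) + M * \<kappa> + M / (2 * \<kappa>)"
    have rh: "((\<lambda>s. c * norm (?g' s) - M / (2 * \<kappa>) * (?g' s \<bullet> e)) has_integral (c * l - M / (2 * \<kappa>) * norm \<Delta>)) {a..b}"
      by (rule has_integral_diff[OF has_integral_mult_right[OF lh] has_integral_mult_right[OF ih]])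
    have "J0 \<le> c * l - M / (2 * \<kappa>) * norm \<Delta>"
      unfolding J0_def integral_unique[OF rh, symmetric]
    proof (rule integral_le[OF nFqi has_integral_integrable[OF rh]])
      fix s
      let ?p = "?g' s"
      have "F q ?p = norm ?p *\<^sub>R F q e + F q (?p - norm ?p *\<^sub>R e)"
        using glipD(2)[OF F, of q] by (simp add: linear_diff linear_cmul)
      then have "norm (F q ?p) \<le> norm ?p * norm (F q e) + norm (F q (?p - norm ?p *\<^sub>R e))"
        using norm_triangle_ineq[of "norm ?p *\<^sub>R F q e" "F q (?p - norm ?p *\<^sub>R e)"] by simp
      also have "norm (F q (?p - norm ?p *\<^sub>R e)) \<le> M * norm (?p - norm ?p *\<^sub>R e)" by (rule glipD(3)[OF F])
      also have "\<dots> \<le> M * (\<kappa> * norm ?p + (norm ?p - ?p \<bullet> e) / (2 * \<kappa>))"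
        by (rule mult_left_mono[OF norm_diff_direction_le[OF e1 \<open>0 < \<kappa>\<close>] M0])
      finally show "norm (F q ?p) \<le> c * norm ?p - M / (2 * \<kappa>) * (?p \<bullet> e)"
        by (simp add: c_def algebra_simps diff_divide_distrib)
    qed
    also have "c * l - M / (2 * \<kappa>) * norm \<Delta> =
        norm (F q e) * norm \<Delta> + norm (F q e) * (l - norm \<Delta>) + M * \<kappa> * l + M / (2 * \<kappa>) * (l - norm \<Delta>)"
      by (simp add: c_def algebra_simps diff_divide_distrib)
    also have "norm (F q e) * norm \<Delta> = norm (F q \<Delta>)"
      by (subst (2) \<Delta>e) (simp add: linear_cmul[OF glipD(2)[OF F]])
    also have "norm (F q e) * (l - norm \<Delta>) \<le> M * (l - norm \<Delta>)"
      using glipD(3)[OF F, of q e] e1 dl by (intro mult_right_mono) auto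
    finally show ?thesis by (simp add: algebra_simps)
  qed
  have "0 \<le> l" using dl norm_ge_zero[of \<Delta>] by linarith
  then have "0 \<le> M * \<kappa> * l" using M0 \<open>0 < \<kappa>\<close> by simp
  moreover have "0 \<le> (M + M / (2 * \<kappa>)) * (l - norm \<Delta>)"
    using M0 \<open>0 < \<kappa>\<close> dl by (intro mult_nonneg_nonneg) auto
  ultimately have "\<bar>J - norm (F q \<Delta>)\<bar> \<le> \<omega> * l + M * \<kappa> * l + (M + M / (2 * \<kappa>)) * (l - norm \<Delta>)"
    using JJ0 low up by linarith
  then show ?thesis unfolding J \<Delta>_def[symmetric] by (simp only: distrib_right)
qed

text \<open>Summed over the partition, the defects of the pieces add up to the length minus the
  inscribed polygon, which is small for a fine partition.\<close>

lemma length_frozen: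
  fixes F :: "'a::euclidean_space \<Rightarrow> 'b::euclidean_space \<Rightarrow> 'a" and \<tau> :: "nat \<Rightarrow> real"
  assumes F: "glip M F" and g: "abs_continuous_on {0..} g" and y: "\<And>b. continuous_on {0..b} y"
    and \<tau>: "\<tau> 0 = 0" "\<And>i. i < m \<Longrightarrow> \<tau> i \<le> \<tau> (Suc i)" and "0 < \<kappa>"
    and \<omega>: "\<And>i s p. i < m \<Longrightarrow> \<tau> i \<le> s \<Longrightarrow> s \<le> \<tau> (Suc i) \<Longrightarrow> norm (F (y s) p - F (q i) p) \<le> \<omega> * norm p"
  shows "\<bar>integral {0..\<tau> m} (\<lambda>s. norm (F (y s) (vector_derivative g (at s)))) -
      (\<Sum>i<m. norm (F (q i) (g (\<tau> (Suc i)) - g (\<tau> i))))\<bar>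
     \<le> (\<omega> + M * \<kappa>) * arc_length g (\<tau> m) +
        (M + M / (2 * \<kappa>)) * (arc_length g (\<tau> m) - (\<Sum>i<m. norm (g (\<tau> (Suc i)) - g (\<tau> i))))"
proof -
  define \<Phi> where "\<Phi> = (\<lambda>t. integral {0..t} (\<lambda>s. norm (F (y s) (vector_derivative g (at s)))))"
  have \<tau>0: "0 \<le> \<tau> i" if "i \<le> m" for i
    using that by (induction i) (use \<tau> in \<open>auto intro: order_trans\<close>)
  have "\<Phi> (\<tau> m) - \<Phi> (\<tau> 0) = (\<Sum>i<m. \<Phi> (\<tau> (Suc i)) - \<Phi> (\<tau> i))"
    by (rule sum_lessThan_telescope[of "\<lambda>i. \<Phi> (\<tau> i)", symmetric])
  moreover have "\<Phi> (\<tau> 0) = 0" by (simp add: \<Phi>_def \<tau>(1))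
  ultimately have "\<bar>\<Phi> (\<tau> m) - (\<Sum>i<m. norm (F (q i) (g (\<tau> (Suc i)) - g (\<tau> i))))\<bar> =
      \<bar>\<Sum>i<m. (\<Phi> (\<tau> (Suc i)) - \<Phi> (\<tau> i)) - norm (F (q i) (g (\<tau> (Suc i)) - g (\<tau> i)))\<bar>"
    by (simp add: sum_subtractf)
  also have "\<dots> \<le> (\<Sum>i<m. \<bar>(\<Phi> (\<tau> (Suc i)) - \<Phi> (\<tau> i)) - norm (F (q i) (g (\<tau> (Suc i)) - g (\<tau> i)))\<bar>)"
    by (rule sum_abs)
  also have "\<dots> \<le> (\<Sum>i<m. (\<omega> + M * \<kappa>) * (arc_length g (\<tau> (Suc i)) - arc_length g (\<tau> i)) +
        (M + M / (2 * \<kappa>)) * ((arc_length g (\<tau> (Suc i)) - arc_length g (\<tau> i)) - norm (g (\<tau> (Suc i)) - g (\<tau> i))))"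
  proof (rule sum_mono)
    fix i assume "i \<in> {..<m}"
    then have i: "i < m" by simp
    show "\<bar>(\<Phi> (\<tau> (Suc i)) - \<Phi> (\<tau> i)) - norm (F (q i) (g (\<tau> (Suc i)) - g (\<tau> i)))\<bar> \<le>
        (\<omega> + M * \<kappa>) * (arc_length g (\<tau> (Suc i)) - arc_length g (\<tau> i)) +
        (M + M / (2 * \<kappa>)) * ((arc_length g (\<tau> (Suc i)) - arc_length g (\<tau> i)) - norm (g (\<tau> (Suc i)) - g (\<tau> i)))"
      unfolding \<Phi>_def
      by (rule length_frozen_piece[OF F g y \<tau>0[OF less_imp_le[OF i]] \<tau>(2)[OF i] \<open>0 < \<kappa>\<close> \<omega>[OF i]])
  qed
  also have "\<dots> = (\<omega> + M * \<kappa>) * (\<Sum>i<m. arc_length g (\<tau> (Suc i)) - arc_length g (\<tau> i)) +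
     (M + M / (2 * \<kappa>)) * ((\<Sum>i<m. arc_length g (\<tau> (Suc i)) - arc_length g (\<tau> i)) - (\<Sum>i<m. norm (g (\<tau> (Suc i)) - g (\<tau> i))))"
    unfolding sum.distrib sum_distrib_left[symmetric] by (simp only: sum_subtractf)
  also have "(\<Sum>i<m. arc_length g (\<tau> (Suc i)) - arc_length g (\<tau> i)) = arc_length g (\<tau> m)"
    using sum_lessThan_telescope[of "\<lambda>i. arc_length g (\<tau> i)" m] by (simp add: \<tau>(1))
  finally show ?thesis by (simp add: \<Phi>_def)
qed

lemma glip_cutoff:
  fixes F :: "'a::euclidean_space \<Rightarrow> 'b::euclidean_space \<Rightarrow> 'a"
  assumes F: "glip M F" and "0 \<le> R"
  shows "glip M (cutoff R F)"
  unfolding glip_def cutoff_def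
proof (intro conjI allI)
  show "0 \<le> M" by (rule glipD(1)[OF F])
  fix y z :: 'a and p
  let ?c = "closest_point (cball 0 R)"
  show "linear (F (?c y))" by (rule glipD(2)[OF F])
  show "norm (F (?c y) p) \<le> M * norm p" by (rule glipD(3)[OF F])
  have "norm (?c y - ?c z) \<le> norm (y - z)"
    using closest_point_lipschitz[of "cball 0 R" y z] \<open>0 \<le> R\<close> by (simp add: dist_norm)
  then have "M * norm (?c y - ?c z) * norm p \<le> M * norm (y - z) * norm p"
    using glipD(1)[OF F] by (intro mult_right_mono mult_left_mono) auto
  then show "norm (F (?c y) p - F (?c z) p) \<le> M * norm (y - z) * norm p"
    using glipD(4)[OF F, of "?c y" p "?c z"] by linarith
qed

lemma glip_loc_lip: "glip M F \<Longrightarrow> loc_lip F"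
  unfolding loc_lip_def using glip_cutoff less_imp_le by blast

text \<open>The driver has no length after \<open>E\<close>, so the crude oscillation bound
  \<open>2 * M\<close> is enough.\<close>

lemma solves_on_const_after:
  fixes F :: "'a::euclidean_space \<Rightarrow> 'b::euclidean_space \<Rightarrow> 'a"
  assumes F: "glip M F" and h: "abs_continuous_on {0..} h" and y: "solves_on F h x0 {0..} y"
    and E: "0 \<le> E" "E \<le> t" and const: "\<And>t. E \<le> t \<Longrightarrow> h t = c"
  shows "y t = y E"
proof -
  have t0: "0 \<le> t" using E by simp
  have "norm (integral {0..t} (\<lambda>s. F (y s) (vector_derivative h (at s))) -
      integral {0..E} (\<lambda>s. F (y s) (vector_derivative h (at s))) - F (y E) (h t - h E))
     \<le> (2 * M) * (arc_length h t - arc_length h E)"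
  proof (rule frozen_increment[OF glip_loc_lip[OF F] h solves_on_eq_integral(2)[OF y t0] E])
    fix s p
    show "norm (F (y s) p - F (y E) p) \<le> 2 * M * norm p"
      using glipD(3)[OF F, of "y s" p] glipD(3)[OF F, of "y E" p] norm_triangle_ineq4[of "F (y s) p" "F (y E) p"]
      by linarith
  qed
  moreover have "arc_length h t = arc_length h E" by (rule arc_length_const_after[OF h E const])
  moreover have "h t - h E = 0" using const[of t] const[of E] E by simp
  ultimately show ?thesis
    using linear_0[OF glipD(2)[OF F]] solves_on_eq_integral(1)[OF y t0] solves_on_eq_integral(1)[OF y E(1)] by simp
qed

lemma arc_length_solution:
  fixes F :: "'a::euclidean_space \<Rightarrow> 'b::euclidean_space \<Rightarrow> 'a"
  assumes F: "loc_lip F" and h: "abs_continuous_on {0..} h" and y: "solves_on F h x0 {0..} y" and b: "0 \<le> b"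
  shows "arc_length y b = integral {0..b} (\<lambda>s. norm (F (y s) (vector_derivative h (at s))))"
proof -
  have "is_solution (drive F h) x0 \<infinity> y" using is_solution_iff[OF F h, of x0 \<infinity> y] y by simp
  then have "AE t in lebesgue. t \<in> half_open \<infinity> \<longrightarrow> (y has_vector_derivative F (y t) (vector_derivative h (at t))) (at t)"
    by (simp add: is_solution_def)
  from negligible_half_open[OF this, of b] b
  have neg: "negligible {t \<in> {0..b}. \<not> (y has_vector_derivative F (y t) (vector_derivative h (at t))) (at t)}" by simp
  show ?thesis
    unfolding arc_length_def
  proof (rule integral_spike[OF neg])
    fix t assume "t \<in> {0..b} - {t \<in> {0..b}. \<not> (y has_vector_derivative F (y t) (vector_derivative h (at t))) (at t)}"
    then have "(y has_vector_derivative F (y t) (vector_derivative h (at t))) (at t)" by simp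
    from vector_derivative_at[OF this]
    show "norm (F (y t) (vector_derivative h (at t))) = norm (vector_derivative y (at t))" by simp
  qed
qed

text \<open>\<open>W\<close> integrates the field along \<open>k\<close> with the state
  \<open>Z\<close>. The defect \<open>D\<close> of \<open>Z\<close> as a solution for
  \<open>k\<close> is bounded by freezing \<open>Z\<close> on each piece: the difference of the
  increments costs \<open>2 * M * \<delta>\<close> per piece, the freezing \<open>M * \<eta>\<close>
  times both lengths. Gronwall's inequality along \<open>k\<close> then compares \<open>Z\<close>
  with \<open>X\<close>.\<close>

lemma continuous_dependence_sup:
  fixes F :: "'a::euclidean_space \<Rightarrow> 'b::euclidean_space \<Rightarrow> 'a" and \<tau> :: "nat \<Rightarrow> real"
  assumes F: "glip M F" and h: "abs_continuous_on {0..} h" and k: "abs_continuous_on {0..} k"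
    and Z: "solves_on F h z0 {0..} Z" and X: "solves_on F k z0 {0..} X"
    and \<tau>: "\<tau> 0 = 0" "\<And>i. i < m \<Longrightarrow> \<tau> i \<le> \<tau> (Suc i)"
    and osc: "\<And>i s. i < m \<Longrightarrow> \<tau> i \<le> s \<Longrightarrow> s \<le> \<tau> (Suc i) \<Longrightarrow> norm (Z s - Z (\<tau> i)) \<le> \<eta>"
    and close: "\<And>t. 0 \<le> t \<Longrightarrow> norm (h t - k t) \<le> \<delta>" and "real m * \<delta> \<le> \<eta>" "0 \<le> \<eta>"
    and B: "arc_length h (\<tau> m) \<le> B" "arc_length k (\<tau> m) \<le> B"
    and t: "0 \<le> t" "t \<le> \<tau> m"
  shows "norm (Z t - X t) \<le> 2 * (2 * M + 2 * M * B) * exp (2 * M * B) * \<eta>"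
proof -
  let ?k' = "\<lambda>s. vector_derivative k (at s)"
  note Fl = glip_loc_lip[OF F]
  have M0: "0 \<le> M" by (rule glipD(1)[OF F])
  have hb: "abs_continuous_on {0..b} h" and kb: "abs_continuous_on {0..b} k" for b
    by (rule abs_continuous_on_restrict[OF h], rule abs_continuous_on_restrict[OF k])
  have Zc: "continuous_on {0..b} Z" and Xc: "continuous_on {0..b} X" for b
    using solves_on_eq_integral(2)[OF Z, of b] solves_on_eq_integral(2)[OF X, of b] by (cases "0 \<le> b"; simp)+
  have \<tau>0: "0 \<le> \<tau> i" if "i \<le> m" for i
    using that by (induction i) (use \<tau> in \<open>auto intro: order_trans\<close>)
  define W where "W = (\<lambda>b. integral {0..b} (\<lambda>s. F (Z s) (?k' s)))"
  define D where "D = (\<lambda>b. Z b - z0 - W b)"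
  define \<eta>2 where "\<eta>2 = (2 * M + 2 * M * B) * \<eta>"
  have int: "(\<lambda>s. F (y s) (?k' s)) integrable_on {0..b}" if "continuous_on {0..b} y" for y b
    using AC_drive[OF F kb that] by (simp add: absolutely_integrable_on_def)
  have D_le: "norm (D r) \<le> \<eta>2" if r: "0 \<le> r" "r \<le> \<tau> m" for r
  proof -
    \<comment> \<open>The partition stopped at \<open>r\<close>: later pieces collapse to a
      point.\<close>
    define c where "c = (\<lambda>i. min r (\<tau> i))"
    have piece: "norm (D (c (Suc i)) - D (c i)) \<le> 2 * M * \<delta> + M * \<eta> * (arc_length h (c (Suc i)) - arc_length h (c i)) +
        M * \<eta> * (arc_length k (c (Suc i)) - arc_length k (c i))" if i: "i < m" for i
    proof (cases "\<tau> i \<le> r")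
      case False
      then have "c (Suc i) = c i" using \<tau>(2)[OF i] by (simp add: c_def min_def)
      moreover have "0 \<le> \<delta>" using close[of 0] norm_ge_zero[of "h 0 - k 0"] by linarith
      ultimately show ?thesis using M0 by simp
    next
      case True
      define a where "a = c i"
      define b where "b = c (Suc i)"
      have ab: "0 \<le> a" "a \<le> b" "a = \<tau> i" "b \<le> \<tau> (Suc i)"
        using True r(1) \<tau>0[of i] \<tau>0[of "Suc i"] i \<tau>(2)[OF i] by (auto simp: a_def b_def c_def)
      have b0: "0 \<le> b" using ab by simp
      have fz: "norm (F (Z s) p - F (Z a) p) \<le> M * \<eta> * norm p" if s: "a \<le> s" "s \<le> b" for s p
      proof -
        have "norm (F (Z s) p - F (Z a) p) \<le> M * norm (Z s - Z a) * norm p" by (rule glipD(4)[OF F])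
        also have "norm (Z s - Z a) \<le> \<eta>" using osc[OF i, of s] s ab by simp
        then have "M * norm (Z s - Z a) * norm p \<le> M * \<eta> * norm p"
          using M0 by (intro mult_right_mono mult_left_mono) auto
        finally show ?thesis .
      qed
      have 1: "norm (Z b - Z a - F (Z a) (h b - h a)) \<le> M * \<eta> * (arc_length h b - arc_length h a)"
        using frozen_increment[OF Fl h Zc ab(1,2) fz]
        by (simp add: solves_on_eq_integral(1)[OF Z ab(1)] solves_on_eq_integral(1)[OF Z b0])
      have 2: "norm (W b - W a - F (Z a) (k b - k a)) \<le> M * \<eta> * (arc_length k b - arc_length k a)"
        unfolding W_def by (rule frozen_increment[OF Fl k Zc ab(1,2) fz])
      have "norm ((h b - k b) - (h a - k a)) \<le> \<delta> + \<delta>"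
        using norm_triangle_ineq4[of "h b - k b" "h a - k a"] close[OF b0] close[OF ab(1)] by linarith
      then have "M * norm ((h b - h a) - (k b - k a)) \<le> M * (2 * \<delta>)"
        using M0 by (intro mult_left_mono) (auto simp: algebra_simps)
      then have 3: "norm (F (Z a) ((h b - h a) - (k b - k a))) \<le> 2 * M * \<delta>"
        using glipD(3)[OF F, of "Z a" "(h b - h a) - (k b - k a)"] by linarith
      have Dba: "D b - D a = F (Z a) ((h b - h a) - (k b - k a)) + (Z b - Z a - F (Z a) (h b - h a)) - (W b - W a - F (Z a) (k b - k a))"
        using linear_diff[OF glipD(2)[OF F], of "Z a" "h b - h a" "k b - k a"] by (simp add: D_def)
      have "norm (D b - D a) \<le> norm (F (Z a) ((h b - h a) - (k b - k a))) + norm (Z b - Z a - F (Z a) (h b - h a))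
          + norm (W b - W a - F (Z a) (k b - k a))"
        unfolding Dba using norm_triangle_ineq4[of "F (Z a) ((h b - h a) - (k b - k a)) + (Z b - Z a - F (Z a) (h b - h a))" "W b - W a - F (Z a) (k b - k a)"]
          norm_triangle_ineq[of "F (Z a) ((h b - h a) - (k b - k a))" "Z b - Z a - F (Z a) (h b - h a)"] by linarith
      then show ?thesis using 1 2 3 unfolding a_def b_def by linarith
    qed
    have D0: "D 0 = 0" using solves_on_eq_integral(1)[OF Z, of 0] by (simp add: D_def W_def)
    have c0: "c 0 = 0" "c m = r" using r \<tau>(1) by (simp_all add: c_def)
    have "D r = (\<Sum>i<m. D (c (Suc i)) - D (c i))"
      using sum_lessThan_telescope[of "\<lambda>i. D (c i)" m] by (simp add: c0 D0)
    also have "norm \<dots> \<le> (\<Sum>i<m. 2 * M * \<delta> + M * \<eta> * (arc_length h (c (Suc i)) - arc_length h (c i)) +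
        M * \<eta> * (arc_length k (c (Suc i)) - arc_length k (c i)))"
    proof (rule sum_norm_le)
      fix i assume "i \<in> {..<m}"
      then have "i < m" by simp
      then show "norm (D (c (Suc i)) - D (c i)) \<le> 2 * M * \<delta> + M * \<eta> * (arc_length h (c (Suc i)) - arc_length h (c i)) +
          M * \<eta> * (arc_length k (c (Suc i)) - arc_length k (c i))" by (rule piece)
    qed
    also have "\<dots> = real m * (2 * M * \<delta>) + M * \<eta> * arc_length h r + M * \<eta> * arc_length k r"
    proof -
      have tel: "(\<Sum>i<m. M * \<eta> * (l (c (Suc i)) - l (c i))) = M * \<eta> * l r" if "l 0 = 0" for l :: "real \<Rightarrow> real"
        using sum_lessThan_telescope[of "\<lambda>i. l (c i)" m] by (simp add: c0 that flip: sum_distrib_left)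
      show ?thesis unfolding sum.distrib tel[of "arc_length h", OF arc_length_0] tel[of "arc_length k", OF arc_length_0] by simp
    qed
    also have "\<dots> \<le> 2 * M * \<eta> + M * \<eta> * B + M * \<eta> * B"
    proof (intro add_mono mult_left_mono)
      have "2 * M * (real m * \<delta>) \<le> 2 * M * \<eta>" using M0 \<open>real m * \<delta> \<le> \<eta>\<close> by (intro mult_left_mono) auto
      then show "real m * (2 * M * \<delta>) \<le> 2 * M * \<eta>" by (simp add: algebra_simps)
      show "arc_length h r \<le> B" using arc_length_mono[OF hb[of "\<tau> m"] r(1,2) order.refl] B(1) by linarith
      show "arc_length k r \<le> B" using arc_length_mono[OF kb[of "\<tau> m"] r(1,2) order.refl] B(2) by linarith
    qed (use M0 \<open>0 \<le> \<eta>\<close> in auto)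
    also have "\<dots> = \<eta>2" by (simp add: \<eta>2_def algebra_simps)
    finally show ?thesis .
  qed
  have B0: "0 \<le> B" using arc_length_mono[OF hb[of "\<tau> m"], of 0 "\<tau> m"] \<tau>0[of m] B(1) by simp
  have \<eta>20: "0 \<le> \<eta>2" using M0 B0 \<open>0 \<le> \<eta>\<close> by (simp add: \<eta>2_def)
  define u where "u = (\<lambda>s. norm (Z s - X s))"
  have uc: "continuous_on {0..b} u" for b unfolding u_def by (intro continuous_intros Zc Xc)
  have "u t \<le> 2 * \<eta>2 * exp (2 * M * arc_length k t)"
  proof (rule gronwall_arc_length[OF kb M0 \<eta>20 uc[of "\<tau> m"]])
    show "0 \<le> u s" for s by (simp add: u_def)
    fix r assume "r \<in> {0..\<tau> m}"
    then have r: "0 \<le> r" "r \<le> \<tau> m" by auto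
    have "W r - (X r - z0) = integral {0..r} (\<lambda>s. F (Z s) (?k' s) - F (X s) (?k' s))"
      using integral_diff[OF int[OF Zc[of r]] int[OF Xc[of r]]]
      by (simp add: W_def solves_on_eq_integral(1)[OF X r(1)])
    also have "norm \<dots> \<le> integral {0..r} (\<lambda>s. M * (u s * norm (?k' s)))"
    proof (rule integral_norm_bound_integral)
      show "(\<lambda>s. F (Z s) (?k' s) - F (X s) (?k' s)) integrable_on {0..r}"
        by (rule integrable_diff[OF int[OF Zc] int[OF Xc]])
      show "(\<lambda>s. M * (u s * norm (?k' s))) integrable_on {0..r}"
        by (rule integrable_on_mult_right[OF integrable_times_norm_derivative[OF kb uc]])
      fix s
      show "norm (F (Z s) (?k' s) - F (X s) (?k' s)) \<le> M * (u s * norm (?k' s))"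
        using glipD(4)[OF F, of "Z s" "?k' s" "X s"] by (simp add: u_def algebra_simps)
    qed
    also have "\<dots> = M * integral {0..r} (\<lambda>s. u s * norm (?k' s))" by simp
    finally have "norm (W r - (X r - z0)) \<le> M * integral {0..r} (\<lambda>s. u s * norm (?k' s))" .
    moreover have ZXr: "Z r - X r = D r + (W r - (X r - z0))" by (simp add: D_def)
    have "u r \<le> norm (D r) + norm (W r - (X r - z0))" unfolding u_def ZXr by (rule norm_triangle_ineq)
    ultimately show "u r \<le> \<eta>2 + M * integral {0..r} (\<lambda>s. u s * norm (?k' s))" using D_le[OF r] by linarith
  qed (use t in auto)
  also have "\<dots> \<le> 2 * \<eta>2 * exp (2 * M * B)"
  proof (intro mult_left_mono)
    have "arc_length k t \<le> B" using arc_length_mono[OF kb[of "\<tau> m"] t order.refl] B(2) by linarith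
    then have "2 * M * arc_length k t \<le> 2 * M * B" using M0 by (intro mult_left_mono) auto
    then show "exp (2 * M * arc_length k t) \<le> exp (2 * M * B)" by simp
  qed (use \<eta>20 in simp)
  finally show ?thesis by (simp add: u_def \<eta>2_def algebra_simps)
qed

text \<open>Uniform closeness of the driving functions does not force convergence of the lengths of the
  trajectories, but together with convergence of the lengths of the driving functions it does.\<close>

lemma continuous_dependence_glip:
  fixes F :: "'a::euclidean_space \<Rightarrow> 'b::euclidean_space \<Rightarrow> 'a"
  assumes F: "glip M F" and h: "abs_continuous_on {0..} h" and E: "0 \<le> E" and hc: "\<And>t. E \<le> t \<Longrightarrow> h t = c"
    and Z: "solves_on F h z0 {0..} Z" and "0 < \<epsilon>"
  obtains \<delta> where "0 < \<delta>" "\<And>k E' c' X. abs_continuous_on {0..} k \<Longrightarrow> 0 \<le> E' \<Longrightarrow> (\<And>t. E' \<le> t \<Longrightarrow> k t = c') \<Longrightarrow>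
      (\<And>t. 0 \<le> t \<Longrightarrow> norm (h t - k t) \<le> \<delta>) \<Longrightarrow> arc_length k E' \<le> arc_length h E + \<delta> \<Longrightarrow>
      solves_on F k z0 {0..} X \<Longrightarrow>
      (\<forall>t\<ge>0. norm (Z t - X t) \<le> \<epsilon>) \<and> \<bar>arc_length Z E - arc_length X E'\<bar> \<le> \<epsilon>"
proof -
  note Fl = glip_loc_lip[OF F]
  have M0: "0 \<le> M" by (rule glipD(1)[OF F])
  have hb: "abs_continuous_on {0..b} h" for b by (rule abs_continuous_on_restrict[OF h])
  have Zac: "abs_continuous_on {0..} Z" by (rule solves_on_ac[OF Fl h Z]) simp
  define L where "L = arc_length h E"
  have L0: "0 \<le> L" using arc_length_mono[OF hb[of E], of 0 E] E by (simp add: L_def)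
  \<comment> \<open>Bounds the lengths of both drivers, as \<open>\<delta>\<close> will be at most
    1.\<close>
  define B where "B = L + 1"
  define C1 where "C1 = 2 * (2 * M + 2 * M * B) * exp (2 * M * B)"
  \<comment> \<open>Fixed before \<open>\<eta>\<close>, since \<open>C2\<close> contains
    \<open>M / (2 * \<kappa>)\<close>. The direction error \<open>M * \<kappa> * B\<close> occurs
    for both curves and takes half of \<open>\<epsilon>\<close>; the terms proportional to
    \<open>\<eta>\<close>, collected in \<open>C2\<close>, take the other half.\<close>
  define \<kappa> where "\<kappa> = \<epsilon> / (4 * (M * B + 1))"
  define C2 where "C2 = M * B + M * (C1 + 1) * B + 8 * (M + M / (2 * \<kappa>)) + 2 * M"
  have B0: "0 < B" using L0 by (simp add: B_def)
  have MB0: "0 \<le> M * B" using M0 B0 by simp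
  have C10: "0 \<le> C1" using M0 B0 by (simp add: C1_def)
  have \<kappa>0: "0 < \<kappa>" using \<open>0 < \<epsilon>\<close> MB0 by (simp add: \<kappa>_def)
  have "0 \<le> M / (2 * \<kappa>)" using M0 \<kappa>0 by simp
  moreover have "0 \<le> M * (C1 + 1) * B" using M0 B0 C10 by simp
  ultimately have C20: "0 \<le> C2" unfolding C2_def using M0 MB0
    by (intro add_nonneg_nonneg mult_nonneg_nonneg) (simp_all add: B0 C10 less_imp_le)
  have \<kappa>B: "2 * (M * \<kappa> * B) \<le> \<epsilon> / 2"
  proof -
    have "4 * (M * B + 1) * \<kappa> = \<epsilon>" using MB0 by (simp add: \<kappa>_def)
    then show ?thesis using \<kappa>0 by (simp add: algebra_simps)
  qed
  define \<eta> where "\<eta> = min 1 (min (\<epsilon> / (C1 + 1)) (\<epsilon> / (2 * (C2 + 1))))"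
  have \<eta>0: "0 < \<eta>" using \<open>0 < \<epsilon>\<close> C10 C20 by (simp add: \<eta>_def)
  have C1\<eta>: "C1 * \<eta> \<le> \<epsilon>"
  proof -
    have "(C1 + 1) * \<eta> \<le> (C1 + 1) * (\<epsilon> / (C1 + 1))" using C10 by (intro mult_left_mono) (auto simp: \<eta>_def)
    also have "\<dots> = \<epsilon>" using C10 by simp
    finally show ?thesis using C10 \<eta>0 by (simp add: algebra_simps)
  qed
  have C2\<eta>: "C2 * \<eta> \<le> \<epsilon> / 2"
  proof -
    have "2 * (C2 + 1) * \<eta> \<le> 2 * (C2 + 1) * (\<epsilon> / (2 * (C2 + 1)))" using C20 by (intro mult_left_mono) (auto simp: \<eta>_def)
    also have "\<dots> = \<epsilon>" using C20 by simp
    finally show ?thesis using \<eta>0 by (simp add: algebra_simps)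
  qed
  obtain n0 where n0: "\<And>n. n0 \<le> n \<Longrightarrow> arc_length h E - \<eta> < (\<Sum>i<Suc n. norm (h (E * Suc i / Suc n) - h (E * i / Suc n)))"
    using arc_length_uniform_partition[OF hb E \<eta>0] by blast
  obtain d where "0 < d" and d: "\<And>s t. s \<in> {0..E} \<Longrightarrow> t \<in> {0..E} \<Longrightarrow> \<bar>t - s\<bar> < d \<Longrightarrow> norm (Z t - Z s) < \<eta>"
    by (rule abs_continuous_on_close[OF abs_continuous_on_restrict[OF Zac] order.refl \<eta>0]) blast
  obtain n1 :: nat where n1: "E / d < n1" using reals_Archimedean2 by blast
  define n where "n = max n0 n1"
  have part: "L - \<eta> < (\<Sum>i<Suc n. norm (h (E * Suc i / Suc n) - h (E * i / Suc n)))"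
    unfolding L_def by (rule n0) (simp add: n_def)
  have mesh: "E / Suc n < d"
  proof -
    have "real n1 < Suc n" by (simp add: n_def)
    then have "E / d < Suc n" using n1 by linarith
    then show ?thesis using \<open>0 < d\<close> by (simp add: field_simps)
  qed
  \<comment> \<open>\<open>Suc n\<close> equal pieces of \<open>[0,E]\<close>, and one more from
    \<open>E\<close> to the larger of the two end parameters.\<close>
  define m where "m = Suc (Suc n)"
  define \<delta> where "\<delta> = min 1 (\<eta> / m)"
  have m0: "0 < real m" by (simp add: m_def)
  have \<delta>0: "0 < \<delta>" using \<eta>0 m0 by (simp add: \<delta>_def)
  have m\<delta>: "real m * \<delta> \<le> \<eta>"
  proof -
    have "real m * \<delta> \<le> real m * (\<eta> / real m)" using m0 by (intro mult_left_mono) (auto simp: \<delta>_def)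
    then show ?thesis using m0 by simp
  qed
  have \<delta>\<eta>: "\<delta> \<le> \<eta>"
  proof -
    have "1 * \<delta> \<le> real m * \<delta>" using \<delta>0 by (intro mult_right_mono) (auto simp: m_def)
    then show ?thesis using m\<delta> by simp
  qed
  show thesis
  proof (rule that[OF \<delta>0])
    fix k :: "real \<Rightarrow> 'b" and E' c' X
    assume k: "abs_continuous_on {0..} k" and E': "0 \<le> E'" and kc: "\<And>t. E' \<le> t \<Longrightarrow> k t = c'"
      and close: "\<And>t. 0 \<le> t \<Longrightarrow> norm (h t - k t) \<le> \<delta>" and len: "arc_length k E' \<le> arc_length h E + \<delta>"
      and X: "solves_on F k z0 {0..} X"
    have kb: "abs_continuous_on {0..b} k" for b by (rule abs_continuous_on_restrict[OF k])
    have Xac: "abs_continuous_on {0..} X" by (rule solves_on_ac[OF Fl k X]) simp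
    define T where "T = max E E'"
    have T: "E \<le> T" "E' \<le> T" "0 \<le> T" using E by (auto simp: T_def)
    define \<tau> where "\<tau> = (\<lambda>i. if i \<le> Suc n then E * real i / Suc n else T)"
    have \<tau>0: "\<tau> 0 = 0" and \<tau>m: "\<tau> m = T" and \<tau>n: "\<tau> (Suc n) = E" by (simp_all add: \<tau>_def m_def)
    have \<tau>i: "\<tau> i = E * real i / Suc n" if "i \<le> Suc n" for i using that by (simp add: \<tau>_def)
    have step: "\<tau> (Suc i) = \<tau> i + E / Suc n" if "i \<le> n" for i
      using that by (simp add: \<tau>i distrib_left add_divide_distrib)
    have \<tau>mono: "\<tau> i \<le> \<tau> (Suc i)" if "i < m" for i
    proof (cases "i \<le> n")
      case True
      then show ?thesis using step[OF True] E by simp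
    next
      case False
      then have "i = Suc n" using that by (simp add: m_def)
      then show ?thesis using \<tau>n \<tau>m T by (simp add: m_def)
    qed
    have \<tau>E: "0 \<le> \<tau> i \<and> \<tau> i \<le> E" if "i \<le> Suc n" for i
    proof -
      have "E * real i \<le> E * Suc n" using that E by (intro mult_left_mono) auto
      then have "E * real i / Suc n \<le> E" by (simp add: field_simps)
      then show ?thesis using E by (simp add: \<tau>i[OF that])
    qed
    have Zc: "Z t = Z E" if "E \<le> t" for t by (rule solves_on_const_after[OF F h Z E that hc])
    have Xc: "X t = X E'" if "E' \<le> t" for t by (rule solves_on_const_after[OF F k X E' that kc])
    have osc: "norm (Z s - Z (\<tau> i)) \<le> \<eta>" if i: "i < m" and s: "\<tau> i \<le> s" "s \<le> \<tau> (Suc i)" for i s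
    proof (cases "i \<le> n")
      case True
      have "s \<in> {0..E}" "\<tau> i \<in> {0..E}" using s \<tau>E[of i] \<tau>E[of "Suc i"] True by auto
      moreover have "\<bar>s - \<tau> i\<bar> < d" using s step[OF True] mesh by simp
      ultimately show ?thesis using d[of "\<tau> i" s] by simp
    next
      case False
      then have "\<tau> i = E" using i \<tau>n by (simp add: m_def less_Suc_eq)
      then show ?thesis using Zc[of s] s \<eta>0 by simp
    qed
    have lhT: "arc_length h T = L" unfolding L_def by (rule arc_length_const_after[OF h E T(1) hc])
    have lkT: "arc_length k T = arc_length k E'" by (rule arc_length_const_after[OF k E' T(2) kc])
    have lB: "arc_length h (\<tau> m) \<le> B" "arc_length k (\<tau> m) \<le> B"
      using len unfolding \<tau>m lhT lkT L_def[symmetric] by (auto simp: B_def \<delta>_def)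
    have supT: "norm (Z t - X t) \<le> C1 * \<eta>" if "0 \<le> t" "t \<le> T" for t
      unfolding C1_def
      by (rule continuous_dependence_sup[OF F h k Z X \<tau>0 \<tau>mono osc close m\<delta> less_imp_le[OF \<eta>0] lB]) (use that \<tau>m in auto)
    have sup: "norm (Z t - X t) \<le> C1 * \<eta>" if t: "0 \<le> t" for t
    proof (cases "t \<le> T")
      case False
      then have "Z t = Z T" "X t = X T" using Zc[of t] Zc[of T] Xc[of t] Xc[of T] T by auto
      then show ?thesis using supT[OF T(3) order.refl] by simp
    qed (rule supT[OF t])
    let ?q = "\<lambda>i. Z (\<tau> i)"
    let ?S = "\<lambda>g. \<Sum>i<m. norm (g (\<tau> (Suc i)) - g (\<tau> i))"
    have ZX: "continuous_on {0..b} Z" "continuous_on {0..b} X" for b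
      by (rule abs_continuous_on_imp_continuous_on_Icc[OF abs_continuous_on_restrict], rule Zac Xac)+
    have Tm: "0 \<le> \<tau> m" using T(3) \<tau>m by simp
    have LZ: "\<bar>arc_length Z T - (\<Sum>i<m. norm (F (?q i) (h (\<tau> (Suc i)) - h (\<tau> i))))\<bar> \<le>
        (M * \<eta> + M * \<kappa>) * arc_length h T + (M + M / (2 * \<kappa>)) * (arc_length h T - ?S h)"
      unfolding \<tau>m[symmetric] arc_length_solution[OF Fl h Z Tm]
    proof (rule length_frozen[OF F h ZX(1) \<tau>0 \<tau>mono \<kappa>0])
      fix i s and p :: 'b assume "i < m" "\<tau> i \<le> s" "s \<le> \<tau> (Suc i)"
      from osc[OF this] have "M * norm (Z s - Z (\<tau> i)) * norm p \<le> M * \<eta> * norm p"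
        using M0 by (intro mult_right_mono mult_left_mono) auto
      then show "norm (F (Z s) p - F (?q i) p) \<le> M * \<eta> * norm p" using glipD(4)[OF F, of "Z s" p "?q i"] by linarith
    qed
    have LX: "\<bar>arc_length X T - (\<Sum>i<m. norm (F (?q i) (k (\<tau> (Suc i)) - k (\<tau> i))))\<bar> \<le>
        (M * ((C1 + 1) * \<eta>) + M * \<kappa>) * arc_length k T + (M + M / (2 * \<kappa>)) * (arc_length k T - ?S k)"
      unfolding \<tau>m[symmetric] arc_length_solution[OF Fl k X Tm]
    proof (rule length_frozen[OF F k ZX(2) \<tau>0 \<tau>mono \<kappa>0])
      fix i s and p :: 'b assume i: "i < m" "\<tau> i \<le> s" "s \<le> \<tau> (Suc i)"
      have "i \<le> Suc n" using i(1) by (simp add: m_def)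
      then have "0 \<le> s" using \<tau>E[of i] i(2) by linarith
      have "norm (X s - Z (\<tau> i)) \<le> norm (Z s - X s) + norm (Z s - Z (\<tau> i))"
        using norm_triangle_ineq4[of "Z s - Z (\<tau> i)" "Z s - X s"] by (simp add: norm_minus_commute)
      then have "norm (X s - Z (\<tau> i)) \<le> (C1 + 1) * \<eta>"
        using sup[OF \<open>0 \<le> s\<close>] osc[OF i] by (simp add: algebra_simps)
      then have "M * norm (X s - Z (\<tau> i)) * norm p \<le> M * ((C1 + 1) * \<eta>) * norm p"
        using M0 by (intro mult_right_mono mult_left_mono) auto
      then show "norm (F (X s) p - F (?q i) p) \<le> M * ((C1 + 1) * \<eta>) * norm p"
        using glipD(4)[OF F, of "X s" p "?q i"] by linarith
    qed
    have \<Delta>: "norm ((h (\<tau> (Suc i)) - h (\<tau> i)) - (k (\<tau> (Suc i)) - k (\<tau> i))) \<le> 2 * \<delta>" if "i < m" for i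
    proof -
      have "0 \<le> \<tau> i" using \<tau>E[of i] that by (simp add: m_def)
      moreover have "0 \<le> \<tau> (Suc i)" using \<tau>mono[OF that] \<open>0 \<le> \<tau> i\<close> by linarith
      ultimately have "norm ((h (\<tau> (Suc i)) - k (\<tau> (Suc i))) - (h (\<tau> i) - k (\<tau> i))) \<le> \<delta> + \<delta>"
        using norm_triangle_ineq4[of "h (\<tau> (Suc i)) - k (\<tau> (Suc i))" "h (\<tau> i) - k (\<tau> i)"] close[of "\<tau> i"] close[of "\<tau> (Suc i)"] by linarith
      then show ?thesis by (simp add: algebra_simps)
    qed
    have Sh: "L - \<eta> \<le> ?S h"
    proof -
      have "(\<Sum>i<Suc n. norm (h (E * Suc i / Suc n) - h (E * i / Suc n))) = (\<Sum>i<Suc n. norm (h (\<tau> (Suc i)) - h (\<tau> i)))"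
        by (rule sum.cong[OF refl]) (simp add: \<tau>i)
      moreover have "?S h = (\<Sum>i<Suc n. norm (h (\<tau> (Suc i)) - h (\<tau> i))) + norm (h (\<tau> (Suc (Suc n))) - h (\<tau> (Suc n)))"
        unfolding m_def by (rule sum.lessThan_Suc)
      ultimately show ?thesis using part norm_ge_zero[of "h (\<tau> (Suc (Suc n))) - h (\<tau> (Suc n))"] by linarith
    qed
    have "?S h \<le> (\<Sum>i<m. norm (k (\<tau> (Suc i)) - k (\<tau> i)) + 2 * \<delta>)"
    proof (rule sum_mono)
      fix i assume "i \<in> {..<m}"
      then show "norm (h (\<tau> (Suc i)) - h (\<tau> i)) \<le> norm (k (\<tau> (Suc i)) - k (\<tau> i)) + 2 * \<delta>"
        using \<Delta>[of i] norm_triangle_sub[of "h (\<tau> (Suc i)) - h (\<tau> i)" "k (\<tau> (Suc i)) - k (\<tau> i)"] by simp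
    qed
    also have "\<dots> = ?S k + 2 * (real m * \<delta>)" by (simp add: sum.distrib)
    \<comment> \<open>One \<open>\<eta>\<close> is lost in the polygon of \<open>h\<close> and two
      in passing to \<open>k\<close>. With the upper bound for the length of \<open>k\<close>, that
      length exceeds its polygon by at most \<open>4 * \<eta>\<close>; this is where hidden
      oscillation is ruled out.\<close>
    finally have Sk: "L - 3 * \<eta> \<le> ?S k" using Sh m\<delta> by linarith
    have SA: "\<bar>(\<Sum>i<m. norm (F (?q i) (h (\<tau> (Suc i)) - h (\<tau> i)))) - (\<Sum>i<m. norm (F (?q i) (k (\<tau> (Suc i)) - k (\<tau> i))))\<bar> \<le> 2 * M * \<eta>"
    proof -
      have "\<bar>\<Sum>i<m. norm (F (?q i) (h (\<tau> (Suc i)) - h (\<tau> i))) - norm (F (?q i) (k (\<tau> (Suc i)) - k (\<tau> i)))\<bar> \<le>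
          (\<Sum>i<m. \<bar>norm (F (?q i) (h (\<tau> (Suc i)) - h (\<tau> i))) - norm (F (?q i) (k (\<tau> (Suc i)) - k (\<tau> i)))\<bar>)"
        by (rule sum_abs)
      also have "\<dots> \<le> (\<Sum>i<m. M * (2 * \<delta>))"
      proof (rule sum_mono)
        fix i assume "i \<in> {..<m}"
        then have "M * norm ((h (\<tau> (Suc i)) - h (\<tau> i)) - (k (\<tau> (Suc i)) - k (\<tau> i))) \<le> M * (2 * \<delta>)"
          using M0 by (intro mult_left_mono \<Delta>) auto
        then show "\<bar>norm (F (?q i) (h (\<tau> (Suc i)) - h (\<tau> i))) - norm (F (?q i) (k (\<tau> (Suc i)) - k (\<tau> i)))\<bar> \<le> M * (2 * \<delta>)"
          using norm_triangle_ineq3[of "F (?q i) (h (\<tau> (Suc i)) - h (\<tau> i))" "F (?q i) (k (\<tau> (Suc i)) - k (\<tau> i))",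
              folded linear_diff[OF glipD(2)[OF F]]]
            glipD(3)[OF F, of "?q i" "(h (\<tau> (Suc i)) - h (\<tau> i)) - (k (\<tau> (Suc i)) - k (\<tau> i))"] by linarith
      qed
      also have "\<dots> = 2 * M * (real m * \<delta>)" by simp
      also have "\<dots> \<le> 2 * M * \<eta>" using M0 m\<delta> by (intro mult_left_mono) auto
      finally show ?thesis by (simp add: sum_subtractf)
    qed
    have P0: "0 \<le> M + M / (2 * \<kappa>)" using M0 \<kappa>0 by simp
    have "(M * \<eta> + M * \<kappa>) * arc_length h T \<le> (M * \<eta> + M * \<kappa>) * B"
      using lB(1) M0 \<eta>0 \<kappa>0 unfolding \<tau>m by (intro mult_left_mono) auto
    moreover have "(M + M / (2 * \<kappa>)) * (arc_length h T - ?S h) \<le> (M + M / (2 * \<kappa>)) * (4 * \<eta>)"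
      using Sh \<eta>0 lhT P0 by (intro mult_left_mono) auto
    ultimately have LZ': "\<bar>arc_length Z T - (\<Sum>i<m. norm (F (?q i) (h (\<tau> (Suc i)) - h (\<tau> i))))\<bar> \<le>
        (M * \<eta> + M * \<kappa>) * B + (M + M / (2 * \<kappa>)) * (4 * \<eta>)" using LZ by linarith
    have "(M * ((C1 + 1) * \<eta>) + M * \<kappa>) * arc_length k T \<le> (M * ((C1 + 1) * \<eta>) + M * \<kappa>) * B"
      using lB(2) M0 \<eta>0 \<kappa>0 C10 unfolding \<tau>m by (intro mult_left_mono) auto
    moreover have "(M + M / (2 * \<kappa>)) * (arc_length k T - ?S k) \<le> (M + M / (2 * \<kappa>)) * (4 * \<eta>)"
      using Sk \<delta>\<eta> len lkT P0 by (intro mult_left_mono) (auto simp: L_def)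
    ultimately have LX': "\<bar>arc_length X T - (\<Sum>i<m. norm (F (?q i) (k (\<tau> (Suc i)) - k (\<tau> i))))\<bar> \<le>
        (M * ((C1 + 1) * \<eta>) + M * \<kappa>) * B + (M + M / (2 * \<kappa>)) * (4 * \<eta>)" using LX by linarith
    have "\<bar>arc_length Z T - arc_length X T\<bar> \<le> ((M * \<eta> + M * \<kappa>) * B + (M + M / (2 * \<kappa>)) * (4 * \<eta>)) +
        ((M * ((C1 + 1) * \<eta>) + M * \<kappa>) * B + (M + M / (2 * \<kappa>)) * (4 * \<eta>)) + 2 * M * \<eta>"
      using LZ' LX' SA by linarith
    also have "\<dots> = C2 * \<eta> + 2 * (M * \<kappa> * B)" by (simp add: C2_def algebra_simps)
    also have "\<dots> \<le> \<epsilon>" using C2\<eta> \<kappa>B by linarith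
    finally have "\<bar>arc_length Z T - arc_length X T\<bar> \<le> \<epsilon>" .
    moreover have "arc_length Z T = arc_length Z E" by (rule arc_length_const_after[OF Zac E T(1) Zc])
    moreover have "arc_length X T = arc_length X E'" by (rule arc_length_const_after[OF Xac E' T(2) Xc])
    ultimately have "\<bar>arc_length Z E - arc_length X E'\<bar> \<le> \<epsilon>" by simp
    moreover have "\<forall>t\<ge>0. norm (Z t - X t) \<le> \<epsilon>" 
    proof (intro allI impI)
      fix t :: real assume "0 \<le> t"
      from sup[OF this] C1\<eta> show "norm (Z t - X t) \<le> \<epsilon>" by linarith
    qed
    ultimately show "(\<forall>t\<ge>0. norm (Z t - X t) \<le> \<epsilon>) \<and> \<bar>arc_length Z E - arc_length X E'\<bar> \<le> \<epsilon>" by blast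
  qed
qed

lemma solves_on_stopped:
  assumes F: "loc_lip F" and h: "abs_continuous_on {0..} h" and E: "0 \<le> E" and const: "\<And>t. E \<le> t \<Longrightarrow> h t = c"
    and y: "solves_on F h x0 {0..} y" and t: "0 \<le> t"
  shows "y t = y (min t E)"
proof -
  have "solves_on F (\<lambda>t. h (min t E)) x0 {0..} (\<lambda>t. y (min t E))"
    by (rule solves_on_stop[OF F h E]) (rule solves_on_subset[OF y], simp)
  then have "solves_on F (\<lambda>t. h (min t E)) x0 {0..t} (\<lambda>t. y (min t E))" by (rule solves_on_subset) simp
  moreover have "h (min s E) = h s" for s using const[of s] const[of E] by (cases "s \<le> E") auto
  then have "(\<lambda>t. h (min t E)) = h" by (rule ext)
  ultimately have z: "solves_on F h x0 {0..t} (\<lambda>t. y (min t E))" by simp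
  have y': "solves_on F h x0 {0..t} y" by (rule solves_on_subset[OF y]) simp
  show ?thesis by (rule solves_on_unique[OF F abs_continuous_on_restrict[OF h] y' z]) (use t in simp)
qed

text \<open>The cutoff at \<open>R + 1\<close> and the tolerance \<open>min \<epsilon> 1\<close>
  keep \<open>X\<close> in the ball where the fields agree. So the solution of the cut-off equation
  solves the original one globally, which is the persistence behind openness.\<close>

lemma continuous_dependence:
  fixes F :: "'a::euclidean_space \<Rightarrow> 'b::euclidean_space \<Rightarrow> 'a"
  assumes F: "loc_lip F" and h: "abs_continuous_on {0..} h" and E: "0 \<le> E" and hc: "\<And>t. E \<le> t \<Longrightarrow> h t = c"
    and Z: "solves_on F h z0 {0..} Z" and \<epsilon>: "0 < \<epsilon>"
  obtains \<delta> where "0 < \<delta>" "\<And>k E' c'. abs_continuous_on {0..} k \<Longrightarrow> 0 \<le> E' \<Longrightarrow> (\<And>t. E' \<le> t \<Longrightarrow> k t = c') \<Longrightarrow>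
      (\<And>t. 0 \<le> t \<Longrightarrow> norm (h t - k t) \<le> \<delta>) \<Longrightarrow> arc_length k E' \<le> arc_length h E + \<delta> \<Longrightarrow>
      \<exists>X. solves_on F k z0 {0..} X \<and> (\<forall>t\<ge>0. norm (Z t - X t) \<le> \<epsilon>) \<and> \<bar>arc_length Z E - arc_length X E'\<bar> \<le> \<epsilon>"
proof -
  have "continuous_on {0..E} Z" by (rule solves_on_eq_integral(2)[OF Z E])
  then obtain R where R: "0 < R" "\<And>s. s \<in> {0..E} \<Longrightarrow> norm (Z s) \<le> R" by (rule bounded_on_Icc) blast
  have ZR: "norm (Z t) \<le> R" if "0 \<le> t" for t
    using R(2)[of "min t E"] solves_on_stopped[OF F h E hc Z that] that E by simp
  obtain M where M: "glip M (cutoff (R + 1) F)" using F R(1) unfolding loc_lip_def by force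
  have ZM: "solves_on (cutoff (R + 1) F) h z0 {0..} Z"
  proof (rule iffD2[OF solves_on_cutoff Z])
    show "norm (Z s) \<le> R + 1" if "b \<in> {0..}" "0 \<le> s" "s \<le> b" for b s :: real using ZR[OF that(2)] by simp
  qed simp
  have "0 < min \<epsilon> 1" using \<epsilon> by simp
  from continuous_dependence_glip[OF M h E hc ZM this]
  obtain \<delta> where \<delta>: "0 < \<delta>" "\<And>k E' c' X. abs_continuous_on {0..} k \<Longrightarrow> 0 \<le> E' \<Longrightarrow> (\<And>t. E' \<le> t \<Longrightarrow> k t = c') \<Longrightarrow>
      (\<And>t. 0 \<le> t \<Longrightarrow> norm (h t - k t) \<le> \<delta>) \<Longrightarrow> arc_length k E' \<le> arc_length h E + \<delta> \<Longrightarrow>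
      solves_on (cutoff (R + 1) F) k z0 {0..} X \<Longrightarrow>
      (\<forall>t\<ge>0. norm (Z t - X t) \<le> min \<epsilon> 1) \<and> \<bar>arc_length Z E - arc_length X E'\<bar> \<le> min \<epsilon> 1"
    by blast
  show thesis
  proof (rule that[OF \<delta>(1)])
    fix k E' c'
    assume k: "abs_continuous_on {0..} k" "0 \<le> E'" "\<And>t. E' \<le> t \<Longrightarrow> k t = c'"
      "\<And>t. 0 \<le> t \<Longrightarrow> norm (h t - k t) \<le> \<delta>" "arc_length k E' \<le> arc_length h E + \<delta>"
    obtain X where X: "solves_on (cutoff (R + 1) F) k z0 {0..} X" using solves_on_exists_glip[OF M k(1)] by blast
    from \<delta>(2)[OF k X] have close: "\<forall>t\<ge>0. norm (Z t - X t) \<le> min \<epsilon> 1"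
      and len: "\<bar>arc_length Z E - arc_length X E'\<bar> \<le> min \<epsilon> 1" by blast+
    have XR: "norm (X s) \<le> R + 1" if "0 \<le> s" for s
      using ZR[OF that] close[rule_format, OF that] norm_triangle_ineq4[of "Z s" "Z s - X s"] by simp
    have "solves_on F k z0 {0..} X"
    proof (rule iffD1[OF solves_on_cutoff X])
      show "norm (X s) \<le> R + 1" if "b \<in> {0..}" "0 \<le> s" "s \<le> b" for b s :: real by (rule XR[OF that(2)])
    qed simp
    then show "\<exists>X. solves_on F k z0 {0..} X \<and> (\<forall>t\<ge>0. norm (Z t - X t) \<le> \<epsilon>) \<and> \<bar>arc_length Z E - arc_length X E'\<bar> \<le> \<epsilon>"
      using close len by (intro exI[of _ X]) auto
  qed
qed

section \<open>Space-time trajectories\<close>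

text \<open>The equation for the space-time trajectory \<open>(V, y)\<close>, where \<open>V\<close> is the first component of the driver.\<close>

definition aug :: "('a::euclidean_space \<Rightarrow> real \<times> 'b::euclidean_space \<Rightarrow> 'a) \<Rightarrow> real \<times> 'a \<Rightarrow> real \<times> 'b \<Rightarrow> real \<times> 'a" where
  "aug H z p = (fst p, H (snd z) p)"

text \<open>The projection acts on space-time, but the state component of a projected point stays in
  the ball of radius \<open>R\<close>, where \<open>H\<close> and its cutoff agree. The extra 1 in
  the constant bounds the time component.\<close>

lemma loc_lip_aug:
  assumes H: "loc_lip H"
  shows "loc_lip (aug H)"
  unfolding loc_lip_def
proof (intro allI impI)
  fix R :: real assume "0 < R"
  then obtain M where M: "glip M (cutoff R H)" using H unfolding loc_lip_def by blast
  note M0 = glipD(1)[OF M]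
  let ?c = "closest_point (cball 0 R) :: real \<times> 'a \<Rightarrow> _"
  have "?c z \<in> cball 0 R" for z using \<open>0 < R\<close> by (intro closest_point_in_set) auto
  then have snd_c: "norm (snd (?c z)) \<le> R" for z
    using norm_snd_diff_le[of "?c z" 0] order_trans[of "norm (snd (?c z))" "norm (?c z)" R] by simp
  have cut: "cutoff R (aug H) z p = (fst p, cutoff R H (snd (?c z)) p)" for z p
    using cutoff_eq[OF snd_c[of z], of H] by (simp add: cutoff_def aug_def)
  have "glip (M + 1) (cutoff R (aug H))"
    unfolding glip_def
  proof (intro conjI allI)
    show "0 \<le> M + 1" using M0 by simp
    fix z w :: "real \<times> 'a" and p :: "real \<times> 'b"
    show "linear (cutoff R (aug H) z)"
      by (rule linearI) (simp_all add: cut linear_add[OF glipD(2)[OF M]] linear_scale[OF glipD(2)[OF M]])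
    have "norm (fst p) \<le> norm p" using norm_fst_diff_le[of p 0] by simp
    then show "norm (cutoff R (aug H) z p) \<le> (M + 1) * norm p"
      using norm_Pair_le[of "fst p" "cutoff R H (snd (?c z)) p"] glipD(3)[OF M, of "snd (?c z)" p]
      by (simp add: cut distrib_right)
    have "norm (snd (?c z) - snd (?c w)) \<le> norm (?c z - ?c w)"
      by (rule norm_snd_diff_le)
    also have "\<dots> \<le> norm (z - w)"
      using closest_point_lipschitz[of "cball 0 R" z w] \<open>0 < R\<close> by (simp add: dist_norm)
    finally have "M * norm (snd (?c z) - snd (?c w)) * norm p \<le> M * norm (z - w) * norm p"
      using M0 by (intro mult_right_mono mult_left_mono) auto
    also have "\<dots> \<le> (M + 1) * norm (z - w) * norm p" by (intro mult_right_mono) auto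
    finally show "norm (cutoff R (aug H) z p - cutoff R (aug H) w p) \<le> (M + 1) * norm (z - w) * norm p"
      using glipD(4)[OF M, of "snd (?c z)" p "snd (?c w)"] by (simp add: cut norm_Pair)
  qed
  then show "\<exists>M. glip M (cutoff R (aug H))" by blast
qed

lemma solves_on_augI:
  fixes H :: "'a::euclidean_space \<Rightarrow> real \<times> 'b::euclidean_space \<Rightarrow> 'a"
  assumes h: "abs_continuous_on {0..} h" "fst (h 0) = 0" and y: "solves_on H h x0 {0..E} y"
  shows "solves_on (aug H) h (0, x0) {0..E} (\<lambda>t. (fst (h t), y t))"
  unfolding solves_on_def
proof (intro ballI conjI)
  fix b assume b: "b \<in> {0..E}"
  have y': "continuous_on {0..b} y" "((\<lambda>s. H (y s) (vector_derivative h (at s))) has_integral (y b - x0)) {0..b}"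
    using y b unfolding solves_on_def by auto
  have hb: "abs_continuous_on {0..b} h" by (rule abs_continuous_on_restrict[OF h(1)])
  show "continuous_on {0..b} (\<lambda>t. (fst (h t), y t))"
    using abs_continuous_on_imp_continuous_on_Icc[OF hb] y'(1) by (intro continuous_intros)
  have 1: "((\<lambda>s. (fst (vector_derivative h (at s)), 0 :: 'a)) has_integral (fst (h b - h 0), 0)) {0..b}"
    using has_integral_linear[OF abs_continuous_on_has_integral_derivative[OF _ hb],
        of "\<lambda>x. (fst x, 0 :: 'a)"] b
    by (simp add: o_def bounded_linear_Pair bounded_linear_fst bounded_linear_zero)
  have 2: "((\<lambda>s. (0 :: real, H (y s) (vector_derivative h (at s)))) has_integral (0, y b - x0)) {0..b}"
    using has_integral_linear[OF y'(2), of "\<lambda>x. (0 :: real, x)"]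
    by (simp add: o_def bounded_linear_Pair bounded_linear_ident bounded_linear_zero)
  show "((\<lambda>s. aug H (fst (h s), y s) (vector_derivative h (at s))) has_integral (fst (h b), y b) - (0, x0)) {0..b}"
    using has_integral_add[OF 1 2] h(2) by (simp add: aug_def)
qed

lemma solves_on_augD:
  fixes H :: "'a::euclidean_space \<Rightarrow> real \<times> 'b::euclidean_space \<Rightarrow> 'a"
  assumes "solves_on (aug H) h (c, x0) I z"
  shows "solves_on H h x0 I (\<lambda>t. snd (z t))"
  unfolding solves_on_def
proof (intro ballI conjI)
  fix b assume "b \<in> I"
  then have z: "continuous_on {0..b} z" "((\<lambda>s. aug H (z s) (vector_derivative h (at s))) has_integral (z b - (c, x0))) {0..b}"
    using assms unfolding solves_on_def by auto
  show "continuous_on {0..b} (\<lambda>t. snd (z t))" using z(1) by (intro continuous_intros)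
  show "((\<lambda>s. H (snd (z s)) (vector_derivative h (at s))) has_integral snd (z b) - x0) {0..b}"
    using has_integral_linear[OF z(2) bounded_linear_snd] by (simp add: o_def aug_def)
qed

text \<open>Identity up to \<open>E\<close>, then \<open>[0,\<infinity>[\<close> is mapped onto
  \<open>[0,c[\<close> by \<open>c * u / (c + u)\<close>, with inverse
  \<open>c * v / (c - v)\<close>. The map is 1-Lipschitz and its inverse Lipschitz on compact
  subintervals. The identity part lets truncations be read off without a change of
  parameter.\<close>

lemma reparam_finite_exists:
  assumes E: "0 \<le> E" "E < b"
  obtains \<gamma> where "\<gamma> \<in> reparam (ereal b)" "\<And>t. t \<le> E \<Longrightarrow> \<gamma> t = t"
proof -
  define c where "c = b - E"
  have c0: "0 < c" using E by (simp add: c_def)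
  define \<phi> where "\<phi> = (\<lambda>u. c * u / (c + u))"
  define \<psi> where "\<psi> = (\<lambda>v. c * v / (c - v))"
  define \<gamma> where "\<gamma> = (\<lambda>t. min t E + \<phi> (max 0 (t - E)))"
  define \<beta> where "\<beta> = (\<lambda>s. min s E + \<psi> (max 0 (s - E)))"
  have \<phi>_diff: "\<phi> v - \<phi> u = c * c * (v - u) / ((c + u) * (c + v))" if "0 \<le> u" "0 \<le> v" for u v
    using c0 that by (simp add: \<phi>_def field_simps)
  have \<psi>_diff: "\<psi> v - \<psi> u = c * c * (v - u) / ((c - u) * (c - v))" if "u < c" "v < c" for u v
    using c0 that by (simp add: \<psi>_def field_simps)
  have \<phi>0: "0 \<le> \<phi> u" "\<phi> u < c" if "0 \<le> u" for u
    using c0 that by (simp_all add: \<phi>_def field_simps)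
  have \<psi>0: "0 \<le> \<psi> v" if "0 \<le> v" "v < c" for v
    using c0 that by (simp add: \<psi>_def)
  have \<phi>\<psi>: "\<phi> (\<psi> v) = v" if "0 \<le> v" "v < c" for v
  proof -
    have "c + \<psi> v = c * c / (c - v)" using that by (simp add: \<psi>_def field_simps)
    then show ?thesis using c0 that by (simp add: \<phi>_def) (simp add: \<psi>_def)
  qed
  have \<phi>z: "\<phi> 0 = 0" "\<psi> 0 = 0" by (simp_all add: \<phi>_def \<psi>_def)
  have split: "min t E - min s E + (max 0 (t - E) - max 0 (s - E)) = t - s" for s t
    by (simp add: min_def max_def)
  show thesis
  proof (rule that)
    show "\<gamma> t = t" if "t \<le> E" for t using that by (simp add: \<gamma>_def \<phi>z)
    show "\<gamma> \<in> reparam (ereal b)"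
    proof (rule reparamI[where \<beta> = \<beta>])
      show "\<gamma> t \<in> half_open (ereal b)" if "0 \<le> t" for t
      proof -
        have "0 \<le> \<gamma> t" using that E \<phi>0(1)[of "max 0 (t - E)"] by (simp add: \<gamma>_def)
        moreover have "\<gamma> t < E + c" using \<phi>0(2)[of "max 0 (t - E)"] unfolding \<gamma>_def by linarith
        ultimately show ?thesis by (simp add: half_open_def c_def)
      qed
      show "0 \<le> \<beta> s \<and> \<gamma> (\<beta> s) = s" if "s \<in> half_open (ereal b)" for s
      proof (cases "s \<le> E")
        case True
        then show ?thesis using that by (simp add: \<beta>_def \<gamma>_def \<phi>z half_open_def)
      next
        case False
        then have s: "0 \<le> s - E" "s - E < c" using that by (auto simp: half_open_def c_def)
        have "\<beta> s = E + \<psi> (s - E)" using False by (simp add: \<beta>_def)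
        then show ?thesis using \<psi>0[OF s] \<phi>\<psi>[OF s] E by (simp add: \<gamma>_def)
      qed
      have step: "0 \<le> \<gamma> t - \<gamma> s" "\<gamma> t - \<gamma> s \<le> t - s" "s < t \<Longrightarrow> \<gamma> s < \<gamma> t" if "s \<le> t" for s t
      proof -
        define u where "u = max 0 (s - E)"
        define v where "v = max 0 (t - E)"
        have uv: "0 \<le> u" "u \<le> v" using that by (auto simp: u_def v_def)
        have d: "\<gamma> t - \<gamma> s = (min t E - min s E) + (\<phi> v - \<phi> u)" by (simp add: \<gamma>_def u_def v_def)
        have t_s: "t - s = (min t E - min s E) + (v - u)" using split[of t s] by (simp add: u_def v_def)
        have m: "0 \<le> min t E - min s E" using that by simp
        have pos: "0 < (c + u) * (c + v)" using c0 uv by simp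
        have \<phi>d: "\<phi> v - \<phi> u = c * c * (v - u) / ((c + u) * (c + v))" by (rule \<phi>_diff) (use uv in auto)
        have "c * c \<le> (c + u) * (c + v)" using c0 uv by (intro mult_mono) auto
        then have "c * c * (v - u) \<le> (c + u) * (c + v) * (v - u)" using uv by (intro mult_right_mono) auto
        then have le: "\<phi> v - \<phi> u \<le> v - u" using pos unfolding \<phi>d by (simp add: divide_le_eq mult.commute)
        have ge: "0 \<le> \<phi> v - \<phi> u" unfolding \<phi>d using pos uv by simp
        show "0 \<le> \<gamma> t - \<gamma> s" "\<gamma> t - \<gamma> s \<le> t - s" using d t_s le ge m by linarith+
        show "\<gamma> s < \<gamma> t" if "s < t"
        proof (cases "u = v")
          case True
          then have "\<phi> v - \<phi> u = 0" "v - u = 0" by simp_all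
          then show ?thesis using d t_s that by linarith
        next
          case False
          then have "0 < \<phi> v - \<phi> u" unfolding \<phi>d using pos uv c0 by (intro divide_pos_pos mult_pos_pos) auto
          then show ?thesis using d m by linarith
        qed
      qed
      show "\<gamma> s < \<gamma> t" if "0 \<le> s" "s < t" for s t using step(3)[of s t] that by simp
      show "abs_continuous_on {0..} \<gamma>"
        by (rule abs_continuous_on_dominated1[OF abs_continuous_on_ident, of _ _ 1]) (use step(1,2) in simp)
      show "abs_continuous_on (half_open (ereal b)) \<beta>"
        unfolding abs_continuous_on_Icc_iff[of "half_open (ereal b)"]
      proof (intro allI impI)
        fix a d :: real assume ad: "a \<le> d" "{a..d} \<subseteq> half_open (ereal b)"
        define w where "w = c - max 0 (d - E)"
        have "d < b" using ad by (auto simp: half_open_def)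
        then have w0: "0 < w" "w \<le> c" using c0 by (auto simp: w_def c_def)
        show "abs_continuous_on {a..d} \<beta>"
        proof (rule abs_continuous_on_dominated1[OF abs_continuous_on_ident, of _ _ "1 + c * c / (w * w)"])
          fix s t assume st: "s \<in> {a..d}" "t \<in> {a..d}" "s \<le> t"
          define u where "u = max 0 (s - E)"
          define v where "v = max 0 (t - E)"
          have uv: "0 \<le> u" "u \<le> v" "w \<le> c - v" "w \<le> c - u" using st by (auto simp: u_def v_def w_def)
          have d: "\<beta> t - \<beta> s = (min t E - min s E) + (\<psi> v - \<psi> u)" by (simp add: \<beta>_def u_def v_def)
          have t_s: "t - s = (min t E - min s E) + (v - u)" using split[of t s] by (simp add: u_def v_def)
          have m: "0 \<le> min t E - min s E" using st by simp
          have \<psi>d: "\<psi> v - \<psi> u = c * c * (v - u) / ((c - u) * (c - v))" by (rule \<psi>_diff) (use uv w0 in auto)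
          have ww: "w * w \<le> (c - u) * (c - v)" using uv w0 by (intro mult_mono) auto
          have ww0: "0 < w * w" using w0 by simp
          have "\<psi> v - \<psi> u \<le> c * c * (v - u) / (w * w)"
            unfolding \<psi>d using ww ww0 uv by (intro divide_left_mono) auto
          also have "\<dots> \<le> c * c * (t - s) / (w * w)"
            using ww0 t_s m by (intro divide_right_mono mult_left_mono) auto
          finally have le: "\<psi> v - \<psi> u \<le> c * c * (t - s) / (w * w)" .
          have ge: "0 \<le> \<psi> v - \<psi> u" unfolding \<psi>d using uv w0 ww ww0 by (intro divide_nonneg_nonneg mult_nonneg_nonneg) auto
          have "0 \<le> \<beta> t - \<beta> s" using d m ge by linarith
          moreover have "\<beta> t - \<beta> s \<le> (t - s) + c * c * (t - s) / (w * w)" using d t_s uv(2) le by linarith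
          ultimately have "\<bar>\<beta> t - \<beta> s\<bar> \<le> (t - s) + c * c * (t - s) / (w * w)" by linarith
          then show "norm (\<beta> t - \<beta> s) \<le> (1 + c * c / (w * w)) * norm (t - s)"
            using st by (simp add: distrib_right)
        qed
      qed
    qed
  qed
qed

lemma reparam_exists:
  assumes "0 \<le> E" "ereal E < S"
  obtains \<gamma> where "\<gamma> \<in> reparam S" "\<And>t. t \<le> E \<Longrightarrow> \<gamma> t = t" "S = \<infinity> \<Longrightarrow> \<gamma> = (\<lambda>t. t)"
proof (cases S)
  case (real b)
  then show ?thesis using reparam_finite_exists[of E b] assms that by auto
next
  case PInf
  then show ?thesis using reparam_id that by auto
qed (use assms in auto)

text \<open>Chords are compared instead of derivatives: along a polygon the terms in
  \<open>m\<close> telescope.\<close>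

lemma arc_length_le_of_diff:
  fixes g :: "real \<Rightarrow> 'a::euclidean_space" and k :: "real \<Rightarrow> 'b::euclidean_space" and m :: "real \<Rightarrow> real"
  assumes g: "abs_continuous_on {0..} g" and k: "abs_continuous_on {0..} k" and E: "0 \<le> E"
    and le: "\<And>s t. 0 \<le> s \<Longrightarrow> s \<le> t \<Longrightarrow> norm (g t - g s) \<le> norm (k t - k s) + (m t - m s)"
  shows "arc_length g E \<le> arc_length k E + (m E - m 0)"
proof (rule field_le_epsilon)
  fix e :: real assume e: "0 < e"
  obtain n where n: "arc_length g E - e < (\<Sum>i<Suc n. norm (g (E * Suc i / Suc n) - g (E * i / Suc n)))"
    using arc_length_uniform_partition[OF abs_continuous_on_restrict[OF g] E e] by blast
  define \<tau> where "\<tau> = (\<lambda>i::nat. E * i / Suc n)"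
  have \<tau>: "0 \<le> \<tau> i" "\<tau> i \<le> \<tau> (Suc i)" for i
    using E by (auto simp: \<tau>_def intro!: divide_right_mono mult_left_mono)
  have end0: "\<tau> 0 = 0" "\<tau> (Suc n) = E" by (simp_all add: \<tau>_def)
  have "(\<Sum>i<Suc n. norm (g (\<tau> (Suc i)) - g (\<tau> i))) \<le> (\<Sum>i<Suc n. norm (k (\<tau> (Suc i)) - k (\<tau> i)) + (m (\<tau> (Suc i)) - m (\<tau> i)))"
    by (rule sum_mono) (rule le[OF \<tau>])
  also have "\<dots> = (\<Sum>i<Suc n. norm (k (\<tau> (Suc i)) - k (\<tau> i))) + (m E - m 0)"
    unfolding sum.distrib using sum_lessThan_telescope[of "\<lambda>i. m (\<tau> i)" "Suc n"] by (simp only: end0)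
  finally have "(\<Sum>i<Suc n. norm (g (\<tau> (Suc i)) - g (\<tau> i))) \<le> \<dots>" .
  moreover have "(\<Sum>i<Suc n. norm (k (\<tau> (Suc i)) - k (\<tau> i))) \<le> arc_length k (\<tau> (Suc n)) - arc_length k (\<tau> 0)"
    by (rule sum_norm_diff_le_arc_length[OF abs_continuous_on_restrict[OF k, of E]]) (use \<tau> end0 in auto)
  moreover have "arc_length k (\<tau> (Suc n)) - arc_length k (\<tau> 0) = arc_length k E" by (simp only: end0 arc_length_0 diff_zero)
  moreover have "arc_length g E - e < (\<Sum>i<Suc n. norm (g (\<tau> (Suc i)) - g (\<tau> i)))" using n by (simp only: \<tau>_def)
  ultimately show "arc_length g E \<le> arc_length k E + (m E - m 0) + e" by linarith
qed

lemma abs_continuous_on_Pair: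
  fixes f :: "real \<Rightarrow> 'a::euclidean_space" and g :: "real \<Rightarrow> 'b::euclidean_space"
  assumes "abs_continuous_on I f" "abs_continuous_on I g"
  shows "abs_continuous_on I (\<lambda>t. (f t, g t))"
proof (rule abs_continuous_on_dominated[OF assms], rule exI[of _ 1], intro allI impI)
  fix s t :: real
  show "norm ((f t, g t) - (f s, g s)) \<le> 1 * (norm (f t - f s) + norm (g t - g s))"
    using norm_Pair_le[of "f t - f s" "g t - g s"] by simp
qed

section \<open>Classes of trajectories and their dependence on the control\<close>

text \<open>The common form of both kinds of trajectories, with one driver in space-time:
  \<open>(V,W)\<close> for a generalized control, the graph \<open>(t,U)\<close> for an ordinary
  one.\<close>

definition gtraj :: "('a::euclidean_space \<Rightarrow> real \<times> 'b::euclidean_space \<Rightarrow> 'a) \<Rightarrow> 'a \<Rightarrow> (real \<Rightarrow> real \<times> 'b) \<Rightarrow> (real \<Rightarrow> real \<times> 'a) set" where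
  "gtraj H x0 h = (let (S, y) = max_solution (drive H h) x0 in frechet_class_on S (\<lambda>t. (fst (h t), y t)))"

context
  fixes H :: "'a::euclidean_space \<Rightarrow> real \<times> 'b::euclidean_space \<Rightarrow> 'a" and x0 :: 'a and T :: real
  assumes H: "loc_lip H" and T: "0 \<le> T"
begin

context
  fixes h S y \<gamma>
  assumes h: "crosses T h" and max: "max_solution (drive H h) x0 = (S, y)" and \<gamma>: "\<gamma> \<in> reparam S"
begin

abbreviation (input) "curve \<equiv> \<lambda>t. (fst (h (\<gamma> t)), y (\<gamma> t))"

lemma curve_ac: "abs_continuous_on (half_open S) (\<lambda>t. (fst (h t), y t))"
proof (rule abs_continuous_on_Pair)
  show "abs_continuous_on (half_open S) (\<lambda>t. fst (h t))"
    by (rule abs_continuous_on_subset[OF crosses_ac_fst[OF crossesD(1)[OF h]]]) (auto simp: half_open_def)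
  show "abs_continuous_on (half_open S) y" by (rule max_solution_ac[OF H crossesD(1)[OF h] max_solution_is_max[OF H crossesD(1)[OF h] max]])
qed

lemma gtraj_eq: "gtraj H x0 h = frechet_class curve"
  using frechet_class_on_eq[OF \<gamma> curve_ac] by (simp add: gtraj_def max)

lemma curve_reparam_ac: "abs_continuous_on {0..} curve"
  using abs_continuous_on_reparam[OF \<gamma> curve_ac] by simp

text \<open>Since \<open>\<gamma>\<close> is the identity up to the end parameter and runs beyond it
  later, truncating the reparametrized curve is the same as stopping the pair of time and state,
  which solves the equation for the stopped driver.\<close>

lemma curve_crosses:
  assumes E: "ereal (end_time T h) < S" and id: "\<And>t. t \<le> end_time T h \<Longrightarrow> \<gamma> t = t"
  shows "crosses T curve" "end_time T curve = end_time T h" "solves_on (aug H) (trunc T h) (0, x0) {0..} (trunc T curve)"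
proof -
  let ?E = "end_time T h"
  have E0: "0 \<le> ?E" by (rule end_time_nonneg[OF T h])
  have gt: "T < fst (h (\<gamma> t))" if "?E < t" for t
  proof (rule fst_gt_after_end_time[OF T h])
    show "?E < \<gamma> t" using reparam_strict[OF \<gamma> E0 that] id[of ?E] by simp
  qed
  show c: "crosses T curve"
    unfolding crosses_def
  proof (intro conjI allI impI)
    show "abs_continuous_on {0..} curve" by (rule curve_reparam_ac)
    show "fst (fst (h (\<gamma> 0)), y (\<gamma> 0)) = 0" using crossesD(2)[OF h] reparam_0[OF \<gamma>] by simp
    show "fst (fst (h (\<gamma> s)), y (\<gamma> s)) \<le> fst (fst (h (\<gamma> t)), y (\<gamma> t))" if "0 \<le> s" "s \<le> t" for s t
      using crossesD(3)[OF h reparam_nonneg[OF \<gamma> that(1)] reparam_mono[OF \<gamma> that]] by simp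
    show "\<exists>t\<ge>0. T < fst (fst (h (\<gamma> t)), y (\<gamma> t))"
      using gt[of "?E + 1"] E0 by (intro exI[of _ "?E + 1"]) simp
  qed
  show e: "end_time T curve = ?E"
    by (rule end_time_unique[OF T c E0]) (use id[of ?E] fst_end_time[OF T h] gt in simp_all)
  have "?E \<in> half_open S" using E E0 by (simp add: half_open_def)
  then have "solves_on H h x0 {0..?E} y"
    by (intro solves_on_subset[OF max_solution_solves[OF H crossesD(1)[OF h] max_solution_is_max[OF H crossesD(1)[OF h] max]]] half_open_interval)
  from solves_on_stop[OF loc_lip_aug[OF H] crossesD(1)[OF h] E0 solves_on_augI[OF crossesD(1,2)[OF h] this]]
  have s: "solves_on (aug H) (\<lambda>t. h (min t ?E)) (0, x0) {0..} (\<lambda>t. (fst (h (min t ?E)), y (min t ?E)))" .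
  have "trunc T curve = (\<lambda>t. (fst (h (min t ?E)), y (min t ?E)))"
  proof
    fix t
    show "trunc T curve t = (fst (h (min t ?E)), y (min t ?E))"
      using trunc_eq[OF T c, of t] id[of "min t ?E"] by (simp add: e)
  qed
  moreover have "trunc T h = (\<lambda>t. h (min t ?E))" by (rule ext) (rule trunc_eq[OF T h])
  ultimately show "solves_on (aug H) (trunc T h) (0, x0) {0..} (trunc T curve)" using s by simp
qed

end

text \<open>A curve of \<open>FF T\<close> exceeds time \<open>T\<close>, so the maximal solution
  must live beyond the end parameter of \<open>h\<close>. The representative obtained shares its
  parameter with \<open>h\<close> up to that point.\<close>

lemma gtraj_FF_D:
  assumes h: "crosses T h" and FF: "gtraj H x0 h \<in> FF T"
  obtains g where "crosses T g" "gtraj H x0 h = frechet_class g" "end_time T g = end_time T h"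
    "solves_on (aug H) (trunc T h) (0, x0) {0..} (trunc T g)"
proof -
  obtain S y where max: "max_solution (drive H h) x0 = (S, y)" by (cases "max_solution (drive H h) x0")
  have "ereal 0 < S" using max_solution_pos[OF H crossesD(1)[OF h] max_solution_is_max[OF H crossesD(1)[OF h] max]] by (simp add: zero_ereal_def)
  \<comment> \<open>A map equal to the identity up to the end parameter presupposes
    \<open>end_time T h < S\<close>, which is derived only below; any map serves to derive
    it.\<close>
  then obtain \<alpha> where \<alpha>: "\<alpha> \<in> reparam S" by (rule reparam_exists[OF order.refl]) blast
  let ?w = "\<lambda>t. (fst (h (\<alpha> t)), y (\<alpha> t))"
  obtain g0 where g0: "crosses T g0" "gtraj H x0 h = frechet_class g0" using FF_E[OF T FF] by blast
  have "?w \<in> frechet_class g0"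
    using mem_frechet_class[OF curve_reparam_ac[OF h max \<alpha>]] gtraj_eq[OF h max \<alpha>] g0(2) by simp
  then have "crosses T ?w" by (rule frechet_class_crosses(1)[OF g0(1)])
  then obtain t where t: "0 \<le> t" "T < fst (h (\<alpha> t))" unfolding crosses_def by auto
  have "end_time T h < \<alpha> t"
  proof (rule ccontr)
    assume "\<not> ?thesis"
    then have "fst (h (\<alpha> t)) \<le> fst (h (end_time T h))"
      by (intro crossesD(3)[OF h reparam_nonneg[OF \<alpha> t(1)]]) simp
    then show False using t fst_end_time[OF T h] by simp
  qed
  moreover have "ereal (\<alpha> t) < S" using reparam_val[OF \<alpha> t(1)] by (simp add: half_open_def)
  ultimately have E: "ereal (end_time T h) < S" by (meson ereal_less_eq(3) less_imp_le order_le_less_trans)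
  obtain \<gamma> where \<gamma>: "\<gamma> \<in> reparam S" "\<And>t. t \<le> end_time T h \<Longrightarrow> \<gamma> t = t"
    by (rule reparam_exists[OF end_time_nonneg[OF T h] E]) blast
  show thesis
    by (rule that[OF curve_crosses(1)[OF h max \<gamma>(1) E \<gamma>(2)] gtraj_eq[OF h max \<gamma>(1)]
      curve_crosses(2,3)[OF h max \<gamma>(1) E \<gamma>(2)]])
qed

text \<open>Infinite length has two sources: if the solution ends at a finite parameter, the state
  is unbounded; otherwise the unboundedness of the time component supplies the length.\<close>

lemma gtraj_FF_I:
  assumes h: "crosses T h" and Z: "solves_on (aug H) (trunc T h) (0, x0) {0..} Z"
    and unb: "\<And>B. \<exists>t\<ge>0. B < fst (h t)"
  shows "gtraj H x0 h \<in> FF T"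
proof -
  let ?E = "end_time T h"
  have E0: "0 \<le> ?E" by (rule end_time_nonneg[OF T h])
  obtain S y where max: "max_solution (drive H h) x0 = (S, y)" by (cases "max_solution (drive H h) x0")
  have "trunc T h = (\<lambda>t. h (min t ?E))" by (rule ext) (rule trunc_eq[OF T h])
  with Z have "solves_on (aug H) (\<lambda>t. h (min t ?E)) (0, x0) {0..} Z" by simp
  from solves_on_subset[OF this, of "{0..?E}"] have "solves_on (aug H) h (0, x0) {0..?E} Z"
    using solves_on_driver_cong[of ?E "\<lambda>t. h (min t ?E)" h "{0..?E}" "aug H" "(0, x0)" Z] by simp
  then have "solves_on H h x0 {0..?E} (\<lambda>t. snd (Z t))" by (rule solves_on_augD)
  from max_solution_reaches(1)[OF H crossesD(1)[OF h] max_solution_is_max[OF H crossesD(1)[OF h] max] this E0] have E: "ereal ?E < S" .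
  obtain \<gamma> where \<gamma>: "\<gamma> \<in> reparam S" "\<And>t. t \<le> ?E \<Longrightarrow> \<gamma> t = t" "S = \<infinity> \<Longrightarrow> \<gamma> = (\<lambda>t. t)"
    by (rule reparam_exists[OF E0 E]) blast
  let ?g = "\<lambda>t. (fst (h (\<gamma> t)), y (\<gamma> t))"
  note c = curve_crosses(1)[OF h max \<gamma>(1) E \<gamma>(2)]
  have big: "\<exists>t\<ge>0. B < norm (?g t - ?g 0)" for B
  proof (cases S)
    case (real b)
    obtain s where s: "0 \<le> s" "s < b" "B + norm (y 0) < norm (y s)"
      using max_solution_unbounded[OF H crossesD(1)[OF h] max_solution_is_max[OF H crossesD(1)[OF h] max] real] by blast
    then have "s \<in> half_open S" by (simp add: half_open_def real)
    note inv = reparam_inv[OF \<gamma>(1) this]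
    have "norm (y s) \<le> norm (y s - y 0) + norm (y 0)" using norm_triangle_sub[of "y s" "y 0"] by simp
    then have "B < norm (y s - y 0)" using s(3) by linarith
    also have "\<dots> \<le> norm (?g (the_inv_into {0..} \<gamma> s) - ?g 0)"
      using norm_snd_diff_le[of "?g (the_inv_into {0..} \<gamma> s)" "?g 0"] by (simp add: inv(2) reparam_0[OF \<gamma>(1)])
    finally show ?thesis using inv(1) by blast
  next
    case PInf
    obtain t where t: "0 \<le> t" "B < fst (h t)" using unb by blast
    have "fst (h t) \<le> norm (?g t - ?g 0)"
      using norm_fst_diff_le[of "?g t" "?g 0"] crossesD(2)[OF h] by (simp add: \<gamma>(3)[OF PInf])
    then show ?thesis using t by (intro exI[of _ t]) linarith
  next
    case MInf
    then show ?thesis using E by simp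
  qed
  have "filterlim (arc_length ?g) at_top at_top"
    unfolding filterlim_at_top eventually_at_top_linorder
  proof
    fix B
    obtain t where t: "0 \<le> t" "B < norm (?g t - ?g 0)" using big by blast
    show "\<exists>N. \<forall>s\<ge>N. B \<le> arc_length ?g s"
    proof (intro exI[of _ t] allI impI)
      fix s assume s: "t \<le> s"
      note ac = abs_continuous_on_restrict[OF crossesD(1)[OF c], of s]
      from norm_diff_le_arc_length[OF ac order.refl t(1) s] arc_length_mono[OF ac t(1) s order.refl]
      show "B \<le> arc_length ?g s" using t(2) arc_length_0[of ?g] by linarith
    qed
  qed
  with c have "?g \<in> YYT T" by (rule YYT_I[OF T])
  then show ?thesis using gtraj_eq[OF h max \<gamma>(1)] by (simp add: FF_def)
qed

text \<open>Everything is compared in the parameter of \<open>h\<close>, to which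
  \<open>\<beta>\<close> aligns the truncation of \<open>h'\<close>; the solution is carried back by
  the inverse. The existence of a solution is stated apart from membership in \<open>FF T\<close>,
  because a trajectory past \<open>T\<close> may still have finite length. Distance and length
  contribute one \<open>\<epsilon>\<close> each.\<close>

lemma gtraj_dependence:
  assumes h: "crosses T h" and FF: "gtraj H x0 h \<in> FF T" and \<epsilon>: "0 < \<epsilon>"
  obtains \<delta> where "0 < \<delta>"
    "\<And>h'. crosses T h' \<Longrightarrow> d_plus T (frechet_class h) (frechet_class h') < \<delta> \<Longrightarrow>
       (\<exists>Z. solves_on (aug H) (trunc T h') (0, x0) {0..} Z) \<and>
       (gtraj H x0 h' \<in> FF T \<longrightarrow> d_plus T (gtraj H x0 h) (gtraj H x0 h') \<le> 2 * \<epsilon>)"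
proof -
  note A = loc_lip_aug[OF H]
  let ?E = "end_time T h"
  obtain g where g: "crosses T g" "gtraj H x0 h = frechet_class g" "end_time T g = ?E"
    "solves_on (aug H) (trunc T h) (0, x0) {0..} (trunc T g)"
    by (rule gtraj_FF_D[OF h FF])
  obtain \<delta> where \<delta>: "0 < \<delta>" "\<And>k E' c'. abs_continuous_on {0..} k \<Longrightarrow> 0 \<le> E' \<Longrightarrow> (\<And>t. E' \<le> t \<Longrightarrow> k t = c') \<Longrightarrow>
      (\<And>t. 0 \<le> t \<Longrightarrow> norm (trunc T h t - k t) \<le> \<delta>) \<Longrightarrow> arc_length k E' \<le> arc_length (trunc T h) ?E + \<delta> \<Longrightarrow>
      \<exists>X. solves_on (aug H) k (0, x0) {0..} X \<and> (\<forall>t\<ge>0. norm (trunc T g t - X t) \<le> \<epsilon>) \<and>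
        \<bar>arc_length (trunc T g) ?E - arc_length X E'\<bar> \<le> \<epsilon>"
    using continuous_dependence[OF A trunc_ac[OF T h] end_time_nonneg[OF T h] trunc_const[OF T h] g(4) \<epsilon>] by blast
  show thesis
  proof (rule that[OF \<delta>(1)])
    fix h' assume h': "crosses T h'" and d: "d_plus T (frechet_class h) (frechet_class h') < \<delta>"
    have dd: "d_T T (frechet_class h) (frechet_class h') < \<delta>"
        "\<bar>arc_length h ?E - arc_length h' (end_time T h')\<bar> < \<delta>"
      using d d_T_nonneg[OF T, of "frechet_class h" "frechet_class h'"]
      unfolding d_plus_def trunc_length_eq[OF T h] trunc_length_eq[OF T h'] by linarith+
    from close_up_to_d_T[OF T h h' dd(1)] obtain \<beta> where \<beta>: "\<beta> \<in> reparam \<infinity>"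
      "\<And>t. 0 \<le> t \<Longrightarrow> norm (trunc T h t - trunc T h' (\<beta> t)) \<le> \<delta>" unfolding close_up_to_def by blast
    let ?i = "the_inv_into {0..} \<beta>"
    define k where "k = (\<lambda>t. trunc T h' (\<beta> t))"
    \<comment> \<open>The end parameter of \<open>h'\<close> expressed in the parameter of
      \<open>h\<close>; from there on \<open>k\<close> is constant.\<close>
    define E' where "E' = ?i (end_time T h')"
    have e0: "0 \<le> end_time T h'" by (rule end_time_nonneg[OF T h'])
    have E': "0 \<le> E'" "\<beta> E' = end_time T h'"
      unfolding E'_def by (rule reparam_inv[OF \<beta>(1)]; simp add: e0)+
    have k: "abs_continuous_on {0..} k"
      unfolding k_def by (rule abs_continuous_on_reparam[OF \<beta>(1)]) (simp add: trunc_ac[OF T h'])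
    have kc: "k t = h' (end_time T h')" if "E' \<le> t" for t
      unfolding k_def using reparam_mono[OF \<beta>(1) E'(1) that] by (intro trunc_const[OF T h']) (simp add: E'(2))
    have "arc_length k E' = arc_length (trunc T h') (end_time T h')"
      unfolding k_def arc_length_reparam[OF trunc_ac[OF T h'] \<beta>(1) E'(1)] E'(2) ..
    also have "\<dots> = arc_length h' (end_time T h')" by (rule arc_length_trunc[OF T h' order.refl])
    also have "\<dots> \<le> arc_length (trunc T h) ?E + \<delta>" using dd(2) arc_length_trunc[OF T h order.refl] by linarith
    finally have len: "arc_length k E' \<le> arc_length (trunc T h) ?E + \<delta>" .
    have cl: "norm (trunc T h t - k t) \<le> \<delta>" if "0 \<le> t" for t unfolding k_def by (rule \<beta>(2)[OF that])
    from \<delta>(2)[OF k E'(1) kc cl len] obtain X where X: "solves_on (aug H) k (0, x0) {0..} X"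
      "\<And>t. 0 \<le> t \<Longrightarrow> norm (trunc T g t - X t) \<le> \<epsilon>" "\<bar>arc_length (trunc T g) ?E - arc_length X E'\<bar> \<le> \<epsilon>" by blast
    have i: "?i \<in> reparam \<infinity>" by (rule reparam_inverse[OF \<beta>(1)])
    have ki: "k (?i t) = trunc T h' t" if "0 \<le> t" for t
      using reparam_inv(2)[OF \<beta>(1), of t] that by (simp add: k_def)
    have Xi: "solves_on (aug H) (trunc T h') (0, x0) {0..b} (\<lambda>t. X (?i t))" for b
    proof (rule iffD1[OF solves_on_driver_cong[of b "\<lambda>t. k (?i t)" "trunc T h'" "{0..b}"]])
      show "solves_on (aug H) (\<lambda>t. k (?i t)) (0, x0) {0..b} (\<lambda>t. X (?i t))"
        by (rule solves_on_subset[OF solves_on_reparam[OF A k i X(1)]]) simp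
    qed (use ki in auto)
    show "(\<exists>Z. solves_on (aug H) (trunc T h') (0, x0) {0..} Z) \<and>
       (gtraj H x0 h' \<in> FF T \<longrightarrow> d_plus T (gtraj H x0 h) (gtraj H x0 h') \<le> 2 * \<epsilon>)"
    proof (intro conjI impI)
      have "solves_on (aug H) (trunc T h') (0, x0) {0..} (\<lambda>t. X (?i t))"
        unfolding solves_on_def
      proof
        fix b :: real assume "b \<in> {0..}"
        then have "b \<in> {0..b}" by simp
        with Xi[of b] show "continuous_on {0..b} (\<lambda>t. X (?i t)) \<and>
            ((\<lambda>s. aug H (X (?i s)) (vector_derivative (trunc T h') (at s))) has_integral X (?i b) - (0, x0)) {0..b}"
          unfolding solves_on_def by blast
      qed
      then show "\<exists>Z. solves_on (aug H) (trunc T h') (0, x0) {0..} Z" by blast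
      assume FF': "gtraj H x0 h' \<in> FF T"
      obtain g' where g': "crosses T g'" "gtraj H x0 h' = frechet_class g'" "end_time T g' = end_time T h'"
        "solves_on (aug H) (trunc T h') (0, x0) {0..} (trunc T g')"
        by (rule gtraj_FF_D[OF h' FF'])
      have g'X: "trunc T g' (\<beta> t) = X t" if "0 \<le> t" for t
      proof -
        have b0: "0 \<le> \<beta> t" by (rule reparam_nonneg[OF \<beta>(1) that])
        have "trunc T g' (\<beta> t) = X (?i (\<beta> t))"
          by (rule solves_on_unique[OF A abs_continuous_on_restrict[OF trunc_ac[OF T h']] solves_on_subset[OF g'(4)] Xi[of "\<beta> t"]])
            (use b0 in auto)
        then show ?thesis by (simp add: reparam_inv_val[OF \<beta>(1) that])
      qed
      have "close_up_to \<epsilon> (trunc T g) (trunc T g')"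
        unfolding close_up_to_def using \<beta>(1) X(2) g'X by (intro bexI[of _ \<beta>]) auto
      from d_T_le(1)[OF T g(1) g'(1) this] have 1: "d_T T (frechet_class g) (frechet_class g') \<le> \<epsilon>" .
      have g'ac: "abs_continuous_on {0..} (trunc T g')" by (rule trunc_ac[OF T g'(1)])
      have "arc_length X E' = arc_length (\<lambda>t. trunc T g' (\<beta> t)) E'"
        unfolding arc_length_def
      proof (rule integral_spike[of "{0, E'}"])
        fix t assume "t \<in> {0..E'} - {0, E'}"
        then have t: "t \<in> {0<..<E'}" by auto
        have "vector_derivative (\<lambda>t. trunc T g' (\<beta> t)) (at t) = vector_derivative X (at t)"
        proof (rule vector_derivative_cong_eq)
          show "\<forall>\<^sub>F x in nhds t. x \<in> UNIV \<longrightarrow> trunc T g' (\<beta> x) = X x"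
            using eventually_nhds_in_open[of "{0<..<E'}" t] t g'X by (auto elim!: eventually_mono)
        qed auto
        then show "norm (vector_derivative (\<lambda>t. trunc T g' (\<beta> t)) (at t)) = norm (vector_derivative X (at t))" by simp
      qed (simp add: negligible_finite)
      also have "\<dots> = arc_length (trunc T g') (end_time T g')"
        unfolding arc_length_reparam[OF g'ac \<beta>(1) E'(1)] E'(2) g'(3) ..
      also have "\<dots> = arc_length g' (end_time T g')" by (rule arc_length_trunc[OF T g'(1) order.refl])
      finally have "arc_length X E' = arc_length g' (end_time T g')" .
      moreover have "arc_length (trunc T g) ?E = arc_length g (end_time T g)"
        using arc_length_trunc[OF T g(1) order.refl] by (simp add: g(3))
      ultimately have "\<bar>arc_length g (end_time T g) - arc_length g' (end_time T g')\<bar> \<le> \<epsilon>" using X(3) by simp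
      then show "d_plus T (gtraj H x0 h) (gtraj H x0 h') \<le> 2 * \<epsilon>"
        using 1 unfolding d_plus_def g(2) g'(2) trunc_length_eq[OF T g(1)] trunc_length_eq[OF T g'(1)] by linarith
    qed
  qed
qed

end

text \<open>After the end parameter the control part is held fixed and time grows at unit speed. The
  truncation is unchanged, and unbounded time guarantees a trajectory of infinite length as soon as
  it reaches \<open>T\<close>.\<close>

lemma extend_after_end_time:
  fixes h :: "real \<Rightarrow> real \<times> 'a::euclidean_space"
  assumes T: "0 \<le> T" and h: "crosses T h" and h0: "snd (h 0) = 0"
  obtains h3 where "h3 \<in> YYT0 T" "trunc T h3 = trunc T h" "\<And>B. \<exists>t\<ge>0. B < fst (h3 t)"
proof -
  let ?E = "end_time T h"
  have E0: "0 \<le> ?E" by (rule end_time_nonneg[OF T h])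
  define h3 where "h3 = (\<lambda>t. (fst (h (min t ?E)) + max 0 (t - ?E), snd (h (min t ?E))))"
  have ac: "abs_continuous_on {0..} h3"
  proof (rule abs_continuous_on_dominated[OF abs_continuous_on_stop[OF crossesD(1)[OF h] E0] abs_continuous_on_ident],
      rule exI[of _ 1], intro allI impI)
    fix s t :: real assume st: "s \<le> t"
    have "h3 t - h3 s = (h (min t ?E) - h (min s ?E)) + (max 0 (t - ?E) - max 0 (s - ?E), 0)"
      by (simp add: h3_def prod_eq_iff)
    moreover have "norm (max 0 (t - ?E) - max 0 (s - ?E), 0 :: 'a) \<le> norm (t - s)" using st by (simp add: norm_Pair)
    ultimately show "norm (h3 t - h3 s) \<le> 1 * (norm (h (min t ?E) - h (min s ?E)) + norm (t - s))"
      using norm_triangle_ineq[of "h (min t ?E) - h (min s ?E)" "(max 0 (t - ?E) - max 0 (s - ?E), 0 :: 'a)"] by simp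
  qed
  have gt: "fst (h3 t) = T + (t - ?E)" if "?E \<le> t" for t
    using that fst_end_time[OF T h] by (simp add: h3_def)
  have c: "crosses T h3"
    unfolding crosses_def
  proof (intro conjI allI impI ac)
    show "fst (h3 0) = 0" using E0 crossesD(2)[OF h] by (simp add: h3_def)
    show "fst (h3 s) \<le> fst (h3 t)" if "0 \<le> s" "s \<le> t" for s t
    proof -
      have "fst (h (min s ?E)) \<le> fst (h (min t ?E))" by (rule crossesD(3)[OF h]) (use that E0 in auto)
      moreover have "max 0 (s - ?E) \<le> max 0 (t - ?E)" using that by simp
      ultimately show ?thesis by (simp add: h3_def)
    qed
    show "\<exists>t\<ge>0. T < fst (h3 t)" using gt[of "?E + 1"] E0 by (intro exI[of _ "?E + 1"]) simp
  qed
  have e: "end_time T h3 = ?E"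
    by (rule end_time_unique[OF T c E0]) (use gt[of ?E] gt in auto)
  have tr: "trunc T h3 = trunc T h"
  proof
    fix t
    show "trunc T h3 t = trunc T h t"
      unfolding trunc_eq[OF T c] trunc_eq[OF T h] e by (simp add: h3_def prod_eq_iff)
  qed
  have unb: "\<exists>t\<ge>0. B < fst (h3 t)" for B
    using gt[of "?E + \<bar>B\<bar> + 1"] E0 T by (intro exI[of _ "?E + \<bar>B\<bar> + 1"]) simp
  have "filterlim (arc_length h3) at_top at_top"
    unfolding filterlim_at_top eventually_at_top_linorder
  proof
    fix B
    show "\<exists>N. \<forall>s\<ge>N. B \<le> arc_length h3 s"
    proof (intro exI[of _ "?E + \<bar>B\<bar>"] allI impI)
      fix s assume s: "?E + \<bar>B\<bar> \<le> s"
      then have s0: "0 \<le> s" using E0 by linarith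
      have "norm (h3 s - h3 0) \<le> arc_length h3 s - arc_length h3 0"
        by (rule norm_diff_le_arc_length[OF abs_continuous_on_restrict[OF ac] order.refl s0 order.refl])
      moreover have "fst (h3 s) \<le> norm (h3 s - h3 0)"
        using norm_fst_diff_le[of "h3 s" "h3 0"] crossesD(2)[OF c] by simp
      moreover have "B \<le> fst (h3 s)" using gt[of s] s T by linarith
      ultimately show "B \<le> arc_length h3 s" using arc_length_0[of h3] by linarith
    qed
  qed
  with c have "h3 \<in> YYT T" by (rule YYT_I[OF T])
  moreover have "snd (h3 0) = 0" using h0 E0 by (simp add: h3_def)
  ultimately have "h3 \<in> YYT0 T" by (simp add: YYT0_def)
  then show thesis using that tr unb by blast
qed

section \<open>Ordinary controls\<close>

lemma AE_has_vector_derivative: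
  fixes h :: "real \<Rightarrow> 'a::euclidean_space"
  assumes "abs_continuous_on {0..} h"
  shows "AE t in lebesgue. 0 \<le> t \<longrightarrow> (h has_vector_derivative vector_derivative h (at t)) (at t)"
  using AE_half_open[of \<infinity>, OF abs_continuous_on_negligible_derivative[OF abs_continuous_on_restrict[OF assms]]] by simp

lemma ordinary_control_ac:
  fixes u :: "real \<Rightarrow> real ^ 'k"
  assumes "ordinary_control u"
  shows "abs_continuous_on {0..} (control_graph u)"
proof -
  have "abs_continuous_on {0..} (\<lambda>t. integral {0..t} u)"
    by (rule abs_continuous_on_integralI[where c = 0 and f = u]) (use assms in \<open>simp add: ordinary_control_def\<close>)
  from abs_continuous_on_Pair[OF abs_continuous_on_ident this] show ?thesis by (simp add: control_graph_def[abs_def])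
qed

lemma fst_control_graph [simp]: "fst (control_graph u t) = t"
  by (simp add: control_graph_def)

lemma control_graph_YYT0:
  fixes u :: "real \<Rightarrow> real ^ 'k"
  assumes u: "ordinary_control u" and T: "0 \<le> T"
  shows "control_graph u \<in> YYT0 T"
proof -
  let ?g = "control_graph u"
  note ac = ordinary_control_ac[OF u]
  have c: "crosses T ?g"
    unfolding crosses_def using ac T by (auto intro!: exI[of _ "T + 1"])
  have "filterlim (arc_length ?g) at_top at_top"
  proof (rule filterlim_at_top_mono[OF filterlim_ident])
    show "\<forall>\<^sub>F s in at_top. s \<le> arc_length ?g s"
      using eventually_ge_at_top[of 0]
    proof eventually_elim
      fix s :: real assume s: "0 \<le> s"
      have "norm (?g s - ?g 0) \<le> arc_length ?g s - arc_length ?g 0"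
        by (rule norm_diff_le_arc_length[OF abs_continuous_on_restrict[OF ac] order.refl s order.refl])
      then show "s \<le> arc_length ?g s"
        using norm_fst_diff_le[of "?g s" "?g 0"] arc_length_0[of ?g] by simp
    qed
  qed
  with c have "?g \<in> YYT T" by (rule YYT_I[OF T])
  then show ?thesis by (simp add: YYT0_def control_graph_def)
qed

text \<open>Slope at least \<open>c\<close> makes the map surjective onto the half-line and its
  inverse Lipschitz with constant \<open>1 / c\<close>.\<close>

lemma strictly_increasing_reparam:
  fixes A :: "real \<Rightarrow> real"
  assumes ac: "abs_continuous_on {0..} A" and A0: "A 0 = 0" and "0 < c"
    and inc: "\<And>s t. 0 \<le> s \<Longrightarrow> s \<le> t \<Longrightarrow> c * (t - s) \<le> A t - A s"
  shows "A \<in> reparam \<infinity>"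
proof -
  have ex: "\<exists>t\<ge>0. A t = s" if s: "0 \<le> s" for s
  proof -
    have "s \<le> A (s / c)" using inc[of 0 "s / c"] A0 s \<open>0 < c\<close> by simp
    moreover have "continuous_on {0..s / c} A"
      by (rule abs_continuous_on_imp_continuous_on_Icc[OF abs_continuous_on_restrict[OF ac]])
    ultimately show ?thesis using IVT'[of A 0 s "s / c"] A0 s \<open>0 < c\<close> by auto
  qed
  define \<beta> where "\<beta> = (\<lambda>s. SOME t. 0 \<le> t \<and> A t = s)"
  have \<beta>: "0 \<le> \<beta> s" "A (\<beta> s) = s" if "0 \<le> s" for s
    using someI_ex[OF ex[OF that]] unfolding \<beta>_def by auto
  have strict: "A s < A t" if "0 \<le> s" "s < t" for s t
  proof -
    have "0 < c * (t - s)" using that \<open>0 < c\<close> by simp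
    then show ?thesis using inc[of s t] that by simp
  qed
  have pos: "0 \<le> A t" if "0 \<le> t" for t
  proof -
    have "0 \<le> c * t" using that \<open>0 < c\<close> by simp
    then show ?thesis using inc[of 0 t] that A0 by simp
  qed
  show ?thesis
  proof (rule reparamI[where \<beta> = \<beta>])
    show "A t \<in> half_open \<infinity>" if "0 \<le> t" for t using pos[OF that] by simp
    show "0 \<le> \<beta> s \<and> A (\<beta> s) = s" if "s \<in> half_open \<infinity>" for s using \<beta>[of s] that by simp
    show "abs_continuous_on (half_open \<infinity>) \<beta>"
    proof (rule abs_continuous_on_dominated1[OF abs_continuous_on_ident, of _ _ "1 / c"])
      fix s t :: real assume st: "s \<in> half_open \<infinity>" "t \<in> half_open \<infinity>" "s \<le> t"
      then have st0: "0 \<le> s" "0 \<le> t" by simp_all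
      have "\<beta> s \<le> \<beta> t"
      proof (rule ccontr)
        assume "\<not> \<beta> s \<le> \<beta> t"
        then have "A (\<beta> t) < A (\<beta> s)" by (intro strict \<beta>(1) st0) simp
        then show False using \<beta>(2)[OF st0(1)] \<beta>(2)[OF st0(2)] st(3) by simp
      qed
      from inc[OF \<beta>(1)[OF st0(1)] this] have "c * (\<beta> t - \<beta> s) \<le> t - s"
        by (simp add: \<beta>(2)[OF st0(1)] \<beta>(2)[OF st0(2)])
      with \<open>\<beta> s \<le> \<beta> t\<close> show "norm (\<beta> t - \<beta> s) \<le> 1 / c * norm (t - s)"
        using st(3) \<open>0 < c\<close> by (simp add: pos_le_divide_eq mult.commute)
    qed
  qed (use ac strict in auto)
qed

text \<open>The time component of a space-time curve is made strictly increasing without moving the time at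
  which it reaches \<open>T\<close>; a curve with that property is the graph of an ordinary control.\<close>

lemma ordinary_controls_dense:
  fixes h :: "real \<Rightarrow> real \<times> (real ^ 'k)"
  assumes T: "0 < T" and h: "crosses T h" and h0: "snd (h 0) = 0" and \<epsilon>: "0 < \<epsilon>"
  obtains u where "ordinary_control u" "d_plus T (frechet_class h) (frechet_class (control_graph u)) < \<epsilon>"
proof -
  have T0: "0 \<le> T" using T by simp
  let ?E = "end_time T h"
  have E0: "0 \<le> ?E" by (rule end_time_nonneg[OF T0 h])
  \<comment> \<open>The distance will be at most \<open>2 * m ?E\<close>, hence at most
    \<open>4 * (e * ?E)\<close>; the added 4 makes the final inequality strict and covers
    \<open>?E = 0\<close>.\<close>
  define e where "e = \<epsilon> / (4 * ?E + 4)"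
  have e0: "0 < e" using \<epsilon> E0 by (simp add: e_def)
  have "4 * (e * ?E) + 4 * e = \<epsilon>"
  proof -
    have "e * (4 * ?E + 4) = \<epsilon>" using E0 by (simp add: e_def)
    then show ?thesis by (simp add: algebra_simps)
  qed
  then have e\<epsilon>: "4 * (e * ?E) < \<epsilon>" using e0 by linarith
  \<comment> \<open>Solves \<open>\<mu> * (T + e * ?E) = T\<close>, so that the new time component
    reaches \<open>T\<close> at the same parameter \<open>?E\<close>; it is positive because
    \<open>0 < T\<close>.\<close>
  define \<mu> where "\<mu> = T / (T + e * ?E)"
  have eE: "0 \<le> e * ?E" using e0 E0 by simp
  then have TE: "0 < T + e * ?E" using T by linarith
  have \<mu>T: "\<mu> * (T + e * ?E) = T" using TE by (simp add: \<mu>_def)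
  have \<mu>01: "0 < \<mu>" "\<mu> \<le> 1" using T eE TE by (simp_all add: \<mu>_def)
  define k where "k = (\<lambda>t. (\<mu> * (fst (h t) + e * t), snd (h t)))"
  \<comment> \<open>Its increments dominate those of \<open>h - k\<close> in norm: the lost share
    \<open>1 - \<mu>\<close> of the old time plus the added linear term. It thus bounds the distance
    and, in both directions, the difference of the lengths.\<close>
  define m where "m = (\<lambda>t. (1 - \<mu>) * fst (h t) + \<mu> * e * t)"
  have m0: "m 0 = 0" using crossesD(2)[OF h] by (simp add: m_def)
  have mE: "m ?E \<le> 2 * (e * ?E)"
  proof -
    have "(1 - \<mu>) * T = \<mu> * (e * ?E)" using \<mu>T by (simp add: algebra_simps)
    then have "m ?E = 2 * (\<mu> * (e * ?E))" using fst_end_time[OF T0 h] by (simp add: m_def)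
    moreover have "\<mu> * (e * ?E) \<le> 1 * (e * ?E)" using \<mu>01 eE by (intro mult_right_mono) auto
    ultimately show ?thesis by simp
  qed
  have mono: "fst (h s) \<le> fst (h t)" if "0 \<le> s" "s \<le> t" for s t by (rule crossesD(3)[OF h that])
  have hk: "h t - h s - (k t - k s) = ((1 - \<mu>) * (fst (h t) - fst (h s)) - \<mu> * e * (t - s), 0)" for s t
    by (simp add: k_def prod_eq_iff algebra_simps)
  have diff: "norm (h t - h s - (k t - k s)) \<le> m t - m s" if "0 \<le> s" "s \<le> t" for s t
  proof -
    have "0 \<le> (1 - \<mu>) * (fst (h t) - fst (h s))" "0 \<le> \<mu> * e * (t - s)"
      using mono[OF that] \<mu>01 e0 that by auto
    moreover have "m t - m s = (1 - \<mu>) * (fst (h t) - fst (h s)) + \<mu> * e * (t - s)" by (simp add: m_def algebra_simps)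
    ultimately show ?thesis unfolding hk by (simp add: norm_Pair)
  qed
  note hac = crossesD(1)[OF h]
  have kac: "abs_continuous_on {0..} k"
    unfolding k_def
  proof (rule abs_continuous_on_Pair[OF _ crosses_ac_snd[OF hac]])
    show "abs_continuous_on {0..} (\<lambda>t. \<mu> * (fst (h t) + e * t))"
    proof (rule abs_continuous_on_dominated[OF hac abs_continuous_on_ident], rule exI[of _ "\<mu> * (1 + e)"], intro allI impI)
      fix s t :: real
      have "\<bar>fst (h t) - fst (h s) + e * (t - s)\<bar> \<le> norm (h t - h s) + e * \<bar>t - s\<bar>"
        using norm_fst_diff_le[of "h t" "h s"] abs_triangle_ineq[of "fst (h t) - fst (h s)" "e * (t - s)"] e0
        by (simp add: abs_mult)
      also have "\<dots> \<le> (1 + e) * (norm (h t - h s) + \<bar>t - s\<bar>)" using e0 by (simp add: algebra_simps)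
      finally have "\<mu> * \<bar>fst (h t) - fst (h s) + e * (t - s)\<bar> \<le> \<mu> * ((1 + e) * (norm (h t - h s) + \<bar>t - s\<bar>))"
        using \<mu>01 by (intro mult_left_mono) auto
      moreover have "\<bar>\<mu> * (fst (h t) + e * t) - \<mu> * (fst (h s) + e * s)\<bar> = \<mu> * \<bar>fst (h t) - fst (h s) + e * (t - s)\<bar>"
        using \<mu>01 abs_mult[of \<mu> "fst (h t) - fst (h s) + e * (t - s)"] by (simp add: algebra_simps)
      ultimately show "norm (\<mu> * (fst (h t) + e * t) - \<mu> * (fst (h s) + e * s)) \<le> \<mu> * (1 + e) * (norm (h t - h s) + norm (t - s))"
        by (simp add: mult.assoc)
    qed
  qed
  have inc: "\<mu> * e * (t - s) \<le> fst (k t) - fst (k s)" if "0 \<le> s" "s \<le> t" for s t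
  proof -
    have "0 \<le> \<mu> * (fst (h t) - fst (h s))" using mono[OF that] \<mu>01 by simp
    then show ?thesis by (simp add: k_def algebra_simps)
  qed
  have \<mu>e: "0 < \<mu> * e" using \<mu>01 e0 by simp
  have strict: "fst (k s) < fst (k t)" if "0 \<le> s" "s < t" for s t
  proof -
    have "0 < \<mu> * e * (t - s)" using that \<mu>e by simp
    then show ?thesis using inc[of s t] that by simp
  qed
  have kE: "fst (k ?E) = T" using \<mu>T fst_end_time[OF T0 h] by (simp add: k_def)
  have k0: "fst (k 0) = 0" "snd (k 0) = 0" using crossesD(2)[OF h] h0 by (simp_all add: k_def)
  have kc: "crosses T k"
    unfolding crosses_def
  proof (intro conjI allI impI kac k0)
    show "fst (k s) \<le> fst (k t)" if "0 \<le> s" "s \<le> t" for s t using strict[of s t] that by (cases "s = t") auto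
    show "\<exists>t\<ge>0. T < fst (k t)" using strict[of ?E "?E + 1"] kE E0 by (intro exI[of _ "?E + 1"]) simp
  qed
  have ke: "end_time T k = ?E"
    by (rule end_time_unique[OF T0 kc E0 kE]) (use strict[OF E0] kE in auto)
  have "close_up_to (m ?E) (trunc T h) (trunc T k)"
  proof (rule close_up_toI_id)
    fix t :: real assume "0 \<le> t"
    then have s: "0 \<le> min t ?E" "min t ?E \<le> ?E" using E0 by auto
    have "h 0 - k 0 = 0" using k0 h0 crossesD(2)[OF h] by (simp add: prod_eq_iff)
    then have "h (min t ?E) - k (min t ?E) = h (min t ?E) - h 0 - (k (min t ?E) - k 0)" by (simp add: algebra_simps)
    then have "norm (h (min t ?E) - k (min t ?E)) \<le> m (min t ?E)"
      using diff[OF order.refl s(1)] m0 by simp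
    moreover have "0 \<le> m ?E - m (min t ?E)" using order_trans[OF norm_ge_zero diff[OF s]] .
    ultimately show "norm (trunc T h t - trunc T k t) \<le> m ?E"
      unfolding trunc_eq[OF T0 h] trunc_eq[OF T0 kc] ke by linarith
  qed
  from d_T_le(1)[OF T0 h kc this] have dT: "d_T T (frechet_class h) (frechet_class k) \<le> m ?E" .
  have "arc_length h ?E \<le> arc_length k ?E + (m ?E - m 0)"
  proof (rule arc_length_le_of_diff[OF hac kac E0])
    fix s t :: real assume "0 \<le> s" "s \<le> t"
    from diff[OF this] show "norm (h t - h s) \<le> norm (k t - k s) + (m t - m s)"
      using norm_triangle_sub[of "h t - h s" "k t - k s"] by linarith
  qed
  moreover have "arc_length k ?E \<le> arc_length h ?E + (m ?E - m 0)"
  proof (rule arc_length_le_of_diff[OF kac hac E0])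
    fix s t :: real assume "0 \<le> s" "s \<le> t"
    from diff[OF this] show "norm (k t - k s) \<le> norm (h t - h s) + (m t - m s)"
      using norm_triangle_sub[of "k t - k s" "h t - h s"] norm_minus_commute[of "k t - k s" "h t - h s"] by linarith
  qed
  ultimately have "d_plus T (frechet_class h) (frechet_class k) \<le> 2 * m ?E"
    using dT m0 unfolding d_plus_def trunc_length_eq[OF T0 h] trunc_length_eq[OF T0 kc] ke by linarith
  then have d: "d_plus T (frechet_class h) (frechet_class k) < \<epsilon>" using mE e\<epsilon> by linarith
  have A: "(\<lambda>t. fst (k t)) \<in> reparam \<infinity>"
    by (rule strictly_increasing_reparam[OF crosses_ac_fst[OF kac] k0(1) \<mu>e inc])
  \<comment> \<open>Time itself becomes the parameter, so that \<open>q\<close> is a graph over time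
    and the derivative of its second component is the control.\<close>
  define I where "I = the_inv_into {0..} (\<lambda>t. fst (k t))"
  have I: "I \<in> reparam \<infinity>" unfolding I_def by (rule reparam_inverse[OF A])
  define q where "q = (\<lambda>t. k (I t))"
  have qac: "abs_continuous_on {0..} q"
    unfolding q_def by (rule abs_continuous_on_reparam[OF I]) (simp add: kac)
  have fq: "fst (q t) = t" if "0 \<le> t" for t
    using reparam_inv(2)[OF A, of t] that by (simp add: q_def I_def)
  have sq0: "snd (q 0) = 0" using k0 reparam_0[OF I] by (simp add: q_def)
  define u where "u = (\<lambda>t. vector_derivative (\<lambda>s. snd (q s)) (at t))"
  note sq = abs_continuous_on_restrict[OF crosses_ac_snd[OF qac]]
  have u: "ordinary_control u"
    unfolding ordinary_control_def u_def using abs_continuous_on_absolutely_integrable_derivative[OF sq] by blast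
  have gq: "control_graph u t = q t" if "0 \<le> t" for t
  proof -
    have "integral {0..t} u = snd (q t) - snd (q 0)"
      unfolding u_def by (rule integral_unique[OF abs_continuous_on_has_integral_derivative[OF that sq]])
    then show ?thesis using fq[OF that] sq0 by (simp add: control_graph_def prod_eq_iff)
  qed
  have "frechet_equiv (control_graph u) k"
    by (rule frechet_equiv_reparam[OF ordinary_control_ac[OF u] kac I]) (simp add: gq q_def)
  then have "frechet_class (control_graph u) = frechet_class k"
    using frechet_class_eq_iff[OF ordinary_control_ac[OF u] kac] by simp
  with d u show thesis using that[of u] by simp
qed

section \<open>Control-affine vector fields\<close>

definition affine_field ::
    "(real ^ 'n \<Rightarrow> real ^ 'n) \<Rightarrow> ('k \<Rightarrow> real ^ 'n \<Rightarrow> real ^ 'n) \<Rightarrow> real ^ 'n \<Rightarrow> real \<times> (real ^ 'k) \<Rightarrow> real ^ 'n" where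
  "affine_field f G y p = fst p *\<^sub>R f y + (\<Sum>i\<in>UNIV. (snd p $ i) *\<^sub>R G i y)"

lemma local_lipschitz_cutoff:
  fixes g :: "real ^ 'n \<Rightarrow> real ^ 'n"
  assumes g: "local_lipschitz (UNIV :: real set) UNIV (\<lambda>_. g)" and R: "0 < R"
  shows "\<exists>M\<ge>0. \<forall>y z. norm (cutoff R g y) \<le> M \<and> norm (cutoff R g y - cutoff R g z) \<le> M * norm (y - z)"
proof -
  let ?c = "closest_point (cball 0 R) :: real ^ 'n \<Rightarrow> _"
  \<comment> \<open>The time argument of \<open>local_lipschitz\<close> is a dummy; it is reduced to
    one point so that compactness yields a Lipschitz constant on the ball.\<close>
  have loc: "local_lipschitz {0 :: real} (cball 0 R) (\<lambda>_. g)" by (rule local_lipschitz_subset[OF g]) auto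
  obtain L where L: "L-lipschitz_on (cball 0 R) g"
    by (rule local_lipschitz_compact_implies_lipschitz[OF loc, of thesis]) auto
  have L0: "0 \<le> L" by (rule lipschitz_on_nonneg[OF L])
  have c: "?c y \<in> cball 0 R" for y using R by (intro closest_point_in_set) auto
  define M where "M = norm (g 0) + L * R + L"
  have LR: "0 \<le> L * R" using L0 R by simp
  show ?thesis
  proof (intro exI[of _ M] conjI allI)
    show "0 \<le> M" using L0 LR by (simp add: M_def)
    fix y z
    have "norm (g (?c y) - g 0) \<le> L * norm (?c y - 0)"
      using lipschitz_onD[OF L c[of y], of 0] R by (simp add: dist_norm)
    also have "\<dots> \<le> L * R" using c[of y] L0 by (intro mult_left_mono) auto
    finally show "norm (cutoff R g y) \<le> M"
      using norm_triangle_sub[of "g (?c y)" "g 0"] L0 by (simp add: cutoff_def M_def)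
    have "norm (g (?c y) - g (?c z)) \<le> L * norm (?c y - ?c z)"
      using lipschitz_onD[OF L c[of y] c[of z]] by (simp add: dist_norm)
    also have "\<dots> \<le> L * norm (y - z)"
      using closest_point_lipschitz[of "cball 0 R" y z] R L0 by (intro mult_left_mono) (auto simp: dist_norm)
    also have "\<dots> \<le> M * norm (y - z)" using LR by (intro mult_right_mono) (auto simp: M_def)
    finally show "norm (cutoff R g y - cutoff R g z) \<le> M * norm (y - z)" by (simp add: cutoff_def)
  qed
qed

lemma loc_lip_affine_field:
  fixes f :: "real ^ 'n \<Rightarrow> real ^ 'n" and G :: "'k::finite \<Rightarrow> real ^ 'n \<Rightarrow> real ^ 'n"
  assumes f: "local_lipschitz (UNIV :: real set) UNIV (\<lambda>_. f)"
    and G: "\<And>i. local_lipschitz (UNIV :: real set) UNIV (\<lambda>_. G i)"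
  shows "loc_lip (affine_field f G)"
  unfolding loc_lip_def
proof (intro allI impI)
  fix R :: real assume R: "0 < R"
  obtain A where A: "0 \<le> A" "\<And>y. norm (cutoff R f y) \<le> A" "\<And>y z. norm (cutoff R f y - cutoff R f z) \<le> A * norm (y - z)"
    using local_lipschitz_cutoff[OF f R] by blast
  have "\<forall>i. \<exists>M\<ge>0. \<forall>y z. norm (cutoff R (G i) y) \<le> M \<and> norm (cutoff R (G i) y - cutoff R (G i) z) \<le> M * norm (y - z)"
    using local_lipschitz_cutoff[OF G R] by simp
  from choice[OF this] obtain B where "\<forall>i. 0 \<le> B i \<and> (\<forall>y z. norm (cutoff R (G i) y) \<le> B i \<and>
      norm (cutoff R (G i) y - cutoff R (G i) z) \<le> B i * norm (y - z))" by (rule exE)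
  then have B: "0 \<le> B i" "norm (cutoff R (G i) y) \<le> B i" "norm (cutoff R (G i) y - cutoff R (G i) z) \<le> B i * norm (y - z)" for i y z
    by simp_all
  have cut: "cutoff R (affine_field f G) y p = fst p *\<^sub>R cutoff R f y + (\<Sum>i\<in>UNIV. (snd p $ i) *\<^sub>R cutoff R (G i) y)" for y p
    by (simp add: cutoff_def affine_field_def)
  have p1: "\<bar>fst p\<bar> \<le> norm p" for p :: "real \<times> (real ^ 'k)" using norm_fst_diff_le[of p 0] by simp
  have p2: "\<bar>snd p $ i\<bar> \<le> norm p" for p :: "real \<times> (real ^ 'k)" and i
    using norm_snd_diff_le[of p 0] component_le_norm_cart[of "snd p" i] by simp
  define M where "M = A + (\<Sum>i\<in>UNIV. B i)"
  \<comment> \<open>One estimate for both conditions in \<open>glip\<close>: \<open>r = 1\<close>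
    gives the bound and \<open>r = norm (y - z)\<close> the Lipschitz condition.\<close>
  have comb: "norm (fst p *\<^sub>R a + (\<Sum>i\<in>UNIV. (snd p $ i) *\<^sub>R b i)) \<le> M * r * norm p"
    if "norm a \<le> A * r" "\<And>i. norm (b i) \<le> B i * r" for p :: "real \<times> (real ^ 'k)" and a :: "real ^ 'n" and b r
  proof -
    have "norm (fst p *\<^sub>R a) \<le> norm p * (A * r)"
      using mult_mono[OF p1[of p] that(1)] by simp
    moreover have "norm (\<Sum>i\<in>UNIV. (snd p $ i) *\<^sub>R b i) \<le> (\<Sum>i\<in>UNIV. norm p * (B i * r))"
    proof (rule sum_norm_le)
      fix i
      show "norm ((snd p $ i) *\<^sub>R b i) \<le> norm p * (B i * r)" using mult_mono[OF p2[of p i] that(2)[of i]] by simp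
    qed
    moreover have "(\<Sum>i\<in>UNIV. norm p * (B i * r)) = norm p * ((\<Sum>i\<in>UNIV. B i) * r)"
      by (simp add: sum_distrib_left sum_distrib_right)
    moreover have "M * r * norm p = norm p * (A * r) + norm p * ((\<Sum>i\<in>UNIV. B i) * r)" by (simp add: M_def algebra_simps)
    ultimately show ?thesis
      using norm_triangle_ineq[of "fst p *\<^sub>R a" "\<Sum>i\<in>UNIV. (snd p $ i) *\<^sub>R b i"] by linarith
  qed
  have "glip M (cutoff R (affine_field f G))"
    unfolding glip_def
  proof (intro conjI allI)
    show "0 \<le> M" using A(1) B(1) by (simp add: M_def sum_nonneg)
    fix y z and p :: "real \<times> (real ^ 'k)"
    show "linear (cutoff R (affine_field f G) y)"
      by (rule linearI) (simp_all add: cut scaleR_add_left scaleR_add_right sum.distrib scaleR_sum_right)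
    show "norm (cutoff R (affine_field f G) y p) \<le> M * norm p"
      using comb[of "cutoff R f y" 1 "\<lambda>i. cutoff R (G i) y" p] A(2) B(2) by (simp add: cut)
    have "cutoff R (affine_field f G) y p - cutoff R (affine_field f G) z p =
        fst p *\<^sub>R (cutoff R f y - cutoff R f z) + (\<Sum>i\<in>UNIV. (snd p $ i) *\<^sub>R (cutoff R (G i) y - cutoff R (G i) z))"
      by (simp add: cut scaleR_diff_right sum_subtractf)
    then show "norm (cutoff R (affine_field f G) y p - cutoff R (affine_field f G) z p) \<le> M * norm (y - z) * norm p"
      using comb[of "cutoff R f y - cutoff R f z" "norm (y - z)" "\<lambda>i. cutoff R (G i) y - cutoff R (G i) z" p] A(3) B(3) by simp
  qed
  then show "\<exists>M. glip M (cutoff R (affine_field f G))" by blast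
qed

lemma generalized_trajectory_eq:
  fixes h :: "real \<Rightarrow> real \<times> (real ^ 'k)"
  assumes h: "abs_continuous_on {0..} h"
  shows "generalized_trajectory f G x0 h = gtraj (affine_field f G) x0 h"
proof -
  let ?v = "\<lambda>t. vector_derivative (\<lambda>s. fst (h s)) (at t)" and ?w = "\<lambda>t. vector_derivative (\<lambda>s. snd (h s)) (at t)"
  have "AE t in lebesgue. 0 \<le> t \<longrightarrow>
      (\<forall>y. ?v t *\<^sub>R f y + (\<Sum>i\<in>UNIV. (?w t $ i) *\<^sub>R G i y) = drive (affine_field f G) h t y)"
    using AE_has_vector_derivative[OF h]
  proof (rule AE_mp, intro AE_I2 impI allI)
    fix t y assume "0 \<le> t \<longrightarrow> (h has_vector_derivative vector_derivative h (at t)) (at t)" "0 \<le> t"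
    then have d: "(h has_vector_derivative vector_derivative h (at t)) (at t)" by simp
    have "?v t = fst (vector_derivative h (at t))" "?w t = snd (vector_derivative h (at t))"
      using vector_derivative_at[OF bounded_linear.has_vector_derivative[OF bounded_linear_fst d]]
        vector_derivative_at[OF bounded_linear.has_vector_derivative[OF bounded_linear_snd d]] by simp_all
    then show "?v t *\<^sub>R f y + (\<Sum>i\<in>UNIV. (?w t $ i) *\<^sub>R G i y) = drive (affine_field f G) h t y"
      by (simp add: affine_field_def)
  qed
  from max_solution_cong[OF this, of x0] show ?thesis by (simp add: generalized_trajectory_def gtraj_def Let_def)
qed

lemma ordinary_trajectory_eq:
  fixes u :: "real \<Rightarrow> real ^ 'k"
  assumes u: "ordinary_control u"
  shows "ordinary_trajectory f G x0 u = gtraj (affine_field f G) x0 (control_graph u)"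
proof -
  let ?U = "\<lambda>t. integral {0..t} u"
  have "AE t in lebesgue. t \<in> half_open \<infinity> \<longrightarrow> (?U has_vector_derivative u t) (at t)"
  proof (rule AE_half_open)
    fix b :: real assume "b \<in> half_open \<infinity>"
    then show "negligible {x \<in> {0..b}. \<not> (?U has_vector_derivative u x) (at x)}"
      using u by (intro negligible_derivative_integral) (simp add: ordinary_control_def)
  qed
  then have "AE t in lebesgue. 0 \<le> t \<longrightarrow>
      (\<forall>y. f y + (\<Sum>i\<in>UNIV. (u t $ i) *\<^sub>R G i y) = drive (affine_field f G) (control_graph u) t y)"
  proof (rule AE_mp, intro AE_I2 impI allI)
    fix t y assume "t \<in> half_open \<infinity> \<longrightarrow> (?U has_vector_derivative u t) (at t)" "0 \<le> t"
    then have "(?U has_vector_derivative u t) (at t)" by simp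
    then have "((\<lambda>s. (s, ?U s)) has_vector_derivative (1, u t)) (at t)"
      by (intro has_vector_derivative_Pair has_vector_derivative_id)
    from vector_derivative_at[OF this]
    show "f y + (\<Sum>i\<in>UNIV. (u t $ i) *\<^sub>R G i y) = drive (affine_field f G) (control_graph u) t y"
      by (simp add: affine_field_def control_graph_def[abs_def])
  qed
  from max_solution_cong[OF this, of x0] show ?thesis by (simp add: ordinary_trajectory_def gtraj_def Let_def)
qed

lemma WW_eq:
  "WW f G x0 T = (\<lambda>h. ident T (frechet_class h)) ` {h \<in> YYT0 T. generalized_trajectory f G x0 h \<in> FF T}"
  unfolding WW_def quotient_def ident_def by blast

lemma FFQ0_eq: "FFQ0 T = (\<lambda>h. ident T (frechet_class h)) ` YYT0 T"
  unfolding FFQ0_def quotient_def ident_def by blast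

lemma YYT0_crosses:
  assumes "h \<in> YYT0 T" "0 \<le> T"
  shows "crosses T h" "snd (h 0) = 0" "frechet_class h \<in> FF T" "abs_continuous_on {0..} h"
proof -
  have h: "h \<in> YYT T" and h0: "snd (h 0) = 0" using assms(1) by (simp_all add: YYT0_def)
  show c: "crosses T h" by (rule YYT_crosses[OF assms(2) h])
  show "snd (h 0) = 0" by (rule h0)
  show "frechet_class h \<in> FF T" using h by (simp add: FF_def)
  show "abs_continuous_on {0..} h" by (rule crossesD(1)[OF c])
qed

section \<open>Local behaviour of the input-to-trajectory map\<close>

context
  fixes f :: "real ^ 'n \<Rightarrow> real ^ 'n"
    and G :: "'k::finite \<Rightarrow> real ^ 'n \<Rightarrow> real ^ 'n"
    and x0 :: "real ^ 'n"
    and T :: real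
  assumes f: "local_lipschitz (UNIV :: real set) UNIV (\<lambda>_. f)"
    and G: "\<And>i. local_lipschitz (UNIV :: real set) UNIV (\<lambda>_. G i)"
    and T: "0 < T"
begin

abbreviation (input) "traj \<equiv> generalized_trajectory f G x0"
abbreviation (input) "pt \<equiv> \<lambda>h. ident T (frechet_class h)"

text \<open>A nearby \<open>h'\<close> has a solution up to its end parameter, but its own
  trajectory may have finite length. In the quotient this is repaired by
  \<open>extend_after_end_time\<close>, which gives the first conclusion; if the time component of
  \<open>h'\<close> is unbounded, as for graphs of ordinary controls, \<open>h'\<close> itself is
  admissible. The third conclusion is continuity, with \<open>\<epsilon> / 3\<close> turning twice
  that into a strict inequality.\<close>

lemma admissible_near:
  assumes h: "h \<in> YYT0 T" and FF: "traj h \<in> FF T" and \<epsilon>: "0 < \<epsilon>"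
  obtains \<delta> where "0 < \<delta>"
    "\<And>h'. h' \<in> YYT0 T \<Longrightarrow> d_plus T (frechet_class h) (frechet_class h') < \<delta> \<Longrightarrow> pt h' \<in> WW f G x0 T"
    "\<And>h'. h' \<in> YYT0 T \<Longrightarrow> d_plus T (frechet_class h) (frechet_class h') < \<delta> \<Longrightarrow>
       (\<And>B. \<exists>t\<ge>0. B < fst (h' t)) \<Longrightarrow> traj h' \<in> FF T"
    "\<And>h'. h' \<in> YYT0 T \<Longrightarrow> d_plus T (frechet_class h) (frechet_class h') < \<delta> \<Longrightarrow>
       traj h' \<in> FF T \<Longrightarrow> d_plus T (traj h) (traj h') < \<epsilon>"
proof -
  let ?H = "affine_field f G"
  have T0: "0 \<le> T" using T by simp
  note H = loc_lip_affine_field[OF f G]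
  note eq = generalized_trajectory_eq[where f = f and G = G and ?x0.0 = x0]
  note hc = YYT0_crosses[OF h T0]
  have FF': "gtraj ?H x0 h \<in> FF T" using FF eq[OF hc(4)] by simp
  have \<epsilon>3: "0 < \<epsilon> / 3" using \<epsilon> by simp
  obtain \<delta> where \<delta>: "0 < \<delta>"
    "\<And>h'. crosses T h' \<Longrightarrow> d_plus T (frechet_class h) (frechet_class h') < \<delta> \<Longrightarrow>
       (\<exists>Z. solves_on (aug ?H) (trunc T h') (0, x0) {0..} Z) \<and>
       (gtraj ?H x0 h' \<in> FF T \<longrightarrow> d_plus T (gtraj ?H x0 h) (gtraj ?H x0 h') \<le> 2 * (\<epsilon> / 3))"
    by (rule gtraj_dependence[OF H T0 hc(1) FF' \<epsilon>3]) blast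
  show thesis
  proof (rule that[OF \<delta>(1)])
    fix h' :: "real \<Rightarrow> real \<times> (real ^ 'k)"
    assume h': "h' \<in> YYT0 T" and d: "d_plus T (frechet_class h) (frechet_class h') < \<delta>"
    note h'c = YYT0_crosses[OF h' T0]
    obtain Z where Z: "solves_on (aug ?H) (trunc T h') (0, x0) {0..} Z" using \<delta>(2)[OF h'c(1) d] by blast
    obtain h3 where h3: "h3 \<in> YYT0 T" "trunc T h3 = trunc T h'" "\<And>B. \<exists>t\<ge>0. B < fst (h3 t)"
      by (rule extend_after_end_time[OF T0 h'c(1,2)]) blast
    note h3c = YYT0_crosses[OF h3(1) T0]
    have "gtraj ?H x0 h3 \<in> FF T"
      by (rule gtraj_FF_I[OF H T0 h3c(1) _ h3(3)]) (unfold h3(2), rule Z)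
    then have "pt h3 \<in> WW f G x0 T" using h3(1) eq[OF h3c(4)] unfolding WW_eq by (intro imageI) simp
    moreover have "d_plus T (frechet_class h') (frechet_class h3) = 0"
      unfolding d_plus_zero_iff[OF T0 h'c(1) h3c(1)] h3(2) by (rule frechet_equiv_refl[OF trunc_ac[OF T0 h'c(1)]])
    then have "pt h' = pt h3" using ident_eq_iff[OF T0 h'c(3) h3c(3)] by simp
    ultimately show "pt h' \<in> WW f G x0 T" by simp
  next
    fix h' :: "real \<Rightarrow> real \<times> (real ^ 'k)"
    assume h': "h' \<in> YYT0 T" and d: "d_plus T (frechet_class h) (frechet_class h') < \<delta>"
      and unb: "\<And>B. \<exists>t\<ge>0. B < fst (h' t)"
    note h'c = YYT0_crosses[OF h' T0]
    obtain Z where "solves_on (aug ?H) (trunc T h') (0, x0) {0..} Z" using \<delta>(2)[OF h'c(1) d] by blast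
    from gtraj_FF_I[OF H T0 h'c(1) this unb] show "traj h' \<in> FF T" using eq[OF h'c(4)] by simp
  next
    fix h' :: "real \<Rightarrow> real \<times> (real ^ 'k)"
    assume h': "h' \<in> YYT0 T" and d: "d_plus T (frechet_class h) (frechet_class h') < \<delta>" and FFh': "traj h' \<in> FF T"
    note h'c = YYT0_crosses[OF h' T0]
    have "gtraj ?H x0 h' \<in> FF T" using FFh' eq[OF h'c(4)] by simp
    then have "d_plus T (traj h) (traj h') \<le> 2 * (\<epsilon> / 3)"
      using \<delta>(2)[OF h'c(1) d] eq[OF hc(4)] eq[OF h'c(4)] by simp
    then show "d_plus T (traj h) (traj h') < \<epsilon>" using \<epsilon> by simp
  qed
qed

text \<open>Identified controls are at distance 0, hence within every \<open>\<delta>\<close> of the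
  continuity estimate; so their trajectories are at distance 0 as well.\<close>

lemma traj_well_defined:
  assumes h: "h \<in> YYT0 T" "traj h \<in> FF T" and h': "h' \<in> YYT0 T" "traj h' \<in> FF T" and eq: "pt h = pt h'"
  shows "ident T (traj h) = ident T (traj h')"
proof -
  have T0: "0 \<le> T" using T by simp
  have d0: "d_plus T (frechet_class h) (frechet_class h') = 0"
    using eq ident_eq_iff[OF T0 YYT0_crosses(3)[OF h(1) T0] YYT0_crosses(3)[OF h'(1) T0]] by simp
  have less: "d_plus T (traj h) (traj h') < \<epsilon>" if \<epsilon>: "0 < \<epsilon>" for \<epsilon>
  proof -
    obtain \<delta> where "0 < \<delta>" "\<And>h'. h' \<in> YYT0 T \<Longrightarrow> d_plus T (frechet_class h) (frechet_class h') < \<delta> \<Longrightarrow>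
       traj h' \<in> FF T \<Longrightarrow> d_plus T (traj h) (traj h') < \<epsilon>"
      by (rule admissible_near[OF h \<epsilon>]) blast
    then show ?thesis using d0 h' by simp
  qed
  have "d_plus T (traj h) (traj h') = 0"
    using less[of "d_plus T (traj h) (traj h')"] d_plus_nonneg[OF T0, of "traj h" "traj h'"] by fastforce
  then show ?thesis using ident_eq_iff[OF T0 h(2) h'(2)] by simp
qed

text \<open>Membership in \<open>WW\<close> provides only some identified curve with a trajectory in
  \<open>FF T\<close>. Since time is unbounded along the graph of an ordinary control, admissibility
  passes to the graph itself.\<close>

lemma admissible_control_graph:
  assumes u: "ordinary_control u" and W: "pt (control_graph u) \<in> WW f G x0 T"
  shows "traj (control_graph u) \<in> FF T"
proof -
  have T0: "0 \<le> T" using T by simp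
  note g = control_graph_YYT0[OF u T0]
  obtain h where h: "h \<in> YYT0 T" "traj h \<in> FF T" "pt (control_graph u) = pt h" using W unfolding WW_eq by auto
  have "d_plus T (frechet_class h) (frechet_class (control_graph u)) = 0"
    using h(3) ident_eq_iff[OF T0 YYT0_crosses(3)[OF h(1) T0] YYT0_crosses(3)[OF g T0]] by simp
  moreover obtain \<delta> where "0 < \<delta>" and \<delta>: "\<And>h'. h' \<in> YYT0 T \<Longrightarrow> d_plus T (frechet_class h) (frechet_class h') < \<delta> \<Longrightarrow>
       (\<And>B. \<exists>t\<ge>0. B < fst (h' t)) \<Longrightarrow> traj h' \<in> FF T"
    by (rule admissible_near[OF h(1,2) zero_less_one]) blast
  moreover have "\<exists>t\<ge>0. B < fst (control_graph u t)" for B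
    by (intro exI[of _ "\<bar>B\<bar> + 1"]) simp
  ultimately show ?thesis using g by (intro \<delta>) simp_all
qed

end

section \<open>Openness, continuous extension and uniqueness on the quotient\<close>

theorem theorem19:
  fixes f :: "real ^ 'n \<Rightarrow> real ^ 'n"
    and G :: "'k::finite \<Rightarrow> real ^ 'n \<Rightarrow> real ^ 'n"
    and x0 :: "real ^ 'n"
    and T :: real
  assumes "local_lipschitz (UNIV :: real set) UNIV (\<lambda>_. f)"
    and "\<And>i. local_lipschitz (UNIV :: real set) UNIV (\<lambda>_. G i)"
    and "0 < T"
  shows "openin (control_topology T) (WW f G x0 T) \<and>
    (\<exists>\<Phi> :: (real \<Rightarrow> real \<times> (real ^ 'k)) set set \<Rightarrow> (real \<Rightarrow> real \<times> (real ^ 'n)) set set.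
       (\<forall>h \<in> YYT0 T. generalized_trajectory f G x0 h \<in> FF T \<longrightarrow>
          \<Phi> (ident T (frechet_class h)) = ident T (generalized_trajectory f G x0 h)) \<and>
       extends_input_to_trajectory f G x0 T \<Phi> \<and>
       continuous_map (subtopology (control_topology T) (WW f G x0 T)) (curve_topology T) \<Phi> \<and>
       (\<forall>\<Psi>. extends_input_to_trajectory f G x0 T \<Psi> \<and>
            continuous_map (subtopology (control_topology T) (WW f G x0 T)) (curve_topology T) \<Psi> \<longrightarrow>
            (\<forall>C \<in> WW f G x0 T. \<Psi> C = \<Phi> C)))"
proof -
  let ?W = "WW f G x0 T"
  let ?pt = "\<lambda>h. ident T (frechet_class h)"
  let ?traj = "generalized_trajectory f G x0"
  have T0: "0 \<le> T" using assms(3) by simp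
  note near = admissible_near[OF assms]
  have Wsub: "?W \<subseteq> FFQ0 T" unfolding WW_eq FFQ0_eq by blast
  have Qsub: "(FFQ0 T :: (real \<Rightarrow> real \<times> (real ^ 'k)) set set set) \<subseteq> FFQ T"
    unfolding FFQ0_eq using ident_mem[OF T0 YYT0_crosses(3)[OF _ T0]] by blast
  interpret Q: Metric_space "FFQ T :: (real \<Rightarrow> real \<times> (real ^ 'k)) set set set" "d_plusQ T" by (rule Metric_space_FFQ[OF T0])
  interpret Q0: Metric_space "FFQ0 T :: (real \<Rightarrow> real \<times> (real ^ 'k)) set set set" "d_plusQ T" by (rule Q.subspace[OF Qsub])
  interpret X: Metric_space "FFQ T :: (real \<Rightarrow> real \<times> (real ^ 'n)) set set set" "d_plusQ T" by (rule Metric_space_FFQ[OF T0])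
  interpret W: Submetric "FFQ0 T :: (real \<Rightarrow> real \<times> (real ^ 'k)) set set set" "d_plusQ T" ?W
    by unfold_locales (rule Wsub)
  have W_E: "\<exists>h. h \<in> YYT0 T \<and> ?traj h \<in> FF T \<and> C = ?pt h" if "C \<in> ?W" for C
    using that unfolding WW_eq by blast
  have dist: "d_plusQ T (?pt h) (?pt h') = d_plus T (frechet_class h) (frechet_class h')"
    if "h \<in> YYT0 T" "h' \<in> YYT0 T" for h h' :: "real \<Rightarrow> real \<times> (real ^ 'k)"
    by (rule d_plusQ_ident[OF T0 YYT0_crosses(3)[OF that(1) T0] YYT0_crosses(3)[OF that(2) T0]])
  have "openin Q0.mtopology ?W"
    unfolding Q0.openin_mtopology
  proof (intro conjI allI impI Wsub)
    fix C assume "C \<in> ?W"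
    then obtain h where h: "h \<in> YYT0 T" "?traj h \<in> FF T" "C = ?pt h" using W_E by blast
    obtain \<delta> where "0 < \<delta>" and \<delta>: "\<And>h'. h' \<in> YYT0 T \<Longrightarrow> d_plus T (frechet_class h) (frechet_class h') < \<delta> \<Longrightarrow> ?pt h' \<in> ?W"
      by (rule near[OF h(1,2) zero_less_one]) blast
    have "Q0.mball C \<delta> \<subseteq> ?W"
    proof
      fix C' assume C': "C' \<in> Q0.mball C \<delta>"
      then have "C' \<in> FFQ0 T" by simp
      then obtain h' where h': "h' \<in> YYT0 T" "C' = ?pt h'" unfolding FFQ0_eq by blast
      have "d_plusQ T C C' < \<delta>" using C' by simp
      then have "d_plus T (frechet_class h) (frechet_class h') < \<delta>" using dist[OF h(1) h'(1)] h(3) h'(2) by simp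
      from \<delta>[OF h'(1) this] show "C' \<in> ?W" using h'(2) by simp
    qed
    with \<open>0 < \<delta>\<close> show "\<exists>r>0. Q0.mball C r \<subseteq> ?W" by blast
  qed
  then have open_W: "openin (control_topology T) ?W" by (simp add: control_topology_def)
  \<comment> \<open>Every point of \<open>?W\<close> has a representative whose own trajectory lies
    in \<open>FF T\<close>. Outside \<open>?W\<close> the choice is arbitrary, and so are the values
    of \<open>\<Phi>\<close> there.\<close>
  define rep where "rep = (\<lambda>C. SOME h. h \<in> YYT0 T \<and> ?traj h \<in> FF T \<and> C = ?pt h)"
  define \<Phi> where "\<Phi> = (\<lambda>C. ident T (?traj (rep C)))"
  have rep: "rep C \<in> YYT0 T" "?traj (rep C) \<in> FF T" "?pt (rep C) = C" if "C \<in> ?W" for C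
    using someI_ex[OF W_E[OF that]] unfolding rep_def by simp_all
  have \<Phi>_eq: "\<Phi> (?pt h) = ident T (?traj h)" if h: "h \<in> YYT0 T" "?traj h \<in> FF T" for h
  proof -
    have W: "?pt h \<in> ?W" unfolding WW_eq using h by blast
    show ?thesis
      unfolding \<Phi>_def by (rule traj_well_defined[OF assms rep(1,2)[OF W] h rep(3)[OF W]])
  qed
  have top: "subtopology (control_topology T) ?W = W.sub.mtopology"
    unfolding control_topology_def by (rule W.mtopology_submetric[symmetric])
  note cont_iff = W.sub.metric_continuous_map[OF Metric_space_FFQ[OF T0]]
  have ext: "extends_input_to_trajectory f G x0 T \<Phi>"
    unfolding extends_input_to_trajectory_def
  proof (intro allI impI, elim conjE)
    fix u assume u: "ordinary_control u" and W: "?pt (control_graph u) \<in> ?W"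
    note FFu = admissible_control_graph[OF assms u W]
    show "\<Phi> (?pt (control_graph u)) = ident T (ordinary_trajectory f G x0 u)"
      unfolding \<Phi>_eq[OF control_graph_YYT0[OF u T0] FFu]
      by (simp add: generalized_trajectory_eq[OF ordinary_control_ac[OF u]] ordinary_trajectory_eq[OF u])
  qed
  have cont: "continuous_map W.sub.mtopology (curve_topology T) \<Phi>"
    unfolding curve_topology_def cont_iff
  proof (intro conjI ballI allI impI)
    show "\<Phi> ` ?W \<subseteq> FFQ T" unfolding \<Phi>_def using ident_mem[OF T0 rep(2)] by blast
    fix C and \<epsilon> :: real assume C: "C \<in> ?W" and \<epsilon>: "0 < \<epsilon>"
    obtain \<delta> where "0 < \<delta>" and \<delta>: "\<And>h'. h' \<in> YYT0 T \<Longrightarrow> d_plus T (frechet_class (rep C)) (frechet_class h') < \<delta> \<Longrightarrow>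
        ?traj h' \<in> FF T \<Longrightarrow> d_plus T (?traj (rep C)) (?traj h') < \<epsilon>"
      by (rule near[OF rep(1,2)[OF C] \<epsilon>]) blast
    have "d_plusQ T (\<Phi> C) (\<Phi> C') < \<epsilon>" if C': "C' \<in> ?W" and d: "d_plusQ T C C' < \<delta>" for C'
    proof -
      have "d_plus T (frechet_class (rep C)) (frechet_class (rep C')) < \<delta>"
        using d dist[OF rep(1)[OF C] rep(1)[OF C']] by (simp add: rep(3)[OF C] rep(3)[OF C'])
      from \<delta>[OF rep(1)[OF C'] this rep(2)[OF C']] show ?thesis
        unfolding \<Phi>_def using d_plusQ_ident[OF T0 rep(2)[OF C] rep(2)[OF C']] by simp
    qed
    with \<open>0 < \<delta>\<close> show "\<exists>\<delta>>0. \<forall>C'. C' \<in> ?W \<and> d_plusQ T C C' < \<delta> \<longrightarrow> d_plusQ T (\<Phi> C) (\<Phi> C') < \<epsilon>" by blast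
  qed
  have unique: "\<Psi> C = \<Phi> C"
    if ext': "extends_input_to_trajectory f G x0 T \<Psi>" and cont': "continuous_map W.sub.mtopology (curve_topology T) \<Psi>"
      and C: "C \<in> ?W" for \<Psi> C
  proof (rule ccontr)
    assume neq: "\<Psi> C \<noteq> \<Phi> C"
    from cont cont' have \<Phi>\<Psi>: "\<And>\<epsilon>. 0 < \<epsilon> \<Longrightarrow> \<exists>\<delta>>0. \<forall>C'. C' \<in> ?W \<and> d_plusQ T C C' < \<delta> \<longrightarrow> d_plusQ T (\<Phi> C) (\<Phi> C') < \<epsilon>"
      "\<And>\<epsilon>. 0 < \<epsilon> \<Longrightarrow> \<exists>\<delta>>0. \<forall>C'. C' \<in> ?W \<and> d_plusQ T C C' < \<delta> \<longrightarrow> d_plusQ T (\<Psi> C) (\<Psi> C') < \<epsilon>"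
      and mem: "\<Phi> ` ?W \<subseteq> FFQ T" "\<Psi> ` ?W \<subseteq> FFQ T"
      using C unfolding curve_topology_def cont_iff by simp_all
    have mC: "\<Psi> C \<in> FFQ T" "\<Phi> C \<in> FFQ T" using mem C by auto
    define r where "r = d_plusQ T (\<Psi> C) (\<Phi> C)"
    have r: "0 < r" unfolding r_def using X.mdist_pos_eq[OF mC] neq by simp
    obtain \<delta>1 where \<delta>1: "0 < \<delta>1" "\<And>C'. C' \<in> ?W \<Longrightarrow> d_plusQ T C C' < \<delta>1 \<Longrightarrow> d_plusQ T (\<Phi> C) (\<Phi> C') < r / 2"
      using \<Phi>\<Psi>(1)[of "r / 2"] r by auto
    obtain \<delta>2 where \<delta>2: "0 < \<delta>2" "\<And>C'. C' \<in> ?W \<Longrightarrow> d_plusQ T C C' < \<delta>2 \<Longrightarrow> d_plusQ T (\<Psi> C) (\<Psi> C') < r / 2"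
      using \<Phi>\<Psi>(2)[of "r / 2"] r by auto
    \<comment> \<open>The approximating ordinary control must itself give a point of
      \<open>?W\<close>, because only there do both maps have prescribed values.\<close>
    obtain \<delta>3 where "0 < \<delta>3" and \<delta>3: "\<And>h'. h' \<in> YYT0 T \<Longrightarrow> d_plus T (frechet_class (rep C)) (frechet_class h') < \<delta>3 \<Longrightarrow> ?pt h' \<in> ?W"
      by (rule near[OF rep(1,2)[OF C] zero_less_one]) blast
    have \<delta>0: "0 < min \<delta>1 (min \<delta>2 \<delta>3)" using \<delta>1(1) \<delta>2(1) \<open>0 < \<delta>3\<close> by simp
    note c = YYT0_crosses[OF rep(1)[OF C] T0]
    obtain u where u: "ordinary_control u"
      "d_plus T (frechet_class (rep C)) (frechet_class (control_graph u)) < min \<delta>1 (min \<delta>2 \<delta>3)"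
      by (rule ordinary_controls_dense[OF assms(3) c(1,2) \<delta>0])
    note g = control_graph_YYT0[OF u(1) T0]
    define C' where "C' = ?pt (control_graph u)"
    have d: "d_plusQ T C C' < min \<delta>1 (min \<delta>2 \<delta>3)"
      using u(2) dist[OF rep(1)[OF C] g] by (simp add: rep(3)[OF C] C'_def)
    have W': "C' \<in> ?W" unfolding C'_def by (rule \<delta>3[OF g]) (use u(2) in simp)
    have "\<Psi> C' = \<Phi> C'"
      using ext ext' u(1) W' unfolding extends_input_to_trajectory_def C'_def by simp
    moreover have "d_plusQ T (\<Phi> C) (\<Phi> C') < r / 2" "d_plusQ T (\<Psi> C) (\<Psi> C') < r / 2"
      using \<delta>1(2)[OF W'] \<delta>2(2)[OF W'] d by simp_all
    moreover have "\<Phi> C' \<in> FFQ T" using mem W' by auto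
    then have "r \<le> d_plusQ T (\<Psi> C) (\<Phi> C') + d_plusQ T (\<Phi> C') (\<Phi> C)"
      unfolding r_def by (rule X.triangle[OF mC(1) _ mC(2)])
    ultimately show False using X.commute[of "\<Phi> C'" "\<Phi> C"] by simp
  qed
  show ?thesis
    unfolding top
  proof (intro conjI exI[of _ \<Phi>] ballI allI impI)
    show "openin (control_topology T) ?W" by (rule open_W)
    show "\<Phi> (?pt h) = ident T (?traj h)" if "h \<in> YYT0 T" "?traj h \<in> FF T" for h by (rule \<Phi>_eq[OF that])
    show "extends_input_to_trajectory f G x0 T \<Phi>" by (rule ext)
    show "continuous_map W.sub.mtopology (curve_topology T) \<Phi>" by (rule cont)
    fix \<Psi> C
    assume \<Psi>: "extends_input_to_trajectory f G x0 T \<Psi> \<and> continuous_map W.sub.mtopology (curve_topology T) \<Psi>"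
      and C: "C \<in> ?W"
    show "\<Psi> C = \<Phi> C" by (rule unique[OF conjunct1[OF \<Psi>] conjunct2[OF \<Psi>] C])
  qed
qed

end
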